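(* Let $1<p<+\infty$ and $\omega\in\mathbb R$. Let $\tilde\zeta\in\mathring L^p(\mathbb S^2)$ satisfy $$\tilde\zeta=\mathfrak g(\omega\sin\theta-\mathcal G\tilde\zeta)\quad\text{on }\mathbb S^2,$$ where $\mathfrak g\in C^1(\mathbb R)$ satisfies $\mathfrak g'(s)<0$ for all $s\in\mathbb R$ and $\inf_{\mathbb R}\mathfrak g'>-6$. Then $\tilde\zeta$ is stable in $L^p$ norm of the absolute vorticity: for any $\varepsilon>0$ there exists $\delta>0$ such that for any smooth solution $\zeta$ of the vorticity equation $(V_\omega)$, $$\|\zeta_0-\tilde\zeta\|_{L^p(\mathbb S^2)}<\delta\quad\Longrightarrow\quad\|\zeta_t-\tilde\zeta\|_{L^p(\mathbb S^2)}<\varepsilon\quad\forall\,t>0.$$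
   Context: $\mathbb S^2$ is the unit sphere in $\mathbb R^3$ with the standard metric and area measure $\sigma$, with spherical coordinates $(\varphi,\theta)\mapsto(\cos\theta\cos\varphi,\cos\theta\sin\varphi,\sin\theta)$; thus $\sin\theta=x_3$. All functions are real-valued. $\mathring L^p(\mathbb S^2)$ is the space of $L^p$ functions with zero mean. For $1<r<\infty$ and $f\in\mathring L^r(\mathbb S^2)$, $\mathcal Gf$ is the unique zero-mean function in $W^{2,r}(\mathbb S^2)$ with $-\Delta(\mathcal Gf)=f$ ($\Delta$ the Laplace-Beltrami operator). $J$ is the anticlockwise rotation by $\pi/2$ in the tangent planes, i.e. $J\mathbf v=\mathbf x\times\mathbf v$ at $\mathbf x\in\mathbb S^2$; in coordinates $J\nabla f=-\partial_\theta f\,\mathbf e_\varphi+\frac1{\cos\theta}\partial_\varphi f\,\mathbf e_\theta$. For a fixed rotation speed $\omega\in\mathbb R$, the vorticity equation $(V_\omega)$ for the absolute vorticity $\zeta$ is $$\partial_t\zeta+J\nabla(\omega\sin\theta-\mathcal G\zeta)\cdot\nabla\zeta=0\quad\text{on }\mathbb S^2,\ t>0.$$ A smooth solution is a smooth function $\zeta$ on $\mathbb S^2\times[0,\infty)$, of zero mean on $\mathbb S^2$ at each time, satisfying this equation; $\zeta_t:=\zeta(\cdot,t)$. *)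

theory Defs
  imports "HOL-Analysis.Analysis"
begin

unbundle no cross3_syntax

abbreviation S2 :: "(real^3) set" where
  "S2 \<equiv> sphere 0 1"

text \<open>
  Functions on the sphere are represented by functions on \<^typ>\<open>real^3\<close>; no notion below depends on
  their values off \<^const>\<open>S2\<close>. In particular the area measure has \<^const>\<open>S2\<close> as its space, so
  that measurability is only required there.
\<close>

definition sph_coords :: "real \<times> real \<Rightarrow> real^3" where
  "sph_coords = (\<lambda>(\<phi>, \<theta>). vector [cos \<theta> * cos \<phi>, cos \<theta> * sin \<phi>, sin \<theta>])"

definition area :: "(real^3) measure" where
  "area = distr
     (density lborel (\<lambda>(\<phi>, \<theta>).
        ennreal (cos \<theta>) * indicator ({0..<2*pi} \<times> {-pi/2..pi/2}) (\<phi>, \<theta>)))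
     (restrict_space borel S2) sph_coords"

subsection \<open>Lebesgue spaces\<close>

definition in_Lp :: "real \<Rightarrow> (real^3 \<Rightarrow> 'b::euclidean_space) \<Rightarrow> bool" where
  "in_Lp r F \<longleftrightarrow> F \<in> borel_measurable area \<and> integrable area (\<lambda>x. norm (F x) powr r)"

definition Lp_norm :: "real \<Rightarrow> (real^3 \<Rightarrow> 'b::euclidean_space) \<Rightarrow> real" where
  "Lp_norm r F = (LINT x|area. norm (F x) powr r) powr (1 / r)"

definition in_Lp0 :: "real \<Rightarrow> (real^3 \<Rightarrow> real) \<Rightarrow> bool" where
  "in_Lp0 r f \<longleftrightarrow> in_Lp r f \<and> (LINT x|area. f x) = 0"

subsection \<open>Smoothness\<close>

primrec Ck_on :: "nat \<Rightarrow> ('a::euclidean_space \<Rightarrow> real) \<Rightarrow> 'a set \<Rightarrow> bool" where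
  "Ck_on 0 f U \<longleftrightarrow> continuous_on U f"
| "Ck_on (Suc k) f U \<longleftrightarrow> (\<forall>x\<in>U. f differentiable at x) \<and>
     (\<forall>v. Ck_on k (\<lambda>x. frechet_derivative f (at x) v) U)"

text \<open>Smoothness on an arbitrary subset (here the sphere, or the sphere times a closed half-line)
  means the existence of a smooth extension to an open neighbourhood.\<close>

definition smooth_on :: "'a::euclidean_space set \<Rightarrow> ('a \<Rightarrow> real) \<Rightarrow> bool" where
  "smooth_on A f \<longleftrightarrow>
     (\<exists>U F. open U \<and> A \<subseteq> U \<and> (\<forall>k. Ck_on k F U) \<and> (\<forall>x\<in>A. F x = f x))"

subsection \<open>Differential operators on the sphere\<close>

text \<open>The derivative within the sphere determines a linear form only on the tangent plane
  \<open>x\<^sup>\<bottom>\<close>; the surface gradient is the tangent vector that represents it.\<close>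

definition has_sgrad :: "(real^3 \<Rightarrow> real) \<Rightarrow> real^3 \<Rightarrow> real^3 \<Rightarrow> bool" where
  "has_sgrad f x v \<longleftrightarrow> x \<bullet> v = 0 \<and> (f has_derivative (\<lambda>h. v \<bullet> h)) (at x within S2)"

definition sgrad :: "(real^3 \<Rightarrow> real) \<Rightarrow> real^3 \<Rightarrow> real^3" where
  "sgrad f x = (THE v. has_sgrad f x v)"

definition rotJ :: "real^3 \<Rightarrow> real^3 \<Rightarrow> real^3" where
  "rotJ x v = cross3 x v"

text \<open>Covariant derivative of a tangent field \<open>X\<close>, as the matrix of the endomorphism
  \<open>v \<mapsto> \<nabla>\<^sub>v X\<close> extended by \<open>0\<close> to the normal direction: the Levi-Civita connection of the
  sphere is the Euclidean derivative along the sphere followed by the orthogonal projection onto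
  the tangent plane.\<close>

definition tproj :: "real^3 \<Rightarrow> real^3^3" where
  "tproj x = (\<chi> i j. (if i = j then 1 else 0) - x $ i * x $ j)"

definition scov :: "(real^3 \<Rightarrow> real^3) \<Rightarrow> real^3 \<Rightarrow> real^3^3" where
  "scov X x = tproj x ** (\<chi> i. sgrad (\<lambda>y. X y $ i) x)"

definition shess :: "(real^3 \<Rightarrow> real) \<Rightarrow> real^3 \<Rightarrow> real^3^3" where
  "shess f = scov (sgrad f)"

subsection \<open>Second-order Sobolev spaces and the inverse of the Laplacian\<close>

text \<open>\<open>u\<close> lies in \<open>W\<^sup>2\<^sup>,\<^sup>r\<close>, the completion of the smooth functions in the norm
  \<open>\<parallel>u\<parallel>\<^sub>r + \<parallel>\<nabla>u\<parallel>\<^sub>r + \<parallel>\<nabla>\<^sup>2u\<parallel>\<^sub>r\<close>, and \<open>H\<close> (unique up to null sets) is its Hessian there.\<close>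

definition W2_hessian :: "real \<Rightarrow> (real^3 \<Rightarrow> real) \<Rightarrow> (real^3 \<Rightarrow> real^3^3) \<Rightarrow> bool" where
  "W2_hessian r u H \<longleftrightarrow> in_Lp r u \<and> in_Lp r H \<and>
     (\<exists>(U :: nat \<Rightarrow> real^3 \<Rightarrow> real) X. in_Lp r X \<and> (\<forall>n. smooth_on S2 (U n)) \<and>
        (\<lambda>n. Lp_norm r (\<lambda>x. U n x - u x)) \<longlonglongrightarrow> 0 \<and>
        (\<lambda>n. Lp_norm r (\<lambda>x. sgrad (U n) x - X x)) \<longlonglongrightarrow> 0 \<and>
        (\<lambda>n. Lp_norm r (\<lambda>x. shess (U n) x - H x)) \<longlonglongrightarrow> 0)"

text \<open>\<open>u\<close> is a representative of \<open>\<G>f\<close>: it lies in \<open>W\<^sup>2\<^sup>,\<^sup>r\<close>, has zero mean and satisfies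
  \<open>-\<Delta>u = f\<close>, where \<open>\<Delta>u\<close> is the trace of the Hessian. As \<open>\<G>f\<close> is only determined up to
  null sets, this is a relation rather than a function.\<close>

definition inv_laplacian :: "real \<Rightarrow> (real^3 \<Rightarrow> real) \<Rightarrow> (real^3 \<Rightarrow> real) \<Rightarrow> bool" where
  "inv_laplacian r f u \<longleftrightarrow> in_Lp0 r f \<and> in_Lp0 r u \<and>
     (\<exists>H. W2_hessian r u H \<and> (AE x in area. - trace (H x) = f x))"

subsection \<open>Smooth solutions of the vorticity equation\<close>

text \<open>At each time \<open>\<psi> t\<close> is the representative of \<open>\<G>(\<zeta> t)\<close> for which the equation makes sense
  pointwise; it is unique, since differentiability forces continuity. For smooth \<open>\<zeta> t\<close> the
  exponent \<open>r\<close> is immaterial.\<close>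

definition smooth_solution :: "real \<Rightarrow> (real \<Rightarrow> real^3 \<Rightarrow> real) \<Rightarrow> bool" where
  "smooth_solution \<omega> \<zeta> \<longleftrightarrow>
     smooth_on (S2 \<times> {0..}) (\<lambda>(x, t). \<zeta> t x) \<and>
     (\<forall>t\<ge>0. (LINT x|area. \<zeta> t x) = 0) \<and>
     (\<exists>\<psi> :: real \<Rightarrow> real^3 \<Rightarrow> real. \<forall>t>0.
        (\<exists>r>1. inv_laplacian r (\<zeta> t) (\<psi> t)) \<and>
        (\<forall>x\<in>S2. (\<exists>v. has_sgrad (\<psi> t) x v) \<and>
           deriv (\<lambda>s. \<zeta> s x) t
             + rotJ x (sgrad (\<lambda>y. \<omega> * y $ 3 - \<psi> t y) x) \<bullet> sgrad (\<zeta> t) x = 0))"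

end

theory Submission
  imports Defs
begin

text \<open>
  With \<open>G' = g\<close>, the function \<open>\<Phi> (g s) = G s - s * g s\<close> is \<open>1/c\<close>-strongly convex, where
  \<open>g' \<ge> - c\<close> and \<open>c < 6\<close>. As \<open>\<Phi>' (zt) = - (\<omega> x\<^sub>3 - \<psi>)\<close>, expanding the conserved quantity
  \<open>\<integral> \<Phi> (\<zeta>) - energy\<close> at the steady state gives, for the perturbation \<open>h\<close>, the lower bound
  \<open>\<parallel>h\<parallel>\<^sup>2 / (2 c) - \<langle>h, \<G> h\<rangle> / 2\<close>. The second nonzero eigenvalue of \<open>- \<Delta>\<close> is \<open>6\<close>, so this is coercive
  up to the projection of \<open>h\<close> onto the first harmonics; that projection rotates about the axis and
  its distance to the projection of the steady state is conserved. The steady state is bounded, so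
  that solutions may be truncated to its range, and the truncation error has a conserved
  \<open>L\<^sup>p\<close> norm; this passes from \<open>L\<^sup>2\<close> to \<open>L\<^sup>p\<close>.

  All integrations by parts on the sphere come from one fact: the derivative of a function along an
  infinitesimal rotation has zero integral. The Laplacian is the sum of the squares of these
  derivatives, and \<open>\<G>\<close> is given by the kernel \<open>- ln (1 - x \<bullet> y)\<close>, which is regularised by
  \<open>- ln (1 + e - x \<bullet> y)\<close>.
\<close>

text \<open>The slope bound \<open>c\<close> is below \<open>6\<close> but may exceed the first
  eigenvalue \<open>2\<close>, so the quadratic form can be negative on first harmonics, and their
  evolution needs separate control. The self-induced velocity drops out of the first moment because
  its kernel is antisymmetric; the moment then solves a linear rotation equation, and the moment of
  the steady state is a fixed point of it. A second obstacle: \<open>\<Phi>\<close> lives on the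
  range of \<open>g\<close>, which need not be the whole line, and a perturbation small in
  \<open>L^p\<close> need be neither bounded nor small in \<open>L^2\<close>. Truncated
  perturbations are uniformly bounded, and for them both kinds of smallness agree. A third: the
  potential can be differentiated freely only after regularisation, so identities are proved for
  \<open>e > 0\<close> and passed to \<open>e = 0\<close> by uniform convergence of potential and
  velocity. Integrals of functions of \<open>\<zeta>\<close> are differentiated in time for
  polynomials and reach continuous functions by Weierstrass approximation. Stability is argued by
  contradiction along a sequence of solutions and times, so that estimates become limits.\<close>

lemmas LINT_add = Bochner_Integration.integral_add
  and LINT_diff = Bochner_Integration.integral_diff
  and LINT_sum = Bochner_Integration.integral_sum
  and LINT_cong = Bochner_Integration.integral_cong
  and area_integrable_add = Bochner_Integration.integrable_add
  and area_integrable_diff = Bochner_Integration.integrable_diff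
  and area_integrable_bound = Bochner_Integration.integrable_bound

section \<open>The area measure in coordinates\<close>

lemma sph_coords_in_S2: "sph_coords p \<in> S2"
proof -
  have "(cos b * cos a)\<^sup>2 + (cos b * sin a)\<^sup>2 + (sin b)\<^sup>2 = 1" for a b :: real
  proof -
    have "(cos b * cos a)\<^sup>2 + (cos b * sin a)\<^sup>2 + (sin b)\<^sup>2
      = (cos b)\<^sup>2 * ((cos a)\<^sup>2 + (sin a)\<^sup>2) + (sin b)\<^sup>2"
      by (simp add: power_mult_distrib algebra_simps del: sin_cos_squared_add sin_cos_squared_add2)
    then show ?thesis by simp
  qed
  then show ?thesis
    by (cases p) (simp add: sph_coords_def norm_eq_1 inner_vec_def sum_3 power2_eq_square)
qed

lemma norm_sph_coords [simp]: "norm (sph_coords p) = 1"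
  using sph_coords_in_S2[of p] by simp

lemma continuous_on_vec3:
  fixes f :: "'a::topological_space \<Rightarrow> real^3"
  assumes "\<And>i. continuous_on A (\<lambda>t. f t $ i)"
  shows "continuous_on A f"
proof -
  have "continuous_on A (\<lambda>t. \<chi> i. f t $ i)" by (intro continuous_on_vec_lambda assms)
  then show ?thesis by simp
qed

lemma continuous_on_sph_coords: "continuous_on A sph_coords"
proof -
  have "continuous_on A (\<lambda>p. sph_coords p $ i)" for i :: 3
  proof -
    have "(i = 1 \<or> i = 2 \<or> i = 3)" using exhaust_3 by blast
    then show ?thesis
      by (elim disjE) (auto simp: sph_coords_def case_prod_beta intro!: continuous_intros)
  qed
  then have "continuous_on A (\<lambda>p. \<chi> i. sph_coords p $ i)"
    by (rule continuous_on_vec_lambda)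
  then show ?thesis by simp
qed

lemma sph_coords_measurable: "sph_coords \<in> borel \<rightarrow>\<^sub>M restrict_space borel S2"
  by (intro measurable_restrict_space2 borel_measurable_continuous_onI continuous_on_sph_coords)
     (auto simp: sph_coords_in_S2)

lemma space_area [simp]: "space area = S2"
  by (simp add: area_def space_restrict_space)

lemma sets_area: "sets area = sets (restrict_space borel S2)"
  by (simp add: area_def)

lemma borel_measurable_area_continuous:
  fixes f :: "real^3 \<Rightarrow> 'b::topological_space"
  assumes "continuous_on S2 f"
  shows "f \<in> borel_measurable area"
  using borel_measurable_continuous_on_restrict[OF assms]
      by (simp add: sets_area cong: measurable_cong_sets)

definition coord_rect :: "(real \<times> real) set" where
  "coord_rect = {0..<2*pi} \<times> {-pi/2..pi/2}"

definition area_dens :: "real \<times> real \<Rightarrow> ennreal" where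
  "area_dens = (\<lambda>(\<phi>, \<theta>). ennreal (cos \<theta>) * indicator ({0..<2*pi} \<times> {-pi/2..pi/2}) (\<phi>, \<theta>))"

lemma coord_rect_borel [measurable]: "coord_rect \<in> sets borel"
  unfolding coord_rect_def borel_prod[symmetric] by (intro pair_measureI) auto

lemma cos_nonneg_coord_rect: "p \<in> coord_rect \<Longrightarrow> 0 \<le> cos (snd p)"
  by (auto simp: coord_rect_def intro!: cos_ge_zero)

lemma area_dens_eq: "area_dens p = ennreal (indicator coord_rect p * cos (snd p))"
  using cos_nonneg_coord_rect[of p]
  by (cases p) (auto simp: area_dens_def coord_rect_def indicator_def)

lemma area_eq: "area = distr (density lborel area_dens) (restrict_space borel S2) sph_coords"
  by (simp add: area_def area_dens_def)

lemma coord_rect_subset: "coord_rect \<subseteq> cbox (0, -pi/2) (2*pi, pi/2)"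
  by (auto simp: coord_rect_def cbox_Pair_eq)

lemma area_dens_measurable [measurable]: "area_dens \<in> borel_measurable borel"
proof -
  have "(\<lambda>p::real\<times>real. cos (snd p)) \<in> borel_measurable borel"
    by (intro borel_measurable_continuous_onI continuous_intros)
  then show ?thesis unfolding area_dens_eq[abs_def] by measurable
qed

lemma finite_measure_area: "finite_measure area"
proof
  have m: "sph_coords \<in> density lborel area_dens \<rightarrow>\<^sub>M restrict_space borel S2"
    using sph_coords_measurable by (simp cong: measurable_cong_sets)
  have "emeasure area (space area) = emeasure (density lborel area_dens) (sph_coords -` S2 \<inter> space
      (density lborel area_dens))"
    unfolding space_area unfolding area_eq
    by (subst emeasure_distr[OF m]) (auto simp: sets_restrict_space)
  also have "sph_coords -` S2 \<inter> space (density lborel area_dens) = UNIV"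
    using sph_coords_in_S2 by auto
  also have "emeasure (density lborel area_dens) UNIV = (\<integral>\<^sup>+p. area_dens p \<partial>lborel)"
    by (subst emeasure_density) auto
  also have "\<dots> \<le> (\<integral>\<^sup>+p. indicator (cbox (0, -pi/2) (2*pi, pi/2)) p \<partial>lborel)"
    using coord_rect_subset
    by (intro nn_integral_mono) (auto simp: area_dens_eq indicator_def ennreal_le_1)
  also have "\<dots> = emeasure lborel (cbox (0, -pi/2) (2*pi, pi/2::real))"
    by simp
  also have "\<dots> < \<infinity>" by (rule emeasure_lborel_cbox_finite)
  finally show "emeasure area (space area) \<noteq> \<infinity>" by simp
qed

interpretation area: finite_measure area by (rule finite_measure_area)

lemma integrable_area_bounded:
  fixes f :: "real^3 \<Rightarrow> 'b::{banach, second_countable_topology}"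
  assumes "f \<in> borel_measurable area" "\<And>x. x \<in> S2 \<Longrightarrow> norm (f x) \<le> B"
  shows "integrable area f"
  using assms by (intro area.integrable_const_bound[of _ B]) auto

lemma continuous_on_S2_bounded:
  fixes f :: "real^3 \<Rightarrow> 'b::real_normed_vector"
  assumes "continuous_on S2 f"
  obtains B where "B > 0" "\<And>x. x \<in> S2 \<Longrightarrow> norm (f x) \<le> B"
proof -
  have "bounded (f ` S2)"
    using assms by (intro compact_imp_bounded compact_continuous_image) auto
  then show thesis using that unfolding bounded_pos by auto
qed

lemma integrable_area_continuous:
  fixes f :: "real^3 \<Rightarrow> 'b::{banach, second_countable_topology}"
  assumes "continuous_on S2 f"
  shows "integrable area f"
proof -
  obtain B where "\<And>x. x \<in> S2 \<Longrightarrow> norm (f x) \<le> B"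
    using continuous_on_S2_bounded[OF assms] by metis
  with borel_measurable_area_continuous[OF assms] show ?thesis
    by (rule integrable_area_bounded)
qed

text \<open>Moves the integral to the gauge integral over a closed box, where iterated integrals of
  continuous functions and the fundamental theorem of calculus are available. The density uses a
  half-open longitude interval; the missing edge is negligible.\<close>

lemma LINT_area_coords:
  fixes f :: "real^3 \<Rightarrow> real"
  assumes f: "continuous_on S2 f"
  shows "(LINT x|area. f x) =
    integral (cbox (0, -pi/2) (2*pi, pi/2)) (\<lambda>p. cos (snd p) * f (sph_coords p))"
proof -
  have m: "sph_coords \<in> density lborel area_dens \<rightarrow>\<^sub>M restrict_space borel S2"
    using sph_coords_measurable by (simp cong: measurable_cong_sets)
  have cf: "continuous_on UNIV (\<lambda>p. f (sph_coords p))"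
    by (rule continuous_on_compose2[OF f continuous_on_sph_coords]) (auto simp: sph_coords_in_S2)
  then have mf: "(\<lambda>p. f (sph_coords p)) \<in> borel_measurable borel"
    by (intro borel_measurable_continuous_onI)
  have mc: "(\<lambda>p::real\<times>real. cos (snd p)) \<in> borel_measurable borel"
    by (intro borel_measurable_continuous_onI continuous_intros)
  have "(LINT x|area. f x) = (LINT p|density lborel area_dens. f (sph_coords p))"
    unfolding area_eq using borel_measurable_continuous_on_restrict[OF f]
    by (intro integral_distr[OF m])
  also have "\<dots> = (LINT p|lborel. (indicator coord_rect p * cos (snd p)) *\<^sub>R f (sph_coords p))"
    unfolding area_dens_eq[abs_def] using mf mc cos_nonneg_coord_rect
    by (intro integral_density) (auto simp: indicator_def)
  also have "\<dots> = (LINT p:coord_rect|lborel. cos (snd p) * f (sph_coords p))"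
    by (simp add: set_lebesgue_integral_def mult.assoc)
  also have "\<dots> = integral coord_rect (\<lambda>p. cos (snd p) * f (sph_coords p))"
  proof (rule set_borel_integral_eq_integral)
    obtain B where B: "\<And>x. x \<in> S2 \<Longrightarrow> norm (f x) \<le> B"
      using continuous_on_S2_bounded[OF f] by metis
    have bb: "norm (cos (snd p) * f (sph_coords p)) \<le> B" for p
      unfolding norm_mult using mult_mono[of "norm (cos (snd p))" 1 "norm (f (sph_coords p))" B]
        B[OF sph_coords_in_S2, of p] norm_ge_zero[of "f (sph_coords p)"] by auto
    have "set_integrable lborel (cbox (0, -pi/2) (2*pi, pi/2::real)) (\<lambda>p. cos (snd p)
        * f (sph_coords p))"
      by (rule borel_integrable_compact[OF compact_cbox, folded set_integrable_def, unfolded])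
         (intro continuous_intros continuous_on_subset[OF cf], auto)
    then show "set_integrable lborel coord_rect (\<lambda>p. cos (snd p) * f (sph_coords p))"
      by (rule set_integrable_subset) (use coord_rect_subset in auto)
  qed
  also have "\<dots> = integral (cbox (0, -pi/2) (2*pi, pi/2)) (\<lambda>p. cos (snd p) * f (sph_coords p))"
  proof (rule integral_spike_set)
    have eq: "(cbox (0, -pi/2) (2*pi, pi/2)) - coord_rect \<subseteq> {p. p \<bullet> (1, 0) = 2*pi}"
      by (auto simp: coord_rect_def cbox_Pair_eq)
    have ng: "negligible {p::real \<times> real. p \<bullet> (1, 0) = 2*pi}"
      by (rule negligible_standard_hyperplane) (simp add: Basis_prod_def)
    show "negligible {x \<in> cbox (0, - pi / 2) (2 * pi, pi / 2) - coord_rect. cos (snd x)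
        * f (sph_coords x) \<noteq> 0}"
      by (rule negligible_subset[OF ng]) (use eq in blast)
    show "negligible {x \<in> coord_rect - cbox (0, - pi / 2) (2 * pi, pi / 2). cos (snd x)
        * f (sph_coords x) \<noteq> 0}"
      by (rule negligible_subset[OF negligible_empty]) (use coord_rect_subset in blast)
  qed
  finally show ?thesis .
qed

lemma measure_area_pos: "0 < measure area S2"
proof -
  have "measure area S2 = (LINT x|area. 1)" by simp
  also have "\<dots> = integral (cbox (0, -pi/2) (2*pi, pi/2)) (\<lambda>p::real\<times>real. cos (snd p) * 1)"
    by (rule LINT_area_coords) auto
  also have "\<dots> = integral (cbox 0 (2*pi)) (\<lambda>a. integral (cbox (-pi/2) (pi/2)) (\<lambda>b. cos (snd (a, b))
      * 1))"
    by (rule integral_prod_continuous) (intro continuous_intros)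
  also have "\<dots> = 4 * pi"
  proof -
    have "(cos has_integral sin (pi/2) - sin (-pi/2)) {-pi/2..pi/2}"
      by (intro fundamental_theorem_of_calculus)
         (auto intro!: derivative_eq_intros simp flip:
             has_real_derivative_iff_has_vector_derivative)
    then have "integral (cbox (-pi/2) (pi/2)) cos = sin (pi/2) - sin (-pi/2)"
      by (simp add: integral_unique)
    then show ?thesis by simp
  qed
  finally show ?thesis by simp
qed

section \<open>Rotational derivatives and their zero mean\<close>

text \<open>The direction \<open>cross3 a x\<close> is tangent to the sphere through
  \<open>x\<close>. So for differentiable \<open>f\<close> the value at a point of \<open>S2\<close>
  depends on \<open>f\<close> on \<open>S2\<close> alone, although \<open>f\<close> has to be given
  in a neighbourhood.\<close>

definition rotderiv :: "real^3 \<Rightarrow> (real^3 \<Rightarrow> real) \<Rightarrow> real^3 \<Rightarrow> real" where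
  "rotderiv a f x = frechet_derivative f (at x) (cross3 a x)"

definition grad :: "(real^3 \<Rightarrow> real) \<Rightarrow> real^3 \<Rightarrow> real^3" where
  "grad f x = (\<chi> i. frechet_derivative f (at x) (axis i 1))"

lemma frechet_eq_grad:
  assumes "f differentiable at x"
  shows "frechet_derivative f (at x) v = grad f x \<bullet> v"
proof -
  interpret bounded_linear "frechet_derivative f (at x)"
    using assms frechet_derivative_works has_derivative_bounded_linear by blast
  have "frechet_derivative f (at x) v = frechet_derivative f (at x) (\<Sum>i\<in>UNIV. (v $ i) *\<^sub>R axis i 1)"
    using basis_expansion[of v] by (simp add: scalar_mult_eq_scaleR)
  also have "\<dots> = (\<Sum>i\<in>UNIV. v $ i * frechet_derivative f (at x) (axis i 1))"
    by (simp add: sum scaleR)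
  also have "\<dots> = grad f x \<bullet> v"
    by (simp add: grad_def inner_vec_def mult.commute)
  finally show ?thesis .
qed

lemma has_derivative_grad:
  assumes "f differentiable at x"
  shows "(f has_derivative (\<lambda>v. grad f x \<bullet> v)) (at x)"
proof -
  have "(f has_derivative frechet_derivative f (at x)) (at x)"
    using assms frechet_derivative_works by blast
  moreover have "frechet_derivative f (at x) = (\<lambda>v. grad f x \<bullet> v)"
    using frechet_eq_grad[OF assms] by auto
  ultimately show ?thesis by simp
qed

lemma grad_eqI:
  assumes "(f has_derivative (\<lambda>v. w \<bullet> v)) (at x)"
  shows "grad f x = w"
  using frechet_derivative_at[OF assms]
  by (simp add: grad_def vec_eq_iff fun_eq_iff inner_axis flip: assms) (metis inner_axis
      inner_real_def mult.right_neutral)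

lemma rotderiv_eq_grad: "f differentiable at x \<Longrightarrow> rotderiv a f x = grad f x \<bullet> cross3 a x"
  by (simp add: rotderiv_def frechet_eq_grad)

lemma rotderiv_eqI:
  assumes "(f has_derivative f') (at x)"
  shows "rotderiv a f x = f' (cross3 a x)"
  unfolding rotderiv_def using frechet_derivative_at[OF assms] by simp

definition C1_on :: "(real^3 \<Rightarrow> real) \<Rightarrow> (real^3) set \<Rightarrow> bool" where
  "C1_on f U \<longleftrightarrow> (\<forall>x\<in>U. f differentiable at x) \<and> continuous_on U (grad f)"

lemma Ck_on_imp_C1_on:
  assumes "Ck_on (Suc k) f U"
  shows "C1_on f U"
proof -
  have c: "continuous_on U g" if "Ck_on k g U" for g :: "real^3 \<Rightarrow> real"
    using that by (cases k) (auto intro!: differentiable_imp_continuous_on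
        differentiable_at_imp_differentiable_on)
  from assms show ?thesis
    unfolding C1_on_def grad_def[abs_def] by (auto intro!: continuous_on_vec_lambda c)
qed

lemma continuous_on_cross3 [continuous_intros]:
  assumes "continuous_on A f" "continuous_on A g"
  shows "continuous_on A (\<lambda>x. cross3 (f x) (g x))"
proof (rule continuous_on_vec3)
  fix i :: 3
  show "continuous_on A (\<lambda>x. cross3 (f x) (g x) $ i)"
    using exhaust_3[of i] assms
    by (elim disjE) (auto simp: cross_components intro!: continuous_intros)
qed

lemma continuous_on_rotderiv:
  assumes "C1_on f U"
  shows "continuous_on U (rotderiv a f)"
proof -
  have "continuous_on U (\<lambda>x. grad f x \<bullet> cross3 a x)"
    using assms unfolding C1_on_def by (intro continuous_intros) auto
  then show ?thesis
    by (rule continuous_on_eq) (use assms in \<open>simp add: C1_on_def rotderiv_eq_grad\<close>)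
qed

definition sph_dph :: "real \<times> real \<Rightarrow> real^3" where
  "sph_dph = (\<lambda>(\<phi>, \<theta>). vector [- cos \<theta> * sin \<phi>, cos \<theta> * cos \<phi>, 0])"
definition sph_dth :: "real \<times> real \<Rightarrow> real^3" where
  "sph_dth = (\<lambda>(\<phi>, \<theta>). vector [- sin \<theta> * cos \<phi>, - sin \<theta> * sin \<phi>, cos \<theta>])"

lemma has_vector_derivative_vec3:
  fixes f :: "real \<Rightarrow> real^3"
  assumes "\<And>i. ((\<lambda>t. f t $ i) has_real_derivative f' $ i) (at t within S)"
  shows "(f has_vector_derivative f') (at t within S)"
proof -
  have "((\<lambda>t. \<chi> i. f t $ i) has_derivative (\<lambda>h. \<chi> i. h *\<^sub>R f' $ i)) (at t within S)"
    unfolding has_derivative_componentwise_within[of "\<lambda>t. \<chi> i. f t $ i"]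
    using assms[unfolded has_field_derivative_def]
    by (auto simp: Basis_vec_def inner_axis mult_commute_abs)
  then show ?thesis
    unfolding has_vector_derivative_def by (simp add: scaleR_vec_def[abs_def])
qed

lemma sph_dph: "((\<lambda>\<phi>. sph_coords (\<phi>, \<theta>)) has_vector_derivative sph_dph (\<phi>, \<theta>)) (at \<phi> within S)"
  apply (rule has_vector_derivative_vec3)
  subgoal for i
    using exhaust_3[of i]
    by (elim disjE) (auto simp: sph_coords_def sph_dph_def vector_3 intro!: derivative_eq_intros)
  done

lemma sph_dth: "((\<lambda>\<theta>. sph_coords (\<phi>, \<theta>)) has_vector_derivative sph_dth (\<phi>, \<theta>)) (at \<theta> within S)"
  apply (rule has_vector_derivative_vec3)
  subgoal for i
    using exhaust_3[of i]
    by (elim disjE) (auto simp: sph_coords_def sph_dth_def vector_3 intro!: derivative_eq_intros)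
  done

lemma continuous_on_sph_d: "continuous_on A sph_dph" "continuous_on A sph_dth"
   apply (rule continuous_on_vec3)
  subgoal for i using exhaust_3[of i]
    by (elim disjE) (auto simp: sph_dph_def case_prod_beta intro!: continuous_intros)
   apply (rule continuous_on_vec3)
  subgoal for i using exhaust_3[of i]
    by (elim disjE) (auto simp: sph_dth_def case_prod_beta intro!: continuous_intros)
  done

text \<open>As \<open>cos \<theta>\<close> is the density of the area measure, this makes the integrand of a rotational
  derivative an exact sum of a \<open>\<theta>\<close>-derivative and a \<open>\<phi>\<close>-derivative.\<close>

lemma cos_cross3_sph:
  "cos \<theta> *\<^sub>R cross3 a (sph_coords (\<phi>, \<theta>)) =
     ((a $ 1 * sin \<phi> - a $ 2 * cos \<phi>) * cos \<theta>) *\<^sub>R sph_dth (\<phi>, \<theta>)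
   + (a $ 3 * cos \<theta> - a $ 1 * sin \<theta> * cos \<phi> - a $ 2 * sin \<theta> * sin \<phi>) *\<^sub>R sph_dph (\<phi>, \<theta>)"
proof -
  have s: "(sin \<phi>)\<^sup>2 = 1 - (cos \<phi>)\<^sup>2" "(sin \<theta>)\<^sup>2 = 1 - (cos \<theta>)\<^sup>2"
    by (simp_all add: sin_squared_eq)
  show ?thesis
    unfolding vec_eq_iff forall_3
    apply (intro conjI; simp only: cross_components sph_coords_def sph_dph_def sph_dth_def vector_3
        vector_add_component vector_scaleR_component real_scaleR_def split)
    using s by (algebra | simp add: algebra_simps)+
qed

text \<open>In \<open>A + B\<close> the terms without a derivative of \<open>h\<close> cancel: a
  rotation field has no divergence. \<open>A\<close> is the \<theta>-derivative of a function with
  the factor \<open>cos \<theta>\<close>, which vanishes at the poles, and \<open>B\<close> is the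
  \<phi>-derivative of a function that is periodic in \<phi>; so each integrates to zero in its own
  variable.\<close>

lemma LINT_rotderiv:
  assumes f: "C1_on f U" and U: "open U" "S2 \<subseteq> U"
  shows "(LINT x|area. rotderiv a f x) = 0"
proof -
  define h where "h = (\<lambda>p. f (sph_coords p))"
  define hth where "hth p = grad f (sph_coords p) \<bullet> sph_dth p" for p
  define hph where "hph p = grad f (sph_coords p) \<bullet> sph_dph p" for p
  have df: "(f has_derivative (\<lambda>v. grad f (sph_coords p) \<bullet> v)) (at (sph_coords p))" for p
    using f U(2)[THEN subsetD, OF sph_coords_in_S2] unfolding C1_on_def
        by (intro has_derivative_grad) auto
  have Dth: "((\<lambda>\<theta>. h (\<phi>, \<theta>)) has_real_derivative hth (\<phi>, \<theta>)) (at \<theta> within S)" for \<phi> \<theta> S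
    unfolding h_def hth_def has_real_derivative_iff_has_vector_derivative has_vector_derivative_def
    using has_derivative_compose[OF sph_dth[unfolded has_vector_derivative_def] df]
    by (simp add: mult.commute)
  have Dph: "((\<lambda>\<phi>. h (\<phi>, \<theta>)) has_real_derivative hph (\<phi>, \<theta>)) (at \<phi> within S)" for \<phi> \<theta> S
    unfolding h_def hph_def has_real_derivative_iff_has_vector_derivative has_vector_derivative_def
    using has_derivative_compose[OF sph_dph[unfolded has_vector_derivative_def] df]
    by (simp add: mult.commute)
  have cg: "continuous_on A (\<lambda>p. grad f (sph_coords p))" for A
    by (rule continuous_on_compose2[OF _ continuous_on_sph_coords])
       (use f U(2)[THEN subsetD, OF sph_coords_in_S2] in \<open>auto simp: C1_on_def\<close>)
  have cf: "continuous_on S2 f"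
    using f U(2) unfolding C1_on_def by (auto intro!: differentiable_imp_continuous_on
        differentiable_at_imp_differentiable_on)
  have ch: "continuous_on A h" for A
    unfolding h_def by (rule continuous_on_compose2[OF cf continuous_on_sph_coords])
      (auto simp: sph_coords_in_S2)
  have cth: "continuous_on A hth" and cph: "continuous_on A hph" for A
    unfolding hth_def hph_def by (intro continuous_intros cg continuous_on_sph_d)+
  define A where "A p = (a $ 1 * sin (fst p) - a $ 2 * cos (fst p)) * (cos (snd p) * hth p
      - sin (snd p) * h p)" for p
  define B where "B p = (a $ 3 * cos (snd p) - a $ 1 * sin (snd p) * cos (fst p) - a $ 2
      * sin (snd p) * sin (fst p)) * hph p
      + (a $ 1 * sin (snd p) * sin (fst p) - a $ 2 * sin (snd p) * cos (fst p)) * h p" for p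
  have cA: "continuous_on X A" and cB: "continuous_on X B" for X
    unfolding A_def B_def by (intro continuous_intros cth cph ch)+
  have eq: "cos (snd p) * rotderiv a f (sph_coords p) = A p + B p" for p
  proof -
    obtain \<phi> \<theta> where p: "p = (\<phi>, \<theta>)" by (cases p)
    have "cos \<theta> * rotderiv a f (sph_coords p)
        = grad f (sph_coords p) \<bullet> (cos \<theta> *\<^sub>R cross3 a (sph_coords p))"
      using f U(2)[THEN subsetD, OF sph_coords_in_S2] unfolding C1_on_def
          by (subst rotderiv_eq_grad) auto
    also have "\<dots> = A p + B p"
      unfolding p cos_cross3_sph by (simp add: A_def B_def hth_def hph_def inner_add_right
          algebra_simps)
    finally show ?thesis by (simp add: p)
  qed
  have "(LINT x|area. rotderiv a f x) =
      integral (cbox (0, -pi/2) (2*pi, pi/2)) (\<lambda>p. cos (snd p) * rotderiv a f (sph_coords p))"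
    using continuous_on_subset[OF continuous_on_rotderiv[OF f] U(2)] by (rule LINT_area_coords)
  also have "\<dots> = integral (cbox (0, -pi/2) (2*pi, pi/2)) (\<lambda>p. A p + B p)"
    by (simp add: eq)
  also have "\<dots> = integral (cbox (0, -pi/2) (2*pi, pi/2)) A
      + integral (cbox (0, -pi/2) (2*pi, pi/2)) B"
    by (intro integral_add integrable_continuous cA cB)
  also have "integral (cbox (0, -pi/2) (2*pi, pi/2)) A
      = integral (cbox 0 (2*pi)) (\<lambda>\<phi>. integral (cbox (-pi/2) (pi/2)) (\<lambda>\<theta>. A (\<phi>, \<theta>)))"
    by (intro integral_prod_continuous cA)
  also have "\<dots> = integral (cbox 0 (2*pi)) (\<lambda>\<phi>. 0)"
  proof (intro integral_cong)
    fix \<phi> :: real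
    let ?F = "\<lambda>\<theta>. (a $ 1 * sin \<phi> - a $ 2 * cos \<phi>) * (cos \<theta> * h (\<phi>, \<theta>))"
    have "((\<lambda>\<theta>. A (\<phi>, \<theta>)) has_integral ?F (pi/2) - ?F (-pi/2)) {-pi/2..pi/2}"
      apply (intro fundamental_theorem_of_calculus)
      apply simp
      unfolding has_real_derivative_iff_has_vector_derivative[symmetric]
      by (auto intro!: derivative_eq_intros Dth simp: A_def algebra_simps)
    then show "integral (cbox (-pi/2) (pi/2)) (\<lambda>\<theta>. A (\<phi>, \<theta>)) = 0"
      by (simp add: integral_unique)
  qed
  also have "integral (cbox (0, -pi/2) (2*pi, pi/2)) B
      = integral (cbox (-pi/2) (pi/2)) (\<lambda>\<theta>. integral (cbox 0 (2*pi)) (\<lambda>\<phi>. B (\<phi>, \<theta>)))"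
    using integral_prod_continuous[OF cB] integral_swap_continuous[of 0 "-pi/2" "2*pi" "pi/2"
        "\<lambda>x y. B (x, y)"] cB
    by (simp add: case_prod_eta[of B, unfolded])
  also have "\<dots> = integral (cbox (-pi/2) (pi/2)) (\<lambda>\<theta>. 0)"
  proof (intro integral_cong)
    fix \<theta> :: real
    let ?F = "\<lambda>\<phi>. (a $ 3 * cos \<theta> - a $ 1 * sin \<theta> * cos \<phi> - a $ 2 * sin \<theta> * sin \<phi>) * h (\<phi>, \<theta>)"
    have "((\<lambda>\<phi>. B (\<phi>, \<theta>)) has_integral ?F (2*pi) - ?F 0) {0..2*pi}"
      apply (intro fundamental_theorem_of_calculus)
      apply simp
      unfolding has_real_derivative_iff_has_vector_derivative[symmetric]
      by (auto intro!: derivative_eq_intros Dph simp: B_def algebra_simps)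
    moreover have "h (2*pi, \<theta>) = h (0, \<theta>)"
      by (simp add: h_def sph_coords_def)
    ultimately show "integral (cbox 0 (2*pi)) (\<lambda>\<phi>. B (\<phi>, \<theta>)) = 0"
      by (simp add: integral_unique)
  qed
  finally show ?thesis by simp
qed

section \<open>Zonal functions\<close>

lemma C1I:
  assumes "\<And>x. x \<in> U \<Longrightarrow> (f has_derivative (\<lambda>v. G x \<bullet> v)) (at x)" "continuous_on U G"
  shows "C1_on f U"
  unfolding C1_on_def
proof (intro conjI ballI)
  show "f differentiable at x" if "x \<in> U" for x
    using assms(1)[OF that] differentiableI by blast
  show "continuous_on U (grad f)"
    by (rule continuous_on_eq[OF assms(2)]) (use assms(1) grad_eqI in metis)
qed

lemma C1_differentiable: "C1_on f U \<Longrightarrow> x \<in> U \<Longrightarrow> f differentiable at x"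
  by (simp add: C1_on_def)

lemma C1_has_derivative: "C1_on f U \<Longrightarrow> x \<in> U \<Longrightarrow> (f has_derivative (\<lambda>v. grad f x \<bullet> v)) (at x)"
  unfolding C1_on_def by (blast intro: has_derivative_grad)

lemma C1_rotderiv: "C1_on f U \<Longrightarrow> x \<in> U \<Longrightarrow> rotderiv a f x = grad f x \<bullet> cross3 a x"
  unfolding C1_on_def by (blast intro: rotderiv_eq_grad)

lemma C1_continuous_grad: "C1_on f U \<Longrightarrow> continuous_on U (grad f)"
  by (simp add: C1_on_def)

lemma C1_continuous: "C1_on f U \<Longrightarrow> continuous_on U f"
  unfolding C1_on_def by (auto intro!: differentiable_imp_continuous_on
      differentiable_at_imp_differentiable_on)

lemma C1_subset: "C1_on f U \<Longrightarrow> V \<subseteq> U \<Longrightarrow> C1_on f V"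
  unfolding C1_on_def by (auto intro: continuous_on_subset)

lemma C1_cong:
  assumes "C1_on f U" "open U" "\<And>x. x \<in> U \<Longrightarrow> f x = g x"
  shows "C1_on g U"
  by (rule C1I[OF has_derivative_transform_within_open[OF C1_has_derivative[OF assms(1)] assms(2)]
        C1_continuous_grad[OF assms(1)]]) (use assms in auto)

lemma rotderiv_cong:
  assumes "open U" "x \<in> U" "\<And>x. x \<in> U \<Longrightarrow> f x = g x" "f differentiable at x"
  shows "rotderiv a f x = rotderiv a g x"
proof -
  have "(g has_derivative (\<lambda>v. grad f x \<bullet> v)) (at x)"
    by (rule has_derivative_transform_within_open[OF has_derivative_grad[OF assms(4)] assms(1,2)])
        (use assms in auto)
  from rotderiv_eqI[OF this] show ?thesis by (simp add: rotderiv_eq_grad[OF assms(4)])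
qed

lemma grad_mult:
  "f differentiable at x \<Longrightarrow> g differentiable at x \<Longrightarrow> grad (\<lambda>x. f x * g x) x
      = g x *\<^sub>R grad f x + f x *\<^sub>R grad g x"
  by (rule grad_eqI)
     (auto intro!: derivative_eq_intros has_derivative_grad simp: inner_add_left algebra_simps)

lemma grad_add:
  "f differentiable at x \<Longrightarrow> g differentiable at x \<Longrightarrow> grad (\<lambda>x. f x + g x) x = grad f x + grad g x"
  by (rule grad_eqI) (auto intro!: derivative_eq_intros has_derivative_grad simp: inner_add_left)

lemma grad_diff:
  "f differentiable at x \<Longrightarrow> g differentiable at x \<Longrightarrow> grad (\<lambda>x. f x - g x) x = grad f x - grad g x"
  by (rule grad_eqI) (auto intro!: derivative_eq_intros has_derivative_grad simp: inner_diff_left)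

lemma grad_linear [simp]: "grad (\<lambda>x. v \<bullet> x) x = v"
  by (rule grad_eqI) (auto intro!: derivative_eq_intros)

lemma C1_mult:
  assumes "C1_on f U" "C1_on g U" shows "C1_on (\<lambda>x. f x * g x) U"
  by (rule C1I[where G = "\<lambda>x. g x *\<^sub>R grad f x + f x *\<^sub>R grad g x"])
     (auto intro!: derivative_eq_intros continuous_intros C1_has_derivative[OF assms(1)]
         C1_has_derivative[OF assms(2)]
        C1_continuous_grad assms C1_continuous simp: inner_add_left algebra_simps)

lemma C1_add:
  assumes "C1_on f U" "C1_on g U" shows "C1_on (\<lambda>x. f x + g x) U"
  by (rule C1I[where G = "\<lambda>x. grad f x + grad g x"])
     (auto intro!: derivative_eq_intros continuous_intros C1_has_derivative[OF assms(1)]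
         C1_has_derivative[OF assms(2)]
        C1_continuous_grad assms C1_continuous simp: inner_add_left algebra_simps)

lemma C1_const: "C1_on (\<lambda>x. c) U"
  by (rule C1I[where G = "\<lambda>x. 0"]) (auto intro!: derivative_eq_intros)

lemma C1_linear: "C1_on (\<lambda>x. v \<bullet> x) U"
  by (rule C1I[where G = "\<lambda>x. v"]) (auto intro!: derivative_eq_intros)

lemma C1_cmult: "C1_on f U \<Longrightarrow> C1_on (\<lambda>x. c * f x) U"
  by (rule C1_mult[OF C1_const])

lemma C1_diff: "C1_on f U \<Longrightarrow> C1_on g U \<Longrightarrow> C1_on (\<lambda>x. f x - g x) U"
  using C1_add[OF _ C1_cmult[of g U "-1"]] by simp

lemma C1_sum: "finite I \<Longrightarrow> (\<And>i. i \<in> I \<Longrightarrow> C1_on (f i) U) \<Longrightarrow> C1_on (\<lambda>x. \<Sum>i\<in>I. f i x) U"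
proof (induction rule: finite_induct)
  case empty then show ?case using C1_const[of 0] by simp
next
  case (insert i I)
  have "C1_on (\<lambda>x. f i x + (\<Sum>i\<in>I. f i x)) U"
    by (intro C1_add insert.IH insert.prems) auto
  then show ?case using insert by simp
qed

lemma grad_compose_real:
  assumes "f differentiable at x" "(\<phi> has_real_derivative d) (at (f x))"
  shows "grad (\<lambda>x. \<phi> (f x)) x = d *\<^sub>R grad f x"
  by (rule grad_eqI)
     (use has_derivative_compose[OF has_derivative_grad[OF assms(1)] assms(2)[unfolded
         has_field_derivative_def]]
      in \<open>simp add: mult.commute\<close>)

lemma C1_compose_real:
  assumes f: "C1_on f U" and \<phi>: "\<And>s. s \<in> f ` U \<Longrightarrow> (\<phi> has_real_derivative \<phi>' s) (at s)"
    and c: "continuous_on (f ` U) \<phi>'"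
  shows "C1_on (\<lambda>x. \<phi> (f x)) U"
proof (rule C1I)
  show "((\<lambda>x. \<phi> (f x)) has_derivative (\<lambda>v. (\<phi>' (f x) *\<^sub>R grad f x) \<bullet> v)) (at x)" if "x \<in> U" for x
    using has_derivative_compose[OF C1_has_derivative[OF f that] \<phi>[unfolded
        has_field_derivative_def, OF imageI[OF that]]]
    by simp
  show "continuous_on U (\<lambda>x. \<phi>' (f x) *\<^sub>R grad f x)"
    by (intro continuous_intros C1_continuous_grad[OF f] continuous_on_compose2[OF c]
        C1_continuous[OF f]) auto
qed

lemma rotderiv_mult:
  "f differentiable at x \<Longrightarrow> g differentiable at x \<Longrightarrow>
    rotderiv a (\<lambda>x. f x * g x) x = f x * rotderiv a g x + rotderiv a f x * g x"
  by (subst rotderiv_eq_grad) (auto simp: grad_mult rotderiv_eq_grad inner_add_left)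

lemma rotderiv_add:
  "f differentiable at x \<Longrightarrow> g differentiable at x \<Longrightarrow>
    rotderiv a (\<lambda>x. f x + g x) x = rotderiv a f x + rotderiv a g x"
  by (subst rotderiv_eq_grad) (auto simp: grad_add rotderiv_eq_grad inner_add_left)

lemma rotderiv_diff:
  "f differentiable at x \<Longrightarrow> g differentiable at x \<Longrightarrow>
    rotderiv a (\<lambda>x. f x - g x) x = rotderiv a f x - rotderiv a g x"
  by (subst rotderiv_eq_grad) (auto simp: grad_diff rotderiv_eq_grad inner_diff_left)

section \<open>The Laplacian and Green's identity\<close>

definition lap :: "(real^3 \<Rightarrow> real) \<Rightarrow> real^3 \<Rightarrow> real" where
  "lap f x = (\<Sum>i\<in>UNIV. rotderiv (axis i 1) (rotderiv (axis i 1) f) x)"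

definition C2_near :: "(real^3 \<Rightarrow> real) \<Rightarrow> (real^3) set \<Rightarrow> bool" where
  "C2_near f U \<longleftrightarrow> open U \<and> S2 \<subseteq> U \<and> C1_on f U \<and> (\<forall>a. C1_on (rotderiv a f) U)"

lemma C2_nearD:
  assumes "C2_near f U"
  shows "open U" "S2 \<subseteq> U" "C1_on f U" "C1_on (rotderiv a f) U"
  using assms unfolding C2_near_def by auto

lemma C2_near_subset:
  assumes "C2_near f U" "V \<subseteq> U" "open V" "S2 \<subseteq> V"
  shows "C2_near f V"
  using assms unfolding C2_near_def by (blast intro: C1_subset)

lemma continuous_on_lap: "C2_near f U \<Longrightarrow> continuous_on S2 (lap f)"
  unfolding lap_def[abs_def]
  by (intro continuous_on_sum continuous_on_subset[OF continuous_on_rotderiv] C2_nearD)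

lemma LINT_lap:
  assumes "C2_near f U" shows "(LINT x|area. lap f x) = 0"
proof -
  note D = C2_nearD[OF assms]
  have "(LINT x|area. lap f x) = (\<Sum>i\<in>UNIV. LINT x|area. rotderiv (axis i 1) (rotderiv (axis i 1) f)
      x)"
    unfolding lap_def
    by (intro LINT_sum integrable_area_continuous continuous_on_subset[OF continuous_on_rotderiv[OF
        D(4)] D(2)])
  also have "\<dots> = 0" by (simp add: LINT_rotderiv[OF D(4) D(1,2)])
  finally show ?thesis .
qed

text \<open>\<open>h * lap f - f * lap h\<close> is the sum of the rotational derivatives of
  \<open>h * R f - f * R h\<close>, where \<open>R\<close> runs over the three rotation fields about
  the axes; each summand has zero integral.\<close>

lemma LINT_green:
  assumes f: "C2_near f U" and h: "C2_near h U"
  shows "(LINT x|area. h x * lap f x) = (LINT x|area. f x * lap h x)"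
proof -
  note Df = C2_nearD[OF f] and Dh = C2_nearD[OF h]
  have "(LINT x|area. h x * lap f x) - (LINT x|area. f x * lap h x)
      = (LINT x|area. h x * lap f x - f x * lap h x)"
    by (intro LINT_diff[symmetric] integrable_area_continuous continuous_intros continuous_on_lap[OF
        f]
      continuous_on_lap[OF h] continuous_on_subset[OF C1_continuous[OF Df(3)] Df(2)]
      continuous_on_subset[OF C1_continuous[OF Dh(3)] Dh(2)])
  also have "\<dots> = (LINT x|area. (\<Sum>i\<in>UNIV. rotderiv (axis i 1) (\<lambda>x. h x * rotderiv (axis i 1) f x
      - f x * rotderiv (axis i 1) h x) x))"
  proof (intro LINT_cong refl)
    fix x assume "x \<in> space area"
    then have x: "x \<in> U" using Df by auto
    note d = C1_differentiable[OF _ x]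
    have "rotderiv a (\<lambda>x. h x * rotderiv a f x - f x * rotderiv a h x) x
        = h x * rotderiv a (rotderiv a f) x - f x * rotderiv a (rotderiv a h) x" for a
      using d[OF Df(3)] d[OF Dh(3)] d[OF Df(4)] d[OF Dh(4)]
      by (simp add: rotderiv_diff rotderiv_mult algebra_simps)
    then show "h x * lap f x - f x * lap h x
        = (\<Sum>i\<in>UNIV. rotderiv (axis i 1) (\<lambda>x. h x * rotderiv (axis i 1) f x - f x
        * rotderiv (axis i 1) h x) x)"
      by (simp add: lap_def sum_distrib_left sum_subtractf)
  qed
  also have "\<dots> = (\<Sum>i\<in>UNIV. LINT x|area. rotderiv (axis i 1) (\<lambda>x. h x * rotderiv (axis i 1) f x - f x
      * rotderiv (axis i 1) h x) x)"
    by (intro LINT_sum integrable_area_continuous continuous_on_subset[OF continuous_on_rotderiv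
        Df(2)]
        C1_diff C1_mult Df Dh)
  also have "\<dots> = 0"
    by (intro sum.neutral ballI LINT_rotderiv[OF _ Df(1,2)] C1_diff C1_mult Df Dh)
  finally show ?thesis by simp
qed

text \<open>For \<open>y\<close> on the unit sphere these are the squared length of the surface
  gradient and the Laplacian of the function \<open>y \<mapsto> x \<bullet> y\<close>. The second
  one exhibits the eigenvalue \<open>2\<close> of the first harmonics.\<close>

lemma sum_cross_axis:
  fixes x y :: "real^3"
  shows "(\<Sum>i\<in>UNIV. (x \<bullet> cross3 (axis i 1) y)\<^sup>2) = (x \<bullet> x) * (y \<bullet> y) - (x \<bullet> y)\<^sup>2"
    and "(\<Sum>i\<in>UNIV. x \<bullet> cross3 (axis i 1) (cross3 (axis i 1) y)) = - 2 * (x \<bullet> y)"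
  by (simp_all add: sum_3 cross_components inner_vec_def axis_def power2_eq_square algebra_simps)

text \<open>On functions of \<open>s = x \<bullet> y\<close> the Laplacian acts as the Legendre
  operator. Smoothness is required only below some \<open>c > 1\<close>, because the kernels to be
  inserted have their singularity at \<open>1 + e\<close>.\<close>

lemma zonal:
  fixes \<phi> \<phi>' \<phi>'' :: "real \<Rightarrow> real"
  assumes \<phi>: "\<And>s. s < c \<Longrightarrow> (\<phi> has_real_derivative \<phi>' s) (at s)"
    and \<phi>': "\<And>s. s < c \<Longrightarrow> (\<phi>' has_real_derivative \<phi>'' s) (at s)"
    and c: "continuous_on {..<c} \<phi>''" "1 < c" and x: "x \<in> S2"
  shows "C2_near (\<lambda>y. \<phi> (x \<bullet> y)) {y. x \<bullet> y < c}"
    and "y \<in> S2 \<Longrightarrow> lap (\<lambda>y. \<phi> (x \<bullet> y)) y = (1 - (x \<bullet> y)\<^sup>2) * \<phi>'' (x \<bullet> y) - 2 * (x \<bullet> y) * \<phi>' (x \<bullet> y)"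
proof -
  let ?U = "{y. x \<bullet> y < c}"
  have U: "open ?U" by (rule open_halfspace_lt)
  have sub: "S2 \<subseteq> ?U"
  proof
    fix y assume "y \<in> S2"
    then show "y \<in> ?U" using x norm_cauchy_schwarz[of x y] c(2) by auto
  qed
  have c': "continuous_on {..<c} \<phi>'"
    using \<phi>' by (auto intro!: continuous_at_imp_continuous_on DERIV_isCont)
  have C1: "C1_on (\<lambda>y. \<phi> (x \<bullet> y)) ?U"
    by (intro C1_compose_real[OF C1_linear, where \<phi>' = \<phi>'] \<phi> continuous_on_subset[OF c']) auto
  have C1': "C1_on (\<lambda>y. \<phi>' (x \<bullet> y)) ?U"
    by (intro C1_compose_real[OF C1_linear, where \<phi>' = \<phi>''] \<phi>' continuous_on_subset[OF c(1)]) auto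
  have r1: "rotderiv a (\<lambda>y. \<phi> (x \<bullet> y)) y = \<phi>' (x \<bullet> y) * (x \<bullet> cross3 a y)" if "y \<in> ?U" for a y
    using that by (subst C1_rotderiv[OF C1]) (auto simp: grad_compose_real[where \<phi> = \<phi>, OF _ \<phi>])
  have lin: "x \<bullet> cross3 a y = cross3 x a \<bullet> y" for a y
    by (metis cross_triple inner_commute)
  have C2: "C1_on (\<lambda>y. \<phi>' (x \<bullet> y) * (x \<bullet> cross3 a y)) ?U" for a
    unfolding lin by (intro C1_mult C1' C1_linear)
  have C2': "C1_on (rotderiv a (\<lambda>y. \<phi> (x \<bullet> y))) ?U" for a
    by (rule C1_cong[OF C2[of a] U]) (simp add: r1)
  show "C2_near (\<lambda>y. \<phi> (x \<bullet> y)) ?U"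
    unfolding C2_near_def using U sub C1 C2' by blast
  assume y: "y \<in> S2"
  then have yU: "y \<in> ?U" using sub by auto
  have "rotderiv a (rotderiv a (\<lambda>y. \<phi> (x \<bullet> y))) y
      = rotderiv a (\<lambda>y. \<phi>' (x \<bullet> y) * (x \<bullet> cross3 a y)) y" for a
    by (rule rotderiv_cong[OF U yU r1]) (auto intro: C1_differentiable[OF C2' yU])
  also have "rotderiv a (\<lambda>y. \<phi>' (x \<bullet> y) * (x \<bullet> cross3 a y)) y =
      \<phi>'' (x \<bullet> y) * (x \<bullet> cross3 a y)\<^sup>2 + \<phi>' (x \<bullet> y) * (x \<bullet> cross3 a (cross3 a y))" for a
  proof -
    have "rotderiv a (\<lambda>y. \<phi>' (x \<bullet> y) * (x \<bullet> cross3 a y)) y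
      = \<phi>' (x \<bullet> y) * rotderiv a (\<lambda>y. x \<bullet> cross3 a y) y + rotderiv a (\<lambda>y. \<phi>' (x \<bullet> y)) y * (x
          \<bullet> cross3 a y)"
      unfolding lin by (intro rotderiv_mult C1_differentiable[OF C1' yU] C1_differentiable[OF
          C1_linear UNIV_I])
    moreover have "rotderiv a (\<lambda>y. x \<bullet> cross3 a y) y = x \<bullet> cross3 a (cross3 a y)"
      unfolding lin by (subst C1_rotderiv[OF C1_linear UNIV_I]) simp
    moreover have "rotderiv a (\<lambda>y. \<phi>' (x \<bullet> y)) y = \<phi>'' (x \<bullet> y) * (x \<bullet> cross3 a y)"
      using yU by (subst C1_rotderiv[OF C1']) (auto simp: grad_compose_real[where \<phi> = \<phi>', OF _ \<phi>'])
    ultimately show ?thesis by (simp add: power2_eq_square)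
  qed
  finally have "lap (\<lambda>y. \<phi> (x \<bullet> y)) y = \<phi>'' (x \<bullet> y) * (\<Sum>i\<in>UNIV. (x \<bullet> cross3 (axis i 1) y)\<^sup>2)
    + \<phi>' (x \<bullet> y) * (\<Sum>i\<in>UNIV. x \<bullet> cross3 (axis i 1) (cross3 (axis i 1) y))"
    by (simp add: lap_def sum.distrib sum_distrib_left)
  then show "lap (\<lambda>y. \<phi> (x \<bullet> y)) y = (1 - (x \<bullet> y)\<^sup>2) * \<phi>'' (x \<bullet> y) - 2 * (x \<bullet> y) * \<phi>' (x \<bullet> y)"
    using x y unfolding sum_cross_axis by (simp add: dot_square_norm algebra_simps)
qed

section \<open>Regularised logarithm, approximate identity and an integrable weight\<close>

abbreviation total_area :: real where "total_area \<equiv> measure area S2"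

lemma inner_S2_le: "x \<in> S2 \<Longrightarrow> y \<in> S2 \<Longrightarrow> x \<bullet> y \<le> 1"
  and inner_S2_ge: "x \<in> S2 \<Longrightarrow> y \<in> S2 \<Longrightarrow> -1 \<le> x \<bullet> y"
  using norm_cauchy_schwarz[of x y] norm_cauchy_schwarz[of "-x" y] by auto

text \<open>The defect of the regularised logarithm from having constant Laplacian. It is
  nonnegative for \<open>e > 0\<close>, has an integral independent of \<open>e\<close>, and
  concentrates at \<open>s = 1\<close> as \<open>e\<close> tends to \<open>0\<close>: an approximate
  identity.\<close>

definition poisson :: "real \<Rightarrow> real \<Rightarrow> real" where
  "poisson e s = e * (2 + e) / (1 + e - s)\<^sup>2"

lemma log_zonal:
  assumes "0 < e" "x \<in> S2"
  shows "C2_near (\<lambda>y. - ln (1 + e - x \<bullet> y)) {y. x \<bullet> y < 1 + e}"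
    and "y \<in> S2 \<Longrightarrow> lap (\<lambda>y. - ln (1 + e - x \<bullet> y)) y = 1 - poisson e (x \<bullet> y)"
proof -
  have d1: "((\<lambda>s. - ln (1 + e - s)) has_real_derivative 1 / (1 + e - s)) (at s)" if "s < 1 + e"
      for s
    using that by (auto intro!: derivative_eq_intros)
  have d2: "((\<lambda>s. 1 / (1 + e - s)) has_real_derivative 1 / (1 + e - s)\<^sup>2) (at s)" if "s < 1 + e"
      for s
    using that by (auto intro!: derivative_eq_intros simp: power2_eq_square)
  have c: "continuous_on {..<1 + e} (\<lambda>s. 1 / (1 + e - s)\<^sup>2)"
    by (auto intro!: continuous_intros)
  note z = zonal[OF d1 d2 c _ assms(2)]
  show "C2_near (\<lambda>y. - ln (1 + e - x \<bullet> y)) {y. x \<bullet> y < 1 + e}"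
    using assms by (intro z(1)) auto
  assume y: "y \<in> S2"
  have pos: "1 + e - x \<bullet> y > 0" using inner_S2_le[OF assms(2) y] assms(1) by auto
  have "lap (\<lambda>y. - ln (1 + e - x \<bullet> y)) y
      = (1 - (x \<bullet> y)\<^sup>2) * (1 / (1 + e - x \<bullet> y)\<^sup>2) - 2 * (x \<bullet> y) * (1 / (1 + e - x \<bullet> y))"
    using assms y by (intro z(2)) auto
  also have "\<dots> = 1 - poisson e (x \<bullet> y)"
    using pos unfolding poisson_def by (simp add: divide_simps power2_eq_square) (simp add:
        algebra_simps)
  finally show "lap (\<lambda>y. - ln (1 + e - x \<bullet> y)) y = 1 - poisson e (x \<bullet> y)" .
qed

lemma continuous_on_zonal:
  assumes "continuous_on {-1..1} \<phi>" "x \<in> S2"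
  shows "continuous_on S2 (\<lambda>y. \<phi> (x \<bullet> y))"
  by (rule continuous_on_compose2[OF assms(1)])
     (use inner_S2_le[OF assms(2)] inner_S2_ge[OF assms(2)] in \<open>auto intro!: continuous_intros\<close>)

lemma continuous_on_poisson: "0 < e \<Longrightarrow> continuous_on {-1..1} (poisson e)"
  unfolding poisson_def[abs_def] by (intro continuous_intros) auto

text \<open>The mass is read off from the vanishing integral of the Laplacian of the regularised
  logarithm.\<close>

lemma LINT_poisson:
  assumes "0 < e" "x \<in> S2"
  shows "(LINT y|area. poisson e (x \<bullet> y)) = total_area"
proof -
  have "0 = (LINT y|area. 1 - poisson e (x \<bullet> y))"
    unfolding LINT_lap[OF log_zonal(1)[OF assms], symmetric]
    by (intro LINT_cong refl) (simp add: log_zonal(2)[OF assms])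
  also have "\<dots> = total_area - (LINT y|area. poisson e (x \<bullet> y))"
    by (subst LINT_diff)
       (auto intro!: integrable_area_continuous continuous_on_zonal[OF continuous_on_poisson] assms)
  finally show ?thesis by simp
qed

text \<open>A common majorant for all kernels. Powers of \<open>1 - s\<close> with exponent above
  \<open>-1\<close> are integrable on the sphere; the velocity kernel needs exponent
  \<open>-1/2\<close>, and the further quarter pays for the rate \<open>e powr (1/4)\<close> at
  which the regularisation is removed.\<close>

definition sing_wt :: "real \<Rightarrow> real \<Rightarrow> real" where
  "sing_wt e s = (1 + e - s) powr (-3/4)"

lemma sing_wt_nonneg [simp]: "0 \<le> sing_wt e s" by (simp add: sing_wt_def)

lemma continuous_on_sing_wt: "0 < e \<Longrightarrow> continuous_on {-1..1} (sing_wt e)"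
  unfolding sing_wt_def[abs_def] by (intro continuous_intros) auto

text \<open>With \<open>d = 1 + e - x \<bullet> y\<close>, the Laplacian of \<open>- d powr (1/4)\<close> integrates to zero, and its two
  singular terms have the same sign; so they are controlled by the integral of \<open>d powr (1/4)\<close>.\<close>

lemma LINT_sing_wt_pos:
  assumes e: "0 < e" "e \<le> 1" and x: "x \<in> S2"
  shows "(LINT y|area. sing_wt e (x \<bullet> y)) \<le> 15/2 * total_area"
proof -
  let ?d = "\<lambda>s. 1 + e - s"
  have d1: "((\<lambda>s. - (?d s powr (1/4))) has_real_derivative (1/4) * ?d s powr (-3/4)) (at s)"
      if "s < 1 + e" for s
    using that by (auto intro!: derivative_eq_intros)
  have d2: "((\<lambda>s. (1/4) * ?d s powr (-3/4)) has_real_derivative (3/16) * ?d s powr (-7/4)) (at s)"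
      if "s < 1 + e" for s
    using that by (auto intro!: derivative_eq_intros)
  have c: "continuous_on {..<1 + e} (\<lambda>s. (3/16) * ?d s powr (-7/4))"
    by (auto intro!: continuous_intros)
  note z = zonal[OF d1 d2 c _ x]
  define h where "h = (\<lambda>y. - (?d (x \<bullet> y) powr (1/4)))"
  have C: "C2_near h {y. x \<bullet> y < 1 + e}"
    unfolding h_def using e by (intro z(1)) auto
  \<comment> \<open>With \<open>q = d powr (1/4)\<close>, the Laplacian of \<open>h\<close> is
    \<open>5/16 * q\<close> minus \<open>(1 + e) / 8 * (q / d)\<close> minus a nonnegative term.
    Multiplication by \<open>8\<close> isolates \<open>q / d\<close>, which is the weight, and the
    crude bound \<open>q \<le> 3\<close> turns \<open>5/2 * q\<close> into
    \<open>15/2\<close>.\<close>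
  have bound: "sing_wt e (x \<bullet> y) \<le> 15/2 - 8 * lap h y" if y: "y \<in> S2" for y
  proof -
    define d where "d = ?d (x \<bullet> y)"
    define q where "q = d powr (1/4)"
    have s: "x \<bullet> y = 1 + e - d" by (simp add: d_def)
    have d: "0 < d" "d \<le> 3" using inner_S2_le[OF x y] inner_S2_ge[OF x y] e by (auto simp: d_def)
    have q: "0 < q" using d by (simp add: q_def)
    have q4: "d = q ^ 4" using d by (simp add: q_def powr_power)
    have p3: "d powr (-3/4) = q / d"
    proof -
      have "d powr (-3/4) = d powr (1/4) * d powr - 1" unfolding powr_add[symmetric] by simp
      then show ?thesis using d by (simp add: q_def powr_neg_one)
    qed
    have p7: "d powr (-7/4) = q / d\<^sup>2"
    proof -
      have "d powr (-7/4) = d powr (1/4) * d powr - 2" unfolding powr_add[symmetric] by simp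
      then show ?thesis using d by (simp add: q_def powr_neg_numeral)
    qed
    have "lap h y = (1 - (x \<bullet> y)\<^sup>2) * ((3/16) * ?d (x \<bullet> y) powr (-7/4)) - 2 * (x \<bullet> y) * ((1/4)
        * ?d (x \<bullet> y) powr (-3/4))"
      unfolding h_def using e y by (intro z(2)) auto
    also have "\<dots> = (1 - (1 + e - d)\<^sup>2) * ((3/16) * (q / d\<^sup>2)) - 2 * (1 + e - d) * ((1/4) * (q / d))"
      unfolding p3[symmetric] p7[symmetric] by (simp add: s)
    also have "\<dots> = 5/16 * q - (1 + e) / 8 * (q / d) - 3/16 * (e * (2 + e)) * (q / d\<^sup>2)"
      using d by (simp add: field_simps power2_eq_square)
    finally have l: "lap h y = 5/16 * q - (1 + e) / 8 * (q / d) - 3/16 * (e * (2 + e))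
        * (q / d\<^sup>2)" .
    have n1: "0 \<le> 3/16 * (e * (2 + e)) * (q / d\<^sup>2)" and n2: "0 \<le> e * (q / d)" using e q d by auto
    have q3: "q \<le> 3"
    proof (rule ccontr)
      assume "\<not> q \<le> 3"
      then have "3 ^ 4 \<le> q ^ 4" by (intro power_mono) auto
      then show False using q4 d by auto
    qed
    have "sing_wt e (x \<bullet> y) = q / d" unfolding p3[symmetric] by (simp add: sing_wt_def s)
    also have "\<dots> \<le> 5/2 * q - 8 * lap h y" unfolding l using n1 n2
        by (simp add: algebra_simps add_divide_distrib)
    also have "\<dots> \<le> 15/2 - 8 * lap h y" using q3 by simp
    finally show ?thesis .
  qed
  have "(LINT y|area. sing_wt e (x \<bullet> y)) \<le> (LINT y|area. 15/2 - 8 * lap h y)"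
    by (intro integral_mono) (auto intro!: integrable_area_continuous continuous_on_zonal[OF
        continuous_on_sing_wt] continuous_intros
       continuous_on_lap[OF C] e x bound)
  also have "\<dots> = 15/2 * total_area"
    by (subst LINT_diff)
       (auto intro!: integrable_area_continuous continuous_intros continuous_on_lap[OF C] simp:
           LINT_lap[OF C])
  finally show ?thesis .
qed

text \<open>At \<open>y = x\<close> the weight with parameter \<open>e\<close> takes the value
  \<open>e powr (-3/4)\<close>, while its integral stays bounded. So the mass of the point is at
  most a constant times \<open>e powr (3/4)\<close> for every small \<open>e\<close>.\<close>

lemma AE_inner_neq_1:
  assumes x: "x \<in> S2"
  shows "AE y in area. x \<bullet> y < 1"
proof -
  let ?N = "{y \<in> space area. \<not> x \<bullet> y < 1}"
  have N: "?N \<in> sets area"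
    using borel_measurable_area_continuous[of "\<lambda>y. x \<bullet> y"]
        by measurable (auto intro: continuous_intros)
  have NS: "?N \<inter> S2 = ?N" by auto
  have le: "measure area ?N * e powr (-3/4) \<le> 15/2 * total_area" if e: "0 < e" "e \<le> 1" for e
  proof -
    have "measure area ?N * e powr (-3/4) = (LINT y|area. indicator ?N y * e powr (-3/4))"
      using N by (simp del: space_area add: Int_absorb2 sets.sets_into_space)
    also have "\<dots> \<le> (LINT y|area. sing_wt e (x \<bullet> y))"
    proof (rule integral_mono)
      show "integrable area (\<lambda>y. sing_wt e (x \<bullet> y))"
        by (intro integrable_area_continuous continuous_on_zonal[OF continuous_on_sing_wt] e x)
      show "integrable area (\<lambda>y. indicator ?N y * e powr (-3/4))"
        by (intro integrable_mult_left integrable_real_indicator N) (simp add: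
            area.emeasure_eq_measure)
      show "indicator ?N y * e powr (-3/4) \<le> sing_wt e (x \<bullet> y)" if "y \<in> space area" for y
        using inner_S2_le[OF x, of y] that by (auto simp: indicator_def sing_wt_def)
    qed
    also have "\<dots> \<le> 15/2 * total_area" by (rule LINT_sing_wt_pos[OF e x])
    finally show ?thesis .
  qed
  have "measure area ?N \<le> 15/2 * total_area * e powr (3/4)" if e: "0 < e" "e \<le> 1" for e
    using le[OF e] e by (simp add: powr_minus field_simps)
  then have "eventually (\<lambda>e. measure area ?N \<le> 15/2 * total_area * e powr (3/4)) (at_right 0)"
    unfolding eventually_at_right_field by (intro exI[of _ 1]) auto
  moreover have "((\<lambda>e. 15/2 * total_area * e powr (3/4))
      \<longlongrightarrow> 15/2 * total_area * (0 powr (3/4))) (at_right 0)"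
    by (intro tendsto_intros tendsto_powr') (auto simp: eventually_at_right_field intro: exI[of _
        1])
  ultimately have "measure area ?N \<le> 15/2 * total_area * (0 powr (3/4))"
    by (intro tendsto_lowerbound) auto
  then have "measure area ?N = 0" by (simp add: measure_le_0_iff)
  then have "?N \<in> null_sets area" using N by (auto simp: null_sets_def area.emeasure_eq_measure)
  then show ?thesis by (rule AE_I') auto
qed

lemma measurable_zonal:
  assumes "\<phi> \<in> borel_measurable borel" "x \<in> S2"
  shows "(\<lambda>y. \<phi> (x \<bullet> y)) \<in> borel_measurable area"
  by (rule measurable_compose[OF borel_measurable_area_continuous assms(1)]) (intro
      continuous_intros)

lemma sing_wt_measurable [measurable]: "sing_wt e \<in> borel_measurable borel"
  unfolding sing_wt_def[abs_def] by measurable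

text \<open>Fatou's lemma carries the bound, which is uniform in \<open>e\<close>, to the singular
  weight.\<close>

lemma integrable_wk0_aux:
  assumes x: "x \<in> S2"
  shows "(\<integral>\<^sup>+y. ennreal (sing_wt 0 (x \<bullet> y)) \<partial>area) \<le> ennreal (15/2 * total_area)"
proof -
  define E where "E n = 1 / real (Suc n)" for n
  have E: "0 < E n" "E n \<le> 1" for n by (auto simp: E_def)
  have E0: "E \<longlonglongrightarrow> 0" unfolding E_def using LIMSEQ_inverse_real_of_nat by (simp add: inverse_eq_divide)
  have "(\<integral>\<^sup>+y. ennreal (sing_wt 0 (x \<bullet> y)) \<partial>area)
      = (\<integral>\<^sup>+y. liminf (\<lambda>n. ennreal (sing_wt (E n) (x \<bullet> y))) \<partial>area)"
  proof (rule nn_integral_cong_AE)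
    show "AE y in area. ennreal (sing_wt 0 (x \<bullet> y)) = liminf (\<lambda>n. ennreal (sing_wt (E n) (x \<bullet> y)))"
      using AE_inner_neq_1[OF x]
    proof (rule AE_mp, intro AE_I2 impI)
      fix y assume "x \<bullet> y < 1"
      then have "(\<lambda>n. (1 + E n - x \<bullet> y) powr (-3/4)) \<longlonglongrightarrow> (1 + 0 - x \<bullet> y) powr (-3/4)"
        by (intro tendsto_intros E0) auto
      then have "(\<lambda>n. ennreal (sing_wt (E n) (x \<bullet> y))) \<longlonglongrightarrow> ennreal (sing_wt 0 (x \<bullet> y))"
        unfolding sing_wt_def by (intro tendsto_ennrealI)
      then show "ennreal (sing_wt 0 (x \<bullet> y)) = liminf (\<lambda>n. ennreal (sing_wt (E n) (x \<bullet> y)))"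
        by (metis lim_imp_Liminf sequentially_bot)
    qed
  qed
  also have "\<dots> \<le> liminf (\<lambda>n. \<integral>\<^sup>+y. ennreal (sing_wt (E n) (x \<bullet> y)) \<partial>area)"
    by (intro nn_integral_liminf measurable_compose[OF measurable_zonal[OF sing_wt_measurable x]
        measurable_ennreal])
  also have "\<dots> \<le> ennreal (15/2 * total_area)"
  proof -
    have "(\<integral>\<^sup>+y. ennreal (sing_wt (E n) (x \<bullet> y)) \<partial>area) \<le> ennreal (15/2 * total_area)" for n
      by (subst nn_integral_eq_integral)
         (use E x LINT_sing_wt_pos[OF E x] in \<open>auto intro!: integrable_area_continuous
             continuous_on_zonal[OF continuous_on_sing_wt] ennreal_leI\<close>)
    then show ?thesis by (intro Liminf_le) auto
  qed
  finally show ?thesis .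
qed

lemma integrable_sing_wt:
  assumes "0 \<le> e" "x \<in> S2"
  shows "integrable area (\<lambda>y. sing_wt e (x \<bullet> y))"
proof (cases "e = 0")
  case True
  show ?thesis unfolding True
    using order.strict_trans1[OF integrable_wk0_aux[OF assms(2)] ennreal_less_top]
    by (intro integrableI_bounded measurable_zonal assms) auto
next
  case False
  then show ?thesis using assms by (intro integrable_area_continuous continuous_on_zonal[OF
      continuous_on_sing_wt]) auto
qed

lemma LINT_sing_wt:
  assumes e: "0 \<le> e" "e \<le> 1" and x: "x \<in> S2"
  shows "(LINT y|area. sing_wt e (x \<bullet> y)) \<le> 15/2 * total_area"
proof (cases "e = 0")
  case True
  have "ennreal (LINT y|area. sing_wt e (x \<bullet> y)) \<le> ennreal (15/2 * total_area)"
    using integrable_wk0_aux[OF x] unfolding True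
    by (subst nn_integral_eq_integral[symmetric]) (auto intro!: integrable_sing_wt x)
  then show ?thesis using measure_nonneg[of area S2] by (subst (asm) ennreal_le_iff) auto
next
  case False
  then show ?thesis using assms by (intro LINT_sing_wt_pos) auto
qed

section \<open>The regularised Green operator and its velocity field\<close>

definition log_ker :: "real \<Rightarrow> real \<Rightarrow> real" where "log_ker e s = - ln (1 + e - s)"
definition vel_ker :: "real \<Rightarrow> real \<Rightarrow> real" where "vel_ker e s = 1 / (1 + e - s)"

text \<open>For \<open>e = 0\<close> this is convolution with the Green function of \<open>- \<Delta>\<close> (up to a constant); the junk
  values \<open>ln 0 = 0\<close> and \<open>1 / 0 = 0\<close> occur only at \<open>y = x\<close>, which is a null set. For \<open>e > 0\<close> the
  kernels are smooth near the sphere.\<close>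

definition green :: "real \<Rightarrow> (real^3 \<Rightarrow> real) \<Rightarrow> real^3 \<Rightarrow> real" where
  "green e f x = (1 / total_area) * (LINT y|area. f y * log_ker e (x \<bullet> y))"

definition vel :: "real \<Rightarrow> (real^3 \<Rightarrow> real) \<Rightarrow> real^3 \<Rightarrow> real^3" where
  "vel e f x = (1 / total_area) *\<^sub>R (LINT y|area. f y *\<^sub>R (vel_ker e (x \<bullet> y) *\<^sub>R cross3 x y))"

lemma log_ker_measurable [measurable]: "log_ker e \<in> borel_measurable borel"
  unfolding log_ker_def[abs_def] by measurable

lemma vel_ker_measurable [measurable]: "vel_ker e \<in> borel_measurable borel"
  unfolding vel_ker_def[abs_def] by measurable

lemma ident_area_measurable [measurable]: "(\<lambda>x. x) \<in> area \<rightarrow>\<^sub>M borel"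
  by (rule borel_measurable_area_continuous) (rule continuous_on_id)

lemma cross3_measurable [measurable (raw)]:
  assumes "f \<in> borel_measurable N" "g \<in> borel_measurable N"
  shows "(\<lambda>x. cross3 (f x) (g x)) \<in> borel_measurable N"
  using borel_measurable_continuous_Pair[OF assms, of cross3]
      by (simp add: continuous_on_cross3 continuous_intros)

section \<open>Pointwise bounds for the kernels\<close>

lemma powr_bounds:
  assumes "-1 \<le> s" "s < (1::real)"
  shows "(1 - s) powr (-1/4) \<le> 2 * sing_wt 0 s" "(1 - s) powr (-1/2) \<le> 2 * sing_wt 0 s"
      "1/2 \<le> sing_wt 0 s"
proof -
  define d where "d = 1 - s"
  have d: "0 < d" "d \<le> 2" using assms by (auto simp: d_def)
  have *: "d powr a \<le> 2" if "0 \<le> a" "a \<le> 1" for a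
  proof -
    have "d powr a \<le> 2 powr a" using d that by (intro powr_mono2) auto
    also have "\<dots> \<le> 2 powr 1" using that by (intro powr_mono) auto
    finally show ?thesis by simp
  qed
  have "d powr (-1/4) = d powr (1/2) * d powr (-3/4)" "d powr (-1/2) = d powr (1/4) * d powr (-3/4)"
    unfolding powr_add[symmetric] by simp_all
  moreover have "d powr (1/2) * d powr (-3/4) \<le> 2 * d powr (-3/4)"
      "d powr (1/4) * d powr (-3/4) \<le> 2 * d powr (-3/4)"
    by (intro mult_right_mono *; simp)+
  ultimately show "(1 - s) powr (-1/4) \<le> 2 * sing_wt 0 s" "(1 - s) powr (-1/2) \<le> 2 * sing_wt 0 s"
    by (auto simp: sing_wt_def d_def)
  have "1 = d powr (3/4) * d powr (-3/4)" unfolding powr_add[symmetric] using d by simp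
  also have "\<dots> \<le> 2 * d powr (-3/4)" by (intro mult_right_mono *) auto
  finally show "1/2 \<le> sing_wt 0 s" by (simp add: sing_wt_def d_def)
qed

lemma log_ker_bound:
  assumes "0 \<le> e" "e \<le> 1" "-1 \<le> s" "s < 1"
  shows "\<bar>log_ker e s\<bar> \<le> 4 * sing_wt 0 s"
proof (cases "1 \<le> 1 + e - s")
  case True
  have "ln (1 + e - s) \<le> (1 + e - s) - 1" using True by (intro ln_le_minus_one) auto
  also have "\<dots> \<le> 2" using assms by auto
  finally have "\<bar>log_ker e s\<bar> \<le> 2" using True by (simp add: log_ker_def)
  then show ?thesis using powr_bounds(3)[OF assms(3,4)] by auto
next
  case False
  have "- ln (1 + e - s) \<le> - ln (1 - s)" using assms by auto
  also have "\<dots> = ln (1 / (1 - s))" using assms by (simp add: ln_div)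
  also have "\<dots> \<le> (1 / (1 - s)) powr (3/4) / (3/4)"
    using False assms by (intro ln_powr_bound) (auto simp: field_simps)
  also have "(1 / (1 - s)) powr (3/4) = sing_wt 0 s" using assms
      by (simp add: sing_wt_def powr_divide powr_minus_divide)
  also have "sing_wt 0 s / (3/4) \<le> 4 * sing_wt 0 s" by simp
  finally have "- ln (1 + e - s) \<le> 4 * sing_wt 0 s" .
  moreover have "ln (1 + e - s) \<le> 0" using False assms by auto
  ultimately show ?thesis by (simp add: log_ker_def)
qed

text \<open>With \<open>u = e / (1 - s)\<close> the difference is \<open>ln (1 + u)\<close>, which
  is at most \<open>4 * u powr (1/4)\<close>. The fourth root splits into a rate in \<open>e\<close>
  and the singularity \<open>(1 - s) powr (-1/4)\<close>, which the weight absorbs.\<close>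

lemma log_ker_diff_bound:
  assumes "0 \<le> e" "-1 \<le> s" "s < 1"
  shows "\<bar>log_ker e s - log_ker 0 s\<bar> \<le> 8 * e powr (1/4) * sing_wt 0 s"
proof -
  define u where "u = e / (1 - s)"
  have u: "0 \<le> u" using assms by (auto simp: u_def)
  have "log_ker 0 s - log_ker e s = ln ((1 + e - s) / (1 - s))" using assms
      by (simp add: log_ker_def ln_div)
  also have "(1 + e - s) / (1 - s) = 1 + u" using assms by (simp add: u_def field_simps)
  finally have eq: "log_ker 0 s - log_ker e s = ln (1 + u)" .
  have "ln (1 + u) = 4 * ln ((1 + u) powr (1/4))" using u by (simp add: ln_powr)
  also have "\<dots> \<le> 4 * ((1 + u) powr (1/4) - 1)"
    using u by (intro mult_left_mono ln_le_minus_one) auto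
  also have "(1 + u) powr (1/4) \<le> 1 + u powr (1/4)"
  proof -
    have "1 + u \<le> (1 + u powr (1/4)) ^ 4"
    proof -
      have "(u powr (1/4)) ^ 4 = u" using u by (cases "u = 0") (auto simp: powr_power)
      moreover have "1 + w ^ 4 \<le> (1 + w) ^ 4" if "0 \<le> w" for w :: real
        using that by (simp add: power4_eq_xxxx algebra_simps)
      ultimately show ?thesis by (metis powr_ge_zero)
    qed
    then have "(1 + u) powr (1/4) \<le> ((1 + u powr (1/4)) ^ 4) powr (1/4)"
      using u by (intro powr_mono2) auto
    also have "\<dots> = 1 + u powr (1/4)"
    proof -
      have z: "0 < 1 + u powr (1/4)" by (intro add_pos_nonneg) auto
      then have "(1 + u powr (1/4)) ^ 4 = (1 + u powr (1/4)) powr 4" by simp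
      then show ?thesis using z by (simp only: powr_powr) simp
    qed
    finally show ?thesis .
  qed
  finally have "ln (1 + u) \<le> 4 * u powr (1/4)" by simp
  also have "u powr (1/4) = e powr (1/4) * (1 - s) powr (-1/4)"
    using assms by (simp add: u_def powr_divide powr_minus_divide)
  also have "\<dots> \<le> e powr (1/4) * (2 * sing_wt 0 s)"
    by (intro mult_left_mono powr_bounds assms) auto
  finally have "ln (1 + u) \<le> 8 * e powr (1/4) * sing_wt 0 s" by simp
  moreover have "0 \<le> ln (1 + u)" using u by auto
  ultimately show ?thesis using eq by linarith
qed

lemma norm_cross_S2:
  assumes "x \<in> S2" "y \<in> S2"
  shows "norm (cross3 x y) \<le> 2 * (1 - x \<bullet> y) powr (1/2)"
proof -
  have "(norm (cross3 x y))\<^sup>2 = 1 - (x \<bullet> y)\<^sup>2"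
    using norm_cross[of x y] assms by simp
  also have "\<dots> = (1 - x \<bullet> y) * (1 + x \<bullet> y)" by (simp add: power2_eq_square algebra_simps)
  also have "\<dots> \<le> (1 - x \<bullet> y) * 4"
    using inner_S2_le[OF assms] by (intro mult_left_mono) auto
  also have "\<dots> = (2 * (1 - x \<bullet> y) powr (1/2))\<^sup>2"
    using inner_S2_le[OF assms] by (simp add: power_mult_distrib powr_half_sqrt)
  finally show ?thesis by (rule power2_le_imp_le) auto
qed

text \<open>\<open>cross3 x y\<close> vanishes like the square root of
  \<open>1 - x \<bullet> y\<close> and so halves the order of the pole of
  \<open>vel_ker\<close>.\<close>

lemma vel_ker_bound:
  assumes "0 \<le> e" "x \<in> S2" "y \<in> S2" "x \<bullet> y < 1"
  shows "norm (vel_ker e (x \<bullet> y) *\<^sub>R cross3 x y) \<le> 4 * sing_wt 0 (x \<bullet> y)"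
proof -
  let ?s = "x \<bullet> y"
  have "norm (vel_ker e ?s *\<^sub>R cross3 x y) = vel_ker e ?s * norm (cross3 x y)"
    using assms by (simp add: vel_ker_def)
  also have "\<dots> \<le> (1 / (1 - ?s)) * (2 * (1 - ?s) powr (1/2))"
    using assms by (intro mult_mono norm_cross_S2) (auto simp: vel_ker_def intro!: divide_left_mono)
  also have "1 / (1 - ?s) = (1 - ?s) powr -1" using assms by (simp add: powr_neg_one)
  also have "(1 - ?s) powr -1 * (2 * (1 - ?s) powr (1/2)) = 2 * (1 - ?s) powr (-1/2)"
  proof -
    have "(1 - ?s) powr (-1/2) = (1 - ?s) powr -1 * (1 - ?s) powr (1/2)"
        unfolding powr_add[symmetric] by simp
    then show ?thesis by (simp only: mult_ac)
  qed
  also have "\<dots> \<le> 2 * (2 * sing_wt 0 ?s)"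
    using assms inner_S2_ge by (intro mult_left_mono powr_bounds) auto
  finally show ?thesis by simp
qed

text \<open>The relative error \<open>e / (d + e)\<close> lies between \<open>0\<close> and
  \<open>1\<close>, so it is at most its own fourth root. This gives the rate
  \<open>e powr (1/4)\<close> at the price of \<open>d powr (-1/4)\<close>, which brings the
  exponent from \<open>-1/2\<close> to exactly that of the weight.\<close>

lemma vel_ker_diff_bound:
  assumes "0 \<le> e" "x \<in> S2" "y \<in> S2" "x \<bullet> y < 1"
  shows "norm (vel_ker e (x \<bullet> y) *\<^sub>R cross3 x y - vel_ker 0 (x \<bullet> y) *\<^sub>R cross3 x y)
      \<le> 8 * e powr (1/4) * sing_wt 0 (x \<bullet> y)"
proof -
  define d where "d = 1 - x \<bullet> y"
  have d: "0 < d" using assms by (simp add: d_def)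
  have "vel_ker 0 (x \<bullet> y) - vel_ker e (x \<bullet> y) = e / (d + e) * (1 / d)"
    using d assms by (simp add: vel_ker_def d_def field_simps)
  then have "norm (vel_ker e (x \<bullet> y) *\<^sub>R cross3 x y - vel_ker 0 (x \<bullet> y) *\<^sub>R cross3 x y)
      = \<bar>e / (d + e) * (1 / d)\<bar> * norm (cross3 x y)"
    by (metis norm_scaleR abs_minus_commute scaleR_diff_left)
  also have "\<bar>e / (d + e) * (1 / d)\<bar> = e / (d + e) * (1 / d)"
    using d assms by (simp add: abs_mult)
  also have "e / (d + e) * (1 / d) * norm (cross3 x y)
      \<le> (e powr (1/4) * d powr (-1/4)) * (d powr -1) * (2 * d powr (1/2))"
  proof (intro mult_mono)
    define r where "r = e / (d + e)"
    have r: "0 \<le> r" "r \<le> 1" using d assms by (auto simp: r_def)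
    have "r = r powr 1" using r by simp
    also have "\<dots> \<le> r powr (1/4)" using r by (intro powr_mono') auto
    also have "\<dots> = e powr (1/4) / (d + e) powr (1/4)" using d assms by (simp add: r_def powr_divide)
    also have "\<dots> \<le> e powr (1/4) / d powr (1/4)"
      using d assms by (intro divide_left_mono powr_mono2 mult_pos_pos) auto
    finally show "e / (d + e) \<le> e powr (1/4) * d powr (-1/4)" by (simp add: r_def powr_minus_divide)
    show "1 / d \<le> d powr -1" using d by (simp add: powr_neg_one)
    show "norm (cross3 x y) \<le> 2 * d powr (1/2)" unfolding d_def
        by (rule norm_cross_S2[OF assms(2,3)])
  qed (use d assms in auto)
  also have "\<dots> = 2 * e powr (1/4) * (d powr (-1/4) * d powr -1 * d powr (1/2))" by simp
  also have "d powr (-1/4) * d powr -1 * d powr (1/2) = sing_wt 0 (x \<bullet> y)"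
    unfolding sing_wt_def d_def powr_add[symmetric] by simp
  also have "2 * e powr (1/4) * sing_wt 0 (x \<bullet> y) \<le> 8 * e powr (1/4) * sing_wt 0 (x \<bullet> y)"
      by (intro mult_right_mono) auto
  finally show ?thesis .
qed

definition bmeas :: "real \<Rightarrow> (real^3 \<Rightarrow> real) \<Rightarrow> bool" where
  "bmeas B f \<longleftrightarrow> f \<in> borel_measurable area \<and> (\<forall>x\<in>S2. \<bar>f x\<bar> \<le> B)"

lemma bmeasD: "bmeas B f \<Longrightarrow> f \<in> borel_measurable area" "bmeas B f \<Longrightarrow> x \<in> S2 \<Longrightarrow> \<bar>f x\<bar> \<le> B"
    "bmeas B f \<Longrightarrow> 0 \<le> B"
proof -
  show "bmeas B f \<Longrightarrow> 0 \<le> B"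
    unfolding bmeas_def using norm_axis_1[of "1::3"] by (metis abs_ge_zero mem_sphere_0 order_trans)
qed (auto simp: bmeas_def)

lemma continuous_bmeas:
  assumes "continuous_on S2 f" obtains B where "bmeas B f"
  using continuous_on_S2_bounded[OF assms] borel_measurable_area_continuous[OF assms]
  unfolding bmeas_def by (metis real_norm_def)

text \<open>Reduces every kernel estimate to the one weight, whose integral is bounded independently
  of \<open>x\<close>. Boundedness of \<open>f\<close> enters linearly, so the same lemma serves for
  size, for regularisation errors and for small perturbations.\<close>

lemma kernel_integral:
  fixes k :: "real^3 \<Rightarrow> 'b::{banach, second_countable_topology}"
  assumes x: "x \<in> S2" and f: "bmeas B f" and k: "k \<in> borel_measurable area"
    and b: "\<And>y. y \<in> S2 \<Longrightarrow> x \<bullet> y < 1 \<Longrightarrow> norm (k y) \<le> c * sing_wt 0 (x \<bullet> y)"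
  shows "integrable area (\<lambda>y. f y *\<^sub>R k y)"
    and "0 \<le> c \<Longrightarrow> norm (LINT y|area. f y *\<^sub>R k y) \<le> c * B * (15/2) * total_area"
proof -
  have i: "integrable area (\<lambda>y. B * (c * sing_wt 0 (x \<bullet> y)))"
    by (intro integrable_mult_right integrable_sing_wt x) auto
  have le: "AE y in area. norm (f y *\<^sub>R k y) \<le> B * (c * sing_wt 0 (x \<bullet> y))"
    using AE_inner_neq_1[OF x]
  proof (rule AE_mp, intro AE_I2 impI)
    fix y assume "y \<in> space area" "x \<bullet> y < 1"
    then show "norm (f y *\<^sub>R k y) \<le> B * (c * sing_wt 0 (x \<bullet> y))"
      unfolding norm_scaleR using bmeasD(2)[OF f, of y] b[of y] bmeasD(3)[OF f]
          by (intro mult_mono) auto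
  qed
  show int: "integrable area (\<lambda>y. f y *\<^sub>R k y)"
    by (rule area_integrable_bound[OF i]) (use le k bmeasD[OF f] in auto)
  assume c: "0 \<le> c"
  have "norm (LINT y|area. f y *\<^sub>R k y) \<le> (LINT y|area. norm (f y *\<^sub>R k y))"
      by (rule integral_norm_bound)
  also have "\<dots> \<le> (LINT y|area. B * (c * sing_wt 0 (x \<bullet> y)))"
    by (rule integral_mono_AE[OF integrable_norm[OF int] i le])
  also have "\<dots> = B * c * (LINT y|area. sing_wt 0 (x \<bullet> y))" by simp
  also have "\<dots> \<le> B * c * (15/2 * total_area)"
    using c bmeasD(3)[OF f] by (intro mult_left_mono LINT_sing_wt x) auto
  finally show "norm (LINT y|area. f y *\<^sub>R k y) \<le> c * B * (15/2) * total_area"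
      by (simp add: mult_ac)
qed

lemma green_integrable:
  assumes "0 \<le> e" "e \<le> 1" "x \<in> S2" "bmeas B f"
  shows "integrable area (\<lambda>y. f y * log_ker e (x \<bullet> y))"
  using kernel_integral(1)[of x B f "\<lambda>y. log_ker e (x
      \<bullet> y)" 4] assms log_ker_bound[OF assms(1,2)] inner_S2_ge[OF assms(3)]
  by auto

lemma vel_integrable:
  assumes "0 \<le> e" "x \<in> S2" "bmeas B f"
  shows "integrable area (\<lambda>y. f y *\<^sub>R (vel_ker e (x \<bullet> y) *\<^sub>R cross3 x y))"
  using kernel_integral(1)[of x B f "\<lambda>y. vel_ker e (x
      \<bullet> y) *\<^sub>R cross3 x y" 4] assms vel_ker_bound[OF assms(1,2)]
  by auto

lemma green_bound:
  assumes "0 \<le> e" "e \<le> 1" "x \<in> S2" "bmeas B f"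
  shows "\<bar>green e f x\<bar> \<le> 30 * B"
  using kernel_integral(2)[of x B f "\<lambda>y. log_ker e (x
      \<bullet> y)" 4] assms log_ker_bound[OF assms(1,2)] inner_S2_ge[OF assms(3)]
    measure_area_pos by (auto simp: green_def abs_mult field_simps)

lemma green_diff_bound:
  assumes "0 \<le> e" "e \<le> 1" "x \<in> S2" "bmeas B f"
  shows "\<bar>green e f x - green 0 f x\<bar> \<le> 60 * B * e powr (1/4)"
proof -
  have "(LINT y|area. f y *\<^sub>R (log_ker e (x \<bullet> y) - log_ker 0 (x \<bullet> y))) =
      (LINT y|area. f y * log_ker e (x \<bullet> y)) - (LINT y|area. f y * log_ker 0 (x \<bullet> y))"
    unfolding real_scaleR_def right_diff_distrib
    by (intro LINT_diff) (auto intro!: green_integrable assms)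
  then have eq: "green e f x - green 0 f x
      = (1 / total_area) * (LINT y|area. f y *\<^sub>R (log_ker e (x \<bullet> y) - log_ker 0 (x \<bullet> y)))"
    unfolding green_def right_diff_distrib[symmetric] by simp
  have "norm (LINT y|area. f y *\<^sub>R (log_ker e (x \<bullet> y) - log_ker 0 (x \<bullet> y)))
      \<le> (8 * e powr (1/4)) * B * (15/2) * total_area"
    by (rule kernel_integral(2)[OF assms(3,4)])
       (use log_ker_diff_bound[OF assms(1)] inner_S2_ge[OF assms(3)] in auto)
  then show ?thesis unfolding eq using measure_area_pos
      by (simp add: abs_mult field_simps del: real_scaleR_def)
qed

lemma vel_diff_bound:
  assumes "0 \<le> e" "x \<in> S2" "bmeas B f"
  shows "norm (vel e f x - vel 0 f x) \<le> 60 * B * e powr (1/4)"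
proof -
  have "(LINT y|area. f y *\<^sub>R (vel_ker e (x \<bullet> y) *\<^sub>R cross3 x y - vel_ker 0 (x
      \<bullet> y) *\<^sub>R cross3 x y)) =
     (LINT y|area. f y *\<^sub>R (vel_ker e (x \<bullet> y) *\<^sub>R cross3 x y)) - (LINT y|area. f y *\<^sub>R (vel_ker 0 (x
         \<bullet> y) *\<^sub>R cross3 x y))"
    unfolding scaleR_diff_right
    by (intro LINT_diff vel_integrable[OF _ assms(2,3)] assms(1) order_refl)
  then have eq: "vel e f x - vel 0 f x = (1 / total_area) *\<^sub>R (LINT y|area. f y *\<^sub>R (vel_ker e (x
      \<bullet> y) *\<^sub>R cross3 x y - vel_ker 0 (x \<bullet> y) *\<^sub>R cross3 x y))"
    unfolding vel_def scaleR_diff_right[symmetric] by simp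
  have "norm (LINT y|area. f y *\<^sub>R (vel_ker e (x \<bullet> y) *\<^sub>R cross3 x y - vel_ker 0 (x
      \<bullet> y) *\<^sub>R cross3 x y)) \<le> (8 * e powr (1/4)) * B * (15/2) * total_area"
    by (rule kernel_integral(2)[OF assms(2,3)])
       (use vel_ker_diff_bound[OF assms(1,2)] in auto)
  then show ?thesis unfolding eq norm_scaleR using measure_area_pos
      by (simp add: abs_mult field_simps)
qed

section \<open>Differentiability of the regularised potential near the sphere\<close>

text \<open>Keeps the argument of the logarithm away from \<open>0\<close> on a ball slightly larger
  than the unit ball. That ball is the open neighbourhood of the sphere in which the regularised
  potential can be differentiated in all directions of space.\<close>

lemma Ue_pos:
  assumes "0 < e" "x \<in> ball 0 (1 + e/2)" "y \<in> S2"
  shows "e / 2 < 1 + e - x \<bullet> y"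
proof -
  have "x \<bullet> y \<le> norm x * norm y" by (rule norm_cauchy_schwarz)
  then show ?thesis using assms by auto
qed

text \<open>With \<open>t = d' / d\<close> the remainder is \<open>t - 1 - ln t\<close>. The
  inequality \<open>ln t \<le> t - 1\<close>, applied at \<open>t\<close> and at
  \<open>1 / t\<close>, bounds it from below by \<open>0\<close> and from above by
  \<open>(d' - d)\<^sup>2 / (d * d')\<close>.\<close>

lemma log_ker_taylor:
  fixes d d' :: real
  assumes "0 < c" "c < d" "c < d'"
  shows "\<bar>- ln d' + ln d + (d' - d) / d\<bar> \<le> (d' - d)\<^sup>2 / c\<^sup>2"
proof -
  define t where "t = d' / d"
  have t: "0 < t" using assms by (auto simp: t_def)
  have eq: "- ln d' + ln d + (d' - d) / d = t - 1 - ln t"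
    using assms by (simp add: t_def ln_div field_simps)
  have 1: "0 \<le> t - 1 - ln t" using ln_le_minus_one[OF t] by simp
  have "- ln t = ln (1 / t)" using t by (simp add: ln_div)
  also have "\<dots> \<le> 1 / t - 1" using t by (intro ln_le_minus_one) auto
  finally have "t - 1 - ln t \<le> t - 1 + 1 / t - 1" by simp
  also have "\<dots> = (d' - d)\<^sup>2 / (d * d')"
    using assms by (simp add: t_def field_simps power2_eq_square)
  also have "\<dots> \<le> (d' - d)\<^sup>2 / c\<^sup>2"
    using assms by (intro divide_left_mono) (auto simp: power2_eq_square intro!: mult_mono)
  finally show ?thesis using eq 1 by simp
qed

definition green_grad :: "real \<Rightarrow> (real^3 \<Rightarrow> real) \<Rightarrow> real^3 \<Rightarrow> real^3" where
  "green_grad e f x = (1 / total_area) *\<^sub>R (LINT y|area. (f y * vel_ker e (x \<bullet> y)) *\<^sub>R y)"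

lemma green_e_int:
  assumes e: "0 < e" and f: "bmeas B f" and x: "x \<in> ball 0 (1 + e/2)"
  shows "integrable area (\<lambda>y. f y * log_ker e (x \<bullet> y))"
    "integrable area (\<lambda>y. (f y * vel_ker e (x \<bullet> y)) *\<^sub>R y)"
proof -
  have "continuous_on S2 (\<lambda>y. log_ker e (x \<bullet> y))" "continuous_on S2 (\<lambda>y. vel_ker e (x \<bullet> y))"
    unfolding log_ker_def vel_ker_def using Ue_pos[OF e x] e
        by (auto intro!: continuous_intros simp: less_eq_real_def[symmetric]) (smt (verit)
        mem_sphere_0)+
  then obtain A A' where A: "\<And>y. y \<in> S2 \<Longrightarrow> norm (log_ker e (x \<bullet> y)) \<le> A"
      "\<And>y. y \<in> S2 \<Longrightarrow> norm (vel_ker e (x \<bullet> y)) \<le> A'"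
    by (metis continuous_on_S2_bounded)
  note [measurable] = bmeasD(1)[OF f]
  show "integrable area (\<lambda>y. f y * log_ker e (x \<bullet> y))"
    by (rule integrable_area_bounded[of _ "B * A"])
       (use A(1) bmeasD(2,3)[OF f] in \<open>auto simp: abs_mult intro!: mult_mono\<close>)
  show "integrable area (\<lambda>y. (f y * vel_ker e (x \<bullet> y)) *\<^sub>R y)"
    by (rule integrable_area_bounded[of _ "B * A'"])
       (use A(2) bmeasD(2,3)[OF f] in \<open>auto simp: abs_mult intro!: mult_mono\<close>)
qed

text \<open>The quadratic remainder of the kernel is uniform in \<open>y\<close>, so integrating it
  against the bounded \<open>f\<close> gives a quadratic remainder for the potential.\<close>

lemma green_has_derivative:
  assumes e: "0 < e" and f: "bmeas B f" and x: "x \<in> ball 0 (1 + e/2)"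
  shows "(green e f has_derivative (\<lambda>v. green_grad e f x \<bullet> v)) (at x)"
proof -
  obtain r where r: "0 < r" "ball x r \<subseteq> ball 0 (1 + e/2)"
    using x open_contains_ball[of "ball 0 (1 + e/2)"] open_ball by blast
  have main: "\<bar>green e f x' - green e f x - green_grad e f x \<bullet> (x' - x)\<bar>
      \<le> B * (4 / e\<^sup>2) * (norm (x' - x))\<^sup>2"
    if x': "x' \<in> ball 0 (1 + e/2)" for x'
  proof -
    let ?R = "\<lambda>y. f y * (log_ker e (x' \<bullet> y) - log_ker e (x \<bullet> y) - vel_ker e (x \<bullet> y) * ((x' - x)
        \<bullet> y))"
    have i1: "integrable area (\<lambda>y. (f y * vel_ker e (x \<bullet> y)) *\<^sub>R y \<bullet> (x' - x))"
      by (intro integrable_inner_left) (use green_e_int(2)[OF e f x] in auto)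
    have "green e f x' - green e f x - green_grad e f x \<bullet> (x' - x) =
      (1 / total_area) * ((LINT y|area. f y * log_ker e (x' \<bullet> y)) - (LINT y|area. f y * log_ker e (x
          \<bullet> y)) - (LINT y|area. (f y * vel_ker e (x \<bullet> y)) *\<^sub>R y \<bullet> (x' - x)))"
      unfolding green_def green_grad_def
      by (subst integral_inner_left) (use green_e_int(2)[OF e f x] in \<open>auto simp: algebra_simps\<close>)
    also have "\<dots> = (1 / total_area) * (LINT y|area. ?R y)"
    proof -
      have "(LINT y|area. ?R y) = (LINT y|area. f y * log_ker e (x' \<bullet> y) - f y * log_ker e (x \<bullet> y)
          - (f y * vel_ker e (x \<bullet> y)) *\<^sub>R y \<bullet> (x' - x))"
        by (intro LINT_cong) (auto simp: algebra_simps inner_commute)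
      also have "\<dots> = (LINT y|area. f y * log_ker e (x' \<bullet> y)) - (LINT y|area. f y * log_ker e (x
          \<bullet> y)) - (LINT y|area. (f y * vel_ker e (x \<bullet> y)) *\<^sub>R y \<bullet> (x' - x))"
        by (simp only: LINT_diff area_integrable_diff i1 green_e_int(1)[OF e f x] green_e_int(1)[OF
            e f x'])
      finally show ?thesis by simp
    qed
    finally have eq: "green e f x' - green e f x - green_grad e f x \<bullet> (x' - x)
        = (1 / total_area) * (LINT y|area. ?R y)" .
    have bd: "\<bar>?R y\<bar> \<le> B * ((4 / e\<^sup>2) * (norm (x' - x))\<^sup>2)" if y: "y \<in> S2" for y
      unfolding abs_mult
    proof (intro mult_mono)
      have "\<bar>log_ker e (x' \<bullet> y) - log_ker e (x \<bullet> y) - vel_ker e (x \<bullet> y) * ((x' - x) \<bullet> y)\<bar>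
          \<le> ((1 + e - x' \<bullet> y) - (1 + e - x \<bullet> y))\<^sup>2 / (e/2)\<^sup>2"
        using log_ker_taylor[of "e/2" "1 + e - x \<bullet> y"
            "1 + e - x' \<bullet> y"] e Ue_pos[OF e x y] Ue_pos[OF e x' y]
        by (simp add: log_ker_def vel_ker_def inner_diff_left algebra_simps diff_divide_distrib)
      also have "((1 + e - x' \<bullet> y) - (1 + e - x \<bullet> y))\<^sup>2 = ((x' - x) \<bullet> y)\<^sup>2"
        by (simp add: inner_diff_left power2_commute)
      also have "((x' - x) \<bullet> y)\<^sup>2 \<le> (norm (x' - x))\<^sup>2"
        using Cauchy_Schwarz_ineq2[of "x' - x" y] y by (intro abs_le_square_iff[THEN iffD1]) auto
      finally show "\<bar>log_ker e (x' \<bullet> y) - log_ker e (x \<bullet> y) - vel_ker e (x \<bullet> y) * ((x' - x) \<bullet> y)\<bar>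
          \<le> (4 / e\<^sup>2) * (norm (x' - x))\<^sup>2"
        using e by (simp add: field_simps power2_eq_square)
    qed (use bmeasD(2,3)[OF f] y in auto)
    have "\<bar>LINT y|area. ?R y\<bar> \<le> (LINT y|area. B * ((4 / e\<^sup>2) * (norm (x' - x))\<^sup>2))"
    proof (rule order_trans[OF integral_abs_bound integral_mono])
      show "integrable area (\<lambda>y. \<bar>?R y\<bar>)"
        by (rule integrable_area_bounded) (use bd bmeasD(1)[OF f] in \<open>auto intro!:
            borel_measurable_times borel_measurable_diff\<close>)
    qed (use bd in auto)
    then show ?thesis unfolding eq using measure_area_pos by (simp add: abs_mult field_simps)
  qed
  show ?thesis
  proof (rule has_derivativeI_sandwich[OF r(1)])
    show "bounded_linear (\<lambda>v. green_grad e f x \<bullet> v)" by (rule bounded_linear_inner_right)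
    fix x' assume "x' \<in> UNIV" "x' \<noteq> x" "dist x' x < r"
    then have "x' \<in> ball 0 (1 + e/2)" using r by (auto simp: dist_commute)
    from main[OF this] show "norm (green e f x' - green e f x - green_grad e f x \<bullet> (x'
        - x)) / norm (x' - x) \<le> B * (4 / e\<^sup>2) * norm (x' - x)"
      using \<open>x' \<noteq> x\<close> by (simp add: field_simps power2_eq_square)
  next
    have "((\<lambda>x'. B * (4 / e\<^sup>2) * norm (x' - x)) \<longlongrightarrow> B * (4 / e\<^sup>2) * norm (x - x)) (at x)"
      by (intro tendsto_intros)
    then show "((\<lambda>x'. B * (4 / e\<^sup>2) * norm (x' - x)) \<longlongrightarrow> 0) (at x within UNIV)" by simp
  qed
qed

lemma continuous_on_green_grad:
  assumes e: "0 < e" and f: "bmeas B f"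
  shows "continuous_on (ball 0 (1 + e/2)) (green_grad e f)"
proof (rule lipschitz_on_continuous_on[of "B * (4 / e\<^sup>2)"], rule lipschitz_onI)
  show "0 \<le> B * (4 / e\<^sup>2)" using bmeasD(3)[OF f] by auto
  fix x x' :: "real^3" assume x: "x \<in> ball 0 (1 + e/2)" and x': "x' \<in> ball 0 (1 + e/2)"
  let ?R = "\<lambda>y. (f y * vel_ker e (x \<bullet> y)) *\<^sub>R y - (f y * vel_ker e (x' \<bullet> y)) *\<^sub>R y"
  have eq: "green_grad e f x - green_grad e f x' = (1 / total_area) *\<^sub>R (LINT y|area. ?R y)"
    unfolding green_grad_def scaleR_diff_right[symmetric]
    by (subst LINT_diff[symmetric]) (use green_e_int(2)[OF e f] x x' in auto)
  have bd: "norm (?R y) \<le> B * ((4 / e\<^sup>2) * norm (x - x'))" if y: "y \<in> S2" for y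
  proof -
    define d d' where "d = 1 + e - x \<bullet> y" and "d' = 1 + e - x' \<bullet> y"
    have d: "e / 2 < d" "e / 2 < d'" using Ue_pos[OF e x y] Ue_pos[OF e x' y]
        by (auto simp: d_def d'_def)
    have "norm (?R y) = \<bar>f y\<bar> * \<bar>1 / d - 1 / d'\<bar>"
    proof -
      have "?R y = (f y * (1 / d - 1 / d')) *\<^sub>R y"
        by (simp add: vel_ker_def d_def d'_def right_diff_distrib scaleR_diff_left)
      then show ?thesis using y by (simp add: abs_mult)
    qed
    also have "\<bar>1 / d - 1 / d'\<bar> = \<bar>(x - x') \<bullet> y\<bar> / (d * d')"
      using d e by (simp add: diff_frac_eq abs_mult) (simp add: d_def d'_def inner_diff_left)
    also have "\<bar>f y\<bar> * (\<bar>(x - x') \<bullet> y\<bar> / (d * d')) \<le> B * (norm (x - x') / ((e/2) * (e/2)))"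
      using d e y bmeasD(2,3)[OF f] Cauchy_Schwarz_ineq2[of "x - x'" y]
      by (intro mult_mono frac_le) auto
    finally show ?thesis by (simp add: power2_eq_square field_simps)
  qed
  have "norm (LINT y|area. ?R y) \<le> (LINT y|area. B * ((4 / e\<^sup>2) * norm (x - x')))"
  proof (rule order_trans[OF integral_norm_bound integral_mono])
    show "integrable area (\<lambda>y. norm (?R y))"
      by (intro integrable_norm area_integrable_diff green_e_int(2)[OF e f] x x')
  qed (use bd in auto)
  then show "dist (green_grad e f x) (green_grad e f x') \<le> B * (4 / e\<^sup>2) * dist x x'"
    unfolding dist_norm eq using measure_area_pos by (simp add: abs_mult field_simps)
qed

lemma green_C1:
  assumes "0 < e" "bmeas B f"
  shows "C1_on (green e f) (ball 0 (1 + e/2))"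
  by (rule C1I[OF green_has_derivative continuous_on_green_grad]) (use assms in auto)

lemma S2_subset_ball: "0 < e \<Longrightarrow> S2 \<subseteq> ball 0 (1 + e/2)" by auto

lemma cross_green_grad:
  assumes "0 < e" "bmeas B f" "x \<in> ball 0 (1 + e/2)"
  shows "cross3 x (green_grad e f x) = vel e f x"
proof -
  have "norm (cross3 x v) \<le> norm v * norm x" for v
  proof (rule power2_le_imp_le)
    show "(norm (cross3 x v))\<^sup>2 \<le> (norm v * norm x)\<^sup>2"
      unfolding norm_cross power_mult_distrib by simp
  qed simp
  then have bl: "bounded_linear (cross3 x)"
    by (intro bounded_linear_intro[of _ "norm x"]) (auto simp: cross_add_right cross_mult_right)
  show ?thesis
    unfolding green_grad_def vel_def cross_mult_right
    using integral_bounded_linear[OF bl green_e_int(2)[OF assms]] by (simp add: cross_mult_right)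
qed

text \<open>By the triple product identity, \<open>vel\<close> collects all rotational derivatives
  of the potential in one vector. It is given by an explicit kernel on the sphere, so this form of
  the derivative still makes sense at \<open>e = 0\<close>.\<close>

lemma rotderiv_green:
  assumes "0 < e" "bmeas B f" "x \<in> ball 0 (1 + e/2)"
  shows "rotderiv a (green e f) x = a \<bullet> vel e f x"
  using rotderiv_eqI[OF green_has_derivative[OF assms]] cross_green_grad[OF assms]
  by (metis cross_triple inner_commute)

lemma continuous_on_green_pos: "0 < e \<Longrightarrow> bmeas B f \<Longrightarrow> continuous_on S2 (green e f)"
  by (rule continuous_on_subset[OF C1_continuous[OF green_C1] S2_subset_ball])

lemma continuous_on_vel_pos:
  assumes "0 < e" "bmeas B f" shows "continuous_on S2 (vel e f)"
proof -
  have "continuous_on S2 (\<lambda>x. cross3 x (green_grad e f x))"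
    by (intro continuous_intros continuous_on_subset[OF continuous_on_green_grad[OF assms]
        S2_subset_ball] assms)
  then show ?thesis by (rule continuous_on_eq) (use cross_green_grad[OF assms] assms in auto)
qed

lemma uniform_limit_quarter:
  assumes "\<And>e x. 0 < e \<Longrightarrow> e \<le> 1 \<Longrightarrow> x \<in> S2 \<Longrightarrow> norm (F e x - F0 x) \<le> C * e powr (1/4)"
  shows "uniform_limit S2 F F0 (at_right (0::real))"
proof (rule uniform_limitI)
  fix r :: real assume r: "0 < r"
  have "((\<lambda>e. C * e powr (1/4)) \<longlongrightarrow> C * 0 powr (1/4)) (at_right (0::real))"
    by (intro tendsto_intros tendsto_powr') (auto simp: eventually_at_right_field intro: exI[of _
        1])
  then have "eventually (\<lambda>e. C * e powr (1/4) < r) (at_right (0::real))"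
    using r by (auto dest: order_tendstoD)
  moreover have "eventually (\<lambda>e. 0 < e \<and> e \<le> 1) (at_right (0::real))"
    unfolding eventually_at_right_field by (intro exI[of _ 1]) auto
  ultimately show "eventually (\<lambda>e. \<forall>x\<in>S2. dist (F e x) (F0 x) < r) (at_right 0)"
    by eventually_elim (use assms in \<open>force simp: dist_norm\<close>)
qed

lemma uniform_green: "bmeas B f \<Longrightarrow> uniform_limit S2 (\<lambda>e. green e f) (green 0 f) (at_right 0)"
  by (rule uniform_limit_quarter[of _ _ "60 * B"]) (use green_diff_bound in auto)

lemma uniform_vel: "bmeas B f \<Longrightarrow> uniform_limit S2 (\<lambda>e. vel e f) (vel 0 f) (at_right 0)"
  by (rule uniform_limit_quarter[of _ _ "60 * B"]) (use vel_diff_bound in auto)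

lemma eventually_at_right_pos: "eventually (\<lambda>e. 0 < e \<and> e \<le> 1) (at_right (0::real))"
  unfolding eventually_at_right_field by (intro exI[of _ 1]) auto

lemma continuous_on_green: assumes "bmeas B f" shows "continuous_on S2 (green 0 f)"
  by (rule uniform_limit_theorem[OF _ uniform_green[OF assms]])
     (auto intro: eventually_mono[OF eventually_at_right_pos] continuous_on_green_pos[OF _ assms])

lemma continuous_on_vel: assumes "bmeas B f" shows "continuous_on S2 (vel 0 f)"
  by (rule uniform_limit_theorem[OF _ uniform_vel[OF assms]])
     (auto intro: eventually_mono[OF eventually_at_right_pos] continuous_on_vel_pos[OF _ assms])

lemma tendsto_LINT_uniform:
  fixes F :: "'c \<Rightarrow> real^3 \<Rightarrow> real"
  assumes u: "uniform_limit S2 F F0 G" and c: "eventually (\<lambda>e. continuous_on S2 (F e)) G"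
      and [simp]: "G \<noteq> bot"
  shows "((\<lambda>e. LINT x|area. F e x) \<longlongrightarrow> (LINT x|area. F0 x)) G"
proof (rule tendstoI)
  fix r :: real assume r: "0 < r"
  have c0: "continuous_on S2 F0" by (rule uniform_limit_theorem[OF c u]) simp
  define q where "q = r / (2 * total_area)"
  have q: "0 < q" using r measure_area_pos by (simp add: q_def)
  show "eventually (\<lambda>e. dist (LINT x|area. F e x) (LINT x|area. F0 x) < r) G"
    using uniform_limitD[OF u q] c
  proof eventually_elim
    case (elim e)
    have "dist (LINT x|area. F e x) (LINT x|area. F0 x) = \<bar>LINT x|area. F e x - F0 x\<bar>"
      unfolding dist_real_def
      by (subst LINT_diff) (auto intro!: integrable_area_continuous elim c0)
    also have "\<dots> \<le> (LINT x|area. q)"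
      by (rule order_trans[OF integral_abs_bound integral_mono])
         (use elim c0 in \<open>auto intro!: integrable_area_continuous continuous_intros simp:
             dist_real_def less_imp_le\<close>)
    also have "\<dots> < r" using r measure_area_pos by (simp add: q_def)
    finally show ?case .
  qed
qed

section \<open>Identities for the Green operator\<close>

lemma Fubini_bounded:
  fixes N :: "real^3 \<Rightarrow> real^3 \<Rightarrow> real"
  assumes m: "(\<lambda>(x, y). N x y) \<in> borel_measurable (area \<Otimes>\<^sub>M area)"
    and b: "\<And>x y. x \<in> S2 \<Longrightarrow> y \<in> S2 \<Longrightarrow> \<bar>N x y\<bar> \<le> B"
  shows "(LINT x|area. LINT y|area. N x y) = (LINT y|area. LINT x|area. N x y)"
proof -
  interpret P: pair_sigma_finite area area ..
  interpret F: finite_measure "area \<Otimes>\<^sub>M area"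
    by (intro finite_measure_pair_measure finite_measure_area)
  have "integrable (area \<Otimes>\<^sub>M area) (\<lambda>(x, y). N x y)"
    by (rule F.integrable_const_bound[of _ B]) (use m b in \<open>auto simp: space_pair_measure\<close>)
  from P.Fubini_integral[OF this] show ?thesis by simp
qed

lemma continuous_on_log_ker: "0 < e \<Longrightarrow> continuous_on {-1..1} (log_ker e)"
  unfolding log_ker_def[abs_def] by (intro continuous_intros) auto

lemma continuous_on_vel_ker: "0 < e \<Longrightarrow> continuous_on {-1..1} (vel_ker e)"
  unfolding vel_ker_def[abs_def] by (intro continuous_intros) auto

lemma zonal_bound:
  assumes "continuous_on {-1..1::real} \<phi>"
  obtains A where "0 \<le> A" "\<And>x y. x \<in> S2 \<Longrightarrow> y \<in> S2 \<Longrightarrow> \<bar>\<phi> (x \<bullet> y)\<bar> \<le> (A::real)"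
proof -
  have "bounded (\<phi> ` {-1..1})"
    using assms by (intro compact_imp_bounded compact_continuous_image) auto
  then obtain A where "\<And>s. s \<in> {-1..1} \<Longrightarrow> \<bar>\<phi> s\<bar> \<le> A" unfolding bounded_iff
      by (metis imageI real_norm_def)
  note A = this
  show thesis
  proof (rule that)
    show "0 \<le> A" using A[of 0] by auto
    show "\<bar>\<phi> (x \<bullet> y)\<bar> \<le> A" if "x \<in> S2" "y \<in> S2" for x y
      using inner_S2_ge[OF that] inner_S2_le[OF that] by (intro A) auto
  qed
qed

text \<open>Fubini and the symmetry of the kernel, which is bounded for \<open>e > 0\<close>. The
  identity at \<open>e = 0\<close> then follows by uniform convergence; the identities for the
  velocity are obtained by the same scheme.\<close>

lemma green_sym_pos:
  assumes e: "0 < e" and f: "bmeas B f" and h: "bmeas C h"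
  shows "(LINT x|area. h x * green e f x) = (LINT x|area. f x * green e h x)"
proof -
  obtain A where A: "0 \<le> A" "\<And>x y. x \<in> S2 \<Longrightarrow> y \<in> S2 \<Longrightarrow> \<bar>log_ker e (x \<bullet> y)\<bar> \<le> A"
    using zonal_bound[OF continuous_on_log_ker[OF e]] by metis
  note [measurable] = bmeasD(1)[OF f] bmeasD(1)[OF h]
  have "(LINT x|area. LINT y|area. h x * f y * log_ker e (x \<bullet> y))
      = (LINT y|area. LINT x|area. h x * f y * log_ker e (x \<bullet> y))"
    by (rule Fubini_bounded[of _ "C * B * A"])
       (measurable, use A bmeasD(2,3)[OF f] bmeasD(2,3)[OF h] in \<open>auto simp: abs_mult intro!:
           mult_mono\<close>)
  then have "(LINT x|area. h x * (LINT y|area. f y * log_ker e (x \<bullet> y)))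
      = (LINT y|area. f y * (LINT x|area. h x * log_ker e (y \<bullet> x)))"
    by (simp add: mult.assoc mult.left_commute[of "h _"
        "f _"] inner_commute flip: integral_mult_right_zero)
  then show ?thesis unfolding green_def by (simp add: mult.left_commute[of _ "1 / total_area"] del:
      times_divide_eq_left)
qed

lemma bmeas_tendsto_LINT:
  assumes f: "bmeas B f" and u: "uniform_limit S2 F F0 G"
      and c: "eventually (\<lambda>e. continuous_on S2 (F e)) G" and [simp]: "G \<noteq> bot"
  shows "((\<lambda>e. LINT x|area. f x * F e x) \<longlongrightarrow> (LINT x|area. f x * F0 x)) G"
proof (rule tendstoI)
  fix r :: real assume r: "0 < r"
  have c0: "continuous_on S2 F0" by (rule uniform_limit_theorem[OF c u]) simp
  define q where "q = r / (2 * total_area * (B + 1))"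
  have q: "0 < q" using r measure_area_pos bmeasD(3)[OF f] by (simp add: q_def)
  have int: "integrable area (\<lambda>x. f x * g x)" if g: "continuous_on S2 g" for g
  proof -
    obtain A where A: "\<And>x. x \<in> S2 \<Longrightarrow> norm (g x) \<le> A" by (metis continuous_on_S2_bounded[OF g])
    show ?thesis
      by (rule integrable_area_bounded[of _ "B * A"])
       (use A bmeasD[OF f] borel_measurable_area_continuous[OF g] in \<open>auto simp: abs_mult intro!:
           mult_mono\<close>)
  qed
  show "eventually (\<lambda>e. dist (LINT x|area. f x * F e x) (LINT x|area. f x * F0 x) < r) G"
    using uniform_limitD[OF u q] c
  proof eventually_elim
    case (elim e)
    have bd: "\<bar>f x * (F e x - F0 x)\<bar> \<le> B * q" if "x \<in> S2" for x
      unfolding abs_mult using elim(1) that bmeasD(2,3)[OF f]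
          by (intro mult_mono) (auto simp: dist_real_def less_imp_le)
    have "dist (LINT x|area. f x * F e x) (LINT x|area. f x * F0 x)
        = \<bar>LINT x|area. f x * (F e x - F0 x)\<bar>"
      unfolding dist_real_def right_diff_distrib
      by (subst LINT_diff) (auto intro!: int elim c0)
    also have "\<dots> \<le> (LINT x|area. B * q)"
      by (rule order_trans[OF integral_abs_bound integral_mono])
         (use elim c0 bd in \<open>auto intro!: integrable_abs int continuous_intros\<close>)
    also have "\<dots> = r / 2 * (B / (B + 1))" using measure_area_pos bmeasD(3)[OF f]
        by (simp add: q_def)
    also have "\<dots> \<le> r / 2 * 1" using r bmeasD(3)[OF f] by (intro mult_left_mono) auto
    also have "\<dots> < r" using r by simp
    finally show ?case .
  qed
qed

lemma eventually_continuous_green: "bmeas B f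
    \<Longrightarrow> eventually (\<lambda>e. continuous_on S2 (green e f)) (at_right 0)"
  by (auto intro: eventually_mono[OF eventually_at_right_pos] continuous_on_green_pos)

lemma eventually_continuous_vel: "bmeas B f
    \<Longrightarrow> eventually (\<lambda>e. continuous_on S2 (vel e f)) (at_right 0)"
  by (auto intro: eventually_mono[OF eventually_at_right_pos] continuous_on_vel_pos)

lemma green_sym:
  assumes f: "bmeas B f" and h: "bmeas C h"
  shows "(LINT x|area. h x * green 0 f x) = (LINT x|area. f x * green 0 h x)"
proof -
  have 1: "((\<lambda>e. LINT x|area. h x * green e f x) \<longlongrightarrow> (LINT x|area. h x * green 0 f x)) (at_right 0)"
    by (rule bmeas_tendsto_LINT[OF h uniform_green[OF f] eventually_continuous_green[OF f]]) simp
  have 2: "((\<lambda>e. LINT x|area. f x * green e h x) \<longlongrightarrow> (LINT x|area. f x * green 0 h x)) (at_right 0)"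
    by (rule bmeas_tendsto_LINT[OF f uniform_green[OF h] eventually_continuous_green[OF h]]) simp
  have "eventually (\<lambda>e. (LINT x|area. f x * green e h x)
      = (LINT x|area. h x * green e f x)) (at_right 0)"
    using eventually_at_right_pos by eventually_elim (use green_sym_pos[OF _ f h] in auto)
  from tendsto_unique[OF _ 1 Lim_transform_eventually[OF 2 this]] show ?thesis by simp
qed

section \<open>Velocity: no divergence and no self-induced moment\<close>

lemma vel_inner:
  assumes "0 \<le> e" "bmeas B f" "x \<in> S2"
  shows "vel e f x \<bullet> v = (1 / total_area) * (LINT y|area. f y * (vel_ker e (x \<bullet> y) * (cross3 x y
      \<bullet> v)))"
proof -
  have "(LINT y|area. f y *\<^sub>R (vel_ker e (x \<bullet> y) *\<^sub>R cross3 x y)) \<bullet> v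
      = (LINT y|area. (f y *\<^sub>R (vel_ker e (x \<bullet> y) *\<^sub>R cross3 x y)) \<bullet> v)"
    using vel_integrable[OF assms(1,3,2)] by (intro integral_inner_left[symmetric]) auto
  then show ?thesis by (simp add: vel_def mult.assoc)
qed

text \<open>Puts the integral over \<open>x\<close> inside, with \<open>y\<close> fixed. In that
  order the inner integral can be evaluated by a rotation about \<open>y\<close>, or compared with
  itself after exchanging the variables.\<close>

lemma vel_inner_swap:
  fixes w :: "real^3 \<Rightarrow> real^3"
  assumes e: "0 < e" and f: "bmeas B f" and w: "w \<in> borel_measurable area"
      "\<And>x. x \<in> S2 \<Longrightarrow> norm (w x) \<le> C"
  shows "(LINT x|area. vel e f x \<bullet> w x) = (1 / total_area) * (LINT y|area. f y
      * (LINT x|area. vel_ker e (x \<bullet> y) * (cross3 x y \<bullet> w x)))"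
proof -
  obtain A where A: "0 \<le> A" "\<And>x y. x \<in> S2 \<Longrightarrow> y \<in> S2 \<Longrightarrow> \<bar>vel_ker e (x \<bullet> y)\<bar> \<le> A"
    using zonal_bound[OF continuous_on_vel_ker[OF e]] by metis
  note [measurable] = bmeasD(1)[OF f] w(1)
  have cr: "norm (cross3 x y) \<le> 1" if "x \<in> S2" "y \<in> S2" for x y :: "real^3"
  proof (rule power2_le_imp_le)
    show "(norm (cross3 x y))\<^sup>2 \<le> 1\<^sup>2" unfolding norm_cross using that by simp
  qed simp
  have cw: "\<bar>cross3 x y \<bullet> w x\<bar> \<le> C" if "x \<in> S2" "y \<in> S2" for x y
  proof -
    have "\<bar>cross3 x y \<bullet> w x\<bar> \<le> norm (cross3 x y) * norm (w x)" by (rule Cauchy_Schwarz_ineq2)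
    also have "\<dots> \<le> 1 * C" using cr[OF that] w(2)[OF that(1)] by (intro mult_mono) auto
    finally show ?thesis by simp
  qed
  have m: "(\<lambda>(x, y). f y * (vel_ker e (x \<bullet> y) * (cross3 x y
      \<bullet> w x))) \<in> borel_measurable (area \<Otimes>\<^sub>M area)"
    by measurable
  have "(LINT x|area. vel e f x \<bullet> w x) = (LINT x|area. (1 / total_area) * (LINT y|area. f y
      * (vel_ker e (x \<bullet> y) * (cross3 x y \<bullet> w x))))"
    using e by (intro LINT_cong refl vel_inner[OF _ f]) auto
  also have "\<dots> = (1 / total_area) * (LINT x|area. LINT y|area. f y * (vel_ker e (x \<bullet> y)
      * (cross3 x y \<bullet> w x)))"
    by simp
  also have "(LINT x|area. LINT y|area. f y * (vel_ker e (x \<bullet> y) * (cross3 x y \<bullet> w x)))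
      = (LINT y|area. LINT x|area. f y * (vel_ker e (x \<bullet> y) * (cross3 x y \<bullet> w x)))"
  proof (rule Fubini_bounded[of _ "B * (A * C)", OF m])
    show "\<bar>f y * (vel_ker e (x \<bullet> y) * (cross3 x y \<bullet> w x))\<bar> \<le> B * (A * C)" if "x \<in> S2" "y \<in> S2"
        for x y
      unfolding abs_mult using A bmeasD(2,3)[OF f] cw that by (intro mult_mono) auto
  qed
  finally show ?thesis by simp
qed

lemma cross_triple': "cross3 x y \<bullet> z = - (z \<bullet> cross3 y x)"
  by (metis cross_skew inner_commute inner_minus_right)

text \<open>Integrating over \<open>x\<close> first: for fixed \<open>y\<close> the factor \<open>x \<bullet> y\<close> is invariant under
  rotations about \<open>y\<close>, so the integrand is a rotational derivative.\<close>

lemma LINT_vel_grad_pos: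
  assumes e: "0 < e" and f: "bmeas B f" and b: "C1_on b U" "open U" "S2 \<subseteq> U"
  shows "(LINT x|area. vel e f x \<bullet> grad b x) = 0"
proof -
  have cg: "continuous_on S2 (grad b)" by (rule continuous_on_subset[OF C1_continuous_grad[OF b(1)]
      b(3)])
  obtain C where C: "\<And>x. x \<in> S2 \<Longrightarrow> norm (grad b x) \<le> C" by (metis continuous_on_S2_bounded[OF cg])
  have inner0: "(LINT x|area. vel_ker e (x \<bullet> y) * (cross3 x y \<bullet> grad b x)) = 0" if y: "y \<in> S2" for y
  proof -
    let ?W = "U \<inter> {x. y \<bullet> x < 1 + e}"
    have W: "open ?W" "S2 \<subseteq> ?W"
      using b inner_S2_le[OF y] e by (auto intro!: open_Int open_halfspace_lt) (smt (verit)
          mem_sphere_0)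
    have d: "(vel_ker e has_real_derivative 1 / (1 + e - s)\<^sup>2) (at s)" if "s < 1 + e" for s
      using that unfolding vel_ker_def[abs_def]
          by (auto intro!: derivative_eq_intros simp: power2_eq_square)
    have Cv: "C1_on (\<lambda>x. vel_ker e (y \<bullet> x)) ?W"
      by (rule C1_compose_real[OF C1_linear, where \<phi>'
          = "\<lambda>s. 1 / (1 + e - s)\<^sup>2"]) (auto intro!: continuous_intros d)
    have Cb: "C1_on b ?W" by (rule C1_subset[OF b(1)]) auto
    have "vel_ker e (x \<bullet> y) * (cross3 x y \<bullet> grad b x)
        = - rotderiv y (\<lambda>x. vel_ker e (y \<bullet> x) * b x) x" if x: "x \<in> S2" for x
    proof -
      have xW: "x \<in> ?W" using W x by blast
      have "rotderiv y (\<lambda>x. vel_ker e (y \<bullet> x)) x = 0"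
        using xW by (subst C1_rotderiv[OF Cv]) (auto simp: grad_compose_real[where \<phi>
            = "vel_ker e", OF _ d] dot_cross_self)
      then have "rotderiv y (\<lambda>x. vel_ker e (y \<bullet> x) * b x) x
          = vel_ker e (y \<bullet> x) * (grad b x \<bullet> cross3 y x)"
        using C1_differentiable[OF Cv xW] C1_differentiable[OF Cb xW]
        by (subst rotderiv_mult) (auto simp: rotderiv_eq_grad)
      then show ?thesis by (simp add: cross_triple'[of x y] inner_commute)
    qed
    then have "(LINT x|area. vel_ker e (x \<bullet> y) * (cross3 x y \<bullet> grad b x))
        = - (LINT x|area. rotderiv y (\<lambda>x. vel_ker e (y \<bullet> x) * b x) x)"
      unfolding integral_minus[symmetric] by (intro LINT_cong) auto
    also have "\<dots> = 0" using LINT_rotderiv[OF C1_mult[OF Cv Cb] W] by simp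
    finally show ?thesis .
  qed
  have "(LINT y|area. f y * (LINT x|area. vel_ker e (x \<bullet> y) * (cross3 x y \<bullet> grad b x)))
      = (LINT y|area. 0)"
    by (intro LINT_cong) (auto simp: inner0)
  then show ?thesis
    using vel_inner_swap[OF e f borel_measurable_area_continuous[OF cg] C] by simp
qed

lemma uniform_vel_inner:
  assumes f: "bmeas B f" and w: "continuous_on S2 w"
  shows "uniform_limit S2 (\<lambda>e x. vel e f x \<bullet> w x) (\<lambda>x. vel 0 f x \<bullet> w x) (at_right 0)"
proof -
  obtain C where C: "\<And>x. x \<in> S2 \<Longrightarrow> norm (w x) \<le> C" by (metis continuous_on_S2_bounded[OF w])
  show ?thesis
  proof (rule uniform_limit_quarter[of _ _ "60 * B * C"])
    fix e x assume e: "0 < (e::real)" "e \<le> 1" and x: "x \<in> S2"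
    have "norm (vel e f x \<bullet> w x - vel 0 f x \<bullet> w x) \<le> norm (vel e f x - vel 0 f x) * norm (w x)"
      using Cauchy_Schwarz_ineq2[of "vel e f x - vel 0 f x" "w x"] by (simp add: inner_diff_left)
    also have "\<dots> \<le> (60 * B * e powr (1/4)) * C"
      using e x f C bmeasD(3)[OF f] by (intro mult_mono vel_diff_bound) auto
    finally show "norm (vel e f x \<bullet> w x - vel 0 f x \<bullet> w x) \<le> 60 * B * C * e powr (1/4)"
        by (simp add: mult_ac)
  qed
qed

lemma eventually_continuous_vel_inner:
  assumes "bmeas B f" "continuous_on S2 w"
  shows "eventually (\<lambda>e. continuous_on S2 (\<lambda>x. vel e f x \<bullet> w x)) (at_right 0)"
  using eventually_continuous_vel[OF assms(1)] by eventually_elim (intro continuous_intros assms)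

text \<open>The weak form of incompressibility, from which conservation of integrals of functions of
  the vorticity will follow.\<close>

lemma LINT_vel_grad:
  assumes f: "bmeas B f" and b: "C1_on b U" "open U" "S2 \<subseteq> U"
  shows "(LINT x|area. vel 0 f x \<bullet> grad b x) = 0"
proof -
  have cg: "continuous_on S2 (grad b)" by (rule continuous_on_subset[OF C1_continuous_grad[OF b(1)]
      b(3)])
  have 1: "((\<lambda>e. LINT x|area. vel e f x \<bullet> grad b x)
      \<longlongrightarrow> (LINT x|area. vel 0 f x \<bullet> grad b x)) (at_right 0)"
    by (rule tendsto_LINT_uniform[OF uniform_vel_inner[OF f cg] eventually_continuous_vel_inner[OF f
        cg]]) simp
  have "eventually (\<lambda>e. (LINT x|area. vel e f x \<bullet> grad b x) = 0) (at_right 0)"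
    using eventually_at_right_pos by eventually_elim (use LINT_vel_grad_pos[OF _ f b] in auto)
  from tendsto_unique[OF _ Lim_transform_eventually[OF 1 this] tendsto_const] show ?thesis by simp
qed

text \<open>The kernel \<open>vel_ker e (x \<bullet> y) *\<^sub>R cross3 x y\<close> changes sign
  when \<open>x\<close> and \<open>y\<close> are exchanged, so its double integral against
  \<open>f x * f y\<close> equals its own negative. This is why the flow induced by \<open>f\<close>
  does not move the first moment of \<open>f\<close>.\<close>

lemma LINT_vel_antisym_pos:
  assumes e: "0 < e" and f: "bmeas B f"
  shows "(LINT x|area. f x * (vel e f x \<bullet> a)) = 0"
proof -
  note [measurable] = bmeasD(1)[OF f]
  obtain A where A: "0 \<le> A" "\<And>x y. x \<in> S2 \<Longrightarrow> y \<in> S2 \<Longrightarrow> \<bar>vel_ker e (x \<bullet> y)\<bar> \<le> A"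
    using zonal_bound[OF continuous_on_vel_ker[OF e]] by metis
  have "(LINT x|area. vel e f x \<bullet> (f x *\<^sub>R a))
      = (1 / total_area) * (LINT y|area. f y * (LINT x|area. vel_ker e (x \<bullet> y) * (cross3 x y
      \<bullet> (f x *\<^sub>R a))))"
    by (rule vel_inner_swap[OF e f, of _ "B
        * norm a"]) (use bmeasD[OF f] in \<open>auto intro!: mult_right_mono\<close>)
  also have "\<dots> = (1 / total_area) * (LINT y|area. f y * - (LINT x|area. f x * (vel_ker e (y \<bullet> x)
      * (cross3 y x \<bullet> a))))"
  proof -
    have "vel_ker e (x \<bullet> y) * (cross3 x y \<bullet> (f x *\<^sub>R a))
        = - (f x * (vel_ker e (y \<bullet> x) * (cross3 y x \<bullet> a)))" for x y
      unfolding cross_skew[of x y] inner_commute[of x y] by simp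
    then show ?thesis by simp
  qed
  also have "\<dots> = - (LINT y|area. (1 / total_area) * (f y * (LINT x|area. f x * (vel_ker e (y \<bullet> x)
      * (cross3 y x \<bullet> a)))))"
    by simp
  also have "(LINT y|area. (1 / total_area) * (f y * (LINT x|area. f x * (vel_ker e (y \<bullet> x)
      * (cross3 y x \<bullet> a))))) = (LINT y|area. f y * (vel e f y \<bullet> a))"
    using e by (intro LINT_cong refl) (simp add: vel_inner[OF _ f])
  finally show ?thesis by simp
qed

lemma LINT_vel_antisym:
  assumes f: "bmeas B f"
  shows "(LINT x|area. f x * (vel 0 f x \<bullet> a)) = 0"
proof -
  have 1: "((\<lambda>e. LINT x|area. f x * (vel e f x \<bullet> a))
      \<longlongrightarrow> (LINT x|area. f x * (vel 0 f x \<bullet> a))) (at_right 0)"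
    by (rule bmeas_tendsto_LINT[OF f uniform_vel_inner[OF f] eventually_continuous_vel_inner[OF f]])
        (auto intro: continuous_intros)
  have "eventually (\<lambda>e. (LINT x|area. f x * (vel e f x \<bullet> a)) = 0) (at_right 0)"
    using eventually_at_right_pos by eventually_elim (use LINT_vel_antisym_pos[OF _ f] in auto)
  from tendsto_unique[OF _ Lim_transform_eventually[OF 1 this] tendsto_const] show ?thesis by simp
qed

section \<open>Approximate identity and representation by the Green function\<close>

text \<open>Near \<open>x\<close> the deviation of \<open>U\<close> from \<open>U x\<close> is small
  by continuity and the mass of the kernel is fixed; away from \<open>x\<close> the kernel is of
  order \<open>e\<close>.\<close>

lemma poisson_limit:
  assumes U: "continuous_on S2 U" and x: "x \<in> S2"
  shows "((\<lambda>e. LINT y|area. poisson e (x \<bullet> y) * U y) \<longlongrightarrow> total_area * U x) (at_right 0)"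
proof (rule tendstoI)
  fix r :: real assume r: "0 < r"
  obtain B where B: "B > 0" "\<And>y. y \<in> S2 \<Longrightarrow> norm (U y) \<le> B" by (metis continuous_on_S2_bounded[OF U])
  define r' where "r' = r / (3 * total_area)"
  have r': "0 < r'" using r measure_area_pos by (simp add: r'_def)
  obtain \<delta> where \<delta>: "0 < \<delta>" "\<And>y. y \<in> S2 \<Longrightarrow> dist y x < \<delta> \<Longrightarrow> dist (U y) (U x) < r'"
    using U x r' unfolding continuous_on_iff by metis
  \<comment> \<open>On the sphere \<open>(dist y x)\<^sup>2 = 2 * (1 - x \<bullet> y)\<close>, so
    points at distance at least \<open>\<delta>\<close> from \<open>x\<close> satisfy
    \<open>q \<le> 1 - x \<bullet> y\<close>.\<close>
  define q where "q = \<delta>\<^sup>2 / 2"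
  have q: "0 < q" using \<delta> by (simp add: q_def)
  define c where "c = 2 * B * (3 / q\<^sup>2)"
  have c: "0 < c" using B q by (simp add: c_def)
  have dev: "\<bar>poisson e (x \<bullet> y) * (U y - U x)\<bar> \<le> r' * poisson e (x \<bullet> y) + c * e" if e: "0 < e"
      "e \<le> 1" and y: "y \<in> S2" for e y
  proof -
    have pn: "0 \<le> poisson e (x \<bullet> y)" using e by (simp add: poisson_def)
    show ?thesis
    proof (cases "dist y x < \<delta>")
      case True
      then have "\<bar>U y - U x\<bar> \<le> r'" using \<delta>(2)[OF y] by (simp add: dist_real_def less_imp_le)
      then have "poisson e (x \<bullet> y) * \<bar>U y - U x\<bar> \<le> poisson e (x \<bullet> y) * r'" using pn
          by (rule mult_left_mono)
      moreover have "0 \<le> c * e" using c e by simp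
      ultimately show ?thesis using pn unfolding abs_mult by (simp add: mult.commute)
    next
      case False
      have "x \<bullet> x = 1" "y \<bullet> y = 1" using x y by (auto simp: dot_square_norm)
      then have "(dist y x)\<^sup>2 = 2 * (1 - x \<bullet> y)"
        unfolding dist_norm power2_norm_eq_inner inner_diff_left inner_diff_right inner_commute[of y
            x] by simp
      moreover have "\<delta>\<^sup>2 \<le> (dist y x)\<^sup>2" using False \<delta>(1) by (intro power_mono) auto
      ultimately have "q \<le> 1 - x \<bullet> y" by (simp add: q_def)
      then have d: "q \<le> 1 + e - x \<bullet> y" using e by simp
      have "poisson e (x \<bullet> y) \<le> e * 3 / q\<^sup>2"
        unfolding poisson_def using e q d by (intro frac_le mult_left_mono power_mono) auto
      moreover have "\<bar>U y - U x\<bar> \<le> 2 * B" using B(2)[OF y] B(2)[OF x] by auto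
      ultimately have "\<bar>poisson e (x \<bullet> y) * (U y - U x)\<bar> \<le> (e * 3 / q\<^sup>2) * (2 * B)"
        unfolding abs_mult using pn B e q by (intro mult_mono) auto
      also have "\<dots> = c * e" by (simp add: c_def)
      also have "\<dots> \<le> r' * poisson e (x \<bullet> y) + c * e" using r' pn by simp
      finally show ?thesis .
    qed
  qed
  have ev: "eventually (\<lambda>e. 0 < e \<and> e \<le> 1 \<and> c * e * total_area < r / 3) (at_right (0::real))"
    unfolding eventually_at_right_field
    by (intro exI[of _ "min 1 (r / (3 * c * total_area))"])
       (use r c measure_area_pos in \<open>auto simp: field_simps\<close>)
  then show "eventually (\<lambda>e. dist (LINT y|area. poisson e (x \<bullet> y) * U y) (total_area * U x)
      < r) (at_right 0)"
  proof eventually_elim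
    case (elim e)
    have cp: "continuous_on S2 (\<lambda>y. poisson e (x \<bullet> y))"
      using elim by (intro continuous_on_zonal[OF continuous_on_poisson] x) auto
    have "(LINT y|area. poisson e (x \<bullet> y) * U y) - total_area * U x
        = (LINT y|area. poisson e (x \<bullet> y) * (U y - U x))"
      unfolding right_diff_distrib using elim
      by (subst LINT_diff)
         (auto intro!: integrable_area_continuous continuous_intros cp U simp: LINT_poisson[OF _ x])
    also have "\<bar>\<dots>\<bar> \<le> (LINT y|area. r' * poisson e (x \<bullet> y) + c * e)"
      by (rule order_trans[OF integral_abs_bound integral_mono])
         (use elim dev in \<open>auto intro!: integrable_area_continuous continuous_intros cp U\<close>)
    also have "\<dots> = r' * total_area + c * e * total_area"
      using elim by (subst LINT_add)
         (auto intro!: integrable_area_continuous continuous_intros cp simp: LINT_poisson[OF _ x])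
    also have "\<dots> < r" using elim r measure_area_pos by (simp add: r'_def)
    finally show ?case by (simp add: dist_real_def)
  qed
qed

text \<open>Green's identity against the regularised logarithm yields the integral of
  \<open>U\<close> minus its average against \<open>poisson e\<close>; as \<open>e\<close> tends to
  \<open>0\<close>, the latter becomes \<open>total_area * U x\<close>. So on functions of zero mean
  \<open>green 0\<close> inverts \<open>- lap\<close>.\<close>

lemma green_representation:
  assumes U: "C2_near U W" and x: "x \<in> S2"
  shows "U x = (1 / total_area) * (LINT y|area. U y) - green 0 (lap U) x"
proof -
  note D = C2_nearD[OF U]
  have cU: "continuous_on S2 U" by (rule continuous_on_subset[OF C1_continuous[OF D(3)] D(2)])
  obtain B where B: "bmeas B (lap U)" using continuous_bmeas[OF continuous_on_lap[OF U]] by metis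
  have "green e (lap U) x = (1 / total_area) * ((LINT y|area. U y) - (LINT y|area. poisson e (x \<bullet> y)
      * U y))" if e: "0 < e" for e
  proof -
    have "(LINT y|area. - ln (1 + e - x \<bullet> y) * lap U y)
        = (LINT y|area. U y * lap (\<lambda>y. - ln (1 + e - x \<bullet> y)) y)"
    proof (rule LINT_green)
      show "C2_near U (W \<inter> {y. x \<bullet> y < 1 + e})"
        using D(1,2) inner_S2_le[OF x] e
        by (intro C2_near_subset[OF U]) (auto intro!: open_Int open_halfspace_lt, smt (verit)
            mem_sphere_0)
      show "C2_near (\<lambda>y. - ln (1 + e - x \<bullet> y)) (W \<inter> {y. x \<bullet> y < 1 + e})"
        using D(1,2) inner_S2_le[OF x] e
        by (intro C2_near_subset[OF log_zonal(1)[OF e x]]) (auto intro!: open_Int open_halfspace_lt,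
            smt (verit) mem_sphere_0)
    qed
    also have "\<dots> = (LINT y|area. U y - poisson e (x \<bullet> y) * U y)"
      by (intro LINT_cong refl) (simp add: log_zonal(2)[OF e x] algebra_simps)
    also have "\<dots> = (LINT y|area. U y) - (LINT y|area. poisson e (x \<bullet> y) * U y)"
      by (intro LINT_diff integrable_area_continuous continuous_intros cU
          continuous_on_zonal[OF continuous_on_poisson] e x)
    finally show ?thesis by (simp add: green_def log_ker_def mult.commute)
  qed
  then have ev: "eventually (\<lambda>e. (1 / total_area) * ((LINT y|area. U y) - (LINT y|area. poisson e (x
      \<bullet> y) * U y)) = green e (lap U) x) (at_right 0)"
    by (intro eventually_mono[OF eventually_at_right_pos]) auto
  have "((\<lambda>e. (1 / total_area) * ((LINT y|area. U y) - (LINT y|area. poisson e (x \<bullet> y) * U y)))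
      \<longlongrightarrow> (1 / total_area) * ((LINT y|area. U y) - total_area * U x)) (at_right 0)"
    by (intro tendsto_intros poisson_limit cU x)
  from Lim_transform_eventually[OF this ev] have "((\<lambda>e. green e (lap U) x)
      \<longlongrightarrow> (1 / total_area) * ((LINT y|area. U y) - total_area * U x)) (at_right 0)" .
  moreover have "((\<lambda>e. green e (lap U) x) \<longlongrightarrow> green 0 (lap U) x) (at_right 0)"
    using tendsto_uniform_limitI[OF uniform_green[OF B] x] .
  ultimately have "green 0 (lap U) x = (1 / total_area) * ((LINT y|area. U y) - total_area * U x)"
    by (intro tendsto_unique[of "at_right 0"]) auto
  then show ?thesis using measure_area_pos by (simp add: field_simps)
qed

text \<open>Averages against \<open>poisson e\<close> ignore null sets, yet in the limit they
  recover the value at each point.\<close>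

lemma continuous_AE_eq:
  assumes f: "continuous_on S2 f" and g: "continuous_on S2 g" and ae: "AE x in area. f x = g x"
      and x: "x \<in> S2"
  shows "f x = (g x :: real)"
proof -
  have ev: "eventually (\<lambda>e. (LINT y|area. poisson e (x \<bullet> y) * f y)
      = (LINT y|area. poisson e (x \<bullet> y) * g y)) (at_right 0)"
  proof (rule eventually_mono[OF eventually_at_right_pos])
    fix e :: real assume "0 < e \<and> e \<le> 1"
    then have "continuous_on S2 (\<lambda>y. poisson e (x \<bullet> y))"
      by (intro continuous_on_zonal[OF continuous_on_poisson] x) auto
    then show "(LINT y|area. poisson e (x \<bullet> y) * f y) = (LINT y|area. poisson e (x \<bullet> y) * g y)"
      by (intro integral_cong_AE borel_measurable_area_continuous continuous_intros f g) (use ae in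
          auto)
  qed
  have "total_area * f x = total_area * g x"
    using tendsto_unique[OF _ Lim_transform_eventually[OF poisson_limit[OF f x] ev] poisson_limit[OF
        g x]] by simp
  then show ?thesis using measure_area_pos by simp
qed

section \<open>Surface gradients along great circles\<close>

definition great_circle :: "real^3 \<Rightarrow> real^3 \<Rightarrow> real \<Rightarrow> real^3" where
  "great_circle x w t = cos t *\<^sub>R x + sin t *\<^sub>R w"

text \<open>A unit-speed great circle is an orbit of the rotation about \<open>cross3 x w\<close>.
  Differentiation along it is therefore a rotational derivative, which is known for the regularised
  potential.\<close>

lemma great_circle:
  assumes x: "x \<in> S2" and w: "w \<in> S2" and xw: "x \<bullet> w = 0"
  shows "great_circle x w t \<in> S2" "great_circle x w 0 = x"
    and "(great_circle x w has_vector_derivative cross3 (cross3 x w) (great_circle x w t)) (at t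
        within T)"
proof -
  have n: "x \<bullet> x = 1" "w \<bullet> w = 1" using x w by (auto simp: dot_square_norm)
  have "great_circle x w t \<bullet> great_circle x w t = (cos t)\<^sup>2 + (sin t)\<^sup>2"
    using xw by (simp add: great_circle_def inner_add n inner_commute[of w x] power2_eq_square)
  then show "great_circle x w t \<in> S2" by (simp add: norm_eq_1)
  show "great_circle x w 0 = x" by (simp add: great_circle_def)
  have c1: "cross3 (cross3 x w) y = (x \<bullet> y) *\<^sub>R w - (w \<bullet> y) *\<^sub>R x" for y
    by (subst cross_skew) (simp add: Lagrange inner_commute)
  have "cross3 (cross3 x w) (great_circle x w t) = cos t *\<^sub>R w - sin t *\<^sub>R x"
    unfolding c1 using xw by (simp add: great_circle_def inner_add n inner_commute[of w x])
  moreover have "(great_circle x w has_vector_derivative cos t *\<^sub>R w - sin t *\<^sub>R x) (at t within T)"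
    unfolding great_circle_def[abs_def] by (auto intro!: derivative_eq_intros simp:
        has_vector_derivative_def algebra_simps)
  ultimately show "(great_circle x w has_vector_derivative cross3 (cross3 x w) (great_circle x w t))
      (at t within T)" by simp
qed

lemma has_sgrad_along_circle:
  assumes v: "has_sgrad f x v" and x: "x \<in> S2" and w: "w \<in> S2" and xw: "x \<bullet> w = 0"
  shows "((\<lambda>t. f (great_circle x w t)) has_real_derivative v \<bullet> w) (at 0)"
proof -
  note g = great_circle[OF x w xw]
  have n: "x \<bullet> x = 1" using x by (auto simp: dot_square_norm)
  have d: "(great_circle x w has_derivative (\<lambda>h. h *\<^sub>R cross3 (cross3 x w) x)) (at 0)"
    using g(3)[of 0 UNIV] by (simp add: g(2) has_vector_derivative_def)
  have "cross3 (cross3 x w) x = w"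
    using n xw by (subst cross_skew) (simp add: Lagrange)
  then have d: "(great_circle x w has_derivative (\<lambda>h. h *\<^sub>R w)) (at 0)" using d by simp
  have f: "(f has_derivative (\<lambda>h. v \<bullet> h)) (at (great_circle x w 0) within S2)"
    using v by (simp add: g(2) has_sgrad_def)
  have "((\<lambda>t. f (great_circle x w t)) has_derivative (\<lambda>h. v \<bullet> (h *\<^sub>R w))) (at 0)"
  proof (rule has_derivative_in_compose[OF d has_derivative_subset[OF f]])
    show "range (great_circle x w) \<subseteq> S2" using g(1) by blast
  qed
  moreover have "(\<lambda>h. v \<bullet> (h *\<^sub>R w)) = (*) (v \<bullet> w)" by (simp add: fun_eq_iff)
  ultimately show ?thesis by (simp add: has_field_derivative_def)
qed

text \<open>Two different candidates would give different derivatives along the great circle that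
  leaves \<open>x\<close> in the direction of their difference.\<close>

lemma sgrad_eqI:
  assumes v: "has_sgrad f x v" and x: "x \<in> S2"
  shows "sgrad f x = v"
  unfolding sgrad_def
proof (rule the_equality[of "has_sgrad f x", OF v])
  fix v' assume v': "has_sgrad f x v'"
  show "v' = v"
  proof (rule ccontr)
    assume ne: "v' \<noteq> v"
    define w where "w = (1 / norm (v' - v)) *\<^sub>R (v' - v)"
    have w: "w \<in> S2" using ne by (simp add: w_def)
    have xw: "x \<bullet> w = 0" using v v' by (simp add: w_def has_sgrad_def inner_diff)
    have "v' \<bullet> w = v \<bullet> w"
      using DERIV_unique[OF has_sgrad_along_circle[OF v x w xw] has_sgrad_along_circle[OF v' x w
          xw]] by simp
    then have "(v' - v) \<bullet> (v' - v) = 0" using ne by (simp add: w_def inner_diff_left)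
    then show False using ne by simp
  qed
qed

text \<open>Existence of the surface gradient is a hypothesis, so only its value has to be found,
  and derivatives along great circles determine it. Along such a circle the regularised potentials
  converge and their derivatives converge uniformly, so the limit may be differentiated
  termwise.\<close>

lemma green_sgrad:
  assumes f: "bmeas B f" and \<psi>: "\<And>y. y \<in> S2 \<Longrightarrow> \<psi> y = green 0 f y" and v: "has_sgrad \<psi> x v"
      and x: "x \<in> S2"
  shows "cross3 x v = vel 0 f x"
proof -
  have n: "x \<bullet> x = 1" using x by (auto simp: dot_square_norm)
  have eq: "v \<bullet> w = cross3 x w \<bullet> vel 0 f x" if w: "w \<in> S2" and xw: "x \<bullet> w = 0" for w
  proof -
    note g = great_circle[OF x w xw]
    define a where "a = cross3 x w"
    define F where "F e t = green e f (great_circle x w t)" for e t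
    define F' where "F' e t = a \<bullet> vel e f (great_circle x w t)" for e t
    have dF: "(F e has_real_derivative F' e t) (at t within T)" if e: "0 < e" for e t T
    proof -
      have U: "great_circle x w t \<in> ball 0 (1 + e/2)" using g(1)[of t] e by simp
      have "(F e has_derivative (\<lambda>h. green_grad e f (great_circle x w t)
          \<bullet> (h *\<^sub>R cross3 a (great_circle x w t)))) (at t within T)"
        unfolding F_def a_def
        by (rule has_derivative_compose[OF g(3)[unfolded has_vector_derivative_def]
            green_has_derivative[OF e f U]])
      moreover have "green_grad e f (great_circle x w t) \<bullet> cross3 a (great_circle x w t) = F' e t"
        unfolding F'_def rotderiv_green[OF e f U, symmetric]
            using rotderiv_eqI[OF green_has_derivative[OF e f U]] by simp
      moreover have "(\<lambda>h. green_grad e f (great_circle x w t)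
          \<bullet> (h *\<^sub>R cross3 a (great_circle x w t)))
          = (*) (green_grad e f (great_circle x w t) \<bullet> cross3 a (great_circle x w t))"
        by (simp add: fun_eq_iff)
      ultimately show ?thesis by (simp add: has_field_derivative_def)
    qed
    have ul: "uniform_limit UNIV F' (F' 0) (at_right 0)"
    proof -
      have "uniform_limit S2 (\<lambda>e y. vel e f y \<bullet> a) (\<lambda>y. vel 0 f y \<bullet> a) (at_right 0)"
        by (rule uniform_vel_inner[OF f]) (rule continuous_on_const)
      then show ?thesis
        unfolding uniform_limit_iff F'_def using g(1)
            by (auto simp: inner_commute elim!: eventually_mono all_forward)
    qed
    have pl: "((\<lambda>e. F e t) \<longlongrightarrow> F 0 t) (at_right 0)" for t
      unfolding F_def by (rule tendsto_uniform_limitI[OF uniform_green[OF f] g(1)])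
    have cF': "continuous_on UNIV (F' 0)"
      unfolding F'_def
      by (intro continuous_intros continuous_on_compose2[OF continuous_on_vel[OF f]])
         (auto simp: great_circle_def intro!: continuous_intros g(1)[unfolded great_circle_def,
             simplified])
    have lim: "((\<lambda>t. (F 0 t - F 0 0) / t) \<longlongrightarrow> F' 0 0) (at 0)"
    proof (rule tendstoI)
      fix r :: real assume r: "0 < r"
      obtain \<delta> where \<delta>: "0 < \<delta>" "\<And>t. dist t 0 < \<delta> \<Longrightarrow> dist (F' 0 t) (F' 0 0) < r/4"
        using cF' r unfolding continuous_on_iff
            by (metis UNIV_I zero_less_divide_iff zero_less_numeral)
      have "dist ((F 0 t - F 0 0) / t) (F' 0 0) < r" if t: "t \<noteq> 0" "dist t 0 < \<delta>" for t
      proof -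
        \<comment> \<open>Mean value inequality for \<open>F e s - s * F' 0 0\<close>: its
          derivative is within \<open>r/4\<close> of \<open>F' 0 s - F' 0 0\<close> by uniform
          convergence, and that is at most \<open>r/4\<close> by continuity, so \<open>r/2\<close>
          bounds the sum.\<close>
        have main: "eventually (\<lambda>e. \<bar>F e t - F e 0 - t * F' 0 0\<bar> \<le> (r/2) * \<bar>t\<bar>) (at_right 0)"
          using uniform_limitD[OF ul divide_pos_pos[OF r zero_less_numeral[of "num.Bit0 (num.Bit0
              num.One)"]]] eventually_at_right_pos
        proof eventually_elim
          case (elim e)
          have "norm ((F e t - t * F' 0 0) - (F e 0 - 0 * F' 0 0)) \<le> (r/2) * norm (t - 0)"
          proof (rule field_differentiable_bound[of "closed_segment 0 t"])
            fix s assume s: "s \<in> closed_segment 0 t"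
            show "((\<lambda>s. F e s - s * F' 0 0) has_field_derivative F' e s
                - F' 0 0) (at s within closed_segment 0 t)"
              using elim by (auto intro!: derivative_eq_intros dF)
            have "dist s 0 < \<delta>" using s t segment_bound1[OF s] by (auto simp: dist_real_def)
            then have "dist (F' 0 s) (F' 0 0) < r/4" by (rule \<delta>)
            moreover have "dist (F' e s) (F' 0 s) < r/4" using elim r by auto
            ultimately show "norm (F' e s - F' 0 0) \<le> r/2" unfolding dist_real_def real_norm_def
                by linarith
          qed auto
          then show ?case by (simp add: algebra_simps)
        qed
        have "((\<lambda>e. \<bar>F e t - F e 0 - t * F' 0 0\<bar>) \<longlongrightarrow> \<bar>F 0 t - F 0 0 - t * F' 0 0\<bar>) (at_right 0)"
          by (intro tendsto_intros pl)
        from tendsto_upperbound[OF this main] have "\<bar>F 0 t - F 0 0 - t * F' 0 0\<bar> \<le> (r/2) * \<bar>t\<bar>"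
            by simp
        moreover have "\<bar>F 0 t - F 0 0 - t * F' 0 0\<bar> = \<bar>(F 0 t - F 0 0) / t - F' 0 0\<bar> * \<bar>t\<bar>"
        proof -
          have "F 0 t - F 0 0 - t * F' 0 0 = ((F 0 t - F 0 0) / t - F' 0 0) * t"
            using t by (simp add: field_simps)
          then show ?thesis by (simp only: abs_mult)
        qed
        ultimately have "\<bar>(F 0 t - F 0 0) / t - F' 0 0\<bar> \<le> r/2" using t by simp
        then show ?thesis using r by (simp add: dist_real_def)
      qed
      then show "eventually (\<lambda>t. dist ((F 0 t - F 0 0) / t) (F' 0 0) < r) (at 0)"
        unfolding eventually_at using \<delta>(1) by auto
    qed
    have "((\<lambda>t. \<psi> (great_circle x w t)) has_real_derivative F' 0 0) (at 0)"
      using lim unfolding DERIV_def F_def by (simp add: \<psi>[OF g(1)])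
    from DERIV_unique[OF has_sgrad_along_circle[OF v x w xw] this]
    show ?thesis by (simp add: F'_def g(2) a_def)
  qed
  have Vx: "x \<bullet> vel 0 f x = 0"
    using vel_inner[OF order_refl f x, of x] by (simp add: dot_cross_self inner_commute)
  define u where "u = cross3 x v - vel 0 f x"
  have xu: "x \<bullet> u = 0" using Vx by (simp add: u_def inner_diff dot_cross_self)
  show ?thesis
  proof (rule ccontr)
    assume "cross3 x v \<noteq> vel 0 f x"
    then have ne: "u \<noteq> 0" by (simp add: u_def)
    \<comment> \<open>Chosen so that \<open>cross3 x w\<close> is the unit vector along
      \<open>u\<close>; then \<open>eq\<close> compares the two sides of the claim along their
      difference.\<close>
    define w where "w = (1 / norm u) *\<^sub>R cross3 u x"
    have "(norm (cross3 u x))\<^sup>2 = (norm u)\<^sup>2"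
      using x xu by (simp add: norm_cross inner_commute)
    then have "norm (cross3 u x) = norm u" by simp
    then have w: "w \<in> S2" using ne by (simp add: w_def)
    have xw: "x \<bullet> w = 0" by (simp add: w_def dot_cross_self)
    have xux: "cross3 x (cross3 u x) = u"
      using n xu by (simp add: Lagrange)
    have "v \<bullet> cross3 u x = u \<bullet> vel 0 f x"
      using eq[OF w xw] ne by (simp add: w_def cross_mult_right xux)
    moreover have "v \<bullet> cross3 u x = u \<bullet> cross3 x v"
      by (metis cross_triple inner_commute)
    ultimately have "u \<bullet> u = 0" by (simp add: u_def inner_diff_right)
    then show False using ne by simp
  qed
qed

section \<open>The inverse Laplacian is the Green operator\<close>

definition tanpart :: "real^3 \<Rightarrow> real^3 \<Rightarrow> real^3" where
  "tanpart x v = v - (x \<bullet> v) *\<^sub>R x"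

text \<open>The multiple \<open>k / 2 * (y \<bullet> y - 1)\<close> vanishes on the sphere;
  subtracting it leaves the values on \<open>S2\<close> alone and removes the normal component of
  the Euclidean gradient.\<close>

lemma has_sgrad_tanpart:
  assumes F: "F differentiable at x" and x: "x \<in> S2" and eq: "\<And>y. y \<in> S2 \<Longrightarrow> F y = f y"
  shows "has_sgrad f x (tanpart x (grad F x))"
proof -
  have n: "x \<bullet> x = 1" using x by (auto simp: dot_square_norm)
  define k where "k = x \<bullet> grad F x"
  have "((\<lambda>y. F y - k / 2 * (y \<bullet> y - 1)) has_derivative (\<lambda>h. grad F x \<bullet> h - k / 2 * (2 * (x
      \<bullet> h)))) (at x within S2)"
    by (rule derivative_eq_intros has_derivative_at_withinI[OF has_derivative_grad[OF F]] refl)+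
       (simp add: inner_commute)
  then have "((\<lambda>y. F y - k / 2 * (y \<bullet> y - 1)) has_derivative (\<lambda>h. tanpart x (grad F x)
      \<bullet> h)) (at x within S2)"
    by (simp add: tanpart_def k_def inner_diff_left)
  then have "(f has_derivative (\<lambda>h. tanpart x (grad F x) \<bullet> h)) (at x within S2)"
    by (rule has_derivative_transform[OF x, rotated]) (simp add: eq dot_square_norm)
  then show ?thesis using n by (simp add: has_sgrad_def tanpart_def inner_diff_right)
qed

lemma sgrad_tanpart:
  assumes "F differentiable at x" "x \<in> S2" "\<And>y. y \<in> S2 \<Longrightarrow> F y = f y"
  shows "sgrad f x = tanpart x (grad F x)"
  using sgrad_eqI[OF has_sgrad_tanpart[OF assms] assms(2)] .

section \<open>The surface Hessian and its trace\<close>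

lemma has_derivative_vec_nth: "((\<lambda>y. y $ i) has_derivative (\<lambda>v. v $ i)) F"
  by (rule bounded_linear_imp_has_derivative[OF bounded_linear_vec_nth])

lemma C1_rotderiv_sum:
  assumes g: "\<And>i. C1_on (\<lambda>y. g y $ i) W" and x: "x \<in> W"
  shows "((\<lambda>y. g y \<bullet> cross3 a y) has_derivative
     (\<lambda>v. (\<Sum>i\<in>UNIV. (grad (\<lambda>y. g y $ i) x \<bullet> v) * cross3 a x $ i) + g x \<bullet> cross3 a v)) (at x)"
proof -
  have lin: "((\<lambda>y. cross3 a y $ i) has_derivative (\<lambda>v. cross3 a v $ i)) (at x)" for i
    using exhaust_3[of i] by (elim disjE) (auto simp: cross_components intro!: derivative_eq_intros
        has_derivative_vec_nth)
  have "((\<lambda>y. \<Sum>i\<in>UNIV. g y $ i * cross3 a y $ i) has_derivative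
     (\<lambda>v. (\<Sum>i\<in>UNIV. g x $ i * cross3 a v $ i + (grad (\<lambda>y. g y $ i) x \<bullet> v)
         * cross3 a x $ i))) (at x)"
    by (intro has_derivative_sum has_derivative_mult lin C1_has_derivative[OF g x])
  then show ?thesis by (simp add: inner_vec_def sum.distrib add.commute)
qed

lemma C1_on_inner:
  assumes "\<And>i. C1_on (\<lambda>y. g y $ i) W" "\<And>i. C1_on (\<lambda>y. h y $ i) W"
  shows "C1_on (\<lambda>y. g y \<bullet> h y) W"
proof -
  have "C1_on (\<lambda>y. \<Sum>i\<in>UNIV. g y $ i * h y $ i) W" by (intro C1_sum C1_mult assms) auto
  then show ?thesis by (simp add: inner_vec_def)
qed

lemma C1_on_component: "C1_on (\<lambda>y. y $ i) W"
  using C1_linear[of "axis i 1" W] by (simp add: inner_axis')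

lemma C1_on_cross3_component: "C1_on (\<lambda>y. cross3 a y $ i) W"
  using exhaust_3[of i] by (elim disjE) (auto simp: cross_components intro!: C1_diff C1_cmult
      C1_mult C1_const C1_on_component)

text \<open>Here \<open>g\<close> stands for the Euclidean gradient at \<open>x\<close> and
  \<open>\<gamma> i\<close> for the gradient of its \<open>i\<close>-th component. The left side is
  the sum of the squared rotational derivatives, the right side the trace of the derivative of the
  surface gradient, extended off the sphere as in \<open>ext_grad\<close>.\<close>

lemma lap_algebra:
  fixes x g :: "real^3" and \<gamma> :: "3 \<Rightarrow> real^3"
  assumes "x \<bullet> x = 1"
  shows "(\<Sum>j\<in>UNIV. (\<Sum>i\<in>UNIV. (\<gamma> i \<bullet> cross3 (axis j 1) x) * cross3 (axis j 1) x $ i) + g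
      \<bullet> cross3 (axis j 1) (cross3 (axis j 1) x))
    = (\<Sum>i\<in>UNIV. tanpart x (\<gamma> i - (x $ i) *\<^sub>R (g + (\<Sum>k\<in>UNIV. x $ k *\<^sub>R \<gamma> k)) - (x
        \<bullet> g) *\<^sub>R axis i 1) $ i)"
proof -
  have sq: "x$1 * x$1 + x$2 * x$2 + x$3 * x$3 = 1" using assms by (simp add: inner_vec_def sum_3)
  show ?thesis
    apply (simp add: tanpart_def sum_3 cross_components inner_vec_def axis_def)
    using sq by algebra
qed

definition smooth_near :: "(real^3 \<Rightarrow> real) \<Rightarrow> (real^3) set \<Rightarrow> bool" where
  "smooth_near F W \<longleftrightarrow> open W \<and> S2 \<subseteq> W \<and> C1_on F W \<and> (\<forall>i. C1_on (\<lambda>y. grad F y $ i) W)"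

lemma Ck_on_smooth_near:
  assumes "\<And>k. Ck_on k F W" "open W" "S2 \<subseteq> W"
  shows "smooth_near F W"
proof -
  have "C1_on (\<lambda>y. grad F y $ i) W" for i
    using assms(1)[of 2] by (auto simp: grad_def numeral_2_eq_2 intro!: Ck_on_imp_C1_on[of 0])
  then show ?thesis
    using assms Ck_on_imp_C1_on[OF assms(1)] by (auto simp: smooth_near_def)
qed

lemma smooth_near_C2:
  assumes F: "smooth_near F W"
  shows "C2_near F W"
    and "x \<in> W \<Longrightarrow> rotderiv a (rotderiv a F) x
        = (\<Sum>i\<in>UNIV. (grad (\<lambda>y. grad F y $ i) x \<bullet> cross3 a x) * cross3 a x $ i) + grad F x
        \<bullet> cross3 a (cross3 a x)"
proof -
  have W: "open W" "S2 \<subseteq> W" and C: "C1_on F W" and g: "\<And>i. C1_on (\<lambda>y. grad F y $ i) W"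
    using F by (auto simp: smooth_near_def)
  have r: "y \<in> W \<Longrightarrow> rotderiv a F y = grad F y \<bullet> cross3 a y" for a y by (rule C1_rotderiv[OF C])
  have C1: "C1_on (\<lambda>y. grad F y \<bullet> cross3 a y) W" for a
    by (intro C1_on_inner g C1_on_cross3_component)
  have C1r: "C1_on (rotderiv a F) W" for a
    by (rule C1_cong[OF C1[of a] W(1)]) (simp add: r)
  then show "C2_near F W" using W C by (simp add: C2_near_def)
  assume x: "x \<in> W"
  have "rotderiv a (rotderiv a F) x = rotderiv a (\<lambda>y. grad F y \<bullet> cross3 a y) x"
    by (rule rotderiv_cong[OF W(1) x r C1_differentiable[OF C1r x]])
  then show "rotderiv a (rotderiv a F) x
      = (\<Sum>i\<in>UNIV. (grad (\<lambda>y. grad F y $ i) x \<bullet> cross3 a x) * cross3 a x $ i) + grad F x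
      \<bullet> cross3 a (cross3 a x)"
    by (simp add: rotderiv_eqI[OF C1_rotderiv_sum[OF g x]])
qed

text \<open>The \<open>i\<close>-th component of the surface gradient, continued off the sphere by a
  formula that can be differentiated in space.\<close>

definition ext_grad :: "(real^3 \<Rightarrow> real) \<Rightarrow> 3 \<Rightarrow> real^3 \<Rightarrow> real" where
  "ext_grad F i y = grad F y $ i - (y \<bullet> grad F y) * y $ i"

lemma ext_grad:
  assumes F: "smooth_near F W"
  shows "C1_on (ext_grad F i) W"
    and "x \<in> W \<Longrightarrow> grad (ext_grad F i) x = grad (\<lambda>y. grad F y $ i) x
        - (x $ i) *\<^sub>R (grad F x + (\<Sum>k\<in>UNIV. x $ k *\<^sub>R grad (\<lambda>y. grad F y $ k) x)) - (x
            \<bullet> grad F x) *\<^sub>R axis i 1"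
proof -
  have W: "open W" "S2 \<subseteq> W" and C: "C1_on F W" and g: "\<And>i. C1_on (\<lambda>y. grad F y $ i) W"
    using F by (auto simp: smooth_near_def)
  show "C1_on (ext_grad F i) W"
    unfolding ext_grad_def[abs_def] by (intro C1_diff C1_mult C1_on_inner g C1_on_component)
  assume x: "x \<in> W"
  have d1: "((\<lambda>y. \<Sum>k\<in>UNIV. y $ k * grad F y $ k) has_derivative
     (\<lambda>v. (\<Sum>k\<in>UNIV. x $ k * (grad (\<lambda>y. grad F y $ k) x \<bullet> v) + v $ k * grad F x $ k))) (at x)"
    by (intro has_derivative_sum has_derivative_mult C1_has_derivative[OF g x]
        has_derivative_vec_nth)
  have e1: "(\<Sum>k\<in>UNIV. x $ k * (grad (\<lambda>y. grad F y $ k) x \<bullet> v) + v $ k * grad F x $ k) =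
     (grad F x + (\<Sum>k\<in>UNIV. x $ k *\<^sub>R grad (\<lambda>y. grad F y $ k) x)) \<bullet> v" for v
    by (simp add: inner_add_left inner_sum_left sum.distrib) (simp add: inner_vec_def mult.commute)
  have e2: "(\<Sum>k\<in>UNIV. y $ k * grad F y $ k) = y \<bullet> grad F y" for y
    by (simp add: inner_vec_def)
  have d2: "((\<lambda>y. y \<bullet> grad F y) has_derivative (\<lambda>v. (grad F x
      + (\<Sum>k\<in>UNIV. x $ k *\<^sub>R grad (\<lambda>y. grad F y $ k) x)) \<bullet> v)) (at x)"
    using d1 unfolding e1 e2 .
  have "(ext_grad F i has_derivative (\<lambda>v. grad (\<lambda>y. grad F y $ i) x \<bullet> v -
     ((x \<bullet> grad F x) * v $ i + ((grad F x + (\<Sum>k\<in>UNIV. x $ k *\<^sub>R grad (\<lambda>y. grad F y $ k) x)) \<bullet> v)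
         * x $ i))) (at x)"
    unfolding ext_grad_def[abs_def]
    by (intro has_derivative_diff has_derivative_mult C1_has_derivative[OF g x]
        has_derivative_vec_nth d2)
  then show "grad (ext_grad F i) x = grad (\<lambda>y. grad F y $ i) x
        - (x $ i) *\<^sub>R (grad F x + (\<Sum>k\<in>UNIV. x $ k *\<^sub>R grad (\<lambda>y. grad F y $ k) x)) - (x
            \<bullet> grad F x) *\<^sub>R axis i 1"
    by (intro grad_eqI) (simp add: inner_diff_left inner_axis' algebra_simps)
qed

text \<open>The rows of the inner matrix are tangent, so the outer projection leaves the trace
  unchanged: \<open>tr (P M) = tr (M P) = tr M\<close>. The remaining trace is matched with the sum
  of squares by \<open>lap_algebra\<close>.\<close>

lemma shess_smooth:
  assumes F: "smooth_near F W" and eq: "\<And>y. y \<in> S2 \<Longrightarrow> F y = f y" and x: "x \<in> S2"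
  shows "shess f x = tproj x ** (\<chi> i. tanpart x (grad (ext_grad F i) x))"
    and "trace (shess f x) = lap F x"
proof -
  have W: "open W" "S2 \<subseteq> W" and C: "C1_on F W" and g: "\<And>i. C1_on (\<lambda>y. grad F y $ i) W"
    using F by (auto simp: smooth_near_def)
  have n: "x \<bullet> x = 1" using x by (auto simp: dot_square_norm)
  have s: "ext_grad F i y = sgrad f y $ i" if "y \<in> S2" for y i
    using that W sgrad_tanpart[OF C1_differentiable[OF C], of y f] eq
    by (auto simp: ext_grad_def tanpart_def)
  have s2: "sgrad (\<lambda>y. sgrad f y $ i) x = tanpart x (grad (ext_grad F i) x)" for i
    by (rule sgrad_tanpart[OF C1_differentiable[OF ext_grad(1)[OF F]] x s]) (use W x in auto)
  show 1: "shess f x = tproj x ** (\<chi> i. tanpart x (grad (ext_grad F i) x))"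
    by (simp add: shess_def scov_def s2)
  have tt: "(\<Sum>i\<in>UNIV. (tproj x ** (\<chi> i. tanpart x (w i))) $ i $ i) = (\<Sum>i\<in>UNIV. tanpart x (w i) $ i)"
      for w
  proof -
    have "x$1 * x$1 + x$2 * x$2 + x$3 * x$3 = 1" using n by (simp add: inner_vec_def sum_3)
    then show ?thesis
      apply (simp add: tproj_def matrix_matrix_mult_def tanpart_def sum_3 inner_vec_def)
      by algebra
  qed
  have xW: "x \<in> W" using x W by auto
  have "trace (shess f x) = (\<Sum>i\<in>UNIV. tanpart x (grad (ext_grad F i) x) $ i)"
    unfolding 1 trace_def by (rule tt)
  also have "\<dots> = lap F x"
    unfolding lap_def smooth_near_C2(2)[OF F xW] ext_grad(2)[OF F xW]
    by (rule lap_algebra[OF n, symmetric])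
  finally show "trace (shess f x) = lap F x" .
qed

lemma continuous_on_shess:
  assumes F: "smooth_near F W" and eq: "\<And>y. y \<in> S2 \<Longrightarrow> F y = f y"
  shows "continuous_on S2 (shess f)"
proof -
  have W: "S2 \<subseteq> W" using F by (auto simp: smooth_near_def)
  have c: "continuous_on S2 (\<lambda>x. grad (ext_grad F i) x)" for i
    by (rule continuous_on_subset[OF C1_continuous_grad[OF ext_grad(1)[OF F]] W])
  have "continuous_on S2 (\<lambda>x. \<chi> i j. \<Sum>k\<in>UNIV. tproj x $ i $ k
      * tanpart x (grad (ext_grad F k) x) $ j)"
    unfolding tproj_def tanpart_def
    by (intro continuous_on_vec_lambda continuous_on_sum continuous_on_mult continuous_intros c |
        simp)+
  then show ?thesis
  proof (rule continuous_on_eq)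
    fix x assume x: "x \<in> S2"
    show "(\<chi> i j. \<Sum>k\<in>UNIV. tproj x $ i $ k * tanpart x (grad (ext_grad F k) x) $ j) = shess f x"
      by (subst shess_smooth(1)[OF F _ x]) (simp_all add: matrix_matrix_mult_def eq)
  qed
qed

section \<open>Potentials of functions in \<open>L^r\<close>\<close>

text \<open>The logarithm grows more slowly than the power \<open>\<kappa> = 3 / (4 * q)\<close>,
  whose \<open>q\<close>-th power has exactly the exponent \<open>3/4\<close> of the weight. For
  \<open>s \<le> 0\<close> the logarithm is at most \<open>1\<close> and the weight is bounded
  below.\<close>

lemma log_ker_power_bound:
  assumes q: "1 < q"
  obtains C where "0 < C" "\<And>s. -1 \<le> s \<Longrightarrow> s < 1 \<Longrightarrow> \<bar>log_ker 0 s\<bar> powr q \<le> C * sing_wt 0 s"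
proof -
  define \<kappa> where "\<kappa> = 3 / (4 * q)"
  have \<kappa>: "0 < \<kappa>" using q by (simp add: \<kappa>_def)
  show thesis
  proof (rule that[of "(1 / \<kappa>) powr q + 2"])
    show "0 < (1 / \<kappa>) powr q + 2" by (intro add_nonneg_pos) auto
    fix s :: real assume s: "-1 \<le> s" "s < 1"
    show "\<bar>log_ker 0 s\<bar> powr q \<le> ((1 / \<kappa>) powr q + 2) * sing_wt 0 s"
    proof (cases "s \<le> 0")
      case True
      have "ln (1 - s) \<le> (1 - s) - 1" using s by (intro ln_le_minus_one) auto
      then have "\<bar>log_ker 0 s\<bar> \<le> 1" using s True by (simp add: log_ker_def)
      then have "\<bar>log_ker 0 s\<bar> powr q \<le> 1 powr q" using q by (intro powr_mono2) auto
      also have "\<dots> \<le> 2 * sing_wt 0 s" using powr_bounds(3)[OF s] by simp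
      also have "\<dots> \<le> ((1 / \<kappa>) powr q + 2) * sing_wt 0 s" by (intro mult_right_mono) auto
      finally show ?thesis .
    next
      case False
      have "- ln (1 - s) = ln (1 / (1 - s))" using s by (simp add: ln_div)
      also have "\<dots> \<le> (1 / (1 - s)) powr \<kappa> / \<kappa>"
        using False s \<kappa> by (intro ln_powr_bound) (auto simp: field_simps)
      also have "\<dots> = (1 - s) powr (- \<kappa>) * (1 / \<kappa>)" using s
          by (simp add: powr_divide powr_minus_divide)
      finally have "\<bar>log_ker 0 s\<bar> \<le> (1 - s) powr (- \<kappa>) * (1 / \<kappa>)" using False s
          by (simp add: log_ker_def)
      then have "\<bar>log_ker 0 s\<bar> powr q \<le> ((1 - s) powr (- \<kappa>) * (1 / \<kappa>)) powr q" using q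
          by (intro powr_mono2) auto
      also have "\<dots> = (1 - s) powr (- \<kappa> * q) * (1 / \<kappa>) powr q"
        using \<kappa> by (subst powr_mult) (auto simp: powr_powr)
      also have "- \<kappa> * q = -3/4" using q by (simp add: \<kappa>_def)
      also have "(1 - s) powr (-3/4) * (1 / \<kappa>) powr q = (1 / \<kappa>) powr q * sing_wt 0 s"
          by (simp add: sing_wt_def)
      also have "\<dots> \<le> ((1 / \<kappa>) powr q + 2) * sing_wt 0 s" by (intro mult_right_mono) auto
      finally show ?thesis .
    qed
  qed
qed

text \<open>Young's inequality with conjugate exponents, rescaled by a factor \<open>l\<close> with
  \<open>l powr q = \<eta> / C\<close>. This makes the logarithmic part as small as desired and
  moves the cost into the constant in front of \<open>h powr r\<close>.\<close>

lemma log_ker_young: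
  assumes r: "1 < r" and \<eta>: "0 < \<eta>"
  obtains C where "0 \<le> C" "\<And>s h. -1 \<le> s \<Longrightarrow> s < 1 \<Longrightarrow> 0 \<le> h \<Longrightarrow> \<bar>log_ker 0 s\<bar> * h
      \<le> \<eta> * sing_wt 0 s + C * h powr r"
proof -
  define q where "q = r / (r - 1)"
  have q: "1 < q" and qr: "1/q + 1/r = 1" using r by (auto simp: q_def field_simps)
  obtain C where C: "0 < C" "\<And>s. -1 \<le> s \<Longrightarrow> s < 1 \<Longrightarrow> \<bar>log_ker 0 s\<bar> powr q \<le> C * sing_wt 0 s"
    using log_ker_power_bound[OF q] by metis
  define l where "l = (\<eta> / C) powr (1 / q)"
  have l: "0 < l" using \<eta> C by (simp add: l_def)
  have lq: "l powr q = \<eta> / C" using q \<eta> C by (simp add: l_def powr_powr)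
  show thesis
  proof (rule that[of "(1 / l) powr r"])
    fix s h :: real assume s: "-1 \<le> s" "s < 1" and h: "0 \<le> h"
    have "\<bar>log_ker 0 s\<bar> * h = (l * \<bar>log_ker 0 s\<bar>) * ((1 / l) * h)" using l by simp
    also have "\<dots> \<le> (l * \<bar>log_ker 0 s\<bar>) powr q / q + ((1 / l) * h) powr r / r"
      using l h by (intro Youngs_inequality q r qr) auto
    also have "\<dots> \<le> (l * \<bar>log_ker 0 s\<bar>) powr q / 1 + ((1 / l) * h) powr r / 1"
      using q r by (intro add_mono divide_left_mono) auto
    also have "(l * \<bar>log_ker 0 s\<bar>) powr q = (\<eta> / C) * \<bar>log_ker 0 s\<bar> powr q"
      using l by (simp add: powr_mult lq)
    also have "((1 / l) * h) powr r = (1 / l) powr r * h powr r"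
      by (rule powr_mult)
    also have "(\<eta> / C) * \<bar>log_ker 0 s\<bar> powr q / 1 \<le> (\<eta> / C) * (C * sing_wt 0 s)"
      using C(2)[OF s] C(1) \<eta> by (simp add: field_simps)
    finally show "\<bar>log_ker 0 s\<bar> * h \<le> \<eta> * sing_wt 0 s + (1 / l) powr r * h powr r" using C(1)
        by simp
  qed simp
qed

text \<open>The shape \<open>\<eta> + C * integral\<close> takes the place of Hoelder's inequality:
  as \<open>\<eta>\<close> is arbitrary, potentials become uniformly small when the integral tends
  to \<open>0\<close>. The factor \<open>2/15\<close> inside cancels the bound \<open>15/2\<close>
  for the integral of the weight.\<close>

lemma green_Lr:
  assumes r: "1 < r" and \<eta>: "0 < \<eta>"
  obtains C where "0 \<le> C" "\<And>x h. x \<in> S2 \<Longrightarrow> h \<in> borel_measurable area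
      \<Longrightarrow> integrable area (\<lambda>y. \<bar>h y\<bar> powr r) \<Longrightarrow>
     integrable area (\<lambda>y. h y * log_ker 0 (x \<bullet> y)) \<and> \<bar>green 0 h x\<bar>
         \<le> \<eta> + C * (LINT y|area. \<bar>h y\<bar> powr r)"
proof -
  obtain C where C: "0 \<le> C" "\<And>s h. -1 \<le> s \<Longrightarrow> s < 1 \<Longrightarrow> 0 \<le> h \<Longrightarrow> \<bar>log_ker 0 s\<bar> * h
      \<le> (\<eta> * 2/15) * sing_wt 0 s + C * h powr r"
    using log_ker_young[OF r, of "\<eta> * 2/15"] \<eta>
        by (metis mult_pos_pos divide_pos_pos zero_less_numeral)
  show thesis
  proof (rule that[of "C / total_area"])
    show "0 \<le> C / total_area" using C measure_area_pos by simp
    fix x h assume x: "x \<in> S2" and h [measurable]: "h \<in> borel_measurable area"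
        and i: "integrable area (\<lambda>y. \<bar>h y\<bar> powr r)"
    let ?b = "\<lambda>y. (\<eta> * 2/15) * sing_wt 0 (x \<bullet> y) + C * \<bar>h y\<bar> powr r"
    have ib: "integrable area ?b"
      by (intro area_integrable_add integrable_mult_right i integrable_sing_wt x) auto
    have le: "AE y in area. norm (h y * log_ker 0 (x \<bullet> y)) \<le> ?b y"
      using AE_inner_neq_1[OF x]
    proof (rule AE_mp, intro AE_I2 impI)
      fix y assume "y \<in> space area" "x \<bullet> y < 1"
      then show "norm (h y * log_ker 0 (x \<bullet> y)) \<le> ?b y"
        using C(2)[of "x \<bullet> y" "\<bar>h y\<bar>"] inner_S2_ge[OF x, of y] by (simp add: abs_mult mult.commute)
    qed
    have int: "integrable area (\<lambda>y. h y * log_ker 0 (x \<bullet> y))"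
      by (rule area_integrable_bound[OF ib]) (use le in auto)
    have "\<bar>LINT y|area. h y * log_ker 0 (x \<bullet> y)\<bar> \<le> (LINT y|area. norm (h y * log_ker 0 (x \<bullet> y)))"
      using integral_norm_bound[of area "\<lambda>y. h y * log_ker 0 (x \<bullet> y)"] by simp
    also have "\<dots> \<le> (LINT y|area. ?b y)"
      by (rule integral_mono_AE[OF integrable_norm[OF int] ib le])
    also have "\<dots> = (\<eta> * 2/15) * (LINT y|area. sing_wt 0 (x \<bullet> y)) + C * (LINT y|area. \<bar>h y\<bar> powr r)"
      by (subst LINT_add) (auto intro!: integrable_mult_right i integrable_sing_wt x)
    also have "\<dots> \<le> (\<eta> * 2/15) * (15/2 * total_area) + C * (LINT y|area. \<bar>h y\<bar> powr r)"
      using \<eta> by (intro add_right_mono mult_left_mono LINT_sing_wt x) auto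
    finally have "\<bar>LINT y|area. h y * log_ker 0 (x \<bullet> y)\<bar>
        \<le> \<eta> * total_area + C * (LINT y|area. \<bar>h y\<bar> powr r)" by simp
    then show "integrable area (\<lambda>y. h y * log_ker 0 (x \<bullet> y)) \<and> \<bar>green 0 h x\<bar>
        \<le> \<eta> + C / total_area * (LINT y|area. \<bar>h y\<bar> powr r)"
      using int measure_area_pos by (simp add: green_def abs_mult field_simps)
  qed
qed

text \<open>Pointwise, either \<open>a \<le> e\<close>, or \<open>a\<close> equals
  \<open>a powr r * a powr (1 - r)\<close> with the last factor at most
  \<open>e powr (1 - r)\<close>.\<close>

lemma L1_Lr:
  assumes r: "1 < r" and \<eta>: "0 < \<eta>"
  obtains C where "0 \<le> C" "\<And>h. h \<in> borel_measurable area \<Longrightarrow> integrable area (\<lambda>y. \<bar>h y\<bar> powr r) \<Longrightarrow>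
     integrable area (\<lambda>y. h y :: real) \<and> (LINT y|area. \<bar>h y\<bar>) \<le> \<eta> + C * (LINT y|area. \<bar>h y\<bar> powr r)"
proof -
  define e where "e = \<eta> / total_area"
  have e: "0 < e" using \<eta> measure_area_pos by (simp add: e_def)
  define C where "C = e powr (1 - r)"
  have pt: "a \<le> e + C * a powr r" if a: "0 \<le> a" for a
  proof (cases "a \<le> e")
    case False
    then have a: "0 < a" "e < a" using e by auto
    have "1 = a powr (r - 1) * a powr (1 - r)" using a by (simp flip: powr_add)
    also have "\<dots> \<le> a powr (r - 1) * C"
      unfolding C_def using a e r by (intro mult_left_mono powr_mono2') auto
    finally have "a * 1 \<le> a * (a powr (r - 1) * C)" using a by (intro mult_left_mono) auto
    also have "\<dots> = C * a powr r" using a by (simp add: powr_diff)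
    finally show ?thesis using e by simp
  next
    case True
    have "0 \<le> C * a powr r" by (simp add: C_def)
    then show ?thesis using True by linarith
  qed
  show thesis
  proof (rule that[of C])
    show "0 \<le> C" by (simp add: C_def)
    fix h :: "real^3 \<Rightarrow> real" assume h: "h \<in> borel_measurable area"
        and i: "integrable area (\<lambda>y. \<bar>h y\<bar> powr r)"
    have ib: "integrable area (\<lambda>y. e + C * \<bar>h y\<bar> powr r)"
      by (intro area_integrable_add integrable_mult_right i) auto
    have int: "integrable area h"
      by (rule area_integrable_bound[OF ib h]) (use pt[of "\<bar>h _\<bar>"] in \<open>auto intro: order_trans[OF _
          abs_ge_self]\<close>)
    have "(LINT y|area. \<bar>h y\<bar>) \<le> (LINT y|area. e + C * \<bar>h y\<bar> powr r)"
      by (intro integral_mono integrable_abs int ib pt) auto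
    also have "\<dots> = \<eta> + C * (LINT y|area. \<bar>h y\<bar> powr r)"
      using measure_area_pos i by (subst LINT_add) (auto simp: e_def)
    finally show "integrable area h \<and> (LINT y|area. \<bar>h y\<bar>) \<le> \<eta> + C * (LINT y|area. \<bar>h y\<bar> powr r)"
      using int by blast
  qed
qed

lemma powr_add_le:
  assumes "1 < (r::real)" "0 \<le> a" "0 \<le> b"
  shows "(a + b) powr r \<le> 2 powr r * (a powr r + b powr r)"
proof -
  have "(a + b) powr r \<le> (2 * max a b) powr r" using assms by (intro powr_mono2) auto
  also have "\<dots> = 2 powr r * (max a b) powr r" by (rule powr_mult)
  also have "\<dots> \<le> 2 powr r * (a powr r + b powr r)"
    by (intro mult_left_mono) (auto simp: max_def)
  finally show ?thesis .
qed

lemma Lr_diff_integrable: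
  fixes f g :: "real^3 \<Rightarrow> 'b::euclidean_space"
  assumes r: "1 < r" and f: "f \<in> borel_measurable area" and g: "g \<in> borel_measurable area"
    and i: "integrable area (\<lambda>x. norm (f x) powr r)" "integrable area (\<lambda>x. norm (g x) powr r)"
  shows "integrable area (\<lambda>x. norm (f x - g x) powr r)"
proof -
  have ib: "integrable area (\<lambda>x. 2 powr r * (norm (f x) powr r + norm (g x) powr r))"
    by (intro integrable_mult_right area_integrable_add i)
  show ?thesis
  proof (rule area_integrable_bound[OF ib])
    show "(\<lambda>x. norm (f x - g x) powr r) \<in> borel_measurable area" using f g by measurable
    show "AE x in area. norm (norm (f x - g x) powr r)
        \<le> norm (2 powr r * (norm (f x) powr r + norm (g x) powr r))"
    proof (intro AE_I2)
      fix x
      have "norm (f x - g x) powr r \<le> (norm (f x) + norm (g x)) powr r"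
        using r by (intro powr_mono2 norm_triangle_ineq4) auto
      also have "\<dots> \<le> 2 powr r * (norm (f x) powr r + norm (g x) powr r)"
        by (intro powr_add_le r) auto
      finally show "norm (norm (f x - g x) powr r)
          \<le> norm (2 powr r * (norm (f x) powr r + norm (g x) powr r))" by simp
    qed
  qed
qed

lemma continuous_Lr_integrable:
  fixes f :: "real^3 \<Rightarrow> 'b::euclidean_space"
  assumes "continuous_on S2 f" "1 < r"
  shows "integrable area (\<lambda>x. norm (f x) powr r)"
  by (intro integrable_area_continuous continuous_on_powr' continuous_intros assms) (use assms in
      auto)

lemma Lp_norm_tendsto:
  fixes F :: "nat \<Rightarrow> real^3 \<Rightarrow> 'b::euclidean_space"
  assumes r: "1 < r" and t: "(\<lambda>n. Lp_norm r (F n)) \<longlonglongrightarrow> 0"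
  shows "(\<lambda>n. LINT x|area. norm (F n x) powr r) \<longlonglongrightarrow> 0"
proof -
  have "(\<lambda>n. Lp_norm r (F n) powr r) \<longlonglongrightarrow> 0 powr r"
    using r by (intro tendsto_powr' t) (auto simp: Lp_norm_def)
  moreover have "Lp_norm r (F n) powr r = (LINT x|area. norm (F n x) powr r)" for n
  proof -
    have "0 \<le> (LINT x|area. norm (F n x) powr r)" by (rule integral_nonneg_AE) auto
    then show ?thesis using r by (simp add: Lp_norm_def powr_powr)
  qed
  ultimately show ?thesis by simp
qed

lemma Lr_to_L1:
  fixes h :: "nat \<Rightarrow> real^3 \<Rightarrow> real"
  assumes r: "1 < r" and h: "\<And>n. h n \<in> borel_measurable area"
      and i: "\<And>n. integrable area (\<lambda>y. \<bar>h n y\<bar> powr r)"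
    and t: "(\<lambda>n. LINT y|area. \<bar>h n y\<bar> powr r) \<longlonglongrightarrow> 0"
  shows "integrable area (h n)" "(\<lambda>n. LINT y|area. \<bar>h n y\<bar>) \<longlonglongrightarrow> 0"
proof -
  obtain C1 where "\<And>h. h \<in> borel_measurable area \<Longrightarrow> integrable area (\<lambda>y. \<bar>h y\<bar> powr r) \<Longrightarrow>
         integrable area (\<lambda>y. h y :: real) \<and> (LINT y|area. \<bar>h y\<bar>)
             \<le> 1 + C1 * (LINT y|area. \<bar>h y\<bar> powr r)"
    using L1_Lr[OF r zero_less_one] by blast
  then show "integrable area (h n)" for n using h i by blast
  show "(\<lambda>n. LINT y|area. \<bar>h n y\<bar>) \<longlonglongrightarrow> 0"
  proof (rule tendstoI)
    fix e :: real assume e: "0 < e"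
    obtain C where C: "0 \<le> C" "\<And>n. (LINT y|area. \<bar>h n y\<bar>) \<le> e/2 + C * (LINT y|area. \<bar>h n y\<bar> powr r)"
      proof -
      obtain C where C: "0 \<le> C" "\<And>h. h \<in> borel_measurable area
          \<Longrightarrow> integrable area (\<lambda>y. \<bar>h y\<bar> powr r) \<Longrightarrow>
         integrable area (\<lambda>y. h y :: real) \<and> (LINT y|area. \<bar>h y\<bar>)
             \<le> e/2 + C * (LINT y|area. \<bar>h y\<bar> powr r)"
        using L1_Lr[OF r half_gt_zero[OF e]] by blast
      show thesis by (rule that[OF C(1)]) (use C(2) h i in blast)
    qed
    have "(\<lambda>n. C * (LINT y|area. \<bar>h n y\<bar> powr r)) \<longlonglongrightarrow> C * 0" by (intro tendsto_intros t)
    then have "eventually (\<lambda>n. C * (LINT y|area. \<bar>h n y\<bar> powr r) < e/2) sequentially"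
      using e by (intro order_tendstoD(2)) auto
    then show "eventually (\<lambda>n. dist (LINT y|area. \<bar>h n y\<bar>) 0 < e) sequentially"
    proof eventually_elim
      case (elim n)
      have "0 \<le> (LINT y|area. \<bar>h n y\<bar>)" by (rule integral_nonneg_AE) auto
      then show ?case using C(2)[of n] elim by simp
    qed
  qed
qed

lemma Lr_green_uniform:
  fixes h :: "nat \<Rightarrow> real^3 \<Rightarrow> real"
  assumes r: "1 < r" and h: "\<And>n. h n \<in> borel_measurable area"
      and i: "\<And>n. integrable area (\<lambda>y. \<bar>h n y\<bar> powr r)"
    and t: "(\<lambda>n. LINT y|area. \<bar>h n y\<bar> powr r) \<longlonglongrightarrow> 0"
  shows "uniform_limit S2 (\<lambda>n. green 0 (h n)) (\<lambda>x. 0) sequentially"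
proof (rule uniform_limitI)
  fix e :: real assume e: "0 < e"
  obtain C where C: "0 \<le> C" "\<And>n x. x \<in> S2 \<Longrightarrow> \<bar>green 0 (h n) x\<bar>
      \<le> e/2 + C * (LINT y|area. \<bar>h n y\<bar> powr r)"
  proof -
    obtain C where C: "0 \<le> C" "\<And>x h. x \<in> S2 \<Longrightarrow> h \<in> borel_measurable area
        \<Longrightarrow> integrable area (\<lambda>y. \<bar>h y\<bar> powr r) \<Longrightarrow>
       integrable area (\<lambda>y. h y * log_ker 0 (x \<bullet> y)) \<and> \<bar>green 0 h x\<bar>
           \<le> e/2 + C * (LINT y|area. \<bar>h y\<bar> powr r)"
      using green_Lr[OF r half_gt_zero[OF e]] by blast
    show thesis by (rule that[OF C(1)]) (use C(2) h i in blast)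
  qed
  have "(\<lambda>n. C * (LINT y|area. \<bar>h n y\<bar> powr r)) \<longlonglongrightarrow> C * 0" by (intro tendsto_intros t)
  then have "eventually (\<lambda>n. C * (LINT y|area. \<bar>h n y\<bar> powr r) < e/2) sequentially"
    using e by (intro order_tendstoD(2)) auto
  then show "eventually (\<lambda>n. \<forall>x\<in>S2. dist (green 0 (h n) x) 0 < e) sequentially"
  proof eventually_elim
    case (elim n)
    show ?case
    proof
      fix x assume "x \<in> S2"
      from C(2)[OF this, of n] elim show "dist (green 0 (h n) x) 0 < e" by simp
    qed
  qed
qed

lemma abs_trace_le: "\<bar>trace (A :: real^3^3)\<bar> \<le> 3 * norm A"
proof -
  have "\<bar>A $ i $ i\<bar> \<le> norm A" for i
    using component_le_norm_cart[of "A $ i" i] Finite_Cartesian_Product.norm_nth_le[of A i]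
        by linarith
  then have "\<bar>\<Sum>i\<in>UNIV. A $ i $ i\<bar> \<le> (\<Sum>i\<in>(UNIV::3 set). norm A)"
    by (intro order_trans[OF sum_abs sum_mono])
  then show ?thesis by (simp add: trace_def)
qed

text \<open>Smooth approximations \<open>U n\<close> of \<open>u\<close> satisfy the representation
  formula with \<open>- lap = f + d n\<close>, where \<open>d n\<close> tends to \<open>0\<close> in
  \<open>L^r\<close> because traces are controlled by Hessians. Their means tend to the mean
  \<open>0\<close> of \<open>u\<close>, and the potentials of \<open>d n\<close> tend to
  \<open>0\<close> uniformly. So \<open>U n\<close> converges uniformly to \<open>green 0 f\<close>,
  which makes it continuous, and in \<open>L^1\<close> to \<open>u\<close>.\<close>

theorem inv_laplacian_green:
  assumes r: "1 < r" and fu: "inv_laplacian r f u"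
  shows "continuous_on S2 (green 0 f)" and "AE x in area. u x = green 0 f x"
proof -
  from fu obtain H U where f: "in_Lp0 r f" and u: "in_Lp0 r u"
      and tr: "AE x in area. - trace (H x) = f x"
    and H: "in_Lp r H" and U: "\<And>n. smooth_on S2 (U n)"
        and tU: "(\<lambda>n. Lp_norm r (\<lambda>x. U n x - u x)) \<longlonglongrightarrow> 0"
    and tH: "(\<lambda>n. Lp_norm r (\<lambda>x. shess (U n) x - H x)) \<longlonglongrightarrow> 0"
    unfolding inv_laplacian_def W2_hessian_def by blast
  have mf [measurable]: "f \<in> borel_measurable area"
      and jf: "integrable area (\<lambda>x. norm (f x) powr r)" and f0: "(LINT x|area. f x) = 0"
    using f by (auto simp: in_Lp0_def in_Lp_def)
  have mu [measurable]: "u \<in> borel_measurable area"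
      and ju: "integrable area (\<lambda>x. norm (u x) powr r)" and u0: "(LINT x|area. u x) = 0"
    using u by (auto simp: in_Lp0_def in_Lp_def)
  have mH [measurable]: "H \<in> borel_measurable area"
      and jH: "integrable area (\<lambda>x. norm (H x) powr r)"
    using H by (auto simp: in_Lp_def)
  have "\<exists>F W. \<forall>n. smooth_near (F n) (W n) \<and> (\<forall>y\<in>S2. F n y = U n y)"
  proof -
    have "\<exists>F W. smooth_near F W \<and> (\<forall>y\<in>S2. F y = U n y)" for n
      using U[of n] unfolding smooth_on_def by (blast intro: Ck_on_smooth_near)
    then show ?thesis by metis
  qed
  then obtain F W where F: "\<And>n. smooth_near (F n) (W n)" and FU: "\<And>n y. y \<in> S2 \<Longrightarrow> F n y = U n y"
      by metis
  note C2 = smooth_near_C2(1)[OF F]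
  have cF: "continuous_on S2 (F n)" for n
    by (rule continuous_on_subset[OF C1_continuous[OF C2_nearD(3)[OF C2]] C2_nearD(2)[OF C2]])
  have cU: "continuous_on S2 (U n)" for n by (rule continuous_on_eq[OF cF FU])
  have cS: "continuous_on S2 (shess (U n))" for n by (rule continuous_on_shess[OF F FU])
  have cl: "continuous_on S2 (\<lambda>x. lap (F n) x)" for n by (rule continuous_on_lap[OF C2])
  have mS [measurable]: "shess (U n) \<in> borel_measurable area" for n
      by (rule borel_measurable_area_continuous[OF cS])
  have mU [measurable]: "U n \<in> borel_measurable area" for n
      by (rule borel_measurable_area_continuous[OF cU])
  have ml [measurable]: "lap (F n) \<in> borel_measurable area" for n
      by (rule borel_measurable_area_continuous[OF cl])
  define d where "d n x = - lap (F n) x - f x" for n x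
  have jS: "integrable area (\<lambda>x. norm (shess (U n) x - H x) powr r)" for n
    by (rule Lr_diff_integrable[OF r mS mH continuous_Lr_integrable[OF cS r] jH])
  have bd: "AE x in area. \<bar>d n x\<bar> powr r \<le> 3 powr r * norm (shess (U n) x - H x) powr r" for n
    using tr
  proof (rule AE_mp, intro AE_I2 impI)
    fix x assume x: "x \<in> space area" and e: "- trace (H x) = f x"
    have "trace (shess (U n) x) = lap (F n) x"
      by (rule shess_smooth(2)[OF F FU]) (use x in auto)
    then have "d n x = - trace (shess (U n) x - H x)"
      using e by (simp add: d_def trace_sub)
    then have "\<bar>d n x\<bar> \<le> 3 * norm (shess (U n) x - H x)" using abs_trace_le by simp
    then have "\<bar>d n x\<bar> powr r \<le> (3 * norm (shess (U n) x - H x)) powr r" using r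
        by (intro powr_mono2) auto
    then show "\<bar>d n x\<bar> powr r \<le> 3 powr r * norm (shess (U n) x - H x) powr r"
        by (simp add: powr_mult)
  qed
  have md [measurable]: "d n \<in> borel_measurable area" for n unfolding d_def[abs_def] by measurable
  have jd: "integrable area (\<lambda>x. \<bar>d n x\<bar> powr r)" for n
    by (rule area_integrable_bound[OF integrable_mult_right[OF jS[of n], of "3 powr r"]])
       (use bd[of n] in auto)
  have td: "(\<lambda>n. LINT x|area. \<bar>d n x\<bar> powr r) \<longlonglongrightarrow> 0"
  proof (rule tendsto_sandwich[of "\<lambda>_. 0"])
    have "(\<lambda>n. 3 powr r * (LINT x|area. norm (shess (U n) x - H x) powr r)) \<longlonglongrightarrow> 3 powr r * 0"
      by (intro tendsto_intros Lp_norm_tendsto[OF r tH])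
    then show "(\<lambda>n. 3 powr r * (LINT x|area. norm (shess (U n) x - H x) powr r)) \<longlonglongrightarrow> 0" by simp
    show "\<forall>\<^sub>F n in sequentially. (LINT x|area. \<bar>d n x\<bar> powr r)
        \<le> 3 powr r * (LINT x|area. norm (shess (U n) x - H x) powr r)"
      unfolding integral_mult_right_zero[symmetric]
      by (intro always_eventually allI integral_mono_AE jd integrable_mult_right jS bd)
  qed auto
  have jU: "integrable area (\<lambda>x. \<bar>U n x - u x\<bar> powr r)" for n
    using Lr_diff_integrable[OF r mU mu continuous_Lr_integrable[OF cU r] ju] by simp
  have tU': "(\<lambda>n. LINT x|area. \<bar>U n x - u x\<bar> powr r) \<longlonglongrightarrow> 0" using Lp_norm_tendsto[OF r tU] by simp
  have mUu: "(\<lambda>x. U n x - u x) \<in> borel_measurable area" for n by measurable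
  note U1 = Lr_to_L1[where h = "\<lambda>n x. U n x - u x", OF r mUu jU tU']
  have iu: "integrable area u"
    using area_integrable_diff[OF integrable_area_continuous[OF cU[of 0]] U1(1)[of 0]] by simp
  have mean: "(\<lambda>n. (1 / total_area) * (LINT x|area. U n x)) \<longlonglongrightarrow> 0"
  proof -
    have "(\<lambda>n. LINT x|area. U n x) \<longlonglongrightarrow> 0"
    proof (rule tendsto_rabs_zero_cancel, rule tendsto_sandwich[OF _ _ tendsto_const U1(2)])
      show "\<forall>\<^sub>F n in sequentially. \<bar>LINT x|area. U n x\<bar> \<le> (LINT x|area. \<bar>U n x - u x\<bar>)"
      proof (intro always_eventually allI)
        fix n
        have "(LINT x|area. U n x) = (LINT x|area. U n x - u x)"
          using u0 by (subst LINT_diff) (auto intro!: integrable_area_continuous cU iu)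
        also have "\<bar>\<dots>\<bar> \<le> (LINT x|area. \<bar>U n x - u x\<bar>)" by (rule integral_abs_bound)
        finally show "\<bar>LINT x|area. U n x\<bar> \<le> (LINT x|area. \<bar>U n x - u x\<bar>)" .
      qed
    qed auto
    from tendsto_mult[OF tendsto_const[of "1 / total_area"] this] show ?thesis by simp
  qed
  have rep: "U n x = (1 / total_area) * (LINT y|area. U n y) + green 0 f x
      + green 0 (d n) x" if x: "x \<in> S2" for n x
  proof -
    obtain C where "0 \<le> C" and C: "\<And>x h. x \<in> S2 \<Longrightarrow> h \<in> borel_measurable area
        \<Longrightarrow> integrable area (\<lambda>y. \<bar>h y\<bar> powr r) \<Longrightarrow>
       integrable area (\<lambda>y. h y * log_ker 0 (x \<bullet> y)) \<and> \<bar>green 0 h x\<bar>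
           \<le> 1 + C * (LINT y|area. \<bar>h y\<bar> powr r)"
      using green_Lr[OF r zero_less_one] by blast
    have "integrable area (\<lambda>y. f y * log_ker 0 (x \<bullet> y))"
        "integrable area (\<lambda>y. d n y * log_ker 0 (x \<bullet> y))"
      using C[OF x mf jf[unfolded real_norm_def]] C[OF x md jd] by blast+
    then have "green 0 f x + green 0 (d n) x
        = (1 / total_area) * (LINT y|area. f y * log_ker 0 (x \<bullet> y) + d n y * log_ker 0 (x \<bullet> y))"
      by (simp add: green_def algebra_simps add_divide_distrib)
    also have "(\<lambda>y. f y * log_ker 0 (x \<bullet> y) + d n y * log_ker 0 (x \<bullet> y))
        = (\<lambda>y. - (lap (F n) y * log_ker 0 (x \<bullet> y)))"
      by (auto simp: d_def algebra_simps)
    finally have "green 0 f x + green 0 (d n) x = - green 0 (lap (F n)) x" by (simp add: green_def)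
    moreover have "(LINT y|area. F n y) = (LINT y|area. U n y)"
      by (intro LINT_cong) (auto simp: FU)
    ultimately show ?thesis using green_representation[OF C2[of n] x] FU[OF x] by simp
  qed
  have ul: "uniform_limit S2 U (green 0 f) sequentially"
  proof (rule uniform_limitI)
    fix e :: real assume e: "0 < e"
    have "\<forall>\<^sub>F n in sequentially. dist ((1 / total_area) * (LINT x|area. U n x)) 0 < e/2"
      using e by (intro tendstoD[OF mean]) auto
    moreover have "\<forall>\<^sub>F n in sequentially. \<forall>x\<in>S2. dist (green 0 (d n) x) 0 < e/2"
      using e by (intro uniform_limitD[OF Lr_green_uniform[OF r md jd td]]) auto
    ultimately show "\<forall>\<^sub>F n in sequentially. \<forall>x\<in>S2. dist (U n x) (green 0 f x) < e"
    proof eventually_elim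
      case (elim n)
      show ?case
      proof
        fix x assume x: "x \<in> S2"
        have "\<bar>green 0 (d n) x\<bar> < e/2" "\<bar>(1 / total_area) * (LINT x|area. U n x)\<bar> < e/2"
          using elim x by (auto simp: dist_real_def)
        then show "dist (U n x) (green 0 f x) < e"
          unfolding rep[OF x, of n] dist_real_def by linarith
      qed
    qed
  qed
  show cK: "continuous_on S2 (green 0 f)"
    by (rule uniform_limit_theorem[OF _ ul]) (use cU in auto)
  have L: "(\<lambda>n. LINT x|area. \<bar>U n x - green 0 f x\<bar>) \<longlonglongrightarrow> (LINT x|area. \<bar>green 0 f x - green 0 f x\<bar>)"
  proof (rule tendsto_LINT_uniform)
    show "uniform_limit S2 (\<lambda>n x. \<bar>U n x - green 0 f x\<bar>) (\<lambda>x. \<bar>green 0 f x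
        - green 0 f x\<bar>) sequentially"
      using ul unfolding uniform_limit_iff by (simp add: dist_real_def)
    show "\<forall>\<^sub>F n in sequentially. continuous_on S2 (\<lambda>x. \<bar>U n x - green 0 f x\<bar>)"
      by (intro always_eventually allI continuous_intros cU cK)
  qed simp
  have "(LINT x|area. \<bar>u x - green 0 f x\<bar>) \<le> 0"
  proof (rule tendsto_lowerbound)
    show "(\<lambda>n. (LINT x|area. \<bar>U n x - u x\<bar>) + (LINT x|area. \<bar>U n x - green 0 f x\<bar>)) \<longlonglongrightarrow> 0"
      using tendsto_add[OF U1(2) L] by simp
    show "\<forall>\<^sub>F n in sequentially. (LINT x|area. \<bar>u x - green 0 f x\<bar>)
        \<le> (LINT x|area. \<bar>U n x - u x\<bar>) + (LINT x|area. \<bar>U n x - green 0 f x\<bar>)"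
    proof (intro always_eventually allI)
      fix n
      have "(LINT x|area. \<bar>u x - green 0 f x\<bar>)
          \<le> (LINT x|area. \<bar>U n x - u x\<bar> + \<bar>U n x - green 0 f x\<bar>)"
        by (intro integral_mono integrable_abs area_integrable_add area_integrable_diff
            iu integrable_area_continuous[OF cK] integrable_area_continuous[OF cU]) auto
      also have "\<dots> = (LINT x|area. \<bar>U n x - u x\<bar>) + (LINT x|area. \<bar>U n x - green 0 f x\<bar>)"
        by (intro LINT_add integrable_abs area_integrable_diff
            iu integrable_area_continuous[OF cK] integrable_area_continuous[OF cU])
      finally show "(LINT x|area. \<bar>u x - green 0 f x\<bar>)
          \<le> (LINT x|area. \<bar>U n x - u x\<bar>) + (LINT x|area. \<bar>U n x - green 0 f x\<bar>)" .
    qed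
  qed simp
  moreover have "0 \<le> (LINT x|area. \<bar>u x - green 0 f x\<bar>)" by (rule integral_nonneg_AE) auto
  ultimately have "(LINT x|area. \<bar>u x - green 0 f x\<bar>) = 0" by simp
  then have "AE x in area. \<bar>u x - green 0 f x\<bar> = 0"
    by (subst (asm) integral_nonneg_eq_0_iff_AE)
       (auto intro!: integrable_abs area_integrable_diff iu integrable_area_continuous[OF cK])
  then show "AE x in area. u x = green 0 f x" by simp
qed

section \<open>Spectral gap\<close>

lemma green_cong: "(\<And>y. y \<in> S2 \<Longrightarrow> f y = g y) \<Longrightarrow> green e f = green e g"
  unfolding green_def fun_eq_iff
  by (intro allI arg_cong2[where f = "(*)"] refl LINT_cong) auto

lemma green_cmult: "green e (\<lambda>x. c * f x) x = c * green e f x"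
  by (simp add: green_def mult.assoc mult.left_commute)

lemma green_add:
  assumes "bmeas A f" "bmeas B g" "x \<in> S2"
  shows "green 0 (\<lambda>x. f x + g x) x = green 0 f x + green 0 g x"
proof -
  have "(LINT y|area. f y * log_ker 0 (x \<bullet> y) + g y * log_ker 0 (x \<bullet> y))
      = (LINT y|area. f y * log_ker 0 (x \<bullet> y)) + (LINT y|area. g y * log_ker 0 (x \<bullet> y))"
    using assms by (intro LINT_add green_integrable) auto
  then show ?thesis by (simp add: green_def distrib_right distrib_left add_divide_distrib)
qed

lemma bmeas_cmult: "bmeas A f \<Longrightarrow> bmeas (\<bar>c\<bar> * A) (\<lambda>x. c * f x)"
  unfolding bmeas_def by (auto simp: abs_mult intro!: mult_left_mono)

lemma green_diff:
  assumes "bmeas A f" "bmeas B g" "x \<in> S2"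
  shows "green 0 (\<lambda>x. f x - g x) x = green 0 f x - green 0 g x"
  using green_add[OF assms(1) bmeas_cmult[OF assms(2), of "-1"] assms(3)] green_cmult[of 0 "-1" g x]
      by simp

text \<open>Polar coordinates at radius one: the Euclidean Laplacian loses its second radial
  derivative and twice its first one.\<close>

lemma lap_formula:
  assumes F: "smooth_near F W" and x: "x \<in> S2"
  shows "lap F x = (\<Sum>i\<in>UNIV. grad (\<lambda>y. grad F y $ i) x $ i)
    - (\<Sum>i\<in>UNIV. x $ i * (grad (\<lambda>y. grad F y $ i) x \<bullet> x)) - 2 * (x \<bullet> grad F x)"
proof -
  have n: "x \<bullet> x = 1" using x by (auto simp: dot_square_norm)
  then have sq: "x$1 * x$1 + x$2 * x$2 + x$3 * x$3 = 1" by (simp add: inner_vec_def sum_3)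
  have xW: "x \<in> W" using F x by (auto simp: smooth_near_def)
  have "lap F x = (\<Sum>j\<in>UNIV. (\<Sum>i\<in>UNIV. (grad (\<lambda>y. grad F y $ i) x \<bullet> cross3 (axis j 1) x)
      * cross3 (axis j 1) x $ i) + grad F x \<bullet> cross3 (axis j 1) (cross3 (axis j 1) x))"
    unfolding lap_def smooth_near_C2(2)[OF F xW] ..
  also have "\<dots> = (\<Sum>i\<in>UNIV. grad (\<lambda>y. grad F y $ i) x $ i)
    - (\<Sum>i\<in>UNIV. x $ i * (grad (\<lambda>y. grad F y $ i) x \<bullet> x)) - 2 * (x \<bullet> grad F x)"
    apply (simp add: sum_3 cross_components inner_vec_def axis_def)
    using sq by algebra
  finally show ?thesis .
qed

lemma smooth_near_add:
  assumes "smooth_near f W" "smooth_near g W"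
  shows "smooth_near (\<lambda>x. f x + g x) W"
proof -
  have W: "open W" and d: "\<And>x. x \<in> W \<Longrightarrow> f differentiable at x" "\<And>x. x \<in> W \<Longrightarrow> g differentiable at x"
    using assms by (auto simp: smooth_near_def C1_on_def)
  have "C1_on (\<lambda>y. grad (\<lambda>x. f x + g x) y $ i) W" for i
    by (rule C1_cong[OF C1_add W, of "\<lambda>y. grad f y $ i" "\<lambda>y. grad g y $ i"])
       (use assms d in \<open>auto simp: smooth_near_def grad_add\<close>)
  then show ?thesis using assms by (auto simp: smooth_near_def intro: C1_add)
qed

lemma grad_cmult: "f differentiable at x \<Longrightarrow> grad (\<lambda>x. c * f x) x = c *\<^sub>R grad f x"
  by (rule grad_eqI) (auto intro!: derivative_eq_intros has_derivative_grad)

lemma rotderiv_cmult: "f differentiable at x \<Longrightarrow> rotderiv a (\<lambda>x. c * f x) x = c * rotderiv a f x"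
  by (subst rotderiv_eq_grad) (auto simp: grad_cmult rotderiv_eq_grad)

lemma smooth_near_cmult:
  assumes "smooth_near f W"
  shows "smooth_near (\<lambda>x. c * f x) W"
proof -
  have W: "open W" and d: "\<And>x. x \<in> W \<Longrightarrow> f differentiable at x"
    using assms by (auto simp: smooth_near_def C1_on_def)
  have "C1_on (\<lambda>y. grad (\<lambda>x. c * f x) y $ i) W" for i
    by (rule C1_cong[OF C1_cmult W, of "\<lambda>y. grad f y $ i" c])
       (use assms d in \<open>auto simp: smooth_near_def grad_cmult\<close>)
  then show ?thesis using assms by (auto simp: smooth_near_def intro: C1_cmult)
qed

lemma lap_add:
  assumes f: "C2_near f W" and g: "C2_near g W" and x: "x \<in> W"
  shows "lap (\<lambda>x. f x + g x) x = lap f x + lap g x"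
proof -
  note Df = C2_nearD[OF f] and Dg = C2_nearD[OF g]
  note d = C1_differentiable[OF Df(3)] C1_differentiable[OF Dg(3)]
  have "rotderiv a (rotderiv a (\<lambda>x. f x + g x)) x
      = rotderiv a (\<lambda>x. rotderiv a f x + rotderiv a g x) x" for a
    by (rule rotderiv_cong[symmetric, OF Df(1) x])
       (use d x in \<open>auto simp: rotderiv_add intro!: differentiable_add C1_differentiable[OF Df(4)]
           C1_differentiable[OF Dg(4)]\<close>)
  also have "rotderiv a (\<lambda>x. rotderiv a f x + rotderiv a g x) x
      = rotderiv a (rotderiv a f) x + rotderiv a (rotderiv a g) x" for a
    by (intro rotderiv_add C1_differentiable[OF Df(4) x] C1_differentiable[OF Dg(4) x])
  finally show ?thesis by (simp add: lap_def sum.distrib)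
qed

lemma lap_cmult:
  assumes f: "C2_near f W" and x: "x \<in> W"
  shows "lap (\<lambda>x. c * f x) x = c * lap f x"
proof -
  note Df = C2_nearD[OF f]
  have "rotderiv a (rotderiv a (\<lambda>x. c * f x)) x = rotderiv a (\<lambda>x. c * rotderiv a f x) x" for a
    by (rule rotderiv_cong[symmetric, OF Df(1) x])
       (use C1_differentiable[OF Df(3)] x in \<open>auto simp: rotderiv_cmult intro!: differentiable_mult
           C1_differentiable[OF Df(4)]\<close>)
  also have "rotderiv a (\<lambda>x. c * rotderiv a f x) x = c * rotderiv a (rotderiv a f) x" for a
    by (intro rotderiv_cmult C1_differentiable[OF Df(4) x])
  finally show ?thesis by (simp add: lap_def sum_distrib_left)
qed

section \<open>Polynomials and their decomposition into eigenfunctions\<close>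

definition monom3 :: "nat \<Rightarrow> nat \<Rightarrow> nat \<Rightarrow> real^3 \<Rightarrow> real" where
  "monom3 a b c x = x $ 1 ^ a * x $ 2 ^ b * x $ 3 ^ c"

definition monom3_grad :: "nat \<Rightarrow> nat \<Rightarrow> nat \<Rightarrow> real^3 \<Rightarrow> real^3" where
  "monom3_grad a b c x = vector [real a * monom3 (a - 1) b c x, real b * monom3 a (b
      - 1) c x, real c * monom3 a b (c - 1) x]"

lemma monom3_has_derivative: "(monom3 a b c has_derivative (\<lambda>v. monom3_grad a b c x \<bullet> v)) (at x)"
  unfolding monom3_def[abs_def] monom3_grad_def inner_vec_def sum_3 vector_3
  by (auto intro!: derivative_eq_intros has_derivative_vec_nth simp: monom3_def algebra_simps)

lemma grad_monom3: "grad (monom3 a b c) x = monom3_grad a b c x"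
  by (rule grad_eqI[OF monom3_has_derivative])

lemma continuous_on_monom3: "continuous_on A (monom3 a b c)"
  unfolding monom3_def[abs_def] by (intro continuous_intros)

lemma C1_on_monom3: "C1_on (monom3 a b c) W"
proof (rule C1I[OF monom3_has_derivative], rule continuous_on_vec3)
  show "continuous_on W (\<lambda>x. monom3_grad a b c x $ i)" for i
    using exhaust_3[of i] by (elim disjE) (auto simp: monom3_grad_def intro!: continuous_intros
        continuous_on_monom3)
qed

lemma smooth_near_monom3: "smooth_near (monom3 a b c) UNIV"
proof -
  have "C1_on (\<lambda>y. grad (monom3 a b c) y $ i) UNIV" for i
    using exhaust_3[of i] by (elim disjE) (auto simp: grad_monom3 monom3_grad_def intro!: C1_cmult
        C1_on_monom3)
  then show ?thesis by (auto simp: smooth_near_def C1_on_monom3)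
qed

lemma euler_monom3: "x \<bullet> monom3_grad a b c x = real (a + b + c) * monom3 a b c x"
proof -
  have p: "y * (real k * y ^ (k - 1)) = real k * y ^ k" for y :: real and k
    by (cases k) auto
  have "x \<bullet> monom3_grad a b c x = (x$1 * (real a * x$1 ^ (a - 1))) * x$2 ^ b * x$3 ^ c
      + x$1 ^ a * (x$2 * (real b * x$2 ^ (b - 1))) * x$3 ^ c + x$1 ^ a * x$2 ^ b * (x$3 * (real c
          * x$3 ^ (c - 1)))"
    by (simp add: monom3_grad_def monom3_def inner_vec_def sum_3 algebra_simps)
  also have "\<dots> = real (a + b + c) * monom3 a b c x"
    unfolding p by (simp add: monom3_def algebra_simps)
  finally show ?thesis .
qed

text \<open>By Euler's identity the radial terms of a monomial of degree \<open>n\<close> add up to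
  \<open>n (n - 1) + 2 n = n (n + 1)\<close> times the monomial, while the Euclidean Laplacian
  lowers the degree by two. Truncated subtraction in \<open>a - 2\<close> is harmless, since the
  coefficient vanishes for \<open>a \<le> 1\<close>.\<close>

lemma lap_monom3:
  assumes x: "x \<in> S2"
  shows "lap (monom3 a b c) x = real a * (real (a - 1) * monom3 (a - 2) b c x) + real b * (real (b
      - 1) * monom3 a (b - 2) c x)
     + real c * (real (c - 1) * monom3 a b (c - 2) x) - real (a + b + c) * (real (a + b + c) + 1)
         * monom3 a b c x"
proof -
  let ?n = "a + b + c"
  have g: "grad (\<lambda>y. grad (monom3 a b c) y $ 1) x = real a *\<^sub>R monom3_grad (a - 1) b c x"
    "grad (\<lambda>y. grad (monom3 a b c) y $ 2) x = real b *\<^sub>R monom3_grad a (b - 1) c x"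
    "grad (\<lambda>y. grad (monom3 a b c) y $ 3) x = real c *\<^sub>R monom3_grad a b (c - 1) x"
    unfolding grad_monom3 monom3_grad_def[of a b c] vector_3
    by (subst grad_cmult; auto simp: grad_monom3 intro: C1_differentiable[OF C1_on_monom3 UNIV_I])+
  have e: "real a * (monom3_grad (a - 1) b c x \<bullet> x)
      = real a * (real (?n) - 1) * monom3 (a - 1) b c x"
    "real b * (monom3_grad a (b - 1) c x \<bullet> x) = real b * (real (?n) - 1) * monom3 a (b - 1) c x"
    "real c * (monom3_grad a b (c - 1) x \<bullet> x) = real c * (real (?n) - 1) * monom3 a b (c - 1) x"
    unfolding inner_commute[of _ x] euler_monom3
    by (cases a, auto simp: algebra_simps) (cases b, auto simp: algebra_simps, cases c, auto simp:
        algebra_simps)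
  have s: "(\<Sum>i\<in>UNIV. x $ i * (grad (\<lambda>y. grad (monom3 a b c) y $ i) x \<bullet> x))
      = (real ?n - 1) * (x \<bullet> monom3_grad a b c x)"
    unfolding sum_3 g inner_scaleR_left e by (simp add: monom3_grad_def inner_vec_def sum_3
        algebra_simps)
  have t: "(\<Sum>i\<in>UNIV. grad (\<lambda>y. grad (monom3 a b c) y $ i) x $ i) =
     real a * (real (a - 1) * monom3 (a - 2) b c x) + real b * (real (b - 1) * monom3 a (b - 2) c x)
         + real c * (real (c - 1) * monom3 a b (c - 2) x)"
    unfolding sum_3 g by (simp add: monom3_grad_def)  (simp add: numeral_2_eq_2)
  show ?thesis
    unfolding lap_formula[OF smooth_near_monom3 x] s t unfolding grad_monom3 euler_monom3
        by (simp add: algebra_simps)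
qed

inductive polydeg :: "nat \<Rightarrow> (real^3 \<Rightarrow> real) \<Rightarrow> bool" for n where
  polydeg_monom3: "a + b + c \<le> n \<Longrightarrow> polydeg n (\<lambda>x. k * monom3 a b c x)"
| polydeg_add: "polydeg n f \<Longrightarrow> polydeg n g \<Longrightarrow> polydeg n (\<lambda>x. f x + g x)"

lemma polydeg_smooth: "polydeg n f \<Longrightarrow> smooth_near f UNIV"
  by (induction rule: polydeg.induct) (auto intro: smooth_near_add smooth_near_cmult
      smooth_near_monom3)

lemma polydeg_C2: "polydeg n f \<Longrightarrow> C2_near f UNIV"
  using smooth_near_C2(1)[OF polydeg_smooth] .

lemma polydeg_continuous: "polydeg n f \<Longrightarrow> continuous_on A f"
  by (induction rule: polydeg.induct) (auto intro!: continuous_intros continuous_on_monom3)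

lemma polydeg_mono: "polydeg n f \<Longrightarrow> n \<le> m \<Longrightarrow> polydeg m f"
  by (induction rule: polydeg.induct) (auto intro: polydeg.intros)

lemma polydeg_cmult: "polydeg n f \<Longrightarrow> polydeg n (\<lambda>x. c * f x)"
proof (induction rule: polydeg.induct)
  case (polydeg_monom3 a b c' k)
  then show ?case using polydeg.polydeg_monom3[of a b c' n "c * k"] by (simp add: mult.assoc)
next
  case (polydeg_add f g)
  then show ?case using polydeg.polydeg_add[of n "\<lambda>x. c * f x" "\<lambda>x. c * g x"]
      by (simp add: distrib_left)
qed

lemma polydeg_const: "polydeg n (\<lambda>x. c)"
  using polydeg_monom3[of 0 0 0 n c] by (simp add: monom3_def)

lemma polydeg_sum: "finite I \<Longrightarrow> (\<And>i. i \<in> I \<Longrightarrow> polydeg n (f i)) \<Longrightarrow> polydeg n (\<lambda>x. \<Sum>i\<in>I. f i x)"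
  by (induction rule: finite_induct) (auto intro: polydeg_const polydeg_add)

lemma monom3_mult: "monom3 a b c x * monom3 a' b' c' x = monom3 (a + a') (b + b') (c + c') x"
  by (simp add: monom3_def power_add)

lemma polydeg_mult: "polydeg n f \<Longrightarrow> polydeg m g \<Longrightarrow> polydeg (n + m) (\<lambda>x. f x * g x)"
proof (induction rule: polydeg.induct)
  case (polydeg_monom3 a b c k)
  from polydeg_monom3(2) show ?case
  proof (induction rule: polydeg.induct)
    case (polydeg_monom3 a' b' c' k')
    have "polydeg (n + m) (\<lambda>x. (k * k') * monom3 (a + a') (b + b') (c + c') x)"
      using polydeg_monom3 \<open>a + b + c \<le> n\<close> by (intro polydeg.polydeg_monom3) auto
    then show ?case by (simp add: monom3_mult[symmetric] mult_ac)
  next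
    case (polydeg_add f g)
    then show ?case using polydeg.polydeg_add[OF polydeg_add.IH] by (simp add: distrib_left)
  qed
next
  case (polydeg_add f g)
  then show ?case using polydeg.polydeg_add[OF polydeg_add.IH] by (simp add: distrib_right)
qed

lemma real_polynomial_polydeg: "real_polynomial_function f \<Longrightarrow> \<exists>n. polydeg n f"
proof (induction rule: real_polynomial_function.induct)
  case (linear f)
  interpret bounded_linear f by fact
  have "f x = f (axis 1 1) * monom3 1 0 0 x + f (axis 2 1) * monom3 0 1 0 x + f (axis 3 1)
      * monom3 0 0 1 x" for x
  proof -
    have "x = x$1 *\<^sub>R axis 1 1 + x$2 *\<^sub>R axis 2 1 + x$3 *\<^sub>R axis 3 1"
      by (simp add: vec_eq_iff forall_3 axis_def)
    then have "f x = f (x$1 *\<^sub>R axis 1 1 + x$2 *\<^sub>R axis 2 1 + x$3 *\<^sub>R axis 3 1)" by simp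
    then show ?thesis by (simp add: add scaleR monom3_def mult.commute)
  qed
  then have "f = (\<lambda>x. f (axis 1 1) * monom3 1 0 0 x + f (axis 2 1) * monom3 0 1 0 x + f (axis 3 1)
      * monom3 0 0 1 x)" by (rule ext)
  moreover have "polydeg 1 (\<lambda>x. f (axis 1 1) * monom3 1 0 0 x + f (axis 2 1) * monom3 0 1 0 x
      + f (axis 3 1) * monom3 0 0 1 x)"
    by (intro polydeg.intros) auto
  ultimately have "polydeg 1 f" by (simp only:)
  then show ?case by blast
next
  case (const c) then show ?case using polydeg_const by blast
next
  case (add f g)
  then obtain n m where "polydeg n f" "polydeg m g" by blast
  then have "polydeg (max n m) (\<lambda>x. f x + g x)" by (intro polydeg_add) (auto intro: polydeg_mono)
  then show ?case by blast
next
  case (mult f g) then show ?case using polydeg_mult by blast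
qed

abbreviation eigval :: "nat \<Rightarrow> real" where "eigval l \<equiv> real l * (real l + 1)"

lemma polydeg_lap_step:
  assumes "polydeg (Suc n) f"
  shows "\<exists>g. polydeg n g \<and> (\<forall>x\<in>S2. - lap f x - eigval (Suc n) * f x = g x)"
  using assms
proof (induction rule: polydeg.induct)
  case (polydeg_monom3 a b c k)
  define m where "m = a + b + c"
  \<comment> \<open>In degree \<open>Suc n\<close> the last coefficient vanishes; in lower degree
    that monomial is itself admissible. The other three terms have lost two degrees or have
    coefficient \<open>0\<close>.\<close>
  define g where "g = (\<lambda>x. (- k * real a * real (a - 1)) * monom3 (a - 2) b c x + (- k * real b
      * real (b - 1)) * monom3 a (b - 2) c x
     + (- k * real c * real (c - 1)) * monom3 a b (c - 2) x + (k * (eigval m - eigval (Suc n)))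
         * monom3 a b c x)"
  have z: "polydeg n (\<lambda>x. 0 * h x)" for h :: "real^3 \<Rightarrow> real" using polydeg_const[of n 0] by simp
  have "polydeg n (\<lambda>x. (- k * real a * real (a - 1)) * monom3 (a - 2) b c x)"
  proof (cases "a \<le> 1")
    case True then have "- k * real a * real (a - 1) = 0" by auto
    then show ?thesis using z by (simp only:)
  next
    case False then show ?thesis using polydeg_monom3 by (intro polydeg.polydeg_monom3) auto
  qed
  moreover have "polydeg n (\<lambda>x. (- k * real b * real (b - 1)) * monom3 a (b - 2) c x)"
  proof (cases "b \<le> 1")
    case True then have "- k * real b * real (b - 1) = 0" by auto
    then show ?thesis using z by (simp only:)
  next
    case False then show ?thesis using polydeg_monom3 by (intro polydeg.polydeg_monom3) auto
  qed
  moreover have "polydeg n (\<lambda>x. (- k * real c * real (c - 1)) * monom3 a b (c - 2) x)"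
  proof (cases "c \<le> 1")
    case True then have "- k * real c * real (c - 1) = 0" by auto
    then show ?thesis using z by (simp only:)
  next
    case False then show ?thesis using polydeg_monom3 by (intro polydeg.polydeg_monom3) auto
  qed
  moreover have "polydeg n (\<lambda>x. (k * (eigval m - eigval (Suc n))) * monom3 a b c x)"
  proof (cases "m = Suc n")
    case True then have "k * (eigval m - eigval (Suc n)) = 0" by simp
    then show ?thesis using z by (simp only:)
  next
    case False then show ?thesis using polydeg_monom3
        by (intro polydeg.polydeg_monom3) (auto simp: m_def)
  qed
  ultimately have "polydeg n g" unfolding g_def by (intro polydeg_add)
  moreover have "- lap (\<lambda>x. k * monom3 a b c x) x - eigval (Suc n) * (k * monom3 a b c x) = g x"
      if "x \<in> S2" for x
    using lap_cmult[OF smooth_near_C2(1)[OF smooth_near_monom3] UNIV_I, of k a b c x] lap_monom3[OF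
        that, of a b c]
    by (simp add: g_def m_def algebra_simps del: of_nat_Suc of_nat_add)
  ultimately show ?case by blast
next
  case (polydeg_add f1 f2)
  then obtain g1 g2 where g: "polydeg n g1" "polydeg n g2"
    "\<forall>x\<in>S2. - lap f1 x - eigval (Suc n) * f1 x = g1 x"
        "\<forall>x\<in>S2. - lap f2 x - eigval (Suc n) * f2 x = g2 x" by blast
  have "- lap (\<lambda>x. f1 x + f2 x) x - eigval (Suc n) * (f1 x + f2 x) = g1 x + g2 x" if "x \<in> S2" for x
    using lap_add[OF polydeg_C2[OF polydeg_add(1)] polydeg_C2[OF polydeg_add(2)] UNIV_I, of x]
        g(3,4) that
    by (simp add: algebra_simps)
  then show ?case using polydeg.polydeg_add[OF g(1,2)] by blast
qed

lemma polydeg_0_const: "polydeg 0 f \<Longrightarrow> \<exists>c. \<forall>x. f x = c"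
  by (induction rule: polydeg.induct) (auto simp: monom3_def)

lemma lap_const: "lap (\<lambda>x. c) x = 0"
proof -
  have r: "rotderiv a (\<lambda>x. c) = (\<lambda>x. 0)" for a c by (rule ext) (simp add: rotderiv_def)
  show ?thesis by (simp add: lap_def r)
qed

lemma lap_sum:
  assumes "finite I" "\<And>i. i \<in> I \<Longrightarrow> polydeg n (f i)"
  shows "lap (\<lambda>x. \<Sum>i\<in>I. f i x) x = (\<Sum>i\<in>I. lap (f i) x)"
  using assms
proof (induction rule: finite_induct)
  case (insert i I)
  then have "lap (\<lambda>x. f i x + (\<Sum>i\<in>I. f i x)) x = lap (f i) x + lap (\<lambda>x. \<Sum>i\<in>I. f i x) x"
    by (intro lap_add[OF polydeg_C2 polydeg_C2 UNIV_I] polydeg_sum) auto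
  then show ?case using insert by simp
qed (simp add: lap_const)

lemma eigval_strict: "l < m \<Longrightarrow> eigval l < eigval m"
  by (intro mult_strict_mono) auto

text \<open>\<open>- \<Delta> - n (n + 1)\<close> maps polynomials of degree \<open>n\<close> to polynomials of smaller degree, so the
  components of lower degree can be solved for.\<close>

lemma eigen_decomposition:
  "polydeg n f \<Longrightarrow> \<exists>F. (\<forall>l\<le>n. polydeg l (F l) \<and> (\<forall>x\<in>S2. lap (F l) x = - eigval l * F l x))
      \<and> (\<forall>x\<in>S2. f x = (\<Sum>l\<le>n. F l x))"
proof (induction n arbitrary: f)
  case 0
  then obtain c where "f = (\<lambda>x. c)" using polydeg_0_const by (metis ext)
  then have "(\<forall>x\<in>S2. lap f x = - eigval 0 * f x)" by (simp add: lap_const)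
  then show ?case using 0 by (intro exI[of _ "\<lambda>_. f"]) auto
next
  case (Suc n)
  obtain g where g: "polydeg n g" "\<And>x. x \<in> S2 \<Longrightarrow> - lap f x - eigval (Suc n) * f x = g x"
    using polydeg_lap_step[OF Suc.prems] by blast
  obtain G where G: "\<And>l. l \<le> n \<Longrightarrow> polydeg l (G l)"
      "\<And>l x. l \<le> n \<Longrightarrow> x \<in> S2 \<Longrightarrow> lap (G l) x = - eigval l * G l x"
    "\<And>x. x \<in> S2 \<Longrightarrow> g x = (\<Sum>l\<le>n. G l x)" using Suc.IH[OF g(1)] by blast
  \<comment> \<open>With this factor, \<open>- lap - eigval (Suc n)\<close> maps \<open>H l\<close>
    to \<open>G l\<close>. Subtracting all \<open>H l\<close> from \<open>f\<close> then leaves a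
    function annihilated by that operator, the component of top degree.\<close>
  define k where "k l = 1 / (eigval l - eigval (Suc n))" for l
  define H where "H l x = k l * G l x" for l x
  have ne: "eigval l - eigval (Suc n) \<noteq> 0" if "l \<le> n" for l using eigval_strict[of l "Suc n"] that
      by linarith
  have H: "polydeg l (H l)" "\<And>x. x \<in> S2 \<Longrightarrow> lap (H l) x = - eigval l * H l x" if "l \<le> n" for l
  proof -
    show "polydeg l (H l)" unfolding H_def[abs_def] by (intro polydeg_cmult G that)
    show "lap (H l) x = - eigval l * H l x" if "x \<in> S2" for x
      unfolding H_def[abs_def] using lap_cmult[OF polydeg_C2[OF G(1)[OF \<open>l
          \<le> n\<close>]] UNIV_I, of "k l" x] G(2)[OF \<open>l \<le> n\<close> that]
      by simp
  qed
  define S where "S = (\<lambda>x. \<Sum>l\<le>n. H l x)"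
  have HS: "polydeg n (H l)" if "l \<le> n" for l using H(1)[OF that] that by (rule polydeg_mono)
  have pS: "polydeg n S" unfolding S_def by (intro polydeg_sum HS) auto
  define T where "T = (\<lambda>x. f x + (-1) * S x)"
  have pS': "polydeg (Suc n) (\<lambda>x. (-1) * S x)" by (intro polydeg_cmult polydeg_mono[OF pS]) auto
  have pT: "polydeg (Suc n) T" unfolding T_def by (intro polydeg_add Suc.prems pS')
  have lT: "lap T x = - eigval (Suc n) * T x" if x: "x \<in> S2" for x
  proof -
    have "lap T x = lap f x - lap S x"
      unfolding T_def using lap_add[OF polydeg_C2[OF Suc.prems] polydeg_C2[OF pS'] UNIV_I, of x]
          lap_cmult[OF polydeg_C2[OF pS] UNIV_I, of "-1" x] by simp
    also have "lap S x = (\<Sum>l\<le>n. - eigval l * H l x)"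
    proof -
      have "lap S x = (\<Sum>l\<le>n. lap (H l) x)" unfolding S_def by (rule lap_sum) (auto intro: HS)
      then show ?thesis using H(2)[OF _ x] by simp
    qed
    also have "\<dots> = - (\<Sum>l\<le>n. eigval l * H l x)" by (simp only: mult_minus_left sum_negf)
    also have "lap f x = - eigval (Suc n) * f x - g x" using g(2)[OF x] by simp
    also have "g x = (\<Sum>l\<le>n. (eigval l - eigval (Suc n)) * H l x)"
      unfolding G(3)[OF x] H_def k_def using ne by (intro sum.cong refl) auto
    also have "\<dots> = (\<Sum>l\<le>n. eigval l * H l x) - eigval (Suc n) * S x"
      by (simp only: S_def left_diff_distrib sum_subtractf sum_distrib_left)
    finally show ?thesis by (simp add: T_def algebra_simps del: of_nat_Suc)
  qed
  define F where "F l = (if l \<le> n then H l else T)" for l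
  show ?case
  proof (intro exI[of _ F] conjI allI impI ballI)
    fix l assume l: "l \<le> Suc n"
    show "polydeg l (F l)" using l H(1)[of l] pT by (auto simp: F_def le_Suc_eq)
    show "lap (F l) x = - eigval l * F l x" if "x \<in> S2" for x
    proof (cases "l \<le> n")
      case True then show ?thesis using H(2)[OF True that] by (simp add: F_def)
    next
      case False then have "l = Suc n" using l by simp
      then show ?thesis using lT[OF that] by (simp add: F_def)
    qed
  next
    fix x
    show "f x = (\<Sum>l\<le>Suc n. F l x)" by (simp add: F_def T_def S_def)
  qed
qed

section \<open>First moments and the spectral inequality\<close>

text \<open>Records the projection onto the first harmonics \<open>v \<bullet> x\<close>: the
  coefficient \<open>v\<close> of the projection is \<open>3 / total_area\<close> times this
  vector.\<close>

definition moment :: "(real^3 \<Rightarrow> real) \<Rightarrow> real^3" where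
  "moment f = (LINT x|area. f x *\<^sub>R x)"

lemma moment_inner:
  assumes "continuous_on S2 f"
  shows "moment f \<bullet> v = (LINT x|area. f x * (v \<bullet> x))"
proof -
  have "integrable area (\<lambda>x. f x *\<^sub>R x)" by (intro integrable_area_continuous continuous_intros
      assms)
  then have "moment f \<bullet> v = (LINT x|area. (f x *\<^sub>R x) \<bullet> v)"
    unfolding moment_def by (intro integral_inner_left[symmetric]) auto
  then show ?thesis by (simp add: inner_commute)
qed

text \<open>For a unit vector \<open>u\<close> the Laplacian of
  \<open>(u \<bullet> x)\<^sup>2\<close> is \<open>2 - 6 * (u \<bullet> x)\<^sup>2\<close>; its
  vanishing integral gives the value.\<close>

lemma LINT_inner_sq:
  "(LINT x|area. (v \<bullet> x)\<^sup>2) = (v \<bullet> v) * total_area / 3"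
proof (cases "v = 0")
  case False
  define u where "u = (1 / norm v) *\<^sub>R v"
  have u: "u \<in> S2" using False by (simp add: u_def)
  have d1: "((\<lambda>s::real. s\<^sup>2) has_real_derivative 2 * s) (at s)" for s
      by (auto intro!: derivative_eq_intros)
  have d2: "((\<lambda>s::real. 2 * s) has_real_derivative 2) (at s)" for s
      by (auto intro!: derivative_eq_intros)
  note z = zonal[where c = 2, OF d1 d2 continuous_on_const _ u, simplified]
  have "0 = (LINT x|area. lap (\<lambda>y. (u \<bullet> y)\<^sup>2) x)" using LINT_lap[OF z(1)] by simp
  also have "\<dots> = (LINT x|area. 2 - 6 * (u \<bullet> x)\<^sup>2)"
    by (intro LINT_cong refl) (simp add: z(2), simp add: power2_eq_square algebra_simps)
  also have "\<dots> = 2 * total_area - 6 * (LINT x|area. (u \<bullet> x)\<^sup>2)"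
    by (subst LINT_diff) (auto intro!: integrable_area_continuous continuous_intros)
  finally have 1: "(LINT x|area. (u \<bullet> x)\<^sup>2) = total_area / 3" by simp
  have "(v \<bullet> x)\<^sup>2 = (v \<bullet> v) * (u \<bullet> x)\<^sup>2" for x
    using False by (simp add: u_def power_divide power2_norm_eq_inner)
  then have "(LINT x|area. (v \<bullet> x)\<^sup>2) = (v \<bullet> v) * (LINT x|area. (u \<bullet> x)\<^sup>2)" by simp
  then show ?thesis using 1 by simp
qed simp

lemma LINT_linear: "(LINT x|area. v \<bullet> x) = 0"
proof (cases "v = 0")
  case False
  define u where "u = (1 / norm v) *\<^sub>R v"
  have u: "u \<in> S2" using False by (simp add: u_def)
  have d1: "((\<lambda>s::real. s) has_real_derivative 1) (at s)" for s
      by (auto intro!: derivative_eq_intros)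
  have d2: "((\<lambda>s::real. 1) has_real_derivative 0) (at s)" for s
      by (auto intro!: derivative_eq_intros)
  note z = zonal[where c = 2, OF d1 d2 continuous_on_const _ u, simplified]
  have "0 = (LINT x|area. lap (\<lambda>y. u \<bullet> y) x)" using LINT_lap[OF z(1)] by simp
  also have "\<dots> = (LINT x|area. - 2 * (u \<bullet> x))"
    by (intro LINT_cong refl) (simp add: z(2))
  finally have 1: "(LINT x|area. u \<bullet> x) = 0" by simp
  have "v \<bullet> x = norm v * (u \<bullet> x)" for x using False by (simp add: u_def)
  then show ?thesis using 1 by simp
qed simp

lemma polydeg_1_affine: "polydeg 1 f \<Longrightarrow> \<exists>c v. \<forall>x. f x = c + v \<bullet> x"
proof (induction rule: polydeg.induct)
  case (polydeg_monom3 a b c k)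
  then consider "a = 0 \<and> b = 0 \<and> c = 0" | "a = 1 \<and> b = 0 \<and> c = 0" | "a = 0 \<and> b = 1 \<and> c = 0" | "a = 0
      \<and> b = 0 \<and> c = 1" by linarith
  then show ?case
  proof cases
    case 1 then show ?thesis by (intro exI[of _ k] exI[of _ 0]) (simp add: monom3_def)
  next
    case 2 then show ?thesis by (intro exI[of _ 0] exI[of _ "k *\<^sub>R axis 1 1"]) (simp add: monom3_def
        inner_axis')
  next
    case 3 then show ?thesis by (intro exI[of _ 0] exI[of _ "k *\<^sub>R axis 2 1"]) (simp add: monom3_def
        inner_axis')
  next
    case 4 then show ?thesis by (intro exI[of _ 0] exI[of _ "k *\<^sub>R axis 3 1"]) (simp add: monom3_def
        inner_axis')
  qed
next
  case (polydeg_add f g)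
  then obtain c v d w where "\<forall>x. f x = c + v \<bullet> x" "\<forall>x. g x = d + w \<bullet> x" by blast
  then show ?case by (intro exI[of _ "c + d"] exI[of _ "v + w"]) (simp add: inner_add_left)
qed

lemma eigen_orthogonal:
  assumes "C2_near f U" "C2_near g U" "\<And>x. x \<in> S2 \<Longrightarrow> lap f x = - a * f x"
      "\<And>x. x \<in> S2 \<Longrightarrow> lap g x = - b * g x" "a \<noteq> b"
  shows "(LINT x|area. f x * g x) = 0"
proof -
  have "(LINT x|area. g x * (- a * f x)) = (LINT x|area. g x * lap f x)"
    by (intro LINT_cong) (auto simp: assms)
  also have "\<dots> = (LINT x|area. f x * lap g x)" by (rule LINT_green[OF assms(1,2)])
  also have "\<dots> = (LINT x|area. f x * (- b * g x))"
    by (intro LINT_cong) (auto simp: assms)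
  finally have "a * (LINT x|area. f x * g x) = b * (LINT x|area. f x * g x)"
    by (simp add: mult.left_commute mult.commute[of "g _"])
  then show ?thesis using assms(5) by simp
qed

lemma eigen_mean:
  assumes "C2_near f U" "\<And>x. x \<in> S2 \<Longrightarrow> lap f x = - a * f x" "a \<noteq> 0"
  shows "(LINT x|area. f x) = 0"
proof -
  have "(LINT x|area. - a * f x) = (LINT x|area. lap f x)"
    by (intro LINT_cong) (auto simp: assms)
  then show ?thesis using LINT_lap[OF assms(1)] assms(3) by simp
qed

lemma eigen_green:
  assumes "C2_near f U" "\<And>x. x \<in> S2 \<Longrightarrow> lap f x = - a * f x" "a \<noteq> 0" "x \<in> S2"
  shows "green 0 f x = f x / a"
proof -
  have "green 0 (lap f) = green 0 (\<lambda>x. - a * f x)" by (rule green_cong) (simp add: assms)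
  then show ?thesis
    using green_representation[OF assms(1,4)] eigen_mean[OF assms(1-3)] assms(3) green_cmult[of 0
        "-a" f x]
    by (simp add: field_simps)
qed

lemma green_sum:
  assumes "finite I" "\<And>i. i \<in> I \<Longrightarrow> continuous_on S2 (f i)" "x \<in> S2"
  shows "green 0 (\<lambda>x. \<Sum>i\<in>I. f i x) x = (\<Sum>i\<in>I. green 0 (f i) x)"
  using assms(1,2)
proof (induction rule: finite_induct)
  case empty then show ?case by (simp add: green_def)
next
  case (insert i I)
  obtain A where A: "bmeas A (f i)" using continuous_bmeas insert by blast
  have "continuous_on S2 (\<lambda>x. \<Sum>i\<in>I. f i x)" using insert by (intro continuous_on_sum) auto
  then obtain B where B: "bmeas B (\<lambda>x. \<Sum>i\<in>I. f i x)" using continuous_bmeas by blast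
  have "green 0 (\<lambda>x. f i x + (\<Sum>i\<in>I. f i x)) x = green 0 (f i) x + green 0 (\<lambda>x. \<Sum>i\<in>I. f i x) x"
    by (rule green_add[OF A B assms(3)])
  then show ?case using insert by simp
qed

text \<open>On an eigenfunction of degree \<open>l \<ge> 1\<close>, \<open>green 0\<close> is
  division by \<open>eigval l\<close>, which is at least \<open>6\<close> from degree two on. The
  excess over \<open>1/6\<close> in degree one is charged to the moment and the whole of degree zero
  to the integral of \<open>f\<close>; the constants there are crude, as both quantities will tend
  to \<open>0\<close>.\<close>

lemma spectral_polynomial:
  assumes "polydeg n f"
  shows "(LINT x|area. f x * green 0 f x)
      \<le> (1/6) * (LINT x|area. (f x)\<^sup>2) + (30 / total_area) * (LINT x|area. f x)\<^sup>2
    + (2 / total_area) * (norm (moment f))\<^sup>2"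
proof -
  \<comment> \<open>The degree is raised by two so that components of degree \<open>0\<close> and
    \<open>1\<close> exist even when \<open>f\<close> is constant.\<close>
  have pf: "polydeg (Suc (Suc n)) f" using polydeg_mono[OF assms] by simp
  define N where "N = Suc (Suc n)"
  obtain F where F: "\<And>l. l \<le> N \<Longrightarrow> polydeg l (F l)"
      "\<And>l x. l \<le> N \<Longrightarrow> x \<in> S2 \<Longrightarrow> lap (F l) x = - eigval l * F l x"
    and fF: "\<And>x. x \<in> S2 \<Longrightarrow> f x = (\<Sum>l\<le>N. F l x)"
    using eigen_decomposition[OF pf] unfolding N_def by blast
  have C2: "C2_near (F l) UNIV" if "l \<le> N" for l using polydeg_C2[OF F(1)[OF that]] .
  have cF: "continuous_on S2 (F l)" if "l \<le> N" for l using polydeg_continuous[OF F(1)[OF that]] .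
  have cf: "continuous_on S2 f" using polydeg_continuous[OF assms] .
  have orth: "(LINT x|area. F l x * F m x) = 0" if "l \<le> N" "m \<le> N" "l \<noteq> m" for l m
    using eigval_strict[of l m] eigval_strict[of m l] that
    by (intro eigen_orthogonal[OF C2[OF that(1)] C2[OF that(2)] F(2)[OF that(1)] F(2)[OF that(2)]])
        (auto simp: neq_iff)
  define q where "q l = (LINT x|area. (F l x)\<^sup>2)" for l
  have q0: "0 \<le> q l" for l unfolding q_def by (rule integral_nonneg_AE) auto
  have fFl: "(LINT x|area. F l x * f x) = q l" if l: "l \<le> N" for l
  proof -
    have "(LINT x|area. F l x * f x) = (LINT x|area. (\<Sum>m\<le>N. F l x * F m x))"
      by (intro LINT_cong) (auto simp: fF sum_distrib_left)
    also have "\<dots> = (\<Sum>m\<le>N. LINT x|area. F l x * F m x)"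
      by (intro LINT_sum integrable_area_continuous continuous_intros cF l) auto
    also have "\<dots> = (\<Sum>m\<le>N. if m = l then q l else 0)"
      using orth[OF l] by (intro sum.cong refl) (auto simp: q_def power2_eq_square)
    finally show ?thesis using l by simp
  qed
  have ff: "(LINT x|area. (f x)\<^sup>2) = (\<Sum>l\<le>N. q l)"
  proof -
    have "(LINT x|area. (f x)\<^sup>2) = (LINT x|area. (\<Sum>l\<le>N. F l x * f x))"
      by (intro LINT_cong refl) (simp add: fF sum_distrib_right[symmetric] power2_eq_square)
    also have "\<dots> = (\<Sum>l\<le>N. LINT x|area. F l x * f x)"
      by (intro LINT_sum integrable_area_continuous continuous_intros cF cf) auto
    finally show ?thesis using fFl by simp
  qed
  obtain c where c: "\<And>x. F 0 x = c" using polydeg_0_const[OF F(1)[of 0]] by auto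
  have KF: "green 0 (F l) x = F l x / eigval l" if "1 \<le> l" "l \<le> N" "x \<in> S2" for l x
    using that by (intro eigen_green[OF C2[OF that(2)] F(2)[OF that(2)]]) auto
  have mF: "(LINT x|area. F l x) = 0" if "1 \<le> l" "l \<le> N" for l
    using that by (intro eigen_mean[OF C2[OF that(2)] F(2)[OF that(2)]]) auto
  have int_f: "(LINT x|area. f x) = c * total_area"
  proof -
    have "(LINT x|area. f x) = (LINT x|area. (\<Sum>l\<le>N. F l x))"
      by (intro LINT_cong) (auto simp: fF)
    also have "\<dots> = (\<Sum>l\<le>N. LINT x|area. F l x)"
      by (intro LINT_sum integrable_area_continuous cF) auto
    also have "\<dots> = (\<Sum>l\<le>N. if l = 0 then c * total_area else 0)"
      using mF by (intro sum.cong refl) (auto simp: c)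
    finally show ?thesis by simp
  qed
  obtain B0 where B0: "bmeas B0 (F 0)" using continuous_bmeas[OF cF[of 0]] by auto
  obtain Bf where Bf: "bmeas Bf f" using continuous_bmeas[OF cf] by auto
  have cK: "continuous_on S2 (green 0 (F l))" if l: "l \<le> N" for l
    using continuous_bmeas[OF cF[OF l]] continuous_on_green by metis
  have Kf: "green 0 f x = (\<Sum>l\<le>N. green 0 (F l) x)" if x: "x \<in> S2" for x
  proof -
    have "green 0 f = green 0 (\<lambda>x. \<Sum>l\<le>N. F l x)" by (rule green_cong) (rule fF)
    then show ?thesis using green_sum[of "{..N}" F x] cF x by simp
  qed
  have Kint: "(LINT x|area. f x * green 0 (F l) x) = q l / eigval l" if "1 \<le> l" "l \<le> N" for l
  proof -
    have "(LINT x|area. f x * green 0 (F l) x) = (LINT x|area. (1 / eigval l) * (F l x * f x))"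
      by (intro LINT_cong) (auto simp: KF[OF that])
    then show ?thesis using fFl[OF that(2)] by simp
  qed
  \<comment> \<open>The logarithmic kernel is not normalised to have zero mean, so
    \<open>green 0\<close> does not annihilate constants; the general bound \<open>30\<close> for
    the operator is used instead.\<close>
  have K0: "(LINT x|area. f x * green 0 (F 0) x) \<le> 30 * c\<^sup>2 * total_area"
  proof -
    have "(LINT x|area. f x * green 0 (F 0) x) = (LINT x|area. F 0 x * green 0 f x)"
        by (rule green_sym[OF B0 Bf])
    also have "\<dots> = (LINT x|area. (\<Sum>l\<le>N. F 0 x * green 0 (F l) x))"
      by (intro LINT_cong) (auto simp: Kf sum_distrib_left)
    also have "\<dots> = (\<Sum>l\<le>N. LINT x|area. F 0 x * green 0 (F l) x)"
      by (intro LINT_sum integrable_area_continuous continuous_intros cF cK) auto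
    also have "\<dots> = (\<Sum>l\<le>N. if l = 0 then LINT x|area. F 0 x * green 0 (F 0) x else 0)"
    proof (intro sum.cong refl)
      fix l assume "l \<in> {..N}"
      then have l: "l \<le> N" by simp
      have "(LINT x|area. F 0 x * green 0 (F l) x) = 0" if "l \<noteq> 0"
      proof -
        have "(LINT x|area. F 0 x * green 0 (F l) x)
            = (LINT x|area. (1 / eigval l) * (F 0 x * F l x))"
          using KF[OF _ l] that by (intro LINT_cong) auto
        also have "\<dots> = (1 / eigval l) * (LINT x|area. F 0 x * F l x)"
            by (rule integral_mult_right_zero)
        also have "\<dots> = 0" using orth[of 0 l] l that by simp
        finally show ?thesis .
      qed
      then show "(LINT x|area. F 0 x * green 0 (F l) x) = (if l
          = 0 then LINT x|area. F 0 x * green 0 (F 0) x else 0)" by simp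
    qed
    also have "\<dots> = (LINT x|area. F 0 x * green 0 (F 0) x)" by simp
    also have "\<dots> \<le> (LINT x|area. 30 * c\<^sup>2)"
    proof (intro integral_mono integrable_area_continuous continuous_intros cF cK)
      fix x assume "x \<in> space area"
      then have x: "x \<in> S2" by simp
      have "bmeas \<bar>c\<bar> (F 0)" unfolding bmeas_def using bmeasD(1)[OF B0] by (simp add: c)
      from green_bound[OF order_refl zero_le_one x this] have "\<bar>green 0 (F 0) x\<bar> \<le> 30 * \<bar>c\<bar>" .
      then have "\<bar>c\<bar> * \<bar>green 0 (F 0) x\<bar> \<le> \<bar>c\<bar> * (30 * \<bar>c\<bar>)" by (rule mult_left_mono) simp
      then show "F 0 x * green 0 (F 0) x \<le> 30 * c\<^sup>2"
        by (simp add: c power2_eq_square flip: abs_mult)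
    qed auto
    finally show ?thesis by (simp add: mult_ac)
  qed
  have q1: "q 1 \<le> 3 / total_area * (norm (moment f))\<^sup>2"
  proof -
    obtain k v where kv: "\<And>x. F 1 x = k + v \<bullet> x" using polydeg_1_affine[OF F(1)[of 1]]
        by (auto simp: N_def)
    have "(LINT x|area. F 1 x) = k * total_area"
      unfolding kv by (subst LINT_add)
        (auto intro!: integrable_area_continuous continuous_intros simp: LINT_linear)
    then have k: "k = 0" using mF[of 1] measure_area_pos by (simp add: N_def)
    have e1: "q 1 = (v \<bullet> v) * total_area / 3" unfolding q_def kv k using LINT_inner_sq[of v] by simp
    have e2: "q 1 = moment f \<bullet> v"
      using fFl[of 1] moment_inner[OF cf, of v] unfolding kv k by (simp add: N_def mult.commute)
    also have "\<dots> \<le> norm (moment f) * norm v" by (rule norm_cauchy_schwarz)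
    finally have "norm v * (norm v * total_area / 3) \<le> norm v * norm (moment f)"
      using e1 by (simp add: power2_norm_eq_inner[symmetric] power2_eq_square mult.commute)
    then have v: "norm v * total_area / 3 \<le> norm (moment f)"
      by (cases "norm v = 0") auto
    then have "(norm v * total_area / 3)\<^sup>2 \<le> (norm (moment f))\<^sup>2" by (intro power_mono) auto
    then have "3 / total_area * (norm v * total_area / 3)\<^sup>2 \<le> 3 / total_area * (norm (moment f))\<^sup>2"
        by (intro mult_left_mono) auto
    moreover have "3 / total_area * (norm v * total_area / 3)\<^sup>2 = q 1"
      unfolding e1 power2_norm_eq_inner[symmetric] using measure_area_pos
          by (simp add: power2_eq_square)
    ultimately show ?thesis by simp
  qed
  have "(LINT x|area. f x * green 0 f x) = (LINT x|area. (\<Sum>l\<le>N. f x * green 0 (F l) x))"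
    by (intro LINT_cong) (auto simp: Kf sum_distrib_left)
  also have "\<dots> = (\<Sum>l\<le>N. LINT x|area. f x * green 0 (F l) x)"
    by (intro LINT_sum integrable_area_continuous continuous_intros cf cK) auto
  also have "\<dots> \<le> (\<Sum>l\<le>N. (if l = 0 then 30 * c\<^sup>2 * total_area else 0) + (if l
      = 1 then q 1 / 2 else 0) + q l / 6)"
  proof (rule sum_mono)
    fix l assume "l \<in> {..N}"
    then have l: "l \<le> N" by simp
    consider "l = 0" | "l = 1" | "2 \<le> l" by linarith
    then show "(LINT x|area. f x * green 0 (F l) x) \<le> (if l
        = 0 then 30 * c\<^sup>2 * total_area else 0) + (if l = 1 then q 1 / 2 else 0) + q l / 6"
    proof cases
      case 1 then show ?thesis using K0 q0[of 0] by simp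
    next
      case 2 then show ?thesis using Kint[of 1] q0[of 1] l by simp
    next
      case 3
      have "2 * (2 + 1) \<le> eigval l" using 3 by (intro mult_mono) auto
      then have "q l / eigval l \<le> q l / 6" using q0[of l] by (intro divide_left_mono) auto
      then show ?thesis using Kint[of l] 3 l by simp
    qed
  qed
  also have "\<dots> = 30 * c\<^sup>2 * total_area + q 1 / 2 + (1/6) * (LINT x|area. (f x)\<^sup>2)"
    unfolding ff by (simp add: sum.distrib sum_divide_distrib N_def del: sum.atMost_Suc)
  also have "30 * c\<^sup>2 * total_area = (30 / total_area) * (LINT x|area. f x)\<^sup>2"
    using measure_area_pos by (simp add: int_f power2_eq_square)
  also have "q 1 / 2 \<le> (2 / total_area) * (norm (moment f))\<^sup>2"
  proof -
    define Y where "Y = (norm (moment f))\<^sup>2 / total_area"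
    have "0 \<le> Y" "q 1 \<le> 3 * Y" using q1 by (simp_all add: Y_def)
    then have "q 1 / 2 \<le> 2 * Y" by simp
    then show ?thesis by (simp add: Y_def)
  qed
  finally show ?thesis by simp
qed

lemma uniform_limit_green:
  assumes u: "uniform_limit S2 f h G" and c: "eventually (\<lambda>n. continuous_on S2 (f n)) G"
      "continuous_on S2 h"
  shows "uniform_limit S2 (\<lambda>n. green 0 (f n)) (green 0 h) G"
proof (rule uniform_limitI)
  fix e :: real assume e: "0 < e"
  \<comment> \<open>\<open>31\<close> exceeds the bound \<open>30\<close> of the operator, which
    makes the final inequality strict.\<close>
  have "eventually (\<lambda>n. \<forall>x\<in>S2. dist (f n x) (h x) < e / 31) G"
    using e by (intro uniform_limitD[OF u]) auto
  from eventually_conj[OF this c(1)] show "eventually (\<lambda>n. \<forall>x\<in>S2. dist (green 0 (f n) x) (green 0 h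
      x) < e) G"
  proof eventually_elim
    case (elim n)
    obtain A where A: "bmeas A (f n)" using continuous_bmeas[of "f n"] elim by blast
    obtain B where B: "bmeas B h" using continuous_bmeas[OF c(2)] by blast
    have b: "bmeas (e / 31) (\<lambda>x. f n x - h x)"
      unfolding bmeas_def using elim bmeasD(1)[OF A] bmeasD(1)[OF B]
          by (auto simp: dist_real_def less_imp_le)
    show ?case
    proof
      fix x assume x: "x \<in> S2"
      have "\<bar>green 0 (\<lambda>x. f n x - h x) x\<bar> \<le> 30 * (e / 31)" by (rule green_bound[OF _ _ x b]) auto
      then show "dist (green 0 (f n) x) (green 0 h x) < e"
        using e unfolding green_diff[OF A B x] dist_real_def by linarith
    qed
  qed
qed

lemma bounded_image_S2: "continuous_on S2 f \<Longrightarrow> bounded (f ` S2)"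
    for f :: "real^3 \<Rightarrow> 'b::real_normed_vector"
  by (intro compact_imp_bounded compact_continuous_image) auto

text \<open>All terms are continuous under uniform convergence, and polynomials are uniformly dense
  by Stone-Weierstrass; this stands in for an eigenfunction expansion of \<open>h\<close>.\<close>

theorem spectral_gap:
  assumes h: "continuous_on S2 h"
  shows "(LINT x|area. h x * green 0 h x)
      \<le> (1/6) * (LINT x|area. (h x)\<^sup>2) + (30 / total_area) * (LINT x|area. h x)\<^sup>2
    + (2 / total_area) * (norm (moment h))\<^sup>2"
proof -
  have "\<exists>g. (\<exists>n. polydeg n g) \<and> (\<forall>x\<in>S2. \<bar>h x - g x\<bar> < inverse (real (Suc k)))" for k
    using Stone_Weierstrass_real_polynomial_function[OF _ h, of "inverse (real (Suc k))"]
        real_polynomial_polydeg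
    by (metis compact_sphere inverse_positive_iff_positive of_nat_0_less_iff zero_less_Suc)
  then obtain f where f: "\<And>k. \<exists>n. polydeg n (f k)"
      "\<And>k x. x \<in> S2 \<Longrightarrow> \<bar>h x - f k x\<bar> < inverse (real (Suc k))"
    by metis
  have cf: "continuous_on S2 (f k)" for k using f(1)[of k] polydeg_continuous by blast
  have u: "uniform_limit S2 f h sequentially"
  proof (rule uniform_limitI)
    fix e :: real assume "0 < e"
    then have "eventually (\<lambda>k. inverse (real (Suc k)) < e) sequentially"
      using order_tendstoD(2)[OF LIMSEQ_inverse_real_of_nat] by blast
    then show "eventually (\<lambda>k. \<forall>x\<in>S2. dist (f k x) (h x) < e) sequentially"
    proof eventually_elim
      case (elim k)
      show ?case
      proof
        fix x assume "x \<in> S2"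
        from f(2)[OF this, of k] elim show "dist (f k x) (h x) < e"
            by (simp add: dist_real_def abs_minus_commute)
      qed
    qed
  qed
  obtain B where B: "bmeas B h" using continuous_bmeas[OF h] by blast
  have cK: "continuous_on S2 (green 0 h)" by (rule continuous_on_green[OF B])
  have cKf: "continuous_on S2 (green 0 (f k))" for k
      using continuous_bmeas[OF cf[of k]] continuous_on_green by metis
  note bd = bounded_image_S2
  have uK: "uniform_limit S2 (\<lambda>k. green 0 (f k)) (green 0 h) sequentially"
      by (rule uniform_limit_green[OF u _ h]) (simp add: cf)
  have t1: "(\<lambda>k. LINT x|area. f k x * green 0 (f k) x) \<longlonglongrightarrow> (LINT x|area. h x * green 0 h x)"
    by (rule tendsto_LINT_uniform[OF uniform_lim_mult[OF u uK bd[OF h] bd[OF cK]]])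
       (auto intro!: always_eventually continuous_intros cf cKf)
  have t2: "(\<lambda>k. LINT x|area. (f k x)\<^sup>2) \<longlonglongrightarrow> (LINT x|area. (h x)\<^sup>2)"
    unfolding power2_eq_square by (rule tendsto_LINT_uniform[OF uniform_lim_mult[OF u u bd[OF h]
        bd[OF h]]])
       (auto intro!: always_eventually continuous_intros cf cKf)
  have t3: "(\<lambda>k. LINT x|area. f k x) \<longlonglongrightarrow> (LINT x|area. h x)"
    by (rule tendsto_LINT_uniform[OF u]) (auto intro!: always_eventually cf)
  have t4: "(\<lambda>k. moment (f k)) \<longlonglongrightarrow> moment h"
  proof (rule vec_tendstoI)
    fix i :: 3
    have mi: "moment g $ i = (LINT x|area. g x * x $ i)" if "continuous_on S2 g" for g
      using moment_inner[OF that, of "axis i 1"] by (simp add: inner_axis inner_axis')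
    have ci: "continuous_on S2 (\<lambda>x. x $ i)" by (intro continuous_intros)
    have "(\<lambda>k. LINT x|area. f k x * x $ i) \<longlonglongrightarrow> (LINT x|area. h x * x $ i)"
      by (rule tendsto_LINT_uniform[OF uniform_lim_mult[OF u uniform_limit_const bd[OF h] bd[OF
          ci]]])
         (auto intro!: always_eventually continuous_intros cf)
    then show "(\<lambda>k. moment (f k) $ i) \<longlonglongrightarrow> moment h $ i" by (simp add: mi cf h)
  qed
  show ?thesis
  proof (rule LIMSEQ_le[OF t1])
    show "(\<lambda>k. (1/6) * (LINT x|area. (f k x)\<^sup>2) + (30 / total_area) * (LINT x|area. f k x)\<^sup>2
        + (2 / total_area) * (norm (moment (f k)))\<^sup>2)
      \<longlonglongrightarrow> (1/6) * (LINT x|area. (h x)\<^sup>2) + (30 / total_area) * (LINT x|area. h x)\<^sup>2 + (2 / total_area)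
          * (norm (moment h))\<^sup>2"
      by (intro tendsto_intros t2 t3 t4)
    show "\<exists>N. \<forall>k\<ge>N. (LINT x|area. f k x * green 0 (f k) x)
        \<le> (1/6) * (LINT x|area. (f k x)\<^sup>2) + (30 / total_area) * (LINT x|area. f k x)\<^sup>2
        + (2 / total_area) * (norm (moment (f k)))\<^sup>2"
      using f(1) spectral_polynomial by blast
  qed
qed

section \<open>Conserved quantities\<close>

abbreviation north :: "real^3" where "north \<equiv> axis 3 1"

text \<open>The rotated gradient of \<open>stream\<close>. Expressing it through \<open>vel\<close>
  gives it a meaning at \<open>e = 0\<close> without a gradient of the potential in space.\<close>

definition absvel :: "real \<Rightarrow> real \<Rightarrow> (real^3 \<Rightarrow> real) \<Rightarrow> real^3 \<Rightarrow> real^3" where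
  "absvel \<omega> e f x = \<omega> *\<^sub>R cross3 x north - vel e f x"

definition stream :: "real \<Rightarrow> real \<Rightarrow> (real^3 \<Rightarrow> real) \<Rightarrow> real^3 \<Rightarrow> real" where
  "stream \<omega> e f x = \<omega> * (north \<bullet> x) - green e f x"

lemma stream_C1:
  assumes "0 < e" "bmeas B f"
  shows "C1_on (stream \<omega> e f) (ball 0 (1 + e/2))"
  unfolding stream_def[abs_def] by (intro C1_diff C1_cmult C1_linear green_C1[OF assms])

lemma cross_grad_stream:
  assumes "0 < e" "bmeas B f" "x \<in> ball 0 (1 + e/2)"
  shows "cross3 x (grad (stream \<omega> e f) x) = absvel \<omega> e f x"
proof -
  have "grad (stream \<omega> e f) x = \<omega> *\<^sub>R north - green_grad e f x"
    unfolding stream_def[abs_def]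
    by (rule grad_eqI) (auto intro!: derivative_eq_intros green_has_derivative assms simp:
        inner_diff_left)
  then show ?thesis
    using cross_green_grad[OF assms] by (simp add: absvel_def cross_mult_right
        Cross3.right_diff_distrib)
qed

lemma rotderiv_stream:
  assumes "0 < e" "bmeas B f" "x \<in> ball 0 (1 + e/2)"
  shows "rotderiv a (stream \<omega> e f) x = absvel \<omega> e f x \<bullet> a"
  using C1_rotderiv[OF stream_C1[OF assms(1,2)] assms(3), of a \<omega>] cross_grad_stream[OF assms, of \<omega>]
  by (metis cross_triple inner_commute)

lemma LINT_cross_grad:
  assumes b: "C1_on b U" "open U" "S2 \<subseteq> U"
  shows "(LINT x|area. cross3 x a \<bullet> grad b x) = 0"
proof -
  have "(LINT x|area. cross3 x a \<bullet> grad b x) = (LINT x|area. - rotderiv a b x)"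
  proof (intro LINT_cong refl)
    fix x assume "x \<in> space area"
    then have "x \<in> U" using b by auto
    then show "cross3 x a \<bullet> grad b x = - rotderiv a b x"
      using C1_rotderiv[OF b(1)] by (simp add: cross_triple')
  qed
  then show ?thesis using LINT_rotderiv[OF b] by simp
qed

lemma continuous_on_absvel_pos: "0 < e \<Longrightarrow> bmeas B f \<Longrightarrow> continuous_on S2 (absvel \<omega> e f)"
  unfolding absvel_def[abs_def] by (intro continuous_intros continuous_on_vel_pos)

lemma continuous_on_absvel: "bmeas B f \<Longrightarrow> continuous_on S2 (absvel \<omega> 0 f)"
  unfolding absvel_def[abs_def] by (intro continuous_intros continuous_on_vel)

lemma continuous_on_stream_pos: "0 < e \<Longrightarrow> bmeas B f \<Longrightarrow> continuous_on S2 (stream \<omega> e f)"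
  unfolding stream_def[abs_def] by (intro continuous_intros continuous_on_green_pos)

lemma continuous_on_stream: "bmeas B f \<Longrightarrow> continuous_on S2 (stream \<omega> 0 f)"
  unfolding stream_def[abs_def] by (intro continuous_intros continuous_on_green)

lemma uniform_stream: "bmeas B f \<Longrightarrow> uniform_limit S2 (\<lambda>e. stream \<omega> e f) (stream \<omega> 0 f) (at_right 0)"
  by (rule uniform_limit_quarter[of _ _ "60 * B"])
     (use green_diff_bound in \<open>force simp: stream_def abs_minus_commute\<close>)

lemma uniform_absvel_inner:
  assumes f: "bmeas B f" and w: "continuous_on S2 w"
  shows "uniform_limit S2 (\<lambda>e x. absvel \<omega> e f x \<bullet> w x) (\<lambda>x. absvel \<omega> 0 f x \<bullet> w x) (at_right 0)"
  using uniform_vel_inner[OF f w] unfolding uniform_limit_iff absvel_def inner_diff_left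
  by (simp add: dist_real_def abs_minus_commute)

lemma LINT_absvel_grad_pos:
  assumes e: "0 < e" and f: "bmeas B f" and b: "C1_on b U" "open U" "S2 \<subseteq> U"
  shows "(LINT x|area. absvel \<omega> e f x \<bullet> grad b x) = 0"
proof -
  have cg: "continuous_on S2 (grad b)" by (rule continuous_on_subset[OF C1_continuous_grad[OF b(1)]
      b(3)])
  have "(LINT x|area. absvel \<omega> e f x \<bullet> grad b x)
      = (LINT x|area. \<omega> * (cross3 x north \<bullet> grad b x) - vel e f x \<bullet> grad b x)"
    by (simp add: absvel_def inner_diff_left)
  also have "\<dots> = \<omega> * (LINT x|area. cross3 x north \<bullet> grad b x) - (LINT x|area. vel e f x \<bullet> grad b x)"
    by (subst LINT_diff)
       (auto intro!: integrable_area_continuous continuous_intros cg continuous_on_vel_pos[OF e f])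
  finally show ?thesis using LINT_cross_grad[OF b] LINT_vel_grad_pos[OF e f b] by simp
qed

lemma LINT_absvel_grad:
  assumes f: "bmeas B f" and b: "C1_on b U" "open U" "S2 \<subseteq> U"
  shows "(LINT x|area. absvel \<omega> 0 f x \<bullet> grad b x) = 0"
proof -
  have cg: "continuous_on S2 (grad b)" by (rule continuous_on_subset[OF C1_continuous_grad[OF b(1)]
      b(3)])
  have "(LINT x|area. absvel \<omega> 0 f x \<bullet> grad b x)
      = (LINT x|area. \<omega> * (cross3 x north \<bullet> grad b x) - vel 0 f x \<bullet> grad b x)"
    by (simp add: absvel_def inner_diff_left)
  also have "\<dots> = \<omega> * (LINT x|area. cross3 x north \<bullet> grad b x) - (LINT x|area. vel 0 f x \<bullet> grad b x)"
    by (subst LINT_diff)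
       (auto intro!: integrable_area_continuous continuous_intros cg continuous_on_vel[OF f])
  finally show ?thesis using LINT_cross_grad[OF b] LINT_vel_grad[OF f b] by simp
qed

lemma eventually_continuous_stream: "bmeas B f
    \<Longrightarrow> eventually (\<lambda>e. continuous_on S2 (stream \<omega> e f)) (at_right 0)"
  by (auto intro: eventually_mono[OF eventually_at_right_pos] continuous_on_stream_pos)

lemma eventually_continuous_absvel: "bmeas B f
    \<Longrightarrow> eventually (\<lambda>e. continuous_on S2 (absvel \<omega> e f)) (at_right 0)"
  by (auto intro: eventually_mono[OF eventually_at_right_pos] continuous_on_absvel_pos)

text \<open>As \<open>absvel\<close> is orthogonal to the gradient of \<open>stream\<close>, the
  factor \<open>stream\<close> can be moved under the gradient, and incompressibility applies to the
  product with \<open>b\<close>. The product rule is used for \<open>e > 0\<close>, where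
  \<open>stream\<close> is differentiable near the sphere. With \<open>b\<close> the vorticity, this
  is conservation of energy.\<close>

lemma LINT_stream_absvel_grad:
  assumes f: "bmeas B f" and b: "C1_on b U" "open U" "S2 \<subseteq> U"
  shows "(LINT x|area. stream \<omega> 0 f x * (absvel \<omega> 0 f x \<bullet> grad b x)) = 0"
proof -
  have cg: "continuous_on S2 (grad b)" by (rule continuous_on_subset[OF C1_continuous_grad[OF b(1)]
      b(3)])
  have pos: "(LINT x|area. stream \<omega> e f x * (absvel \<omega> e f x \<bullet> grad b x)) = 0" if e: "0 < e" for e
  proof -
    let ?W = "U \<inter> ball 0 (1 + e/2)"
    have W: "open ?W" "S2 \<subseteq> ?W" using b e by auto
    have Ch: "C1_on (stream \<omega> e f) ?W" and Cb: "C1_on b ?W"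
      by (auto intro: C1_subset[OF stream_C1[OF e f]] C1_subset[OF b(1)])
    have "(LINT x|area. stream \<omega> e f x * (absvel \<omega> e f x \<bullet> grad b x))
        = (LINT x|area. absvel \<omega> e f x \<bullet> grad (\<lambda>x. stream \<omega> e f x * b x) x)"
    proof (intro LINT_cong refl)
      fix x assume "x \<in> space area"
      then have x: "x \<in> ?W" using W by auto
      have "absvel \<omega> e f x \<bullet> grad (stream \<omega> e f) x = 0"
        using cross_grad_stream[OF e f, of x \<omega>] x by (metis IntD2 dot_cross_self(3))
      then show "stream \<omega> e f x * (absvel \<omega> e f x \<bullet> grad b x)
          = absvel \<omega> e f x \<bullet> grad (\<lambda>x. stream \<omega> e f x * b x) x"
        by (subst grad_mult[OF C1_differentiable[OF Ch x] C1_differentiable[OF Cb x]]) (simp add: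
            inner_add_right)
    qed
    also have "\<dots> = 0" by (rule LINT_absvel_grad_pos[OF e f C1_mult[OF Ch Cb] W])
    finally show ?thesis .
  qed
  have cU: "continuous_on S2 (\<lambda>x. absvel \<omega> 0 f x \<bullet> grad b x)"
    by (intro continuous_intros continuous_on_absvel[OF f] cg)
  have 1: "((\<lambda>e. LINT x|area. stream \<omega> e f x * (absvel \<omega> e f x \<bullet> grad b x))
      \<longlongrightarrow> (LINT x|area. stream \<omega> 0 f x * (absvel \<omega> 0 f x \<bullet> grad b x))) (at_right 0)"
  proof (rule tendsto_LINT_uniform[OF uniform_lim_mult[OF uniform_stream[OF f]
      uniform_absvel_inner[OF f cg] bounded_image_S2 bounded_image_S2]])
    show "\<forall>\<^sub>F e in at_right 0. continuous_on S2 (\<lambda>b'. stream \<omega> e f b' * (absvel \<omega> e f b'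
        \<bullet> grad b b'))"
      using eventually_continuous_stream[OF f, of \<omega>] eventually_continuous_absvel[OF f, of \<omega>]
          by eventually_elim (intro continuous_intros cg)
  qed (auto intro: continuous_on_stream[OF f] cU)
  have "eventually (\<lambda>e. (LINT x|area. stream \<omega> e f x * (absvel \<omega> e f x \<bullet> grad b x))
      = 0) (at_right 0)"
    using eventually_at_right_pos by eventually_elim (use pos in auto)
  from tendsto_unique[OF _ Lim_transform_eventually[OF 1 this] tendsto_const] show ?thesis by simp
qed

text \<open>Antisymmetry removes the self-induced part; what remains is linear in the moment. It
  will be the right-hand side of the evolution of the moment, an infinitesimal rotation about the
  polar axis.\<close>

lemma LINT_absvel_moment:
  assumes f: "continuous_on S2 f"
  shows "(LINT x|area. f x * (absvel \<omega> 0 f x \<bullet> a)) = \<omega> * (cross3 (moment f) north \<bullet> a)"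
proof -
  obtain B where B: "bmeas B f" using continuous_bmeas[OF f] by blast
  have "(LINT x|area. f x * (absvel \<omega> 0 f x \<bullet> a))
      = (LINT x|area. \<omega> * (f x * (cross3 north a \<bullet> x)) - f x * (vel 0 f x \<bullet> a))"
    by (intro LINT_cong refl)
       (simp add: absvel_def inner_diff_left cross_triple[of _ north a] algebra_simps)
  also have "\<dots> = \<omega> * (LINT x|area. f x * (cross3 north a \<bullet> x)) - (LINT x|area. f x * (vel 0 f x
      \<bullet> a))"
    by (subst LINT_diff)
       (auto intro!: integrable_area_continuous continuous_intros f continuous_on_vel[OF B])
  also have "(LINT x|area. f x * (cross3 north a \<bullet> x)) = moment f \<bullet> cross3 north a"
    by (rule moment_inner[OF f, symmetric])
  also have "moment f \<bullet> cross3 north a = cross3 (moment f) north \<bullet> a"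
    by (metis cross_triple inner_commute)
  finally show ?thesis using LINT_vel_antisym[OF B, of a] by simp
qed

text \<open>For a steady state, \<open>z * (absvel \<bullet> a)\<close> is the limit of rotational
  derivatives of \<open>G\<close> composed with the regularised \<open>stream\<close>, so its
  integral vanishes for every \<open>a\<close>. Hence \<open>\<omega> = 0\<close> or the moment is
  parallel to the axis: it is fixed by the rotation that the moments of solutions undergo.\<close>

lemma steady_moment:
  assumes z: "continuous_on S2 z" and zg: "\<And>x. x \<in> S2 \<Longrightarrow> z x = g (stream \<omega> 0 z x)"
    and G: "\<And>s. (G has_real_derivative g s) (at s)" and L: "\<And>s t. \<bar>g s - g t\<bar> \<le> L * \<bar>s - t\<bar>"
  shows "\<omega> *\<^sub>R cross3 (moment z) north = 0"
proof -
  obtain B where B: "bmeas B z" using continuous_bmeas[OF z] by blast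
  have L0: "0 \<le> L" using L[of 1 0] by auto
  have cg: "continuous_on UNIV g"
    by (rule lipschitz_on_continuous_on[of L], rule lipschitz_onI) (use L L0 in \<open>auto simp:
        dist_real_def\<close>)
  have pos: "(LINT x|area. g (stream \<omega> e z x) * (absvel \<omega> e z x \<bullet> a)) = 0" if e: "0 < e" for e a
  proof -
    have C: "C1_on (\<lambda>x. G (stream \<omega> e z x)) (ball 0 (1 + e/2))"
      by (rule C1_compose_real[OF stream_C1[OF e B] G continuous_on_subset[OF cg]]) auto
    have "(LINT x|area. g (stream \<omega> e z x) * (absvel \<omega> e z x \<bullet> a))
        = (LINT x|area. rotderiv a (\<lambda>x. G (stream \<omega> e z x)) x)"
    proof (intro LINT_cong refl)
      fix x assume "x \<in> space area"
      then have x: "x \<in> ball 0 (1 + e/2)" using e by auto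
      note d = C1_differentiable[OF stream_C1[OF e B, of \<omega>] x]
      show "g (stream \<omega> e z x) * (absvel \<omega> e z x \<bullet> a) = rotderiv a (\<lambda>x. G (stream \<omega> e z x)) x"
        using rotderiv_stream[OF e B x, of a \<omega>]
        by (simp add: C1_rotderiv[OF C x] grad_compose_real[OF d G] rotderiv_eq_grad[OF d])
    qed
    also have "\<dots> = 0" by (rule LINT_rotderiv[OF C]) (use e in auto)
    finally show ?thesis .
  qed
  have ug: "uniform_limit S2 (\<lambda>e x. g (stream \<omega> e z x)) (\<lambda>x. g (stream \<omega> 0 z x)) (at_right 0)"
  proof (rule uniform_limitI)
    fix r :: real assume r: "0 < r"
    have "eventually (\<lambda>e. \<forall>x\<in>S2. dist (stream \<omega> e z x) (stream \<omega> 0 z x) < r / (L + 1)) (at_right 0)"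
      using r L0 by (intro uniform_limitD[OF uniform_stream[OF B]]) auto
    then show "eventually (\<lambda>e. \<forall>x\<in>S2. dist (g (stream \<omega> e z x)) (g (stream \<omega> 0 z x))
        < r) (at_right 0)"
    proof eventually_elim
      case (elim e)
      show ?case
      proof
        fix x assume "x \<in> S2"
        then have "\<bar>stream \<omega> e z x - stream \<omega> 0 z x\<bar> < r / (L + 1)" using elim
            by (auto simp: dist_real_def)
        then have "\<bar>stream \<omega> e z x - stream \<omega> 0 z x\<bar> * (L + 1) < r" using L0
            by (simp add: field_simps)
        moreover have "L * \<bar>stream \<omega> e z x - stream \<omega> 0 z x\<bar>
            \<le> \<bar>stream \<omega> e z x - stream \<omega> 0 z x\<bar> * (L + 1)"
          by (simp add: algebra_simps)
        ultimately show "dist (g (stream \<omega> e z x)) (g (stream \<omega> 0 z x)) < r"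
          using L[of "stream \<omega> e z x" "stream \<omega> 0 z x"] by (simp add: dist_real_def)
      qed
    qed
  qed
  have c0: "continuous_on S2 (\<lambda>x. g (stream \<omega> 0 z x))"
    by (rule continuous_on_compose2[OF cg continuous_on_stream[OF B]]) auto
  have "\<omega> * (cross3 (moment z) north \<bullet> a) = 0" for a
  proof -
    have ca: "continuous_on S2 (\<lambda>x::real^3. a)" by (rule continuous_on_const)
    have 1: "((\<lambda>e. LINT x|area. g (stream \<omega> e z x) * (absvel \<omega> e z x \<bullet> a))
        \<longlongrightarrow> (LINT x|area. g (stream \<omega> 0 z x) * (absvel \<omega> 0 z x \<bullet> a))) (at_right 0)"
    proof (rule tendsto_LINT_uniform[OF uniform_lim_mult[OF ug uniform_absvel_inner[OF B ca]
        bounded_image_S2 bounded_image_S2]])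
      show "\<forall>\<^sub>F e in at_right 0. continuous_on S2 (\<lambda>b. g (stream \<omega> e z b) * (absvel \<omega> e z b \<bullet> a))"
        using eventually_continuous_stream[OF B, of \<omega>] eventually_continuous_absvel[OF B, of \<omega>]
        by eventually_elim (intro continuous_intros continuous_on_compose2[OF cg], auto)
    qed (auto intro!: c0 continuous_intros continuous_on_absvel[OF B])
    have "eventually (\<lambda>e. (LINT x|area. g (stream \<omega> e z x) * (absvel \<omega> e z x \<bullet> a))
        = 0) (at_right 0)"
      using eventually_at_right_pos by eventually_elim (use pos in auto)
    from tendsto_unique[OF _ Lim_transform_eventually[OF 1 this] tendsto_const]
    have "(LINT x|area. g (stream \<omega> 0 z x) * (absvel \<omega> 0 z x \<bullet> a)) = 0" by simp
    moreover have "(LINT x|area. g (stream \<omega> 0 z x) * (absvel \<omega> 0 z x \<bullet> a))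
        = (LINT x|area. z x * (absvel \<omega> 0 z x \<bullet> a))"
      by (intro LINT_cong) (auto simp: zg)
    ultimately show ?thesis using LINT_absvel_moment[OF z, of \<omega> a] by simp
  qed
  from this[of "\<omega> *\<^sub>R cross3 (moment z) north"]
  have "(\<omega> *\<^sub>R cross3 (moment z) north) \<bullet> (\<omega> *\<^sub>R cross3 (moment z) north) = 0" by simp
  then show ?thesis by simp
qed

section \<open>Differentiation in time under the integral\<close>

text \<open>The sphere times \<open>{0..t + 1}\<close> is compact, which makes the modulus of
  continuity in time independent of \<open>x\<close>.\<close>

lemma uniform_continuous_time:
  fixes N :: "(real^3) \<times> real \<Rightarrow> real"
  assumes W: "S2 \<times> {0..} \<subseteq> W" and N: "continuous_on W N" and t: "0 \<le> t" and e: "0 < e"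
  obtains d where "0 < d" "\<And>x s. x \<in> S2 \<Longrightarrow> 0 \<le> s \<Longrightarrow> \<bar>s - t\<bar> < d \<Longrightarrow> \<bar>N (x, s) - N (x, t)\<bar> < e"
proof -
  have "uniformly_continuous_on (S2 \<times> {0..t + 1}) N"
    by (intro compact_uniformly_continuous continuous_on_subset[OF N] compact_Times) (use W in auto)
  then obtain d where d: "0 < d" "\<And>p q. p \<in> S2 \<times> {0..t + 1} \<Longrightarrow> q \<in> S2 \<times> {0..t + 1} \<Longrightarrow> dist q p < d
      \<Longrightarrow> dist (N q) (N p) < e"
    using e unfolding uniformly_continuous_on_def by metis
  show thesis
  proof (rule that[of "min d 1"])
    fix x s assume "x \<in> S2" "0 \<le> s" "\<bar>s - t\<bar> < min d 1"
    then show "\<bar>N (x, s) - N (x, t)\<bar> < e"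
      using d(2)[of "(x, t)" "(x, s)"] t by (auto simp: dist_Pair_Pair dist_real_def)
  qed (use d in auto)
qed

text \<open>\<open>W\<close> is meant to be the domain of a smooth extension: being open, it gives
  two-sided time derivatives even at time \<open>0\<close>, while only the sphere at nonnegative
  times is guaranteed to lie in it.\<close>

definition time_C1 :: "((real^3) \<times> real) set \<Rightarrow> ((real^3) \<times> real \<Rightarrow> real) \<Rightarrow> ((real^3) \<times> real \<Rightarrow> real) \<Rightarrow>
    bool" where
  "time_C1 W N N' \<longleftrightarrow> open W \<and> S2 \<times> {0..} \<subseteq> W \<and> continuous_on W N \<and> continuous_on W N' \<and>
     (\<forall>x t. (x, t) \<in> W \<longrightarrow> ((\<lambda>s. N (x, s)) has_real_derivative N' (x, t)) (at t))"

lemma time_C1_continuous: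
  assumes "time_C1 W N N'" "0 \<le> t"
  shows "continuous_on S2 (\<lambda>x. N (x, t))" "continuous_on S2 (\<lambda>x. N' (x, t))"
proof -
  have s: "(\<lambda>x. (x, t)) ` S2 \<subseteq> W" using assms by (auto simp: time_C1_def)
  show "continuous_on S2 (\<lambda>x. N (x, t))" "continuous_on S2 (\<lambda>x. N' (x, t))"
    using assms by (auto simp: time_C1_def intro!: continuous_on_compose2[OF _ _ s]
        continuous_intros)
qed

lemma time_uniform_limit:
  assumes N: "time_C1 W N N'" and t: "0 \<le> t"
  shows "uniform_limit S2 (\<lambda>s x. N (x, s)) (\<lambda>x. N (x, t)) (at t within {0..})"
proof (rule uniform_limitI)
  fix e :: real assume e: "0 < e"
  obtain d where d: "0 < d" "\<And>x s. x \<in> S2 \<Longrightarrow> 0 \<le> s \<Longrightarrow> \<bar>s - t\<bar> < d \<Longrightarrow> \<bar>N (x, s) - N (x, t)\<bar> < e"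
    using uniform_continuous_time[of W N t e] N t e by (auto simp: time_C1_def)
  then show "\<forall>\<^sub>F s in at t within {0..}. \<forall>x\<in>S2. dist (N (x, s)) (N (x, t)) < e"
    unfolding eventually_at by (auto simp: dist_real_def intro!: exI[of _ d])
qed

text \<open>By the mean value theorem a difference quotient is a value of \<open>N'\<close> at a
  nearby time, and such values are close uniformly on the sphere.\<close>

lemma time_difference_quotient:
  assumes N: "time_C1 W N N'" and t: "0 < t"
  shows "uniform_limit S2 (\<lambda>h x. (N (x, t + h) - N (x, t)) / h) (\<lambda>x. N' (x, t)) (at 0)"
proof (rule uniform_limitI)
  fix e :: real assume e: "0 < e"
  have W: "S2 \<times> {0..} \<subseteq> W" using N by (simp add: time_C1_def)
  obtain d where d: "0 < d" "\<And>x s. x \<in> S2 \<Longrightarrow> 0 \<le> s \<Longrightarrow> \<bar>s - t\<bar> < d \<Longrightarrow> \<bar>N' (x, s) - N' (x, t)\<bar> < e"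
    using uniform_continuous_time[of W N' t e] N t e by (auto simp: time_C1_def)
  have main: "dist ((N (x, t + h) - N (x, t)) / h) (N' (x, t)) < e" if h: "h \<noteq> 0" "\<bar>h\<bar> < min d t"
      and x: "x \<in> S2" for h x
  proof -
    have D: "((\<lambda>s. N (x, s)) has_real_derivative N' (x, s)) (at s)" if "0 \<le> s" for s
    proof -
      have "(x, s) \<in> W" using W x that by auto
      then show ?thesis using N by (simp add: time_C1_def)
    qed
    have "\<exists>s. \<bar>s - t\<bar> \<le> \<bar>h\<bar> \<and> (N (x, t + h) - N (x, t)) / h = N' (x, s)"
    proof (cases "0 < h")
      case True
      then obtain s where "t < s" "s < t + h" "N (x, t + h) - N (x, t) = (t + h - t) * N' (x, s)"
        using MVT2[of t "t + h" "\<lambda>s. N (x, s)" "\<lambda>s. N' (x, s)"] D t by auto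
      then show ?thesis using True by (intro exI[of _ s]) auto
    next
      case False
      then have "h < 0" using h by simp
      then obtain s where "t + h < s" "s < t" "N (x, t) - N (x, t + h) = (t - (t + h)) * N' (x, s)"
        using MVT2[of "t + h" t "\<lambda>s. N (x, s)" "\<lambda>s. N' (x, s)"] D t h by auto
      then show ?thesis using \<open>h < 0\<close> by (intro exI[of _ s]) (auto simp: field_simps)
    qed
    then obtain s where s: "\<bar>s - t\<bar> \<le> \<bar>h\<bar>" "(N (x, t + h) - N (x, t)) / h = N' (x, s)" by blast
    have "0 \<le> s" "\<bar>s - t\<bar> < d" using s(1) h by auto
    then show ?thesis using d(2)[OF x] by (simp add: s(2) dist_real_def)
  qed
  then show "\<forall>\<^sub>F h in at 0. \<forall>x\<in>S2. dist ((N (x, t + h) - N (x, t)) / h) (N' (x, t)) < e"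
    unfolding eventually_at using d(1) t by (intro exI[of _ "min d t"]) (auto simp: dist_real_def)
qed

lemma eventually_time_pos: "0 < t \<Longrightarrow> eventually (\<lambda>h. 0 < t + h) (at (0::real))"
  unfolding eventually_at by (intro exI[of _ t]) (auto simp: dist_real_def)

lemma DERIV_LINT:
  assumes N: "time_C1 W N N'" and t: "0 < t"
  shows "((\<lambda>s. LINT x|area. N (x, s)) has_real_derivative (LINT x|area. N' (x, t))) (at t)"
proof -
  have "((\<lambda>h. LINT x|area. (N (x, t + h) - N (x, t)) / h) \<longlongrightarrow> (LINT x|area. N' (x, t))) (at 0)"
  proof (rule tendsto_LINT_uniform[OF time_difference_quotient[OF N t]])
    show "\<forall>\<^sub>F h in at 0. continuous_on S2 (\<lambda>x. (N (x, t + h) - N (x, t)) / h)"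
      using eventually_time_pos[OF t]
      by eventually_elim (unfold divide_inverse, intro continuous_intros time_C1_continuous[OF N],
          use t in auto)
  qed simp
  moreover have "\<forall>\<^sub>F h in at 0. (LINT x|area. (N (x, t + h) - N (x, t)) / h)
      = ((LINT x|area. N (x, t + h)) - (LINT x|area. N (x, t))) / h"
    using eventually_time_pos[OF t]
  proof eventually_elim
    case (elim h)
    have "(LINT x|area. N (x, t + h) - N (x, t))
        = (LINT x|area. N (x, t + h)) - (LINT x|area. N (x, t))"
      by (intro LINT_diff integrable_area_continuous time_C1_continuous[OF N]) (use elim t in auto)
    then show ?case by simp
  qed
  ultimately show ?thesis unfolding DERIV_def by (rule Lim_transform_eventually)
qed

lemma continuous_on_LINT_time:
  assumes N: "time_C1 W N N'"
  shows "continuous_on {0..} (\<lambda>s. LINT x|area. N (x, s))"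
  unfolding continuous_on_def
proof
  fix t :: real assume t: "t \<in> {0..}"
  show "((\<lambda>s. LINT x|area. N (x, s)) \<longlongrightarrow> (LINT x|area. N (x, t))) (at t within {0..})"
  proof (rule tendsto_LINT_uniform[OF time_uniform_limit[OF N]])
    show "\<forall>\<^sub>F e in at t within {0..}. continuous_on S2 (\<lambda>x. N (x, e))"
      unfolding eventually_at by (intro exI[of _ 1]) (auto intro: time_C1_continuous[OF N])
    show "at t within {0..} \<noteq> bot"
    proof -
      have "at_right t \<le> at t within {0..}" by (rule at_le) (use t in auto)
      then show ?thesis using trivial_limit_at_right_real[of t] by (auto simp: bot_unique)
    qed
  qed (use t in auto)
qed

text \<open>The vorticity equation holds for positive times only; the initial value is reached by
  continuity.\<close>

lemma constant_of_zero_deriv: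
  fixes q :: "real \<Rightarrow> real"
  assumes "continuous_on {0..} q" "\<And>t. 0 < t \<Longrightarrow> (q has_real_derivative 0) (at t)" "0 \<le> t"
  shows "q t = q 0"
proof (cases "t = 0")
  case False
  then have "0 < t" using assms by simp
  then show ?thesis
    by (rule DERIV_isconst2[of 0 t q t]) (use assms in \<open>auto intro: continuous_on_subset\<close>)
qed simp

text \<open>Its first variation at \<open>f\<close> is \<open>- stream \<omega> 0 f\<close>, which
  links it to the steady state relation.\<close>

definition energy :: "real \<Rightarrow> (real^3 \<Rightarrow> real) \<Rightarrow> real" where
  "energy \<omega> f = (LINT x|area. f x * green 0 f x) / 2 - \<omega> * (LINT x|area. f x * (north \<bullet> x))"

text \<open>Symmetry of \<open>green 0\<close> factors the difference of the quadratic parts like a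
  difference of squares. The factor \<open>f - g\<close> serves three purposes: the time derivative,
  continuity with respect to the \<open>L^1\<close> distance, and the expansion at the steady
  state.\<close>

lemma energy_diff:
  assumes f: "continuous_on S2 f" and g: "continuous_on S2 g"
  shows "energy \<omega> f - energy \<omega> g = (LINT x|area. (f x - g x) * ((green 0 f x + green 0 g x) / 2 - \<omega>
      * (north \<bullet> x)))"
proof -
  obtain A B where A: "bmeas A f" and B: "bmeas B g"
      using continuous_bmeas[OF f] continuous_bmeas[OF g] by metis
  note cK = continuous_on_green[OF A] continuous_on_green[OF B]
  have "(LINT x|area. (f x - g x) * ((green 0 f x + green 0 g x) / 2 - \<omega> * (north \<bullet> x)))
    = (LINT x|area. f x * green 0 f x / 2 + f x * green 0 g x / 2 - g x * green 0 f x / 2 - g x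
        * green 0 g x / 2 - \<omega> * (f x * (north \<bullet> x)) + \<omega> * (g x * (north \<bullet> x)))"
    by (intro LINT_cong refl) (simp add: field_simps)
  also have "\<dots> = (LINT x|area. f x * green 0 f x) / 2 + (LINT x|area. f x * green 0 g x) / 2
      - (LINT x|area. g x * green 0 f x) / 2
     - (LINT x|area. g x * green 0 g x) / 2 - \<omega> * (LINT x|area. f x * (north \<bullet> x)) + \<omega>
         * (LINT x|area. g x * (north \<bullet> x))"
  proof -
    have i: "integrable area (\<lambda>x. f x * green 0 f x)" "integrable area (\<lambda>x. f x * green 0 g x)"
        "integrable area (\<lambda>x. g x * green 0 f x)"
        "integrable area (\<lambda>x. g x * green 0 g x)" "integrable area (\<lambda>x. f x * (north \<bullet> x))"
            "integrable area (\<lambda>x. g x * (north \<bullet> x))"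
      by (auto intro!: integrable_area_continuous continuous_intros f g cK)
    show ?thesis
      by (simp only: LINT_add LINT_diff area_integrable_add
        area_integrable_diff integrable_mult_right integrable_divide_zero integral_divide_zero
            integral_mult_right_zero i)
  qed
  finally show ?thesis using green_sym[OF A B] by (simp add: energy_def)
qed

lemma time_C1_eventually_continuous:
  assumes N: "time_C1 W N N'" and t: "0 < t"
  shows "\<forall>\<^sub>F h in at 0. continuous_on S2 (\<lambda>x. N (x, t + h))"
  using eventually_time_pos[OF t] by eventually_elim (intro time_C1_continuous(1)[OF N], auto)

lemma time_uniform_limit_shift:
  assumes N: "time_C1 W N N'" and t: "0 < t"
  shows "uniform_limit S2 (\<lambda>h x. N (x, t + h)) (\<lambda>x. N (x, t)) (at 0)"
proof (rule uniform_limitI)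
  fix e :: real assume e: "0 < e"
  obtain d where d: "0 < d" "\<And>x s. x \<in> S2 \<Longrightarrow> 0 \<le> s \<Longrightarrow> \<bar>s - t\<bar> < d \<Longrightarrow> \<bar>N (x, s) - N (x, t)\<bar> < e"
    using uniform_continuous_time[of W N t e] N t e by (auto simp: time_C1_def)
  show "\<forall>\<^sub>F h in at 0. \<forall>x\<in>S2. dist (N (x, t + h)) (N (x, t)) < e"
    unfolding eventually_at using d t by (intro exI[of _ "min d t"]) (auto simp: dist_real_def)
qed

lemma DERIV_energy:
  assumes N: "time_C1 W N N'" and t: "0 < t"
  shows "((\<lambda>s. energy \<omega> (\<lambda>x. N (x, s))) has_real_derivative
     (LINT x|area. N' (x, t) * (- stream \<omega> 0 (\<lambda>x. N (x, t)) x))) (at t)"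
proof -
  let ?f = "\<lambda>s x. N (x, s)"
  have cf: "continuous_on S2 (?f s)" if "0 \<le> s" for s using time_C1_continuous[OF N that] by simp
  have ck: "continuous_on S2 (green 0 (?f s))" if "0 \<le> s" for s
    using continuous_bmeas[OF cf[OF that]] continuous_on_green by metis
  have uK: "uniform_limit S2 (\<lambda>h. green 0 (?f (t + h))) (green 0 (?f t)) (at 0)"
    by (rule uniform_limit_green[OF time_uniform_limit_shift[OF N t]
        time_C1_eventually_continuous[OF N t] cf]) (use t in auto)
  have uH: "uniform_limit S2 (\<lambda>h x. (green 0 (?f (t + h)) x + green 0 (?f t) x) / 2 - \<omega> * (north
      \<bullet> x)) (\<lambda>x. - stream \<omega> 0 (?f t) x) (at 0)"
  proof (rule uniform_limitI)
    fix e :: real assume e: "0 < e"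
    from uniform_limitD[OF uK e]
    show "\<forall>\<^sub>F h in at 0. \<forall>x\<in>S2. dist ((green 0 (?f (t + h)) x + green 0 (?f t) x) / 2 - \<omega> * (north
        \<bullet> x)) (- stream \<omega> 0 (?f t) x) < e"
    proof eventually_elim
      case (elim h)
      show ?case
      proof
        fix x assume "x \<in> S2"
        then have "\<bar>green 0 (?f (t + h)) x - green 0 (?f t) x\<bar> < e" using elim
            by (auto simp: dist_real_def)
        moreover have "(green 0 (?f (t + h)) x + green 0 (?f t) x) / 2 - \<omega> * (north \<bullet> x)
            - (- stream \<omega> 0 (?f t) x) = (green 0 (?f (t + h)) x - green 0 (?f t) x) / 2"
          by (simp add: stream_def field_simps)
        moreover have "\<bar>X / 2\<bar> < e" if "\<bar>X\<bar> < e" for X :: real using that e by auto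
        ultimately show "dist ((green 0 (?f (t + h)) x + green 0 (?f t) x) / 2 - \<omega> * (north
            \<bullet> x)) (- stream \<omega> 0 (?f t) x) < e"
          unfolding dist_real_def by (simp only:)
      qed
    qed
  qed
  obtain B where B: "bmeas B (?f t)" using continuous_bmeas[OF cf[of t]] t by auto
  have "((\<lambda>h. LINT x|area. (N (x, t + h) - N (x, t)) / h * ((green 0 (?f (t + h)) x
      + green 0 (?f t) x) / 2 - \<omega> * (north \<bullet> x)))
     \<longlongrightarrow> (LINT x|area. N' (x, t) * (- stream \<omega> 0 (?f t) x))) (at 0)"
  proof (rule tendsto_LINT_uniform[OF uniform_lim_mult[OF time_difference_quotient[OF N t] uH
      bounded_image_S2 bounded_image_S2]])
    show "\<forall>\<^sub>F h in at 0. continuous_on S2 (\<lambda>x. (N (x, t + h) - N (x, t)) / h * ((green 0 (?f (t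
        + h)) x + green 0 (?f t) x) / 2 - \<omega> * (north \<bullet> x)))"
      using eventually_time_pos[OF t]
      by eventually_elim (unfold divide_inverse, intro continuous_intros cf ck, use t in auto)
  qed (use t in \<open>auto intro!: continuous_intros continuous_on_stream[OF B] time_C1_continuous[OF
      N]\<close>)
  moreover have "\<forall>\<^sub>F h in at 0. (LINT x|area. (N (x, t + h) - N (x, t)) / h * ((green 0 (?f (t
      + h)) x + green 0 (?f t) x) / 2 - \<omega> * (north \<bullet> x)))
      = (energy \<omega> (?f (t + h)) - energy \<omega> (?f t)) / h"
    using eventually_time_pos[OF t]
  proof eventually_elim
    case (elim h)
    have "energy \<omega> (?f (t + h)) - energy \<omega> (?f t)
        = (LINT x|area. (?f (t + h) x - ?f t x) * ((green 0 (?f (t + h)) x + green 0 (?f t) x) / 2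
        - \<omega> * (north \<bullet> x)))"
      by (rule energy_diff[OF cf cf]) (use elim t in auto)
    then show ?case by simp
  qed
  ultimately show ?thesis unfolding DERIV_def by (rule Lim_transform_eventually)
qed

lemma continuous_on_energy_time:
  assumes N: "time_C1 W N N'"
  shows "continuous_on {0..} (\<lambda>s. energy \<omega> (\<lambda>x. N (x, s)))"
  unfolding continuous_on_def
proof
  let ?f = "\<lambda>s x. N (x, s)"
  fix t :: real assume t: "t \<in> {0..}"
  have nb: "at t within {0..} \<noteq> bot"
  proof -
    have "at_right t \<le> at t within {0..}" by (rule at_le) (use t in auto)
    then show ?thesis using trivial_limit_at_right_real[of t] by (auto simp: bot_unique)
  qed
  have cf: "continuous_on S2 (?f s)" if "0 \<le> s" for s using time_C1_continuous[OF N that] by simp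
  have ck: "continuous_on S2 (green 0 (?f s))" if "0 \<le> s" for s
    using continuous_bmeas[OF cf[OF that]] continuous_on_green by metis
  have en: "\<forall>\<^sub>F s in at t within {0..}. 0 \<le> s" unfolding eventually_at by (intro exI[of _ 1]) auto
  have u: "uniform_limit S2 ?f (?f t) (at t within {0..})" using time_uniform_limit[OF N] t by auto
  have uK: "uniform_limit S2 (\<lambda>s. green 0 (?f s)) (green 0 (?f t)) (at t within {0..})"
    by (rule uniform_limit_green[OF u]) (use t in \<open>auto intro: cf eventually_mono[OF en]\<close>)
  have "((\<lambda>s. LINT x|area. ?f s x * green 0 (?f s) x)
      \<longlongrightarrow> (LINT x|area. ?f t x * green 0 (?f t) x)) (at t within {0..})"
    by (rule tendsto_LINT_uniform[OF uniform_lim_mult[OF u uK bounded_image_S2 bounded_image_S2] _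
        nb])
       (use t in \<open>auto intro!: eventually_mono[OF en] continuous_intros cf ck\<close>)
  moreover have "((\<lambda>s. LINT x|area. ?f s x * (north \<bullet> x))
      \<longlongrightarrow> (LINT x|area. ?f t x * (north \<bullet> x))) (at t within {0..})"
    by (rule tendsto_LINT_uniform[OF uniform_lim_mult[OF u uniform_limit_const bounded_image_S2
        bounded_image_S2] _ nb])
       (use t in \<open>auto intro!: eventually_mono[OF en] continuous_intros cf\<close>)
  ultimately show "((\<lambda>s. energy \<omega> (?f s)) \<longlongrightarrow> energy \<omega> (?f t)) (at t within {0..})"
    unfolding energy_def by (intro tendsto_intros) auto
qed

section \<open>From the equation to the conservation laws\<close>

lemma has_sgrad_diff:
  "has_sgrad f x a \<Longrightarrow> has_sgrad g x b \<Longrightarrow> has_sgrad (\<lambda>y. f y - g y) x (a - b)"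
  unfolding has_sgrad_def by (simp add: inner_diff_right inner_diff_left[abs_def]
      has_derivative_diff)

lemma has_sgrad_continuous:
  assumes "\<And>x. x \<in> S2 \<Longrightarrow> \<exists>v. has_sgrad f x v"
  shows "continuous_on S2 f"
  unfolding continuous_on_eq_continuous_within
  using assms has_derivative_continuous unfolding has_sgrad_def by blast

lemma cross3_tanpart: "cross3 x (tanpart x w) = cross3 x w"
  by (simp add: tanpart_def Cross3.right_diff_distrib cross_mult_right)

lemma green_continuous_of: "continuous_on S2 f \<Longrightarrow> continuous_on S2 (green 0 f)"
  using continuous_bmeas continuous_on_green by metis

text \<open>\<open>\<psi>\<close> equals \<open>green 0 f\<close> almost everywhere, and both are
  continuous, \<open>\<psi>\<close> because it is differentiable; so they agree on the whole sphere,
  and the gradient of \<open>\<psi>\<close> is given by the velocity kernel.\<close>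

lemma vorticity_velocity:
  assumes r: "1 < r" and \<psi>: "inv_laplacian r f \<psi>" and f: "continuous_on S2 f"
    and sg: "\<And>x. x \<in> S2 \<Longrightarrow> \<exists>v. has_sgrad \<psi> x v" and x: "x \<in> S2"
  shows "rotJ x (sgrad (\<lambda>y. \<omega> * y $ 3 - \<psi> y) x) = absvel \<omega> 0 f x"
proof -
  obtain B where B: "bmeas B f" using continuous_bmeas[OF f] by blast
  note K = inv_laplacian_green[OF r \<psi>]
  have eq: "\<psi> y = green 0 f y" if "y \<in> S2" for y
    by (rule continuous_AE_eq[OF has_sgrad_continuous[OF sg] K that])
  obtain v where v: "has_sgrad \<psi> x v" using sg[OF x] by blast
  have c: "cross3 x v = vel 0 f x" by (rule green_sgrad[OF B eq v x])
  have C: "C1_on (\<lambda>y. \<omega> * y $ 3) UNIV" by (intro C1_cmult C1_on_component)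
  have g: "grad (\<lambda>y. \<omega> * y $ 3) x = \<omega> *\<^sub>R north"
    by (rule grad_eqI) (auto intro!: derivative_eq_intros has_derivative_vec_nth simp: inner_axis')
  have "has_sgrad (\<lambda>y. \<omega> * y $ 3) x (tanpart x (\<omega> *\<^sub>R north))"
    using has_sgrad_tanpart[OF C1_differentiable[OF C UNIV_I] x] by (simp add: g)
  from sgrad_eqI[OF has_sgrad_diff[OF this v] x]
  show ?thesis by (simp add: rotJ_def Cross3.right_diff_distrib cross3_tanpart c absvel_def
      cross_mult_right)
qed

lemma smooth_slice:
  fixes F :: "(real^3) \<times> real \<Rightarrow> real"
  assumes F: "\<And>k. Ck_on k F W" and W: "open W" "S2 \<times> {0..} \<subseteq> W"
  defines "F' \<equiv> (\<lambda>p. frechet_derivative F (at p) (0, 1))"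
  shows "time_C1 W F F'" and "0 \<le> t \<Longrightarrow> C1_on (\<lambda>x. F (x, t)) {x. (x, t) \<in> W}"
    and "0 \<le> t \<Longrightarrow> open {x. (x, t) \<in> W} \<and> S2 \<subseteq> {x. (x, t) \<in> W}"
proof -
  have d: "(F has_derivative frechet_derivative F (at p)) (at p)" if "p \<in> W" for p
    using F[of 1] that frechet_derivative_works by auto
  have c: "continuous_on W (\<lambda>p. frechet_derivative F (at p) v)" for v using F[of 1]
      by (cases v) simp
  have dt: "((\<lambda>s. F (x, s)) has_real_derivative F' (x, t)) (at t)" if "(x, t) \<in> W" for x t
  proof -
    interpret bounded_linear "frechet_derivative F (at (x, t))" using d[OF that]
        by (rule has_derivative_bounded_linear)
    have "((\<lambda>s. (x, s)) has_derivative (\<lambda>h. (0, h))) (at t)" by (auto intro!: derivative_eq_intros)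
    from has_derivative_compose[OF this d[OF that]]
    have "((\<lambda>s. F (x, s)) has_derivative (\<lambda>h. frechet_derivative F (at (x, t)) (0, h))) (at t)" .
    moreover have "(\<lambda>h. frechet_derivative F (at (x, t)) (0, h)) = (*) (F' (x, t))"
    proof
      fix h :: real
      have "(0 :: real^3, h) = h *\<^sub>R (0, 1)" by simp
      then show "frechet_derivative F (at (x, t)) (0, h) = F' (x, t) * h"
        unfolding F'_def by (metis scaleR mult.commute real_scaleR_def)
    qed
    ultimately show ?thesis by (simp add: has_field_derivative_def)
  qed
  show "time_C1 W F F'"
    using W F[of 0] c dt unfolding time_C1_def F'_def by auto
  assume t: "0 \<le> t"
  have cp: "continuous_on A (\<lambda>x::real^3. (x, t))" for A by (intro continuous_intros)
  have eqv: "{x. (x, t) \<in> W} = (\<lambda>x. (x, t)) -` W" by auto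
  show "open {x. (x, t) \<in> W} \<and> S2 \<subseteq> {x. (x, t) \<in> W}"
    unfolding eqv using W t cp by (auto intro!: open_vimage)
  have dx: "((\<lambda>x. F (x, t)) has_derivative (\<lambda>v. frechet_derivative F (at (x, t)) (v, 0))) (at x)"
      if "(x, t) \<in> W" for x
  proof -
    have "((\<lambda>x. (x, t)) has_derivative (\<lambda>h. (h, 0))) (at x)" by (auto intro!: derivative_eq_intros)
    from has_derivative_compose[OF this d[OF that]] show ?thesis .
  qed
  show "C1_on (\<lambda>x. F (x, t)) {x. (x, t) \<in> W}"
    unfolding C1_on_def
  proof
    show "\<forall>x\<in>{x. (x, t) \<in> W}. (\<lambda>x. F (x, t)) differentiable at x"
      using dx by (auto intro: differentiableI)
    have "continuous_on {x. (x, t) \<in> W} (\<lambda>x. \<chi> i. frechet_derivative F (at (x, t)) (axis i 1, 0))"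
      by (intro continuous_on_vec_lambda continuous_on_compose2[OF c cp]) auto
    then show "continuous_on {x. (x, t) \<in> W} (grad (\<lambda>x. F (x, t)))"
      by (rule continuous_on_eq) (auto simp: grad_def vec_eq_iff frechet_derivative_at[OF dx,
          symmetric])
  qed
qed

text \<open>Both functions take values in one compact interval, on which \<open>\<Phi>\<close> is a
  uniform limit of polynomials. The functionals needed for stability contain a truncation, so they
  are continuous but need not be differentiable.\<close>

lemma LINT_polynomial_constant_imp_continuous:
  fixes \<Phi> :: "real \<Rightarrow> real"
  assumes f: "continuous_on S2 f" and g: "continuous_on S2 g" and \<Phi>: "continuous_on UNIV \<Phi>"
    and poly: "\<And>q. real_polynomial_function q \<Longrightarrow> (LINT x|area. q (f x))
        = (LINT x|area. q (g x :: real))"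
  shows "(LINT x|area. \<Phi> (f x)) = (LINT x|area. \<Phi> (g x))"
proof -
  obtain A where A: "\<And>x. x \<in> S2 \<Longrightarrow> norm (f x) \<le> A" by (metis continuous_on_S2_bounded[OF f])
  obtain B where B: "\<And>x. x \<in> S2 \<Longrightarrow> norm (g x) \<le> B" by (metis continuous_on_S2_bounded[OF g])
  define I where "I = {- max A B..max A B}"
  have I: "f x \<in> I" "g x \<in> I" if "x \<in> S2" for x using A[OF that] B[OF that] by (auto simp: I_def)
  have main: "\<bar>(LINT x|area. \<Phi> (f x)) - (LINT x|area. \<Phi> (g x))\<bar> \<le> 2 * total_area * e" if e: "0 < e"
      for e
  proof -
    obtain q where q: "real_polynomial_function q" "\<And>s. s \<in> I \<Longrightarrow> \<bar>\<Phi> s - q s\<bar> < e"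
      using Stone_Weierstrass_real_polynomial_function[OF _ continuous_on_subset[OF \<Phi>], of I e] e
          by (auto simp: I_def)
    have cq: "continuous_on UNIV q"
      using q(1) by (auto intro!: continuous_at_imp_continuous_on
          continuous_real_polymonial_function)
    have est: "\<bar>(LINT x|area. \<Phi> (h x)) - (LINT x|area. q (h x))\<bar>
        \<le> total_area * e" if h: "continuous_on S2 h" "\<And>x. x \<in> S2 \<Longrightarrow> h x \<in> I" for h
    proof -
      have c1: "continuous_on S2 (\<lambda>x. \<Phi> (h x))" by (rule continuous_on_compose2[OF \<Phi> h(1)]) auto
      have c2: "continuous_on S2 (\<lambda>x. q (h x))" by (rule continuous_on_compose2[OF cq h(1)]) auto
      have "(LINT x|area. \<Phi> (h x)) - (LINT x|area. q (h x)) = (LINT x|area. \<Phi> (h x) - q (h x))"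
        by (intro LINT_diff[symmetric] integrable_area_continuous c1 c2)
      also have "\<bar>\<dots>\<bar> \<le> (LINT x|area. e)"
        by (rule order_trans[OF integral_abs_bound integral_mono])
           (use q(2) h(2) in \<open>auto intro!: integrable_area_continuous continuous_intros c1 c2 simp:
               less_imp_le\<close>)
      finally show ?thesis by simp
    qed
    show ?thesis using est[OF f I(1)] est[OF g I(2)] poly[OF q(1)] by linarith
  qed
  have "\<bar>(LINT x|area. \<Phi> (f x)) - (LINT x|area. \<Phi> (g x))\<bar> \<le> 0"
  proof (rule field_le_epsilon)
    fix e :: real assume "0 < e"
    then show "\<bar>(LINT x|area. \<Phi> (f x)) - (LINT x|area. \<Phi> (g x))\<bar> \<le> 0 + e"
      using main[of "e / (2 * total_area)"] measure_area_pos by simp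
  qed
  then show ?thesis by simp
qed

text \<open>For polynomials of \<open>\<zeta>\<close> the chain rule turns the equation into the
  integral of \<open>absvel\<close> against a gradient, which vanishes. The energy is constant
  because \<open>absvel\<close> is orthogonal to the gradient of its stream function. The moment is
  not constant but rotates about the axis, which preserves its distance from any \<open>m\<close>
  fixed by that rotation.\<close>

theorem conservation_laws:
  fixes \<Phi> :: "real \<Rightarrow> real"
  assumes sol: "smooth_solution \<omega> \<zeta>" and t: "0 \<le> t"
  shows "continuous_on S2 (\<zeta> t)" and "(LINT x|area. \<zeta> t x) = 0"
    and "continuous_on UNIV \<Phi> \<Longrightarrow> (LINT x|area. \<Phi> (\<zeta> t x)) = (LINT x|area. \<Phi> (\<zeta> 0 x))"
    and "energy \<omega> (\<zeta> t) = energy \<omega> (\<zeta> 0)"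
    and "\<omega> *\<^sub>R cross3 m north = 0 \<Longrightarrow> norm (moment (\<zeta> t) - m) = norm (moment (\<zeta> 0) - m)"
proof -
  from sol have "smooth_on (S2 \<times> {0..}) (\<lambda>(x, t). \<zeta> t x)" unfolding smooth_solution_def
      by (rule conjunct1)
  then obtain W F where W: "open W" "S2 \<times> {0..} \<subseteq> W" and F': "\<forall>k. Ck_on k F W"
    and FZ': "\<forall>p\<in>S2 \<times> {0..}. F p = (case p of (x, t) \<Rightarrow> \<zeta> t x)"
    unfolding smooth_on_def by blast
  note F = F'[rule_format]
  have FZ: "F (x, t) = \<zeta> t x" if "x \<in> S2" "0 \<le> t" for x t using FZ' that by auto
  define F' where "F' = (\<lambda>p. frechet_derivative F (at p) (0, 1))"
  note sl = smooth_slice[OF F W, folded F'_def]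
  have N: "time_C1 W F F'" by (rule sl)
  have cF: "continuous_on S2 (\<lambda>x. F (x, t))" if "0 \<le> t" for t
      using time_C1_continuous(1)[OF N that] .
  have cZ: "continuous_on S2 (\<zeta> t)" if "0 \<le> t" for t
    by (rule continuous_on_eq[OF cF[OF that]]) (use FZ that in auto)
  show "continuous_on S2 (\<zeta> t)" by (rule cZ[OF t])
  show "(LINT x|area. \<zeta> t x) = 0" using sol t by (simp add: smooth_solution_def)
  from sol have "\<exists>\<psi>. \<forall>t>0. (\<exists>r>1. inv_laplacian r (\<zeta> t) (\<psi> t)) \<and> (\<forall>x\<in>S2. (\<exists>v. has_sgrad (\<psi> t) x v) \<and>
      deriv (\<lambda>s. \<zeta> s x) t + rotJ x (sgrad (\<lambda>y. \<omega> * y $ 3 - \<psi> t y) x) \<bullet> sgrad (\<zeta> t) x = 0)"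
    unfolding smooth_solution_def by (elim conjE)
  then obtain \<psi> where \<psi>': "\<forall>t>0. (\<exists>r>1. inv_laplacian r (\<zeta> t) (\<psi> t))
      \<and> (\<forall>x\<in>S2. (\<exists>v. has_sgrad (\<psi> t) x v) \<and>
      deriv (\<lambda>s. \<zeta> s x) t + rotJ x (sgrad (\<lambda>y. \<omega> * y $ 3 - \<psi> t y) x) \<bullet> sgrad (\<zeta> t) x = 0)" ..
  have \<psi>: "\<And>t. 0 < t \<Longrightarrow> \<exists>r>1. inv_laplacian r (\<zeta> t) (\<psi> t)"
      "\<And>t x. 0 < t \<Longrightarrow> x \<in> S2 \<Longrightarrow> \<exists>v. has_sgrad (\<psi> t) x v"
      "\<And>t x. 0 < t \<Longrightarrow> x \<in> S2 \<Longrightarrow> deriv (\<lambda>s. \<zeta> s x) t + rotJ x (sgrad (\<lambda>y. \<omega> * y $ 3 - \<psi> t y) x)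
          \<bullet> sgrad (\<zeta> t) x = 0"
    using \<psi>' by blast+
  have vel_eq: "absvel \<omega> e (\<zeta> t) = absvel \<omega> e (\<lambda>x. F (x, t))" if "0 \<le> t" for e t
  proof -
    have "vel e (\<zeta> t) = vel e (\<lambda>x. F (x, t))"
      unfolding vel_def fun_eq_iff
      by (intro allI arg_cong2[where f = "(*\<^sub>R)"] refl LINT_cong) (use FZ that in auto)
    then show ?thesis by (simp add: absvel_def fun_eq_iff)
  qed
  \<comment> \<open>The equation for the extension \<open>F\<close>, with its Euclidean gradient:
    the tangential projection hidden in \<open>sgrad\<close> drops out because \<open>absvel\<close>
    is tangent to the sphere.\<close>
  have eqn: "F' (x, t) = - (absvel \<omega> 0 (\<lambda>x. F (x, t)) x \<bullet> grad (\<lambda>x. F (x, t)) x)" if t: "0 < t"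
      and x: "x \<in> S2" for t x
  proof -
    obtain r where r: "1 < r" "inv_laplacian r (\<zeta> t) (\<psi> t)" using \<psi>(1)[OF t] by blast
    have u: "rotJ x (sgrad (\<lambda>y. \<omega> * y $ 3 - \<psi> t y) x) = absvel \<omega> 0 (\<zeta> t) x"
      using t by (intro vorticity_velocity[OF r cZ \<psi>(2)[OF t] x]) auto
    have "x \<bullet> absvel \<omega> 0 (\<zeta> t) x = 0"
      unfolding u[symmetric] rotJ_def by (rule dot_cross_self)
    then have ux: "absvel \<omega> 0 (\<zeta> t) x \<bullet> x = 0" by (simp add: inner_commute)
    have "(x, t) \<in> W" using W x t by auto
    then have "(\<lambda>x. F (x, t)) differentiable at x"
      using C1_differentiable[OF sl(2)] t by auto
    then have sg: "sgrad (\<zeta> t) x = tanpart x (grad (\<lambda>x. F (x, t)) x)"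
      by (rule sgrad_tanpart[OF _ x]) (use FZ t in auto)
    have "((\<lambda>s. F (x, s)) has_real_derivative F' (x, t)) (at t)"
      using N \<open>(x, t) \<in> W\<close> by (simp add: time_C1_def)
    \<comment> \<open>\<open>F\<close> and \<open>\<zeta>\<close> agree at nonnegative times only,
      so the derivatives are compared inside the open half-line.\<close>
    then have "((\<lambda>s. \<zeta> s x) has_real_derivative F' (x, t)) (at t)"
      by (rule has_field_derivative_transform_within_open[of _ _ _ "{0<..}"]) (use t FZ[OF x] in
          auto)
    then have "deriv (\<lambda>s. \<zeta> s x) t = F' (x, t)" by (rule DERIV_imp_deriv)
    then have "F' (x, t) = - (absvel \<omega> 0 (\<zeta> t) x \<bullet> grad (\<lambda>x. F (x, t)) x)"
      using \<psi>(3)[OF t x] ux unfolding u sg by (simp add: tanpart_def inner_diff_right)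
    then show ?thesis using vel_eq[of t 0] t by simp
  qed
  have U: "C1_on (\<lambda>x. F (x, t)) {x. (x, t) \<in> W}" "open {x. (x, t) \<in> W}" "S2 \<subseteq> {x. (x, t) \<in> W}"
      if "0 < t" for t
    using sl(2,3)[of t] that by auto
  have cgrad: "continuous_on S2 (grad (\<lambda>x. F (x, t)))" if "0 < t" for t
    by (rule continuous_on_subset[OF C1_continuous_grad[OF U(1)[OF that]] U(3)[OF that]])

  have poly: "(LINT x|area. q (\<zeta> t x)) = (LINT x|area. q (\<zeta> 0 x))" if q: "real_polynomial_function
      q" for q
  proof -
    obtain q' where q': "real_polynomial_function q'" "\<And>x. (q has_real_derivative q' x) (at x)"
      using has_real_derivative_polynomial_function[OF q] by blast
    have c: "continuous_on A q" "continuous_on A q'" for A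
      using q q'(1) by (auto intro!: continuous_at_imp_continuous_on
          continuous_real_polymonial_function)
    have Nq: "time_C1 W (\<lambda>p. q (F p)) (\<lambda>p. q' (F p) * F' p)"
      using N unfolding time_C1_def
      by (auto intro!: continuous_intros continuous_on_compose2[OF c(1)[of UNIV]]
          continuous_on_compose2[OF c(2)[of UNIV]]
          DERIV_chain2[where f = q, OF q'(2)])
    have "(LINT x|area. q (F (x, t))) = (LINT x|area. q (F (x, 0)))"
    proof (rule constant_of_zero_deriv[OF continuous_on_LINT_time[OF Nq] _ t])
      fix t :: real assume t: "0 < t"
      obtain B where B: "bmeas B (\<lambda>x. F (x, t))" using continuous_bmeas[OF cF[of t]] t by auto
      have C: "C1_on (\<lambda>x. q (F (x, t))) {x. (x, t) \<in> W}"
        by (rule C1_compose_real[OF U(1)[OF t] q'(2) c(2)])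
      have "(LINT x|area. q' (F (x, t)) * F' (x, t))
          = (LINT x|area. - (absvel \<omega> 0 (\<lambda>x. F (x, t)) x \<bullet> grad (\<lambda>x. q (F (x, t))) x))"
      proof (intro LINT_cong refl)
        fix x assume "x \<in> space area"
        then have x: "x \<in> S2" "x \<in> {x. (x, t) \<in> W}" using U(3)[OF t] by auto
        show "q' (F (x, t)) * F' (x, t) = - (absvel \<omega> 0 (\<lambda>x. F (x, t)) x
            \<bullet> grad (\<lambda>x. q (F (x, t))) x)"
          unfolding eqn[OF t x(1)] grad_compose_real[OF C1_differentiable[OF U(1)[OF t] x(2)] q'(2)]
              by simp
      qed
      also have "\<dots> = 0" using LINT_absvel_grad[OF B C U(2,3)[OF t], of \<omega>] by simp
      finally show "((\<lambda>s. LINT x|area. q (F (x, s))) has_real_derivative 0) (at t)"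
          using DERIV_LINT[OF Nq t] by simp
    qed
    moreover have "(LINT x|area. q (F (x, s))) = (LINT x|area. q (\<zeta> s x))" if "0 \<le> s" for s
      by (intro LINT_cong) (use FZ that in auto)
    ultimately show ?thesis using t by simp
  qed
  show "continuous_on UNIV \<Phi> \<Longrightarrow> (LINT x|area. \<Phi> (\<zeta> t x)) = (LINT x|area. \<Phi> (\<zeta> 0 x))"
    by (rule LINT_polynomial_constant_imp_continuous) (auto intro: cZ t poly)

  have E: "energy \<omega> (\<lambda>x. F (x, s)) = energy \<omega> (\<zeta> s)" if "0 \<le> s" for s
  proof -
    have "green 0 (\<lambda>x. F (x, s)) = green 0 (\<zeta> s)" by (rule green_cong) (use FZ that in auto)
    then show ?thesis unfolding energy_def
      by (intro arg_cong2[where f = "(-)"] arg_cong2[where f = "(/)"] arg_cong2[where f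
          = "(*)"] refl LINT_cong)
         (use FZ that in auto)
  qed
  have "energy \<omega> (\<lambda>x. F (x, t)) = energy \<omega> (\<lambda>x. F (x, 0))"
  proof (rule constant_of_zero_deriv[OF continuous_on_energy_time[OF N] _ t])
    fix t :: real assume t: "0 < t"
    obtain B where B: "bmeas B (\<lambda>x. F (x, t))" using continuous_bmeas[OF cF[of t]] t by auto
    have "(LINT x|area. F' (x, t) * (- stream \<omega> 0 (\<lambda>x. F (x, t)) x))
        = (LINT x|area. stream \<omega> 0 (\<lambda>x. F (x, t)) x * (absvel \<omega> 0 (\<lambda>x. F (x, t)) x
        \<bullet> grad (\<lambda>x. F (x, t)) x))"
      by (intro LINT_cong refl) (simp add: eqn[OF t])
    also have "\<dots> = 0" by (rule LINT_stream_absvel_grad[OF B U[OF t]])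
    finally show "((\<lambda>s. energy \<omega> (\<lambda>x. F (x, s))) has_real_derivative 0) (at t)"
        using DERIV_energy[OF N t, of \<omega>] by simp
  qed
  then show "energy \<omega> (\<zeta> t) = energy \<omega> (\<zeta> 0)" using E t by simp

  assume m: "\<omega> *\<^sub>R cross3 m north = 0"
  define mu where "mu s = moment (\<lambda>x. F (x, s))" for s
  have Na: "time_C1 W (\<lambda>p. F p * (a \<bullet> fst p)) (\<lambda>p. F' p * (a \<bullet> fst p))" for a
    using N unfolding time_C1_def by (auto intro!: continuous_intros derivative_eq_intros)
  have mua: "mu s \<bullet> a = (LINT x|area. F (x, s) * (a \<bullet> x))" if "0 \<le> s" for s a
    unfolding mu_def by (rule moment_inner[OF cF[OF that]])
  have dmu: "((\<lambda>s. LINT x|area. F (x, s) * (a \<bullet> x)) has_real_derivative \<omega> * (cross3 (mu s) north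
      \<bullet> a)) (at s)" if s: "0 < s" for s a
  proof -
    obtain B where B: "bmeas B (\<lambda>x. F (x, s))" using continuous_bmeas[OF cF[of s]] s by auto
    have C: "C1_on (\<lambda>x. F (x, s) * (a \<bullet> x)) {x. (x, s) \<in> W}"
      by (intro C1_mult U(1)[OF s] C1_linear)
    have "(LINT x|area. F' (x, s) * (a \<bullet> x))
        = (LINT x|area. F (x, s) * (absvel \<omega> 0 (\<lambda>x. F (x, s)) x \<bullet> a)
        - absvel \<omega> 0 (\<lambda>x. F (x, s)) x \<bullet> grad (\<lambda>x. F (x, s) * (a \<bullet> x)) x)"
    proof (intro LINT_cong refl)
      fix x assume "x \<in> space area"
      then have x: "x \<in> S2" "x \<in> {x. (x, s) \<in> W}" using U(3)[OF s] by auto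
      show "F' (x, s) * (a \<bullet> x) = F (x, s) * (absvel \<omega> 0 (\<lambda>x. F (x, s)) x \<bullet> a)
        - absvel \<omega> 0 (\<lambda>x. F (x, s)) x \<bullet> grad (\<lambda>x. F (x, s) * (a \<bullet> x)) x"
        unfolding eqn[OF s x(1)] grad_mult[OF C1_differentiable[OF U(1)[OF s] x(2)]
            C1_differentiable[OF C1_linear UNIV_I]]
        by (simp add: inner_add_right)
    qed
    also have "\<dots> = (LINT x|area. F (x, s) * (absvel \<omega> 0 (\<lambda>x. F (x, s)) x \<bullet> a))
        - (LINT x|area. absvel \<omega> 0 (\<lambda>x. F (x, s)) x \<bullet> grad (\<lambda>x. F (x, s) * (a \<bullet> x)) x)"
      using s by (intro LINT_diff integrable_area_continuous continuous_intros cF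
          continuous_on_absvel[OF B]
         continuous_on_subset[OF C1_continuous_grad[OF C] U(3)[OF s]]) auto
    also have "\<dots> = \<omega> * (cross3 (mu s) north \<bullet> a)"
      using LINT_absvel_moment[OF cF[of s], of \<omega> a] LINT_absvel_grad[OF B C U(2,3)[OF s], of \<omega>] s
          by (simp add: mu_def)
    finally show ?thesis using DERIV_LINT[OF Na[of a] s] by simp
  qed
  define Q where "Q s = (\<Sum>i\<in>UNIV. ((LINT x|area. F (x, s) * (axis i 1 \<bullet> x)) - m $ i)\<^sup>2)" for s
  have Qn: "Q s = (norm (mu s - m))\<^sup>2" if "0 \<le> s" for s
    unfolding Q_def mua[OF that, symmetric] power2_norm_eq_inner inner_vec_def[of "mu s - m"]
    by (simp add: inner_axis power2_eq_square)
  have "Q t = Q 0"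
  proof (rule constant_of_zero_deriv[OF _ _ t])
    show "continuous_on {0..} Q"
      unfolding Q_def by (intro continuous_intros continuous_on_LINT_time[OF Na, simplified])
    fix s :: real assume s: "0 < s"
    have "(Q has_real_derivative (\<Sum>i\<in>UNIV. 2 * ((LINT x|area. F (x, s) * (axis i 1 \<bullet> x)) - m $ i)
        * (\<omega> * (cross3 (mu s) north \<bullet> axis i 1)))) (at s)"
      unfolding Q_def by (auto intro!: derivative_eq_intros dmu[OF s] sum.cong simp: algebra_simps)
    also have "(\<Sum>i\<in>UNIV. 2 * ((LINT x|area. F (x, s) * (axis i 1 \<bullet> x)) - m $ i) * (\<omega>
        * (cross3 (mu s) north \<bullet> axis i 1)))
       = 2 * ((mu s - m) \<bullet> (\<omega> *\<^sub>R cross3 (mu s) north))"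
      unfolding mua[OF less_imp_le[OF s], symmetric] inner_vec_def[of "mu s - m"] sum_distrib_left
      by (intro sum.cong refl) (simp add: inner_axis algebra_simps)
    \<comment> \<open>As \<open>m\<close> is fixed by the rotation, it may be subtracted inside the
      cross product, which then becomes orthogonal to \<open>mu s - m\<close>.\<close>
    also have "\<omega> *\<^sub>R cross3 (mu s) north = \<omega> *\<^sub>R cross3 (mu s - m) north"
      using m by (simp add: Cross3.left_diff_distrib scaleR_diff_right)
    also have "(mu s - m) \<bullet> (\<omega> *\<^sub>R cross3 (mu s - m) north) = 0"
      by (simp add: dot_cross_self)
    finally show "(Q has_real_derivative 0) (at s)" by simp
  qed
  then have "norm (mu t - m) = norm (mu 0 - m)" using Qn t by simp
  moreover have "mu s = moment (\<zeta> s)" if "0 \<le> s" for s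
    unfolding mu_def moment_def by (intro LINT_cong) (use FZ that in auto)
  ultimately show "norm (moment (\<zeta> t) - m) = norm (moment (\<zeta> 0) - m)" using t by simp
qed

section \<open>Stability\<close>

lemma exists_antiderivative:
  fixes g :: "real \<Rightarrow> real"
  assumes g: "continuous_on UNIV g"
  obtains G where "\<And>s. (G has_real_derivative g s) (at s)"
proof (rule that[of "\<lambda>u. LBINT y=0..u. g y"])
  fix s :: real
  \<comment> \<open>The interval contains the base point \<open>0\<close>, and \<open>s\<close> lies
    in its interior.\<close>
  have "((\<lambda>u. LBINT y=0..u. g y) has_vector_derivative g s) (at s within {- \<bar>s\<bar> - 1..\<bar>s\<bar> + 1})"
    unfolding zero_ereal_def by (rule interval_integral_FTC2) (auto intro: continuous_on_subset[OF
        g])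
  moreover have "at s within {- \<bar>s\<bar> - 1..\<bar>s\<bar> + 1} = at s"
    by (rule at_within_interior) auto
  ultimately show "((\<lambda>u. LBINT y=0..u. g y) has_real_derivative g s) (at s)"
    by (simp add: has_real_derivative_iff_has_vector_derivative)
qed

lemma lipschitz_of_derivative:
  fixes g g' :: "real \<Rightarrow> real"
  assumes g: "\<And>s. (g has_real_derivative g' s) (at s)" and b: "\<And>s. - c \<le> g' s" "\<And>s. g' s \<le> 0"
      and st: "s \<le> t"
  shows "g t \<le> g s" "g s - g t \<le> c * (t - s)"
proof -
  show "g t \<le> g s" by (rule DERIV_nonpos_imp_nonincreasing[OF st]) (use g b in blast)
  have "(\<lambda>x. g x + c * x) s \<le> (\<lambda>x. g x + c * x) t"
  proof (rule DERIV_nonneg_imp_nondecreasing[OF st])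
    fix x
    have "((\<lambda>x. g x + c * x) has_real_derivative g' x + c) (at x)"
        by (auto intro!: derivative_eq_intros g)
    then show "\<exists>y. ((\<lambda>x. g x + c * x) has_real_derivative y) (at x) \<and> 0 \<le> y" using b(1)[of x]
        by (intro exI[of _ "g' x + c"]) simp
  qed
  then show "g s - g t \<le> c * (t - s)" by (simp add: algebra_simps)
qed

text \<open>As a function of \<open>y = g s\<close>, the quantity \<open>G s - s * g s\<close> has derivative \<open>- s\<close>.\<close>

lemma legendre_strong_convexity:
  fixes g g' G :: "real \<Rightarrow> real"
  assumes g: "\<And>s. (g has_real_derivative g' s) (at s)"
      and G: "\<And>s. (G has_real_derivative g s) (at s)"
    and b: "\<And>s. - c \<le> g' s" "\<And>s. g' s \<le> 0" and c: "0 < c"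
  shows "(g s - g t)\<^sup>2 / (2 * c) \<le> (G s - s * g s) - (G t - t * g t) + t * (g s - g t)"
proof -
  define D where "D x = G x - G t - (x - t) * g x - (g x - g t)\<^sup>2 / (2 * c)" for x
  \<comment> \<open>As \<open>g\<close> is decreasing with slope at least \<open>- c\<close>, the
    bracket has the sign of \<open>x - t\<close>, and the factor in front is nonnegative. So
    \<open>D\<close> has its minimum at \<open>t\<close>, with value \<open>0\<close>.\<close>
  define D' where "D' x = - g' x * ((x - t) + (g x - g t) / c)" for x
  have dD: "(D has_real_derivative D' x) (at x)" for x
    unfolding D_def D'_def using c by (auto intro!: derivative_eq_intros g G simp: field_simps)
  have "0 \<le> D s"
  proof (cases "t \<le> s")
    case True
    have "D t \<le> D s"
    proof (rule DERIV_nonneg_imp_nondecreasing[OF True])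
      fix x assume x: "t \<le> x"
      have "- (c * (x - t)) \<le> g x - g t" using lipschitz_of_derivative(2)[OF g b x] by simp
      then have "0 \<le> (x - t) + (g x - g t) / c" using c by (simp add: field_simps)
      then have "0 \<le> D' x" using b(2)[of x] by (simp add: D'_def mult_nonpos_nonneg)
      then show "\<exists>y. (D has_real_derivative y) (at x) \<and> 0 \<le> y" using dD by blast
    qed
    then show ?thesis by (simp add: D_def)
  next
    case False
    then have "s \<le> t" by simp
    have "D t \<le> D s"
    proof (rule DERIV_nonpos_imp_nonincreasing[OF \<open>s \<le> t\<close>])
      fix x assume x: "x \<le> t"
      have "g x - g t \<le> c * (t - x)" using lipschitz_of_derivative(2)[OF g b x] by simp
      then have "(x - t) + (g x - g t) / c \<le> 0" using c by (simp add: field_simps)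
      then have "D' x \<le> 0" using b(2)[of x] by (simp add: D'_def mult_nonpos_nonpos)
      then show "\<exists>y. (D has_real_derivative y) (at x) \<and> y \<le> 0" using dD by blast
    qed
    then show ?thesis by (simp add: D_def)
  qed
  then show ?thesis by (simp add: D_def algebra_simps)
qed

text \<open>The energy is quadratic, but after factoring out \<open>f n - g n\<close> the other
  factor is bounded as soon as the potentials are; smallness in \<open>L^1\<close> then
  suffices.\<close>

lemma energy_diff_tendsto:
  assumes f: "\<And>n. continuous_on S2 (f n)" and g: "\<And>n. continuous_on S2 (g n)"
    and t: "(\<lambda>n. LINT x|area. \<bar>f n x - g n x\<bar>) \<longlonglongrightarrow> 0"
    and C: "\<forall>\<^sub>F n in sequentially. \<forall>x\<in>S2. \<bar>green 0 (f n) x\<bar> \<le> C \<and> \<bar>green 0 (g n) x\<bar> \<le> C"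
  shows "(\<lambda>n. energy \<omega> (f n) - energy \<omega> (g n)) \<longlonglongrightarrow> 0"
proof (rule tendsto_rabs_zero_cancel, rule tendsto_sandwich[OF _ _ tendsto_const])
  show "(\<lambda>n. (C + \<bar>\<omega>\<bar>) * (LINT x|area. \<bar>f n x - g n x\<bar>)) \<longlonglongrightarrow> 0"
    using tendsto_mult[OF tendsto_const t] by simp
  show "\<forall>\<^sub>F n in sequentially. \<bar>energy \<omega> (f n) - energy \<omega> (g n)\<bar>
      \<le> (C + \<bar>\<omega>\<bar>) * (LINT x|area. \<bar>f n x - g n x\<bar>)"
    using C
  proof eventually_elim
    case (elim n)
    have bd: "\<bar>(f n x - g n x) * ((green 0 (f n) x + green 0 (g n) x) / 2 - \<omega> * (north \<bullet> x))\<bar>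
        \<le> (C + \<bar>\<omega>\<bar>) * \<bar>f n x - g n x\<bar>" if x: "x \<in> S2" for x
    proof -
      have "\<bar>north \<bullet> x\<bar> \<le> 1" using Cauchy_Schwarz_ineq2[of north x] x by simp
      then have "\<bar>\<omega>\<bar> * \<bar>north \<bullet> x\<bar> \<le> \<bar>\<omega>\<bar> * 1" by (intro mult_left_mono) auto
      then have "\<bar>\<omega> * (north \<bullet> x)\<bar> \<le> \<bar>\<omega>\<bar>" by (simp add: abs_mult)
      moreover have "\<bar>green 0 (f n) x\<bar> \<le> C" "\<bar>green 0 (g n) x\<bar> \<le> C" using elim x by auto
      moreover have "\<bar>(a + b) / 2 - d\<bar> \<le> C + w" if "\<bar>d\<bar> \<le> w" "\<bar>a\<bar> \<le> C" "\<bar>b\<bar> \<le> C" for a b d w :: real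
        using that by (simp add: abs_le_iff field_simps)
      ultimately have "\<bar>(green 0 (f n) x + green 0 (g n) x) / 2 - \<omega> * (north \<bullet> x)\<bar> \<le> C + \<bar>\<omega>\<bar>"
          by blast
      then have "\<bar>f n x - g n x\<bar> * \<bar>(green 0 (f n) x + green 0 (g n) x) / 2 - \<omega> * (north \<bullet> x)\<bar>
          \<le> \<bar>f n x - g n x\<bar> * (C + \<bar>\<omega>\<bar>)"
        by (intro mult_left_mono) auto
      then show ?thesis by (simp add: abs_mult mult.commute)
    qed
    have "\<bar>energy \<omega> (f n) - energy \<omega> (g n)\<bar> \<le> (LINT x|area. (C + \<bar>\<omega>\<bar>) * \<bar>f n x - g n x\<bar>)"
      unfolding energy_diff[OF f g]
      by (rule order_trans[OF integral_abs_bound integral_mono])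
         (use bd in \<open>auto intro!: integrable_area_continuous continuous_intros f g
             green_continuous_of\<close>)
    then show ?case by simp
  qed
qed auto

lemma moment_bound:
  assumes "continuous_on S2 f" shows "norm (moment f) \<le> (LINT x|area. \<bar>f x\<bar>)"
proof -
  have "norm (moment f) \<le> (LINT x|area. norm (f x *\<^sub>R x))" unfolding moment_def
      by (rule integral_norm_bound)
  also have "\<dots> = (LINT x|area. \<bar>f x\<bar>)" by (intro LINT_cong) auto
  finally show ?thesis .
qed

lemma moment_diff:
  assumes "continuous_on S2 f" "continuous_on S2 g"
  shows "moment (\<lambda>x. f x - g x) = moment f - moment g"
  unfolding moment_def scaleR_diff_left
  by (intro LINT_diff integrable_area_continuous continuous_intros assms)

lemma continuous_on_abs_powr:
  "continuous_on A f \<Longrightarrow> 1 < p \<Longrightarrow> continuous_on A (\<lambda>x. \<bar>f x\<bar> powr p :: real)"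
  by (intro continuous_on_powr' continuous_intros) auto

section \<open>Stability for sequences of states\<close>

text \<open>\<open>A n\<close> stands for initial states and \<open>B n\<close> for later ones. They
  are linked only through conserved quantities; neither time nor the equation appears.\<close>

lemma static_stability:
  fixes A B :: "nat \<Rightarrow> real^3 \<Rightarrow> real"
  assumes p: "1 < p" and z: "continuous_on S2 z" and z0: "(LINT x|area. z x) = 0"
    and zg: "\<And>x. x \<in> S2 \<Longrightarrow> z x = g (stream \<omega> 0 z x)"
    and g: "\<And>s. (g has_real_derivative g' s) (at s)" and G: "\<And>s. (G has_real_derivative g s) (at s)"
    and b: "\<And>s. - c \<le> g' s" "\<And>s. g' s < 0" and c: "0 < c" "c < 6"
    and A: "\<And>n. continuous_on S2 (A n)" and B: "\<And>n. continuous_on S2 (B n)"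
    and B0: "\<And>n. (LINT x|area. B n x) = 0"
    and cas: "\<And>n (\<Phi> :: real \<Rightarrow> real). continuous_on UNIV \<Phi> \<Longrightarrow> (LINT x|area. \<Phi> (B n x))
        = (LINT x|area. \<Phi> (A n x))"
    and en: "\<And>n. energy \<omega> (B n) = energy \<omega> (A n)"
    and mo: "\<And>n. norm (moment (B n) - moment z) = norm (moment (A n) - moment z)"
    and tA: "(\<lambda>n. LINT x|area. \<bar>A n x - z x\<bar> powr p) \<longlonglongrightarrow> 0"
  shows "(\<lambda>n. LINT x|area. \<bar>B n x - z x\<bar> powr p) \<longlonglongrightarrow> 0"
proof -
  have b0: "\<And>s. g' s \<le> 0" using b(2) less_imp_le by blast
  obtain Bz where Bz: "bmeas Bz z" using continuous_bmeas[OF z] by blast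
  define \<eta> where "\<eta> = stream \<omega> 0 z"
  have c\<eta>: "continuous_on S2 \<eta>" unfolding \<eta>_def by (rule continuous_on_stream[OF Bz])
  obtain R where R: "0 < R" "\<And>x. x \<in> S2 \<Longrightarrow> \<bar>\<eta> x\<bar> \<le> R"
    using continuous_on_S2_bounded[OF c\<eta>] by (metis real_norm_def)
  have gs: "g t < g s" if "s < t" for s t
    by (rule DERIV_neg_imp_decreasing[OF that]) (use g b(2) in blast)
  have inj: "inj_on g X" for X by (rule linorder_inj_onI) (use gs in fastforce)+
  have cg: "continuous_on X g" for X by (rule continuous_at_imp_continuous_on) (use g DERIV_isCont
      in blast)
  define l u where "l = g R" and "u = g (- R)"
  have lu: "l < u" unfolding l_def u_def by (rule gs) (use R in simp)
  have mono: "g t \<le> g s" if "s \<le> t" for s t using lipschitz_of_derivative(1)[OF g b(1) b0 that] .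
  have img: "g ` {- R..R} = {l..u}"
  proof
    show "g ` {- R..R} \<subseteq> {l..u}" using mono by (auto simp: l_def u_def)
    show "{l..u} \<subseteq> g ` {- R..R}"
    proof
      fix y assume "y \<in> {l..u}"
      then have "g R \<le> y" "y \<le> g (- R)" by (auto simp: l_def u_def)
      then obtain s where "- R \<le> s" "s \<le> R" "g s = y" using IVT2'[of g R y "- R"] cg R by auto
      then show "y \<in> g ` {- R..R}" by auto
    qed
  qed
  \<comment> \<open>The inverse of \<open>g\<close> on the compact range \<open>{l..u}\<close> that
    contains the values of \<open>z\<close>. There it is continuous and bounded by \<open>R\<close>,
    and \<open>\<sigma> (z x)\<close> is the stream function of the steady state.\<close>
  define \<sigma> where "\<sigma> = inv_into {- R..R} g"
  have \<sigma>: "\<sigma> (g s) = s" if "s \<in> {- R..R}" for s unfolding \<sigma>_def by (rule inv_into_f_f[OF inj that])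
  have \<sigma>g: "g (\<sigma> y) = y" "\<sigma> y \<in> {- R..R}" if "y \<in> {l..u}" for y
    unfolding \<sigma>_def using that unfolding img[symmetric] by (rule f_inv_into_f, rule inv_into_into)
  have c\<sigma>: "continuous_on {l..u} \<sigma>"
    unfolding img[symmetric] by (rule continuous_on_inv[OF cg]) (auto simp: \<sigma>)
  \<comment> \<open>Truncation to the range of \<open>z\<close>: it removes the part of the perturbation on which \<open>\<Phi>\<close> cannot
    be defined, and this part has a conserved norm.\<close>
  define T where "T y = max l (min u y)" for y
  have cT: "continuous_on X T" for X unfolding T_def by (intro continuous_intros)
  have TI: "T y \<in> {l..u}" for y using lu by (auto simp: T_def)
  have TT: "T (T y) = T y" for y using lu by (auto simp: T_def)
  have Tid: "T y = y" if "y \<in> {l..u}" for y using that by (auto simp: T_def)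
  have zI: "z x \<in> {l..u}" if "x \<in> S2" for x
  proof -
    have "\<eta> x \<in> {- R..R}" using R(2)[OF that] by (simp add: abs_le_iff)
    then have "g (\<eta> x) \<in> {l..u}" unfolding img[symmetric] by (rule imageI)
    then show ?thesis using zg[OF that] by (simp add: \<eta>_def)
  qed
  have \<sigma>z: "\<sigma> (z x) = \<eta> x" if "x \<in> S2" for x
  proof -
    have "\<eta> x \<in> {- R..R}" using R(2)[OF that] by (simp add: abs_le_iff)
    then show ?thesis using zg[OF that] \<sigma>[of "\<eta> x"] by (simp add: \<eta>_def)
  qed
  \<comment> \<open>Composition with \<open>T\<close> continues the function by constants beyond
    \<open>{l..u}\<close>, so that it is continuous on the whole line and its integral is among the
    conserved ones.\<close>
  define \<Phi> where "\<Phi> y = G (\<sigma> (T y)) - \<sigma> (T y) * T y" for y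
  have cG: "continuous_on X G" for X by (rule continuous_at_imp_continuous_on) (use G DERIV_isCont
      in blast)
  have c\<Phi>: "continuous_on UNIV \<Phi>"
    unfolding \<Phi>_def
    by (intro continuous_intros continuous_on_compose2[OF cG[of UNIV]] continuous_on_compose2[OF c\<sigma>
        cT] cT)
       (use TI in auto)
  have \<Phi>T: "\<Phi> (T y) = \<Phi> y" for y by (simp add: \<Phi>_def TT)
  have leg: "(y - w)\<^sup>2 / (2 * c) \<le> \<Phi> y - \<Phi> w + \<sigma> w * (y - w)" if "y \<in> {l..u}" "w \<in> {l..u}" for y w
    using legendre_strong_convexity[OF g G b(1) b0 c(1), of "\<sigma> y" "\<sigma> w"] \<sigma>g that
        by (simp add: \<Phi>_def Tid)
  \<comment> \<open>Convexity is used at both points; the slopes are values of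
    \<open>\<sigma>\<close>, hence bounded by \<open>R\<close>.\<close>
  have \<Phi>lip: "\<bar>\<Phi> y - \<Phi> w\<bar> \<le> R * \<bar>y - w\<bar>" if "y \<in> {l..u}" "w \<in> {l..u}" for y w
  proof -
    have *: "- (R * \<bar>y - w\<bar>) \<le> \<Phi> y - \<Phi> w" if "y \<in> {l..u}" "w \<in> {l..u}" for y w
    proof -
      have "0 \<le> (y - w)\<^sup>2 / (2 * c)" using c by simp
      then have "0 \<le> \<Phi> y - \<Phi> w + \<sigma> w * (y - w)" using leg[OF that] by linarith
      moreover have "\<bar>\<sigma> w * (y - w)\<bar> \<le> R * \<bar>y - w\<bar>"
        unfolding abs_mult using \<sigma>g(2)[OF that(2)] by (intro mult_right_mono) auto
      ultimately show ?thesis by linarith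
    qed
    show ?thesis using *[OF that] *[OF that(2,1)] by (simp add: abs_minus_commute)
  qed
  \<comment> \<open>\<open>T\<close> is the nearest-point map onto the interval; for
    \<open>w\<close> inside it, \<open>y - T y\<close> and \<open>T y - w\<close> have the same sign
    and add up to \<open>y - w\<close>.\<close>
  have near: "\<bar>y - T y\<bar> \<le> \<bar>y - w\<bar>" "\<bar>T y - w\<bar> \<le> \<bar>y - w\<bar>" if "w \<in> {l..u}" for y w
    using that lu by (auto simp: T_def)
  define TA TB dA dB where "TA n x = T (A n x)" and "TB n x = T (B n x)"
    and "dA n x = A n x - T (A n x)" and "dB n x = B n x - T (B n x)" for n x
  have cTA: "continuous_on S2 (TA n)" and cTB: "continuous_on S2 (TB n)" for n
    unfolding TA_def TB_def by (intro continuous_on_compose2[OF cT[of UNIV]] A B, simp)+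
  have cdA: "continuous_on S2 (dA n)" and cdB: "continuous_on S2 (dB n)" for n
    using continuous_on_diff[OF A cTA] continuous_on_diff[OF B cTB]
        by (simp_all add: dA_def dB_def TA_def TB_def)
  note abp = continuous_on_abs_powr[OF _ p]
  have ip: "integrable area (\<lambda>x. \<bar>f x\<bar> powr p)" if "continuous_on S2 f" for f
    by (intro integrable_area_continuous abp that)
  have small: "(\<lambda>n. LINT x|area. \<bar>f n x\<bar> powr p) \<longlonglongrightarrow> 0"
    if f: "\<And>n. continuous_on S2 (f n)" and le: "\<And>n x. x \<in> S2 \<Longrightarrow> \<bar>f n x\<bar> \<le> \<bar>A n x - z x\<bar>" for f
  proof (rule tendsto_sandwich[OF _ _ tendsto_const tA])
    show "\<forall>\<^sub>F n in sequentially. (LINT x|area. \<bar>f n x\<bar> powr p)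
        \<le> (LINT x|area. \<bar>A n x - z x\<bar> powr p)"
      using p le by (intro always_eventually allI integral_mono ip f continuous_intros A z
          powr_mono2) auto
  qed auto
  have L1: "(\<lambda>n. LINT x|area. \<bar>f n x\<bar>) \<longlonglongrightarrow> 0"
    if "\<And>n. continuous_on S2 (f n)" "(\<lambda>n. LINT x|area. \<bar>f n x\<bar> powr p) \<longlonglongrightarrow> 0" for f
    by (rule Lr_to_L1(2)[OF p borel_measurable_area_continuous[OF that(1)] ip[OF that(1)] that(2)])
  have KU: "uniform_limit S2 (\<lambda>n. green 0 (f n)) (\<lambda>x. 0) sequentially"
    if "\<And>n. continuous_on S2 (f n)" "(\<lambda>n. LINT x|area. \<bar>f n x\<bar> powr p) \<longlonglongrightarrow> 0" for f
    by (rule Lr_green_uniform[OF p borel_measurable_area_continuous[OF that(1)] ip[OF that(1)]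
        that(2)])
  have pA: "(\<lambda>n. LINT x|area. \<bar>dA n x\<bar> powr p) \<longlonglongrightarrow> 0"
    by (rule small[OF cdA]) (use near(1)[OF zI] in \<open>auto simp: dA_def\<close>)
  have pB: "(\<lambda>n. LINT x|area. \<bar>dB n x\<bar> powr p) \<longlonglongrightarrow> 0"
  proof -
    have "continuous_on UNIV (\<lambda>y. \<bar>y - T y\<bar> powr p)" by (intro abp continuous_intros cT)
    from cas[OF this] show ?thesis using pA by (simp add: dA_def dB_def)
  qed
  have pE: "(\<lambda>n. LINT x|area. \<bar>TA n x - z x\<bar> powr p) \<longlonglongrightarrow> 0"
    by (rule small) (use near(2)[OF zI] in \<open>auto simp: TA_def intro!: continuous_intros cTA[unfolded
        TA_def] z\<close>)
  have cE: "continuous_on S2 (\<lambda>x. TA n x - z x)" for n by (intro continuous_intros cTA z)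
  have cAz: "continuous_on S2 (\<lambda>x. A n x - z x)" for n by (intro continuous_intros A z)
  note dA1 = L1[OF cdA pA] and dB1 = L1[OF cdB pB] and E1 = L1[OF cE pE] and A1 = L1[OF cAz tA]
  define K0 where "K0 = 30 * max \<bar>l\<bar> \<bar>u\<bar>"
  have bmI: "bmeas (max \<bar>l\<bar> \<bar>u\<bar>) f" if "continuous_on S2 f" "\<And>x. x \<in> S2 \<Longrightarrow> f x \<in> {l..u}" for f
    unfolding bmeas_def using borel_measurable_area_continuous[OF that(1)] that(2)
        by (fastforce simp: abs_le_iff le_max_iff_disj)
  have Kb: "\<bar>green 0 f x\<bar> \<le> K0" if "continuous_on S2 f" "\<And>x. x \<in> S2 \<Longrightarrow> f x \<in> {l..u}" "x \<in> S2" for f x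
    unfolding K0_def by (rule green_bound[OF _ _ that(3) bmI[OF that(1,2)]]) auto
  have KTA: "\<bar>green 0 (TA n) x\<bar> \<le> K0" and KTB: "\<bar>green 0 (TB n) x\<bar> \<le> K0"
      and Kz: "\<bar>green 0 z x\<bar> \<le> K0" if "x \<in> S2" for n x
    using that TI by (auto intro!: Kb cTA cTB z zI simp: TA_def TB_def simp del: atLeastAtMost_iff
        mem_sphere_0)
  \<comment> \<open>The states themselves have no uniform bound. But they differ from functions with
    bounded potential by something that tends to \<open>0\<close> in \<open>L^p\<close>, and the
    potential of that difference is eventually below \<open>1\<close>.\<close>
  have Kfull: "\<forall>\<^sub>F n in sequentially. \<forall>x\<in>S2. \<bar>green 0 (f n) x\<bar> \<le> K0 + 1 \<and> \<bar>green 0 (h n) x\<bar>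
      \<le> K0 + 1"
    if f: "\<And>n. continuous_on S2 (f n)" and h: "\<And>n. continuous_on S2 (h n)"
      and d: "(\<lambda>n. LINT x|area. \<bar>f n x - h n x\<bar> powr p) \<longlonglongrightarrow> 0"
          and hK: "\<And>n x. x \<in> S2 \<Longrightarrow> \<bar>green 0 (h n) x\<bar> \<le> K0" for f h
  proof -
    have cd: "continuous_on S2 (\<lambda>x. f n x - h n x)" for n by (intro continuous_intros f h)
    show ?thesis
      using uniform_limitD[OF KU[OF cd d] zero_less_one]
    proof eventually_elim
      case (elim n)
      obtain F where F: "bmeas F (f n)" using continuous_bmeas[OF f] by blast
      obtain H where H: "bmeas H (h n)" using continuous_bmeas[OF h] by blast
      show ?case
      proof
        fix x assume x: "x \<in> S2"
        have "\<bar>green 0 (\<lambda>x. f n x - h n x) x\<bar> < 1" using elim x by (auto simp: dist_real_def)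
        then show "\<bar>green 0 (f n) x\<bar> \<le> K0 + 1 \<and> \<bar>green 0 (h n) x\<bar> \<le> K0 + 1"
          using hK[OF x, of n] unfolding green_diff[OF F H x] by linarith
      qed
    qed
  qed
  have eA: "(\<lambda>n. energy \<omega> (A n) - energy \<omega> (TA n)) \<longlonglongrightarrow> 0"
    by (rule energy_diff_tendsto[OF A cTA _ Kfull[OF A cTA _ KTA]]) (use dA1 pA in \<open>simp_all add:
        dA_def TA_def\<close>)
  have eB: "(\<lambda>n. energy \<omega> (B n) - energy \<omega> (TB n)) \<longlonglongrightarrow> 0"
    by (rule energy_diff_tendsto[OF B cTB _ Kfull[OF B cTB _ KTB]]) (use dB1 pB in \<open>simp_all add:
        dB_def TB_def\<close>)
  have eE: "(\<lambda>n. energy \<omega> (TA n) - energy \<omega> z) \<longlonglongrightarrow> 0"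
    by (rule energy_diff_tendsto[OF cTA z _ Kfull[OF cTA z _ Kz]]) (use E1 pE in simp_all)
  \<comment> \<open>The chain of comparisons runs from \<open>TB n\<close> through
    \<open>B n\<close>, \<open>A n\<close> and \<open>TA n\<close> to \<open>z\<close>; the middle
    link is conservation of energy, and the others are closeness in \<open>L^1\<close>.\<close>
  have e: "(\<lambda>n. energy \<omega> (TB n) - energy \<omega> z) \<longlonglongrightarrow> 0"
    using tendsto_add[OF tendsto_diff[OF eA eB] eE] by (simp add: en)
  have ci\<Phi>: "continuous_on S2 (\<lambda>x. \<Phi> (f x))" if "continuous_on S2 f" for f
    by (rule continuous_on_compose2[OF c\<Phi> that]) auto
  \<comment> \<open>Conservation replaces \<open>TB n\<close> by \<open>TA n\<close>, since
    \<open>\<Phi>\<close> does not see the truncation; the initial states are close to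
    \<open>z\<close>, and \<open>\<Phi>\<close> is Lipschitz on the range.\<close>
  have ph: "(\<lambda>n. (LINT x|area. \<Phi> (TB n x)) - (LINT x|area. \<Phi> (z x))) \<longlonglongrightarrow> 0"
  proof (rule tendsto_rabs_zero_cancel, rule tendsto_sandwich[OF _ _ tendsto_const])
    show "(\<lambda>n. R * (LINT x|area. \<bar>TA n x - z x\<bar>)) \<longlonglongrightarrow> 0" using tendsto_mult[OF tendsto_const E1]
        by simp
    show "\<forall>\<^sub>F n in sequentially. \<bar>(LINT x|area. \<Phi> (TB n x)) - (LINT x|area. \<Phi> (z x))\<bar>
        \<le> R * (LINT x|area. \<bar>TA n x - z x\<bar>)"
    proof (intro always_eventually allI)
      fix n
      have "(LINT x|area. \<Phi> (TB n x)) = (LINT x|area. \<Phi> (TA n x))"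
        unfolding TA_def TB_def \<Phi>T by (rule cas[OF c\<Phi>])
      then have "(LINT x|area. \<Phi> (TB n x)) - (LINT x|area. \<Phi> (z x))
          = (LINT x|area. \<Phi> (TA n x) - \<Phi> (z x))"
        by (simp add: LINT_diff[OF integrable_area_continuous[OF ci\<Phi>[OF cTA]]
            integrable_area_continuous[OF ci\<Phi>[OF z]]])
      also have "\<bar>\<dots>\<bar> \<le> (LINT x|area. R * \<bar>TA n x - z x\<bar>)"
      proof (rule order_trans[OF integral_abs_bound integral_mono])
        show "\<bar>\<Phi> (TA n x) - \<Phi> (z x)\<bar> \<le> R * \<bar>TA n x - z x\<bar>" if "x \<in> space area" for x
          using \<Phi>lip[OF TI zI, of x "A n x"] that by (simp add: TA_def)
      qed (auto intro!: integrable_area_continuous continuous_intros ci\<Phi> cTA z)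
      finally show "\<bar>(LINT x|area. \<Phi> (TB n x)) - (LINT x|area. \<Phi> (z x))\<bar>
          \<le> R * (LINT x|area. \<bar>TA n x - z x\<bar>)" by simp
    qed
  qed auto
  define h where "h n x = TB n x - z x" for n x
  have ch: "continuous_on S2 (h n)" for n unfolding h_def by (intro continuous_intros cTB z)
  \<comment> \<open>Truncation destroys the zero mean, but \<open>B n\<close> and \<open>z\<close>
    both have it, so the mean of \<open>h n\<close> is minus that of the discarded part.\<close>
  have ih: "(\<lambda>n. LINT x|area. h n x) \<longlonglongrightarrow> 0"
  proof (rule tendsto_rabs_zero_cancel, rule tendsto_sandwich[OF _ _ tendsto_const dB1])
    show "\<forall>\<^sub>F n in sequentially. \<bar>LINT x|area. h n x\<bar> \<le> (LINT x|area. \<bar>dB n x\<bar>)"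
    proof (intro always_eventually allI)
      fix n
      have "h n = (\<lambda>x. B n x - dB n x - z x)" by (auto simp: h_def TB_def dB_def)
      then have "(LINT x|area. h n x) = (LINT x|area. B n x) - (LINT x|area. dB n x)
          - (LINT x|area. z x)"
        by (simp add: LINT_diff integrable_area_continuous B cdB z)
      then have "\<bar>LINT x|area. h n x\<bar> = \<bar>LINT x|area. dB n x\<bar>" by (simp add: B0 z0)
      also have "\<dots> \<le> (LINT x|area. \<bar>dB n x\<bar>)" by (rule integral_abs_bound)
      finally show "\<bar>LINT x|area. h n x\<bar> \<le> (LINT x|area. \<bar>dB n x\<bar>)" .
    qed
  qed auto
  \<comment> \<open>The distance between the moments of \<open>B n\<close> and \<open>z\<close> is
    the one of the initial states, which tends to \<open>0\<close>; the discarded part adds a small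
    error.\<close>
  have mh: "(\<lambda>n. norm (moment (h n))) \<longlonglongrightarrow> 0"
  proof (rule tendsto_sandwich[OF _ _ tendsto_const])
    show "(\<lambda>n. (LINT x|area. \<bar>A n x - z x\<bar>) + (LINT x|area. \<bar>dB n x\<bar>)) \<longlonglongrightarrow> 0"
      using tendsto_add[OF A1 dB1] by simp
    show "\<forall>\<^sub>F n in sequentially. norm (moment (h n))
        \<le> (LINT x|area. \<bar>A n x - z x\<bar>) + (LINT x|area. \<bar>dB n x\<bar>)"
    proof (intro always_eventually allI)
      fix n
      have "h n = (\<lambda>x. (B n x - z x) - dB n x)" by (auto simp: h_def TB_def dB_def)
      then have "moment (h n) = moment (B n) - moment z - moment (dB n)"
        using moment_diff[OF continuous_on_diff[OF B z] cdB] moment_diff[OF B z] by simp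
      then have "norm (moment (h n)) \<le> norm (moment (B n) - moment z) + norm (moment (dB n))"
        by (metis norm_triangle_ineq4)
      also have "norm (moment (B n) - moment z) = norm (moment (\<lambda>x. A n x - z x))"
        using mo moment_diff[OF A z] by simp
      also have "norm (moment (\<lambda>x. A n x - z x)) + norm (moment (dB n))
          \<le> (LINT x|area. \<bar>A n x - z x\<bar>) + (LINT x|area. \<bar>dB n x\<bar>)"
        by (intro add_mono moment_bound cAz cdB)
      finally show "norm (moment (h n)) \<le> (LINT x|area. \<bar>A n x - z x\<bar>) + (LINT x|area. \<bar>dB n x\<bar>)" .
    qed
  qed auto
  \<comment> \<open>The coefficient of coercivity: \<open>1 / (2 * c)\<close> comes from convexity,
    \<open>1/12\<close> is half of the spectral bound \<open>1/6\<close>, and \<open>c < 6\<close>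
    makes the difference positive.\<close>
  define q where "q = 1 / (2 * c) - 1 / 12"
  have q: "0 < q" using c by (simp add: q_def field_simps)
  define rhs where "rhs n = ((LINT x|area. \<Phi> (TB n x)) - (LINT x|area. \<Phi> (z x))) - (energy \<omega> (TB n)
      - energy \<omega> z)
      + 15 / total_area * (LINT x|area. h n x)\<^sup>2 + 1 / total_area * (norm (moment (h n)))\<^sup>2" for n
  \<comment> \<open>Convexity of \<open>\<Phi>\<close> at \<open>z\<close> is combined with the
    expansion of the energy at \<open>z\<close>. The linear terms carry the stream function
    \<open>\<eta>\<close> with opposite signs and cancel; half the quadratic form of
    \<open>green 0\<close> in \<open>h n\<close> remains and is estimated by the spectral
    gap.\<close>
  have main: "q * (LINT x|area. (h n x)\<^sup>2) \<le> rhs n" for n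
  proof -
    have cKh: "continuous_on S2 (green 0 (h n))" by (rule green_continuous_of[OF ch])
    have "(1 / (2 * c)) * (LINT x|area. (h n x)\<^sup>2) = (LINT x|area. (h n x)\<^sup>2 / (2 * c))" by simp
    also have "\<dots> \<le> (LINT x|area. \<Phi> (TB n x) - \<Phi> (z x) + \<eta> x * h n x)"
    proof (rule integral_mono)
      fix x assume "x \<in> space area"
      then have x: "x \<in> S2" by simp
      show "(h n x)\<^sup>2 / (2 * c) \<le> \<Phi> (TB n x) - \<Phi> (z x) + \<eta> x * h n x"
        using leg[OF TI zI[OF x], of "B n x"] by (simp add: h_def TB_def \<sigma>z[OF x])
    qed (use c in \<open>auto intro!: integrable_area_continuous continuous_intros ch ci\<Phi> cTB z c\<eta>\<close>)
    also have "\<dots> = ((LINT x|area. \<Phi> (TB n x)) - (LINT x|area. \<Phi> (z x))) + (LINT x|area. \<eta> x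
        * h n x)"
      by (simp add: LINT_diff LINT_add integrable_area_continuous continuous_on_mult ci\<Phi> cTB z c\<eta>
          ch)
    also have "(LINT x|area. \<eta> x * h n x)
        = - (energy \<omega> (TB n) - energy \<omega> z) + (1/2) * (LINT x|area. h n x * green 0 (h n) x)"
    proof -
      have Kh: "green 0 (TB n) x = green 0 z x + green 0 (h n) x" if x: "x \<in> S2" for x
      proof -
        obtain C where C: "bmeas C (TB n)" using continuous_bmeas[OF cTB] by blast
        have "h n = (\<lambda>x. TB n x - z x)" by (auto simp: h_def)
        then show ?thesis using green_diff[OF C Bz x] by simp
      qed
      have "energy \<omega> (TB n) - energy \<omega> z
          = (LINT x|area. (1/2) * (h n x * green 0 (h n) x) - \<eta> x * h n x)"
        unfolding energy_diff[OF cTB z]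
      proof (intro LINT_cong refl)
        fix x assume "x \<in> space area"
        then have x: "x \<in> S2" by simp
        show "(TB n x - z x) * ((green 0 (TB n) x + green 0 z x) / 2 - \<omega> * (north \<bullet> x))
            = (1/2) * (h n x * green 0 (h n) x) - \<eta> x * h n x"
          unfolding Kh[OF x] h_def[symmetric] \<eta>_def stream_def by (simp add: field_simps)
      qed
      also have "\<dots> = (LINT x|area. (1/2) * (h n x * green 0 (h n) x)) - (LINT x|area. \<eta> x * h n x)"
        by (intro LINT_diff integrable_area_continuous continuous_intros ch cKh c\<eta>)
      finally show ?thesis by simp
    qed
    finally have 1: "(1 / (2 * c)) * (LINT x|area. (h n x)\<^sup>2)
        \<le> ((LINT x|area. \<Phi> (TB n x)) - (LINT x|area. \<Phi> (z x))) +
      (- (energy \<omega> (TB n) - energy \<omega> z) + (1/2) * (LINT x|area. h n x * green 0 (h n) x))" .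
    define S1 S2' S3 where "S1 = (LINT x|area. (h n x)\<^sup>2)"
        and "S2' = (LINT x|area. h n x)\<^sup>2 / total_area"
        and "S3 = (norm (moment (h n)))\<^sup>2 / total_area"
    have "(LINT x|area. h n x * green 0 (h n) x) \<le> (1/6) * S1 + 30 * S2' + 2 * S3"
      using spectral_gap[OF ch[of n]] by (simp add: S1_def S2'_def S3_def)
    then have "(1 / (2 * c)) * S1 \<le> ((LINT x|area. \<Phi> (TB n x)) - (LINT x|area. \<Phi> (z x)))
        - (energy \<omega> (TB n) - energy \<omega> z) + (1/12) * S1 + 15 * S2' + S3"
      using 1 unfolding S1_def[symmetric] by linarith
    then show ?thesis unfolding rhs_def q_def S1_def[symmetric] left_diff_distrib
        by (simp add: S2'_def S3_def)
  qed
  have "rhs \<longlonglongrightarrow> 0"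
    unfolding rhs_def by (rule tendsto_eq_intros ph e ih mh refl)+ simp
  have h2: "(\<lambda>n. LINT x|area. (h n x)\<^sup>2) \<longlonglongrightarrow> 0"
  proof (rule tendsto_sandwich[OF _ _ tendsto_const])
    show "(\<lambda>n. rhs n / q) \<longlonglongrightarrow> 0" using tendsto_divide[OF \<open>rhs \<longlonglongrightarrow> 0\<close> tendsto_const[of q]] q by simp
    show "\<forall>\<^sub>F n in sequentially. (LINT x|area. (h n x)\<^sup>2) \<le> rhs n / q"
      using main q by (intro always_eventually allI) (simp add: field_simps)
  qed auto
  have hb: "\<bar>h n x\<bar> \<le> u - l" if "x \<in> S2" for n x
    using TI[of "B n x"] zI[OF that] by (auto simp: h_def TB_def)
  have hp: "(\<lambda>n. LINT x|area. \<bar>h n x\<bar> powr p) \<longlonglongrightarrow> 0"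
  proof (rule tendstoI)
    fix r :: real assume r: "0 < r"
    \<comment> \<open>The threshold below which values of \<open>h n\<close> contribute at most
      \<open>r / 2\<close> to the integral of the \<open>p\<close>-th power.\<close>
    define k where "k = (r / (2 * total_area)) powr (1 / p)"
    have k: "0 < k" "k powr p * total_area = r / 2"
      using r measure_area_pos p by (auto simp: k_def powr_powr)
    define D where "D = (u - l) powr p / k\<^sup>2"
    \<comment> \<open>Above the threshold \<open>k\<close>, the \<open>p\<close>-th power is at most
      \<open>(u - l) powr p\<close>, and \<open>(h n x)\<^sup>2 / k\<^sup>2\<close> is at least
      \<open>1\<close>. This split works for \<open>p\<close> on either side of \<open>2\<close>,
      and it is where the uniform bound from the truncation enters.\<close>
    have pt: "\<bar>h n x\<bar> powr p \<le> k powr p + D * (h n x)\<^sup>2" if "x \<in> S2" for n x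
    proof (cases "\<bar>h n x\<bar> \<le> k")
      case True
      have "\<bar>h n x\<bar> powr p \<le> k powr p" using True p by (intro powr_mono2) auto
      moreover have "0 \<le> D * (h n x)\<^sup>2" by (simp add: D_def)
      ultimately show ?thesis by linarith
    next
      case False
      have "\<bar>h n x\<bar> powr p \<le> (u - l) powr p * 1" using hb[OF that] p by (auto intro!: powr_mono2)
      also have "1 \<le> (h n x)\<^sup>2 / k\<^sup>2"
        using False k power_mono[of k "\<bar>h n x\<bar>" 2] by simp
      then have "(u - l) powr p * 1 \<le> (u - l) powr p * ((h n x)\<^sup>2 / k\<^sup>2)"
          by (intro mult_left_mono) auto
      also have "\<dots> = D * (h n x)\<^sup>2" by (simp add: D_def)
      finally show ?thesis using powr_ge_zero[of k p] by linarith
    qed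
    have "(\<lambda>n. D * (LINT x|area. (h n x)\<^sup>2)) \<longlonglongrightarrow> D * 0" by (intro tendsto_intros h2)
    then have "\<forall>\<^sub>F n in sequentially. D * (LINT x|area. (h n x)\<^sup>2) < r / 2"
      using r by (intro order_tendstoD(2)) auto
    then show "\<forall>\<^sub>F n in sequentially. dist (LINT x|area. \<bar>h n x\<bar> powr p) 0 < r"
    proof eventually_elim
      case (elim n)
      have "(LINT x|area. \<bar>h n x\<bar> powr p) \<le> (LINT x|area. k powr p + D * (h n x)\<^sup>2)"
        by (intro integral_mono ip ch) (use pt in \<open>auto intro!: integrable_area_continuous
            continuous_intros ch\<close>)
      also have "\<dots> = k powr p * total_area + D * (LINT x|area. (h n x)\<^sup>2)"
        by (subst LINT_add) (auto intro!: integrable_area_continuous continuous_intros ch)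
      also have "\<dots> < r" using elim k by simp
      finally have "(LINT x|area. \<bar>h n x\<bar> powr p) < r" .
      moreover have "0 \<le> (LINT x|area. \<bar>h n x\<bar> powr p)" by (rule integral_nonneg_AE) auto
      ultimately show ?case by simp
    qed
  qed
  show ?thesis
  proof (rule tendsto_sandwich[OF _ _ tendsto_const])
    show "(\<lambda>n. 2 powr p * ((LINT x|area. \<bar>h n x\<bar> powr p) + (LINT x|area. \<bar>dB n x\<bar> powr p))) \<longlonglongrightarrow> 0"
      using tendsto_mult[OF tendsto_const tendsto_add[OF hp pB]] by simp
    show "\<forall>\<^sub>F n in sequentially. (LINT x|area. \<bar>B n x - z x\<bar> powr p)
        \<le> 2 powr p * ((LINT x|area. \<bar>h n x\<bar> powr p) + (LINT x|area. \<bar>dB n x\<bar> powr p))"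
    proof (intro always_eventually allI)
      fix n
      have "(LINT x|area. \<bar>B n x - z x\<bar> powr p)
          \<le> (LINT x|area. 2 powr p * (\<bar>h n x\<bar> powr p + \<bar>dB n x\<bar> powr p))"
      proof (rule integral_mono)
        fix x
        have "\<bar>B n x - z x\<bar> \<le> \<bar>h n x\<bar> + \<bar>dB n x\<bar>" by (simp add: h_def TB_def dB_def)
        then have "\<bar>B n x - z x\<bar> powr p \<le> (\<bar>h n x\<bar> + \<bar>dB n x\<bar>) powr p" using p
            by (intro powr_mono2) auto
        also have "\<dots> \<le> 2 powr p * (\<bar>h n x\<bar> powr p + \<bar>dB n x\<bar> powr p)"
            by (rule powr_add_le[OF p]) auto
        finally show "\<bar>B n x - z x\<bar> powr p \<le> 2 powr p * (\<bar>h n x\<bar> powr p + \<bar>dB n x\<bar> powr p)" .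
      qed (intro ip integrable_mult_right area_integrable_add continuous_intros B z ch cdB)+
      also have "\<dots> = 2 powr p * ((LINT x|area. \<bar>h n x\<bar> powr p) + (LINT x|area. \<bar>dB n x\<bar> powr p))"
        by (simp add: LINT_add[OF ip[OF ch] ip[OF cdB]])
      finally show "(LINT x|area. \<bar>B n x - z x\<bar> powr p)
          \<le> 2 powr p * ((LINT x|area. \<bar>h n x\<bar> powr p) + (LINT x|area. \<bar>dB n x\<bar> powr p))" .
    qed
  qed auto
qed

theorem theorem5p7:
  fixes p \<omega> :: real
    and zt \<psi> :: "real^3 \<Rightarrow> real"
    and g g' :: "real \<Rightarrow> real"
  assumes "1 < p"
    and "in_Lp0 p zt"
    and "inv_laplacian p zt \<psi>"
    and "AE x in area. zt x = g (\<omega> * x $ 3 - \<psi> x)"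
    and "\<And>s. (g has_real_derivative g' s) (at s)"
    and "continuous_on UNIV g'"
    and "\<And>s. g' s < 0"
    and "(INF s. ereal (g' s)) > - 6"
  shows "\<forall>\<epsilon>>0. \<exists>\<delta>>0. \<forall>\<zeta>. smooth_solution \<omega> \<zeta> \<longrightarrow>
           Lp_norm p (\<lambda>x. \<zeta> 0 x - zt x) < \<delta> \<longrightarrow>
           (\<forall>t>0. Lp_norm p (\<lambda>x. \<zeta> t x - zt x) < \<epsilon>)"
proof -
  note p = assms(1) and g = assms(5)
  have mzt: "zt \<in> borel_measurable area" and zt0: "(LINT x|area. zt x) = 0"
    using assms(2) by (auto simp: in_Lp0_def in_Lp_def)
  \<comment> \<open>A number strictly between \<open>-6\<close> and the infimum gives the slope
    bound; the maximum with \<open>1\<close> makes positivity of \<open>c\<close> immediate and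
    keeps it below \<open>6\<close>.\<close>
  obtain c where c: "0 < c" "c < 6" "\<And>s. - c \<le> g' s"
  proof -
    obtain y where y: "- 6 < ereal y" "ereal y < (INF s. ereal (g' s))"
        using ereal_dense2[OF assms(8)] by blast
    have "- 6 < y" using y(1) by (metis less_ereal.simps(1) uminus_ereal.simps(1) numeral_eq_ereal)
    moreover have "y < g' s" for s using less_INF_D[OF y(2), of s] by simp
    moreover have "- max 1 (- y) \<le> y" using max.cobounded2[of "- y" 1] by linarith
    ultimately have "- max 1 (- y) \<le> g' s" "max 1 (- y) < 6" for s
      by (blast intro: order_trans less_imp_le, simp)
    then show thesis by (intro that[of "max 1 (- y)"]) auto
  qed
  have cg: "continuous_on X g" for X by (rule continuous_at_imp_continuous_on) (use g DERIV_isCont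
      in blast)
  obtain G where G: "\<And>s. (G has_real_derivative g s) (at s)" using exists_antiderivative[OF cg]
      by blast
  note K = inv_laplacian_green[OF p assms(3)]
  \<comment> \<open>The continuous representative of \<open>zt\<close>: the potential of
    \<open>zt\<close> is continuous, and so is \<open>g\<close> of the stream function. As
    potentials ignore null sets, \<open>z\<close> satisfies the steady relation at every
    point.\<close>
  define z where "z x = g (stream \<omega> 0 zt x)" for x
  have cz: "continuous_on S2 z"
    unfolding z_def stream_def by (intro continuous_on_compose2[OF cg[of UNIV]] continuous_intros K)
        auto
  have ae: "AE x in area. zt x = z x"
    using assms(4) K(2) by eventually_elim (simp add: z_def stream_def inner_axis')
  have Kz: "green 0 z = green 0 zt"
    unfolding green_def fun_eq_iff
  proof (intro allI arg_cong2[where f = "(*)"] refl integral_cong_AE)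
    fix x
    show "AE y in area. z y * log_ker 0 (x \<bullet> y) = zt y * log_ker 0 (x \<bullet> y)" using ae
        by eventually_elim simp
  qed (use mzt borel_measurable_area_continuous[OF cz] in measurable)
  have zg: "z x = g (stream \<omega> 0 z x)" for x unfolding stream_def Kz by (simp add: z_def stream_def)
  have z0: "(LINT x|area. z x) = 0"
    using integral_cong_AE[OF mzt borel_measurable_area_continuous[OF cz] ae] zt0 by simp
  have L: "\<bar>g s - g t\<bar> \<le> c * \<bar>s - t\<bar>" for s t
  proof -
    have b0: "\<And>s. g' s \<le> 0" using assms(7) less_imp_le by blast
    show ?thesis
      using lipschitz_of_derivative[OF g c(3) b0, of s t] lipschitz_of_derivative[OF g c(3) b0, of t
          s] by (cases "s \<le> t") auto
  qed
  have m: "\<omega> *\<^sub>R cross3 (moment z) north = 0" by (rule steady_moment[OF cz zg G L])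
  have Lp: "Lp_norm p (\<lambda>x. f x - zt x) = (LINT x|area. \<bar>f x
      - z x\<bar> powr p) powr (1 / p)" if f: "continuous_on S2 f" for f
  proof -
    have "(LINT x|area. norm (f x - zt x) powr p) = (LINT x|area. \<bar>f x - z x\<bar> powr p)"
    proof (rule integral_cong_AE)
      show "AE x in area. norm (f x - zt x) powr p = \<bar>f x - z x\<bar> powr p" using ae
          by eventually_elim simp
    qed (use mzt borel_measurable_area_continuous[OF cz] borel_measurable_area_continuous[OF f] in
        measurable)
    then show ?thesis by (simp add: Lp_norm_def)
  qed
  show ?thesis
  proof (intro allI impI, rule ccontr)
    fix \<epsilon> :: real assume \<epsilon>: "0 < \<epsilon>"
    define S N where "S = smooth_solution \<omega>" and "N \<zeta> t = Lp_norm p (\<lambda>x. \<zeta> t x - zt x)" for \<zeta>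
        and t :: real
    assume "\<not> (\<exists>\<delta>>0. \<forall>\<zeta>. smooth_solution \<omega> \<zeta> \<longrightarrow> Lp_norm p (\<lambda>x. \<zeta> 0 x - zt x) < \<delta> \<longrightarrow>
      (\<forall>t>0. Lp_norm p (\<lambda>x. \<zeta> t x - zt x) < \<epsilon>))"
    then have "\<not> (\<exists>\<delta>>0. \<forall>\<zeta>. S \<zeta> \<longrightarrow> N \<zeta> 0 < \<delta> \<longrightarrow> (\<forall>t>0. N \<zeta> t < \<epsilon>))"
      unfolding S_def N_def .
    then have "\<And>\<delta>. 0 < \<delta> \<Longrightarrow> \<exists>\<zeta> t. S \<zeta> \<and> N \<zeta> 0 < \<delta> \<and> 0 < t \<and> \<not> N \<zeta> t < \<epsilon>"
      by blast
    note bad = this[unfolded S_def N_def]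
    \<comment> \<open>Failure of stability at \<open>\<delta> = 1 / (n + 1)\<close> supplies a
      solution and a time for each \<open>n\<close>. The conservation laws compare that time with
      time \<open>0\<close>, which is all that the sequential statement needs.\<close>
    have "\<forall>n. \<exists>\<zeta> t. smooth_solution \<omega> \<zeta> \<and> Lp_norm p (\<lambda>x. \<zeta> 0 x - zt x) < inverse (real (Suc n)) \<and> 0
        < t \<and> \<not> Lp_norm p (\<lambda>x. \<zeta> t x - zt x) < \<epsilon>"
      by (intro allI bad) simp
    then obtain Z t where Z: "\<And>n. smooth_solution \<omega> (Z n)"
        "\<And>n. Lp_norm p (\<lambda>x. Z n 0 x - zt x) < inverse (real (Suc n))"
        "\<And>n. 0 < t n" "\<And>n. \<not> Lp_norm p (\<lambda>x. Z n (t n) x - zt x) < \<epsilon>" by metis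
    have t: "0 \<le> t n" for n using Z(3)[of n] by simp
    note C0 = conservation_laws[OF Z(1) order_refl] and C = conservation_laws[OF Z(1) t]
    have "(\<lambda>n. Lp_norm p (\<lambda>x. Z n 0 x - z x)) \<longlonglongrightarrow> 0"
    proof (rule tendsto_sandwich[OF _ _ tendsto_const LIMSEQ_inverse_real_of_nat])
      show "\<forall>\<^sub>F n in sequentially. Lp_norm p (\<lambda>x. Z n 0 x - z x) \<le> inverse (real (Suc n))"
      proof (intro always_eventually allI)
        fix n
        have "Lp_norm p (\<lambda>x. Z n 0 x - zt x) = Lp_norm p (\<lambda>x. Z n 0 x - z x)"
          unfolding Lp[OF C0(1)] by (simp add: Lp_norm_def)
        then show "Lp_norm p (\<lambda>x. Z n 0 x - z x) \<le> inverse (real (Suc n))" using Z(2)[of n] by simp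
      qed
      show "\<forall>\<^sub>F n in sequentially. 0 \<le> Lp_norm p (\<lambda>x. Z n 0 x - z x)" by (simp add: Lp_norm_def)
    qed
    from Lp_norm_tendsto[OF p this] have tA: "(\<lambda>n. LINT x|area. \<bar>Z n 0 x - z x\<bar> powr p) \<longlonglongrightarrow> 0" by simp
    have "(\<lambda>n. LINT x|area. \<bar>Z n (t n) x - z x\<bar> powr p) \<longlonglongrightarrow> 0"
      by (rule static_stability[OF p cz z0 zg g G c(3) assms(7) c(1,2) C0(1) C(1) C(2) C(3) C(4)
          C(5)[OF m] tA])
    then have "(\<lambda>n. (LINT x|area. \<bar>Z n (t n) x - z x\<bar> powr p) powr (1 / p)) \<longlonglongrightarrow> 0 powr (1 / p)"
      using p by (intro tendsto_powr') (auto intro!: always_eventually integral_nonneg_AE)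
    then have "\<forall>\<^sub>F n in sequentially. Lp_norm p (\<lambda>x. Z n (t n) x - zt x) < \<epsilon>"
      using \<epsilon> by (simp add: Lp[OF C(1)] order_tendstoD(2))
    then show False using Z(4) by (auto simp: eventually_sequentially)
  qed
qed

end
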